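(* Let $Z\subseteq Z(G)$ be a subgroup. If $(\pi,\mathcal H)$ is an irreducible positive energy representation of $LG$ and $\zeta\in L_ZG$, the conjugated representation $\zeta_*\pi$, $\zeta_*\pi(\gamma)=\pi(\zeta^{-1}\gamma\zeta)$, is of positive energy.
   Context: $G$ is a compact, connected, simply connected simple Lie group. $LG=C^\infty(S^1,G)$ and $L_ZG=\{\zeta\in C^\infty(\mathbb R,G):\zeta(x+2\pi)\zeta(x)^{-1}\in Z\text{ (a constant)}\}$, which acts on $LG$ by conjugation. A positive energy representation of $LG$ is a strongly continuous homomorphism $\pi:LG\to PU(\mathcal H)=U(\mathcal H)/\mathbb T$ on a complex Hilbert space which extends to $LG\rtimes\operatorname{Rot}(S^1)$ (rotations acting on loops by $(R_\theta\gamma)(x)=\gamma(x-\theta)$) in such a way that, lifting the restriction to $\operatorname{Rot}(S^1)$ to a unitary representation, $\mathcal H=\bigoplus_{n\ge n_0}\mathcal H(n)$ for some $n_0\in\mathbb Z$, with each $\mathcal H(n)=\{\xi\in\mathcal H:\pi(R_\theta)\xi=e^{in\theta}\xi\}$ finite-dimensional (the lift may be normalised so that $n_0=0$). *)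

theory Defs
  imports "HOL-Analysis.Analysis" "HOL-Algebra.Coset"
begin

section \<open>Smooth maps and Lie groups\<close>

text \<open>
  \<open>k\<close>-fold continuous differentiability on an open subset of a Euclidean space, through iterated
  directional derivatives, so that the type does not change under differentiation.
\<close>

fun times_cont_diff_on ::
    "nat \<Rightarrow> 'a::euclidean_space set \<Rightarrow> ('a \<Rightarrow> 'b::real_normed_vector) \<Rightarrow> bool" where
  "times_cont_diff_on 0 S f \<longleftrightarrow> continuous_on S f"
| "times_cont_diff_on (Suc k) S f \<longleftrightarrow>
     (\<forall>x\<in>S. f differentiable (at x)) \<and>
     (\<forall>v. times_cont_diff_on k S (\<lambda>x. frechet_derivative f (at x) v))"

definition smooth_on :: "'a::euclidean_space set \<Rightarrow> ('a \<Rightarrow> 'b::real_normed_vector) \<Rightarrow> bool" where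
  "smooth_on S f \<longleftrightarrow> (\<forall>k. times_cont_diff_on k S f)"

text \<open>
  A chart is a pair of its domain and its coordinate map. The manifold described by an atlas is the
  union of the chart domains, with the subspace topology of the ambient type; the atlas is not
  required to be maximal.
\<close>

type_synonym ('m, 'e) atlas = "('m set \<times> ('m \<Rightarrow> 'e)) set"

definition atlas_space :: "('m, 'e) atlas \<Rightarrow> 'm set" where
  "atlas_space A = (\<Union>(U, \<phi>)\<in>A. U)"

definition smooth_atlas ::
    "('m::topological_space, 'e::euclidean_space) atlas \<Rightarrow> bool" where
  "smooth_atlas A \<longleftrightarrow>
     (\<forall>(U, \<phi>)\<in>A. openin (top_of_set (atlas_space A)) U \<and> open (\<phi> ` U) \<and>
        homeomorphism U (\<phi> ` U) \<phi> (inv_into U \<phi>)) \<and>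
     (\<forall>(U, \<phi>)\<in>A. \<forall>(V, \<psi>)\<in>A. smooth_on (\<phi> ` (U \<inter> V)) (\<psi> \<circ> inv_into U \<phi>))"

definition smooth_map ::
    "('m::topological_space, 'd::euclidean_space) atlas \<Rightarrow>
     ('n::topological_space, 'e::euclidean_space) atlas \<Rightarrow> ('m \<Rightarrow> 'n) \<Rightarrow> bool" where
  "smooth_map A B f \<longleftrightarrow>
     f ` atlas_space A \<subseteq> atlas_space B \<and> continuous_on (atlas_space A) f \<and>
     (\<forall>(U, \<phi>)\<in>A. \<forall>(V, \<psi>)\<in>B. smooth_on (\<phi> ` (U \<inter> f -` V)) (\<psi> \<circ> f \<circ> inv_into U \<phi>))"

definition prod_atlas :: "('m, 'd) atlas \<Rightarrow> ('n, 'e) atlas \<Rightarrow> ('m \<times> 'n, 'd \<times> 'e) atlas" where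
  "prod_atlas A B = {(U \<times> V, map_prod \<phi> \<psi>) |U \<phi> V \<psi>. (U, \<phi>) \<in> A \<and> (V, \<psi>) \<in> B}"

definition line_atlas :: "(real, real) atlas" where
  "line_atlas = {(UNIV, id)}"

locale lie_group = group G
  for G :: "('g::t2_space, 'b) monoid_scheme" (structure) +
  fixes A :: "('g, 'e::euclidean_space) atlas"
  assumes atlas: "smooth_atlas A"
    and carrier_eq: "atlas_space A = carrier G"
    and second_countable: "second_countable (top_of_set (carrier G))"
    and smooth_mult: "smooth_map (prod_atlas A A) A (\<lambda>(x, y). x \<otimes> y)"
    and smooth_inv: "smooth_map A A (\<lambda>x. inv x)"

text \<open>
  The Lie algebra is the tangent space at the identity, identified with the model space by a chart
  \<open>(U, \<phi>)\<close> around the identity. \<open>Ad(g)\<close> is the derivative at the identity of conjugation by \<open>g\<close>, and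
  the bracket is \<open>[X, Y] = ad(X) Y\<close>, where \<open>ad\<close> is the derivative of \<open>Ad\<close> at the identity.
  Outside a neighbourhood of the identity the formulas below have no meaning, which is harmless
  because only derivatives at the identity are taken.
\<close>

definition Ad_chart ::
    "('g, 'b) monoid_scheme \<Rightarrow> 'g set \<Rightarrow> ('g \<Rightarrow> 'e) \<Rightarrow> 'g \<Rightarrow> 'e \<Rightarrow> 'e::euclidean_space" where
  "Ad_chart G U \<phi> g Y =
     frechet_derivative (\<lambda>v. \<phi> (g \<otimes>\<^bsub>G\<^esub> inv_into U \<phi> v \<otimes>\<^bsub>G\<^esub> inv\<^bsub>G\<^esub> g)) (at (\<phi> \<one>\<^bsub>G\<^esub>)) Y"

definition lie_bracket ::
    "('g, 'b) monoid_scheme \<Rightarrow> 'g set \<Rightarrow> ('g \<Rightarrow> 'e) \<Rightarrow> 'e \<Rightarrow> 'e \<Rightarrow> 'e::euclidean_space" where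
  "lie_bracket G U \<phi> X Y =
     frechet_derivative (\<lambda>v. Ad_chart G U \<phi> (inv_into U \<phi> v) Y) (at (\<phi> \<one>\<^bsub>G\<^esub>)) X"

definition simple_bracket :: "('e::real_vector \<Rightarrow> 'e \<Rightarrow> 'e) \<Rightarrow> bool" where
  "simple_bracket br \<longleftrightarrow>
     (\<exists>X Y. br X Y \<noteq> 0) \<and>
     (\<forall>I. subspace I \<and> (\<forall>X. \<forall>Y\<in>I. br X Y \<in> I) \<longrightarrow> I = {0} \<or> I = UNIV)"

definition simple_lie_group ::
    "('g::t2_space, 'b) monoid_scheme \<Rightarrow> ('g, 'e::euclidean_space) atlas \<Rightarrow> bool" where
  "simple_lie_group G A \<longleftrightarrow>
     lie_group G A \<and> connected (carrier G) \<and>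
     (\<forall>(U, \<phi>)\<in>A. \<one>\<^bsub>G\<^esub> \<in> U \<longrightarrow> simple_bracket (lie_bracket G U \<phi>))"

definition group_center :: "('g, 'b) monoid_scheme \<Rightarrow> 'g set" where
  "group_center G = {z \<in> carrier G. \<forall>g\<in>carrier G. z \<otimes>\<^bsub>G\<^esub> g = g \<otimes>\<^bsub>G\<^esub> z}"


section \<open>Loop groups\<close>

text \<open>
  Smooth maps on \<open>S\<^sup>1\<close> are represented by smooth \<open>2\<pi>\<close>-periodic maps on the real line.
\<close>

definition loop_group ::
    "('g::topological_space, 'b) monoid_scheme \<Rightarrow> ('g, 'e::euclidean_space) atlas \<Rightarrow>
     (real \<Rightarrow> 'g) monoid" where
  "loop_group G A =
     \<lparr>carrier = {\<gamma>. smooth_map line_atlas A \<gamma> \<and> (\<forall>x. \<gamma> (x + 2 * pi) = \<gamma> x)},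
      mult = (\<lambda>\<gamma> \<eta> x. \<gamma> x \<otimes>\<^bsub>G\<^esub> \<eta> x),
      one = (\<lambda>x. \<one>\<^bsub>G\<^esub>)\<rparr>"

definition twisted_loops ::
    "('g::topological_space, 'b) monoid_scheme \<Rightarrow> ('g, 'e::euclidean_space) atlas \<Rightarrow> 'g set \<Rightarrow>
     (real \<Rightarrow> 'g) set" where
  "twisted_loops G A Z =
     {\<zeta>. smooth_map line_atlas A \<zeta> \<and>
         (\<exists>z\<in>Z. \<forall>x. \<zeta> (x + 2 * pi) \<otimes>\<^bsub>G\<^esub> inv\<^bsub>G\<^esub> (\<zeta> x) = z)}"

definition iter_vector_derivative ::
    "nat \<Rightarrow> (real \<Rightarrow> 'e::real_normed_vector) \<Rightarrow> real \<Rightarrow> 'e" where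
  "iter_vector_derivative k = (\<lambda>f t. vector_derivative f (at t)) ^^ k"

text \<open>
  The \<open>C\<^sup>\<infinity>\<close> topology: uniform convergence of all derivatives in charts. The sets below are the usual
  subbasic neighbourhoods of a loop \<open>\<gamma>\<close> carrying a compact interval into a chart domain.
\<close>

definition loop_nhd ::
    "('g::topological_space, 'b) monoid_scheme \<Rightarrow> ('g, 'e::euclidean_space) atlas \<Rightarrow>
     (real \<Rightarrow> 'g) \<Rightarrow> 'g set \<Rightarrow> ('g \<Rightarrow> 'e) \<Rightarrow> real \<Rightarrow> real \<Rightarrow> nat \<Rightarrow> real \<Rightarrow> (real \<Rightarrow> 'g) set" where
  "loop_nhd G A \<gamma> U \<phi> a b k \<epsilon> =
     {\<eta> \<in> carrier (loop_group G A). \<eta> ` {a..b} \<subseteq> U \<and>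
        (\<forall>t\<in>{a..b}. norm (iter_vector_derivative k (\<phi> \<circ> \<eta>) t -
                          iter_vector_derivative k (\<phi> \<circ> \<gamma>) t) < \<epsilon>)}"

definition loop_topology ::
    "('g::topological_space, 'b) monoid_scheme \<Rightarrow> ('g, 'e::euclidean_space) atlas \<Rightarrow>
     (real \<Rightarrow> 'g) topology" where
  "loop_topology G A = topology_generated_by
     {loop_nhd G A \<gamma> U \<phi> a b k \<epsilon> |\<gamma> U \<phi> a b k \<epsilon>.
        \<gamma> \<in> carrier (loop_group G A) \<and> (U, \<phi>) \<in> A \<and> \<gamma> ` {a..b} \<subseteq> U \<and> 0 < \<epsilon>}"

text \<open>
  \<open>Rot(S\<^sup>1)\<close> is the circle group of unit complex numbers, with \<open>R\<^sub>\<theta>\<close> represented by \<open>cis \<theta>\<close>. The choice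
  of the argument does not matter for periodic \<open>\<gamma>\<close>.
\<close>

definition circle_group :: "complex monoid" where
  "circle_group = \<lparr>carrier = sphere 0 1, mult = (*), one = 1\<rparr>"

definition rotate_loop :: "complex \<Rightarrow> (real \<Rightarrow> 'g) \<Rightarrow> real \<Rightarrow> 'g" where
  "rotate_loop z \<gamma> = (\<lambda>x. \<gamma> (x - Arg z))"

definition loop_rot_group ::
    "('g::topological_space, 'b) monoid_scheme \<Rightarrow> ('g, 'e::euclidean_space) atlas \<Rightarrow>
     ((real \<Rightarrow> 'g) \<times> complex) monoid" where
  "loop_rot_group G A =
     \<lparr>carrier = carrier (loop_group G A) \<times> carrier circle_group,
      mult = (\<lambda>(\<gamma>, z) (\<eta>, w).
        (\<gamma> \<otimes>\<^bsub>loop_group G A\<^esub> rotate_loop z \<eta>, z \<otimes>\<^bsub>circle_group\<^esub> w)),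
      one = (\<one>\<^bsub>loop_group G A\<^esub>, \<one>\<^bsub>circle_group\<^esub>)\<rparr>"

definition loop_rot_topology ::
    "('g::topological_space, 'b) monoid_scheme \<Rightarrow> ('g, 'e::euclidean_space) atlas \<Rightarrow>
     ((real \<Rightarrow> 'g) \<times> complex) topology" where
  "loop_rot_topology G A =
     prod_topology (loop_topology G A) (top_of_set (carrier circle_group))"


section \<open>Complex Hilbert spaces and their projective unitary groups\<close>

text \<open>
  The inner product is linear in its second argument; its real part is the real inner product,
  which determines the norm and the topology.
\<close>

class complex_hilbert_space = real_inner + complete_space +
  fixes scaleC :: "complex \<Rightarrow> 'a \<Rightarrow> 'a" (infixr "*\<^sub>C" 75)
    and cinner :: "'a \<Rightarrow> 'a \<Rightarrow> complex"
  assumes scaleC_add_right: "c *\<^sub>C (x + y) = c *\<^sub>C x + c *\<^sub>C y"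
    and scaleC_add_left: "(c + d) *\<^sub>C x = c *\<^sub>C x + d *\<^sub>C x"
    and scaleC_scaleC: "c *\<^sub>C d *\<^sub>C x = (c * d) *\<^sub>C x"
    and scaleC_of_real: "complex_of_real r *\<^sub>C x = r *\<^sub>R x"
    and cinner_commute: "cinner x y = cnj (cinner y x)"
    and cinner_add_right: "cinner x (y + z) = cinner x y + cinner x z"
    and cinner_scaleC_right: "cinner x (c *\<^sub>C y) = c * cinner x y"
    and Re_cinner: "Re (cinner x y) = inner x y"

lemma scaleC_one: "1 *\<^sub>C x = (x :: 'h::complex_hilbert_space)"
  using scaleC_of_real[of 1 x] by simp

global_interpretation complex_vector: vector_space
  "scaleC :: complex \<Rightarrow> 'h \<Rightarrow> 'h::complex_hilbert_space"
  by unfold_locales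
    (simp_all add: scaleC_add_right scaleC_add_left scaleC_scaleC scaleC_one)

definition unitary_group :: "('h::complex_hilbert_space \<Rightarrow> 'h) monoid" where
  "unitary_group =
     \<lparr>carrier = {u. (\<forall>x y. u (x + y) = u x + u y) \<and> (\<forall>c x. u (c *\<^sub>C x) = c *\<^sub>C u x) \<and>
                    (\<forall>x y. cinner (u x) (u y) = cinner x y) \<and> surj u},
      mult = (\<circ>),
      one = id\<rparr>"

definition phases :: "('h::complex_hilbert_space \<Rightarrow> 'h) set" where
  "phases = {(\<lambda>x. c *\<^sub>C x) |c. c \<in> sphere 0 1}"

definition projective_unitary_group :: "('h::complex_hilbert_space \<Rightarrow> 'h) set monoid" where
  "projective_unitary_group = unitary_group Mod phases"

definition projective_class ::
    "('h::complex_hilbert_space \<Rightarrow> 'h) \<Rightarrow> ('h \<Rightarrow> 'h) set" where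
  "projective_class u = phases #>\<^bsub>unitary_group\<^esub> u"

definition quotient_topology :: "'a topology \<Rightarrow> ('a \<Rightarrow> 'b) \<Rightarrow> 'b topology" where
  "quotient_topology X f =
     topology (\<lambda>S. S \<subseteq> f ` topspace X \<and> openin X {x \<in> topspace X. f x \<in> S})"

lemma openin_quotient_topology:
  "openin (quotient_topology X f) S \<longleftrightarrow>
     S \<subseteq> f ` topspace X \<and> openin X {x \<in> topspace X. f x \<in> S}"
proof -
  have "istopology (\<lambda>S. S \<subseteq> f ` topspace X \<and> openin X {x \<in> topspace X. f x \<in> S})"
    unfolding istopology_def
  proof (intro conjI allI impI)
    fix S T
    assume S: "S \<subseteq> f ` topspace X \<and> openin X {x \<in> topspace X. f x \<in> S}"
      and T: "T \<subseteq> f ` topspace X \<and> openin X {x \<in> topspace X. f x \<in> T}"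
    show "S \<inter> T \<subseteq> f ` topspace X" using S by blast
    have "{x \<in> topspace X. f x \<in> S \<inter> T} =
          {x \<in> topspace X. f x \<in> S} \<inter> {x \<in> topspace X. f x \<in> T}" by blast
    then show "openin X {x \<in> topspace X. f x \<in> S \<inter> T}" using openin_Int[OF conjunct2[OF S] conjunct2[OF T]] by (simp only:)
  next
    fix K
    assume K: "\<forall>S\<in>K. S \<subseteq> f ` topspace X \<and> openin X {x \<in> topspace X. f x \<in> S}"
    then show "\<Union>K \<subseteq> f ` topspace X" by blast
    have "{x \<in> topspace X. f x \<in> \<Union>K} = (\<Union>S\<in>K. {x \<in> topspace X. f x \<in> S})" by blast
    then show "openin X {x \<in> topspace X. f x \<in> \<Union>K}" using K by auto
  qed
  then show ?thesis by (simp add: quotient_topology_def)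
qed

text \<open>
  The topology of the type of functions is that of pointwise convergence, so its restriction to the
  unitary group is the strong operator topology; the projective unitary group carries the quotient.
\<close>

definition unitary_topology :: "('h::complex_hilbert_space \<Rightarrow> 'h) topology" where
  "unitary_topology = top_of_set (carrier unitary_group)"

definition projective_unitary_topology :: "('h::complex_hilbert_space \<Rightarrow> 'h) set topology" where
  "projective_unitary_topology = quotient_topology unitary_topology projective_class"

definition hilbert_direct_sum :: "'i set \<Rightarrow> ('i \<Rightarrow> 'h::complex_hilbert_space set) \<Rightarrow> bool" where
  "hilbert_direct_sum I V \<longleftrightarrow>
     (\<forall>i\<in>I. complex_vector.subspace (V i) \<and> closed (V i)) \<and>
     (\<forall>i\<in>I. \<forall>j\<in>I. i \<noteq> j \<longrightarrow> (\<forall>x\<in>V i. \<forall>y\<in>V j. cinner x y = 0)) \<and>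
     closure (complex_vector.span (\<Union>i\<in>I. V i)) = UNIV"

definition finite_dimensional :: "'h::complex_hilbert_space set \<Rightarrow> bool" where
  "finite_dimensional V \<longleftrightarrow> (\<exists>B. finite B \<and> V \<subseteq> complex_vector.span B)"


section \<open>Positive energy representations\<close>

definition energy_space :: "(complex \<Rightarrow> 'h \<Rightarrow> 'h::complex_hilbert_space) \<Rightarrow> int \<Rightarrow> 'h set" where
  "energy_space U n = {\<xi>. \<forall>\<theta>. U (cis \<theta>) \<xi> = cis (of_int n * \<theta>) *\<^sub>C \<xi>}"

definition positive_energy ::
    "('g::topological_space, 'b) monoid_scheme \<Rightarrow> ('g, 'e::euclidean_space) atlas \<Rightarrow>
     ((real \<Rightarrow> 'g) \<Rightarrow> ('h::complex_hilbert_space \<Rightarrow> 'h) set) \<Rightarrow> bool" where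
  "positive_energy G A \<pi> \<longleftrightarrow>
     \<pi> \<in> hom (loop_group G A) projective_unitary_group \<and>
     continuous_map (loop_topology G A) projective_unitary_topology \<pi> \<and>
     (\<exists>\<rho>. \<rho> \<in> hom (loop_rot_group G A) projective_unitary_group \<and>
        continuous_map (loop_rot_topology G A) projective_unitary_topology \<rho> \<and>
        (\<forall>\<gamma>\<in>carrier (loop_group G A). \<rho> (\<gamma>, \<one>\<^bsub>circle_group\<^esub>) = \<pi> \<gamma>) \<and>
        (\<exists>U. U \<in> hom circle_group unitary_group \<and>
           continuous_map (top_of_set (carrier circle_group)) unitary_topology U \<and>
           (\<forall>z\<in>carrier circle_group. \<rho> (\<one>\<^bsub>loop_group G A\<^esub>, z) = projective_class (U z)) \<and>
           (\<exists>n\<^sub>0. hilbert_direct_sum {n\<^sub>0..} (energy_space U) \<and>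
                 (\<forall>n\<ge>n\<^sub>0. finite_dimensional (energy_space U n)))))"

text \<open>
  A subspace is invariant under a projective unitary if it is invariant under one, equivalently
  every, unitary representing it.
\<close>

definition irreducible_rep ::
    "('g::topological_space, 'b) monoid_scheme \<Rightarrow> ('g, 'e::euclidean_space) atlas \<Rightarrow>
     ((real \<Rightarrow> 'g) \<Rightarrow> ('h::complex_hilbert_space \<Rightarrow> 'h) set) \<Rightarrow> bool" where
  "irreducible_rep G A \<pi> \<longleftrightarrow>
     (UNIV :: 'h set) \<noteq> {0} \<and>
     (\<forall>W. complex_vector.subspace W \<and> closed W \<and>
          (\<forall>\<gamma>\<in>carrier (loop_group G A). \<forall>u\<in>\<pi> \<gamma>. u ` W \<subseteq> W) \<longrightarrow> W = {0} \<or> W = UNIV)"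

definition conjugate_rep ::
    "('g, 'b) monoid_scheme \<Rightarrow> (real \<Rightarrow> 'g) \<Rightarrow> ((real \<Rightarrow> 'g) \<Rightarrow> 'p) \<Rightarrow> (real \<Rightarrow> 'g) \<Rightarrow> 'p" where
  "conjugate_rep G \<zeta> \<pi> = (\<lambda>\<gamma>. \<pi> (\<lambda>x. inv\<^bsub>G\<^esub> (\<zeta> x) \<otimes>\<^bsub>G\<^esub> \<gamma> x \<otimes>\<^bsub>G\<^esub> \<zeta> x))"

end

theory Submission
  imports Defs
begin

text \<open>
  Let \<open>z\<close> be the constant \<open>\<zeta> (x + 2\<pi>) \<zeta> (x)\<^sup>-\<^sup>1\<close>. The center of a compact simple Lie group is discrete, so
  \<open>z\<^sup>k = 1\<close> for some \<open>k \<ge> 2\<close>. There is a one-parameter subgroup \<open>g\<close> with \<open>g (2\<pi>) = z\<close>: among the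
  factorisations of \<open>z\<close> into \<open>n\<close> elements near the identity choose one of least total squared size,
  for a conjugation invariant size that replaces a bi-invariant metric. Strict convexity makes the factors
  equal, so \<open>z\<close> has an \<open>n\<close>-th root of size \<open>O(1/n)\<close>, and the powers of these roots cluster at \<open>g\<close>.
  Now \<open>\<zeta> = \<gamma> g\<close> for a loop \<open>\<gamma>\<close>, conjugation by which is inner, so only \<open>g\<close> has to be treated.

  Let \<open>U\<close> lift the rotations. The loop \<open>h (x) = g (k x)\<close> gives a second lift \<open>U' = \<pi> (h)\<^sup>-\<^sup>1 U \<pi> (h)\<close> of the
  rotations twisted by \<open>g (- k \<theta>)\<close>, and it commutes with \<open>U\<close>. Therefore \<open>V0 (\<theta>) = U' (\<theta>/k) U (\<theta> - \<theta>/k)\<close>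
  implements, over the real line, the rotations for the conjugated representation. The full turn \<open>V0 (2\<pi>)\<close>
  commutes with \<open>\<pi>\<close> up to a character of the loop group with values in the \<open>k\<close>-th roots of unity; this
  character is trivial because \<open>G\<close> is simply connected, so the full turn is a scalar by irreducibility and a
  phase \<open>\<tau>\<close> turns \<open>V0\<close> into a representation \<open>V\<close> of the circle. On vectors of energy \<open>n\<close> for \<open>U\<close> and \<open>m\<close> for
  \<open>U'\<close> it has energy \<open>\<tau> + m/k + n (1 - 1/k)\<close>. This is bounded below, and bounding it above bounds \<open>n\<close>,
  whence the energy spaces of \<open>V\<close> are finite-dimensional.
\<close>

section \<open>Smooth maps between Euclidean spaces\<close>

text \<open>The weights 1/k and 1 - 1/k are both positive once k is at least 2, so up to the shift
  \<tau> the new energy is a convex combination of two energies that are bounded below. No formula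
  for a level or for the action of coroots on energies enters. The path from 1 to \<open>z\<close>
  has to be a homomorphism: since g (x - \<theta>) = g x g (- \<theta>), a rotation changes
  \<open>g\<close> only by a constant loop, and constant loops are fixed by rotations. As the
  representations are projective, a relation between classes determines the unitaries only up to a
  phase. Two different arguments remove these phases: the existence of a lowest energy makes U and
  U' commute, and the character argument makes the full turn commute with the loops. Simple
  connectedness contracts a loop only through continuous loops while the character lives on smooth
  ones, hence the smoothing of loops. The bounds behind the convexity argument are uniform over all
  conjugations because \<open>G\<close> is compact.\<close>

lemma times_cont_diff_on_subset:
  "times_cont_diff_on k S f \<Longrightarrow> T \<subseteq> S \<Longrightarrow> times_cont_diff_on k T f"
  by (induction k arbitrary: f) (auto intro: continuous_on_subset)

lemma frechet_derivative_cong_open: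
  assumes "open S" "x \<in> S" "\<And>y. y \<in> S \<Longrightarrow> f y = g y"
  shows "frechet_derivative f (at x) = frechet_derivative g (at x)"
proof -
  have "(f has_derivative D) (at x) \<longleftrightarrow> (g has_derivative D) (at x)" for D
    using assms by (metis has_derivative_transform_within_open)
  then show ?thesis by (simp add: frechet_derivative_def)
qed

lemma differentiable_cong_open:
  assumes "open S" "x \<in> S" "\<And>y. y \<in> S \<Longrightarrow> f y = g y" "f differentiable (at x)"
  shows "g differentiable (at x)"
  using assms unfolding differentiable_def by (metis has_derivative_transform_within_open)

lemma times_cont_diff_on_cong:
  assumes "open S" "\<And>x. x \<in> S \<Longrightarrow> f x = g x" "times_cont_diff_on k S f"
  shows "times_cont_diff_on k S g"
  using assms(2,3)
proof (induction k arbitrary: f g)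
  case 0
  then show ?case using continuous_on_cong by (metis times_cont_diff_on.simps(1))
next
  case (Suc k)
  have "frechet_derivative f (at x) = frechet_derivative g (at x)" if "x \<in> S" for x
    using frechet_derivative_cong_open[OF assms(1) that] Suc.prems(1) by blast
  moreover have "g differentiable (at x)" if "x \<in> S" for x
    using differentiable_cong_open[OF assms(1) that Suc.prems(1)] Suc.prems(2) that by simp
  moreover have "times_cont_diff_on k S (\<lambda>x. frechet_derivative g (at x) v)" for v
    by (rule Suc.IH[of "\<lambda>x. frechet_derivative f (at x) v"])
      (use Suc.prems calculation in \<open>simp_all\<close>)
  ultimately show ?case by simp
qed

lemma times_cont_diff_on_local:
  assumes "\<And>x. x \<in> S \<Longrightarrow> \<exists>T. open T \<and> x \<in> T \<and> times_cont_diff_on k T f"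
  shows "times_cont_diff_on k S f"
  using assms
proof (induction k arbitrary: f)
  case 0
  show ?case
    unfolding times_cont_diff_on.simps
  proof (rule continuous_at_imp_continuous_on, rule ballI)
    fix x assume "x \<in> S"
    then obtain T where "open T" "x \<in> T" "continuous_on T f"
      using 0 by (metis times_cont_diff_on.simps(1))
    then show "isCont f x" using continuous_on_eq_continuous_at by blast
  qed
next
  case (Suc k)
  show ?case unfolding times_cont_diff_on.simps
  proof (intro conjI ballI allI)
    fix x assume "x \<in> S" then show "f differentiable at x"
      using Suc.prems by (metis times_cont_diff_on.simps(2))
  next
    fix v show "times_cont_diff_on k S (\<lambda>x. frechet_derivative f (at x) v)"
      by (rule Suc.IH) (metis Suc.prems times_cont_diff_on.simps(2))
  qed
qed

lemma times_cont_diff_on_SucD: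
  "times_cont_diff_on (Suc k) S f \<Longrightarrow> times_cont_diff_on k S f"
proof (induction k arbitrary: f)
  case 0
  then show ?case
    by (simp add: continuous_at_imp_continuous_on differentiable_imp_continuous_within)
next
  case (Suc k)
  then show ?case by (metis times_cont_diff_on.simps(2))
qed

text \<open>Lets a derivative be supplied explicitly, so that the inductions on the order of
  differentiability need not identify \<open>frechet_derivative\<close> of a composite
  expression.\<close>

lemma times_cont_diff_on_SucI:
  assumes "open S" "\<And>x. x \<in> S \<Longrightarrow> (f has_derivative D x) (at x)"
    and "\<And>v. times_cont_diff_on k S (\<lambda>x. D x v)"
  shows "times_cont_diff_on (Suc k) S f"
  unfolding times_cont_diff_on.simps
proof (intro conjI ballI allI)
  fix x assume "x \<in> S" then show "f differentiable at x" using assms(2) differentiableI by blast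
next
  fix v show "times_cont_diff_on k S (\<lambda>x. frechet_derivative f (at x) v)"
    by (rule times_cont_diff_on_cong[OF assms(1) _ assms(3)])
      (simp add: frechet_derivative_at[OF assms(2), symmetric])
qed

lemma times_cont_diff_on_has_derivative:
  "times_cont_diff_on (Suc k) S f \<Longrightarrow> x \<in> S
    \<Longrightarrow> (f has_derivative frechet_derivative f (at x)) (at x)"
  by (simp add: frechet_derivative_works[symmetric])

lemma times_cont_diff_on_derivative:
  "times_cont_diff_on (Suc k) S f \<Longrightarrow> times_cont_diff_on k S (\<lambda>x. frechet_derivative f (at x) v)"
  by simp

lemma times_cont_diff_on_const: "times_cont_diff_on k S (\<lambda>x. c)"
proof (induction k arbitrary: c)
  case 0
  then show ?case by (simp add: continuous_on_const)
next
  case (Suc k)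
  have "frechet_derivative (\<lambda>x. c) (at y) = (\<lambda>v. 0)" for y :: 'a
    by (rule frechet_derivative_const)
  then show ?case using Suc by simp
qed

lemma times_cont_diff_on_add:
  assumes "open S"
  shows "times_cont_diff_on k S f \<Longrightarrow> times_cont_diff_on k S g
    \<Longrightarrow> times_cont_diff_on k S (\<lambda>x. f x + g x)"
proof (induction k arbitrary: f g)
  case 0
  then show ?case by (simp add: continuous_on_add)
next
  case (Suc k)
  have d: "((\<lambda>x. f x + g x) has_derivative
      (\<lambda>v. frechet_derivative f (at x) v + frechet_derivative g (at x) v)) (at x)"
    if "x \<in> S" for x
    by (rule has_derivative_add[OF times_cont_diff_on_has_derivative[OF Suc.prems(1) that]
          times_cont_diff_on_has_derivative[OF Suc.prems(2) that]])
  show ?case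
    by (rule times_cont_diff_on_SucI[OF assms d], assumption,
        rule Suc.IH[OF times_cont_diff_on_derivative[OF Suc.prems(1)]
          times_cont_diff_on_derivative[OF Suc.prems(2)]])
qed

lemma times_cont_diff_on_linear:
  assumes "open S" "bounded_linear L"
  shows "times_cont_diff_on k S f \<Longrightarrow> times_cont_diff_on k S (\<lambda>x. L (f x))"
proof (induction k arbitrary: f)
  case 0
  then show ?case using bounded_linear.continuous_on[OF assms(2)] by simp
next
  case (Suc k)
  have d: "((\<lambda>x. L (f x)) has_derivative (\<lambda>v. L (frechet_derivative f (at x) v))) (at x)"
    if "x \<in> S" for x
    by (rule bounded_linear.has_derivative[OF assms(2) times_cont_diff_on_has_derivative[OF Suc.prems that]])
  show ?case
    by (rule times_cont_diff_on_SucI[OF assms(1) d], assumption,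
        rule Suc.IH[OF times_cont_diff_on_derivative[OF Suc.prems]])
qed

lemma times_cont_diff_on_bounded_linear:
  assumes "open S" "bounded_linear L"
  shows "times_cont_diff_on k S L"
proof (cases k)
  case 0
  then show ?thesis using assms by (simp add: linear_continuous_on)
next
  case (Suc m)
  have "(L has_derivative L) (at x)" for x
    using assms(2) by (rule bounded_linear_imp_has_derivative)
  then show ?thesis unfolding Suc
    by (rule times_cont_diff_on_SucI[where D = "\<lambda>x. L", OF assms(1) _ times_cont_diff_on_const])
qed

lemma times_cont_diff_on_bilinear:
  assumes "open S" "bounded_bilinear B"
  shows "times_cont_diff_on k S f \<Longrightarrow> times_cont_diff_on k S g
    \<Longrightarrow> times_cont_diff_on k S (\<lambda>x. B (f x) (g x))"
proof (induction k arbitrary: f g)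
  case 0
  then show ?case using bounded_bilinear.continuous_on[OF assms(2)] by simp
next
  case (Suc k)
  note fg = times_cont_diff_on_has_derivative[OF Suc.prems(1)] times_cont_diff_on_has_derivative[OF Suc.prems(2)]
  note l = times_cont_diff_on_SucD[OF Suc.prems(1)] times_cont_diff_on_SucD[OF Suc.prems(2)]
  note r = times_cont_diff_on_derivative[OF Suc.prems(1)] times_cont_diff_on_derivative[OF Suc.prems(2)]
  have d: "((\<lambda>x. B (f x) (g x)) has_derivative (\<lambda>v. B (f x) (frechet_derivative g (at x) v) +
        B (frechet_derivative f (at x) v) (g x))) (at x)" if "x \<in> S" for x
    by (rule bounded_bilinear.FDERIV[OF assms(2) fg(1)[OF that] fg(2)[OF that]])
  show ?case
  proof (rule times_cont_diff_on_SucI[OF assms(1) d], assumption)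
    show "times_cont_diff_on k S (\<lambda>x. B (f x) (frechet_derivative g (at x) v) +
        B (frechet_derivative f (at x) v) (g x))" for v
      by (rule times_cont_diff_on_add[OF assms(1) Suc.IH[OF l(1) r(2)] Suc.IH[OF r(1) l(2)]])
  qed
qed

lemma times_cont_diff_on_sum:
  assumes "open S" "finite I" "\<And>i. i \<in> I \<Longrightarrow> times_cont_diff_on k S (f i)"
  shows "times_cont_diff_on k S (\<lambda>x. \<Sum>i\<in>I. f i x)"
  using assms(2,3)
  by (induction I rule: finite_induct)
    (auto intro: times_cont_diff_on_const times_cont_diff_on_add[OF assms(1)])

text \<open>The order of differentiability is defined through derivatives along fixed vectors. This
  expansion reduces a derivative along a varying vector to derivatives along the basis
  vectors.\<close>

lemma frechet_derivative_basis_expansion: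
  fixes f :: "'a::euclidean_space \<Rightarrow> 'b::real_normed_vector"
  assumes "f differentiable (at x)"
  shows "frechet_derivative f (at x) v = (\<Sum>b\<in>Basis. (v \<bullet> b) *\<^sub>R frechet_derivative f (at x) b)"
proof -
  have "linear (frechet_derivative f (at x))"
    using assms linear_frechet_derivative by blast
  then have "(\<Sum>b\<in>Basis. (v \<bullet> b) *\<^sub>R frechet_derivative f (at x) b)
    = frechet_derivative f (at x) (\<Sum>b\<in>Basis. (v \<bullet> b) *\<^sub>R b)"
    by (simp add: linear_sum linear_cmul)
  then show ?thesis by (simp add: euclidean_representation)
qed

text \<open>The chain rule differentiates \<open>g\<close> along the moving vector
  \<open>frechet_derivative f (at x) v\<close>. Expanding that vector in the basis leaves products
  of its components with \<open>frechet_derivative g (at (f x)) b\<close>, which is again a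
  composite with the inner map \<open>f\<close>. Hence the induction over all \<open>g\<close> for
  fixed \<open>f\<close>.\<close>

lemma times_cont_diff_on_comp:
  fixes f :: "'a::euclidean_space \<Rightarrow> 'b::euclidean_space" and g :: "'b \<Rightarrow> 'c::real_normed_vector"
  assumes "open S" "open T" "f ` S \<subseteq> T"
  shows "times_cont_diff_on k S f \<Longrightarrow> times_cont_diff_on k T g
    \<Longrightarrow> times_cont_diff_on k S (\<lambda>x. g (f x))"
proof (induction k arbitrary: g)
  case 0
  then show ?case using assms continuous_on_compose2 by (metis times_cont_diff_on.simps(1))
next
  case (Suc k)
  note fd = times_cont_diff_on_has_derivative[OF Suc.prems(1)]
  have gd: "(g has_derivative frechet_derivative g (at (f x))) (at (f x))" if "x \<in> S" for x
    using times_cont_diff_on_has_derivative[OF Suc.prems(2)] assms(3) that by blast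
  have d: "((\<lambda>x. g (f x)) has_derivative (\<lambda>v. \<Sum>b\<in>Basis.
      (frechet_derivative f (at x) v \<bullet> b) *\<^sub>R frechet_derivative g (at (f x)) b)) (at x)"
    if "x \<in> S" for x
  proof -
    have "((\<lambda>x. g (f x)) has_derivative
        (\<lambda>v. frechet_derivative g (at (f x)) (frechet_derivative f (at x) v))) (at x)"
      using diff_chain_at[OF fd[OF that] gd[OF that]] by (simp add: o_def)
    moreover have gdx: "g differentiable (at (f x))" using gd[OF that] differentiableI by blast
    have "(\<lambda>v. frechet_derivative g (at (f x)) (frechet_derivative f (at x) v)) = (\<lambda>v. \<Sum>b\<in>Basis.
      (frechet_derivative f (at x) v \<bullet> b) *\<^sub>R frechet_derivative g (at (f x)) b)"
      by (rule ext) (rule frechet_derivative_basis_expansion[OF gdx])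
    ultimately show ?thesis by (simp only:)
  qed
  have c: "times_cont_diff_on k S (\<lambda>x. frechet_derivative g (at (f x)) b)" for b
    by (rule Suc.IH[OF times_cont_diff_on_SucD[OF Suc.prems(1)] times_cont_diff_on_derivative[OF Suc.prems(2)]])
  have e: "times_cont_diff_on k S (\<lambda>x. frechet_derivative f (at x) v \<bullet> b)" for v b
    by (rule times_cont_diff_on_linear[OF assms(1) bounded_linear_inner_left
          times_cont_diff_on_derivative[OF Suc.prems(1)]])
  have "times_cont_diff_on k S (\<lambda>x. \<Sum>b\<in>Basis. (frechet_derivative f (at x) v \<bullet> b) *\<^sub>R
      frechet_derivative g (at (f x)) b)" for v
    by (rule times_cont_diff_on_sum[OF assms(1) finite_Basis])
      (rule times_cont_diff_on_bilinear[OF assms(1) bounded_bilinear_scaleR e c])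
  then show ?case
    by (intro times_cont_diff_on_SucI[OF assms(1) d])
qed

section \<open>Functions with continuous derivatives of all orders\<close>

lemma smooth_on_subset: "smooth_on S f \<Longrightarrow> T \<subseteq> S \<Longrightarrow> smooth_on T f"
  unfolding smooth_on_def using times_cont_diff_on_subset by blast

lemma smooth_on_cong:
  "open S \<Longrightarrow> (\<And>x. x \<in> S \<Longrightarrow> f x = g x) \<Longrightarrow> smooth_on S f \<Longrightarrow> smooth_on S g"
  unfolding smooth_on_def using times_cont_diff_on_cong by blast

lemma smooth_on_local:
  "(\<And>x. x \<in> S \<Longrightarrow> \<exists>T. open T \<and> x \<in> T \<and> smooth_on T f) \<Longrightarrow> smooth_on S f"
  unfolding smooth_on_def
proof (rule allI, rule times_cont_diff_on_local)
  fix k x assume "\<And>x. x \<in> S \<Longrightarrow> \<exists>T. open T \<and> x \<in> T \<and> (\<forall>k. times_cont_diff_on k T f)" "x \<in> S"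
  then show "\<exists>T. open T \<and> x \<in> T \<and> times_cont_diff_on k T f" by metis
qed

lemma smooth_on_const: "smooth_on S (\<lambda>x. c)"
  unfolding smooth_on_def using times_cont_diff_on_const by blast

lemma smooth_on_add:
  "open S \<Longrightarrow> smooth_on S f \<Longrightarrow> smooth_on S g \<Longrightarrow> smooth_on S (\<lambda>x. f x + g x)"
  unfolding smooth_on_def using times_cont_diff_on_add by blast

lemma smooth_on_linear:
  "open S \<Longrightarrow> bounded_linear L \<Longrightarrow> smooth_on S f \<Longrightarrow> smooth_on S (\<lambda>x. L (f x))"
  unfolding smooth_on_def using times_cont_diff_on_linear by blast

lemma smooth_on_bounded_linear: "open S \<Longrightarrow> bounded_linear L \<Longrightarrow> smooth_on S L"
  unfolding smooth_on_def using times_cont_diff_on_bounded_linear by blast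

lemma smooth_on_bilinear:
  "open S \<Longrightarrow> bounded_bilinear B \<Longrightarrow> smooth_on S f \<Longrightarrow> smooth_on S g
    \<Longrightarrow> smooth_on S (\<lambda>x. B (f x) (g x))"
  unfolding smooth_on_def using times_cont_diff_on_bilinear by blast

lemma smooth_on_diff:
  assumes "open S" "smooth_on S f" "smooth_on S g"
  shows "smooth_on S (\<lambda>x. f x - g x)"
  using smooth_on_add[OF assms(1,2) smooth_on_linear[OF assms(1) bounded_linear_minus[OF bounded_linear_ident] assms(3)]]
  by simp

lemma smooth_on_id: "open S \<Longrightarrow> smooth_on S (\<lambda>x. x)"
  using smooth_on_bounded_linear bounded_linear_ident by blast

lemma smooth_on_comp:
  fixes f :: "'a::euclidean_space \<Rightarrow> 'b::euclidean_space" and g :: "'b \<Rightarrow> 'c::real_normed_vector"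
  shows "smooth_on S f \<Longrightarrow> smooth_on T g \<Longrightarrow> open S \<Longrightarrow> open T \<Longrightarrow> f ` S \<subseteq> T
    \<Longrightarrow> smooth_on S (\<lambda>x. g (f x))"
  unfolding smooth_on_def using times_cont_diff_on_comp by blast

lemma smooth_on_Pair:
  assumes "open S" "smooth_on S f" "smooth_on S g"
  shows "smooth_on S (\<lambda>x. (f x, g x))"
proof -
  have "smooth_on S (\<lambda>x. (f x, 0) + (0, g x))"
    by (intro smooth_on_add[OF assms(1)] smooth_on_linear[OF assms(1) _ assms(2)]
        smooth_on_linear[OF assms(1) _ assms(3)] bounded_linear_Pair bounded_linear_ident bounded_linear_zero)
  then show ?thesis by simp
qed

lemma smooth_on_fst: "open S \<Longrightarrow> smooth_on S f \<Longrightarrow> smooth_on S (\<lambda>x. fst (f x))"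
  using smooth_on_linear bounded_linear_fst by blast

lemma smooth_on_snd: "open S \<Longrightarrow> smooth_on S f \<Longrightarrow> smooth_on S (\<lambda>x. snd (f x))"
  using smooth_on_linear bounded_linear_snd by blast

lemma smooth_on_imp_continuous_on: "smooth_on S f \<Longrightarrow> continuous_on S f"
  unfolding smooth_on_def by (metis times_cont_diff_on.simps(1))

lemma smooth_on_imp_differentiable: "smooth_on S f \<Longrightarrow> x \<in> S \<Longrightarrow> f differentiable (at x)"
  unfolding smooth_on_def by (metis times_cont_diff_on.simps(2))

lemma smooth_on_has_derivative:
  "smooth_on S f \<Longrightarrow> x \<in> S \<Longrightarrow> (f has_derivative frechet_derivative f (at x)) (at x)"
  using smooth_on_imp_differentiable frechet_derivative_works by blast

lemma smooth_on_derivative: "smooth_on S f \<Longrightarrow> smooth_on S (\<lambda>x. frechet_derivative f (at x) v)"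
  unfolding smooth_on_def by (metis times_cont_diff_on.simps(2))

lemma smooth_on_vector_derivative:
  fixes f :: "real \<Rightarrow> 'b::real_normed_vector"
  assumes "open S" "smooth_on S f"
  shows "smooth_on S (\<lambda>x. vector_derivative f (at x))"
proof -
  have "vector_derivative f (at x) = frechet_derivative f (at x) 1" if "x \<in> S" for x
    using frechet_derivative_eq_vector_derivative[OF smooth_on_imp_differentiable[OF assms(2) that]]
    by simp
  then show ?thesis
    using smooth_on_cong[OF assms(1) _ smooth_on_derivative[OF assms(2), of 1]] by metis
qed

lemma smooth_on_has_vector_derivative:
  fixes f :: "real \<Rightarrow> 'b::real_normed_vector"
  assumes "smooth_on S f" "x \<in> S"
  shows "(f has_vector_derivative vector_derivative f (at x)) (at x)"
  using smooth_on_imp_differentiable[OF assms]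
  by (simp add: vector_derivative_works[symmetric])

text \<open>On a compact ball the finitely many partial derivatives are bounded. The sum of the
  bounds controls the whole derivative, and the mean value inequality on the convex ball makes it a
  Lipschitz constant.\<close>

lemma smooth_on_bounded_derivative:
  fixes f :: "'a::euclidean_space \<Rightarrow> 'b::real_normed_vector"
  assumes "smooth_on S f" "cball x0 r \<subseteq> S"
  shows "\<exists>L\<ge>0. (\<forall>x\<in>cball x0 r. \<forall>v. norm (frechet_derivative f (at x) v) \<le> L * norm v) \<and>
    (\<forall>x\<in>cball x0 r. \<forall>y\<in>cball x0 r. norm (f x - f y) \<le> L * norm (x - y))"
proof -
  have "\<exists>C. \<forall>x\<in>cball x0 r. norm (frechet_derivative f (at x) b) \<le> C" for b
  proof -
    have "compact ((\<lambda>x. frechet_derivative f (at x) b) ` cball x0 r)"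
      using assms by (intro compact_continuous_image smooth_on_imp_continuous_on
          smooth_on_derivative compact_cball) (auto intro: smooth_on_subset)
    then show ?thesis
      using compact_imp_bounded bounded_iff by (metis (mono_tags, lifting) imageI)
  qed
  then obtain C where C: "\<And>b x. x \<in> cball x0 r \<Longrightarrow> norm (frechet_derivative f (at x) b) \<le> C b"
    by metis
  define L where "L = (\<Sum>b\<in>(Basis::'a set). \<bar>C b\<bar>)"
  have L0: "L \<ge> 0" unfolding L_def by (simp add: sum_nonneg)
  have bound: "norm (frechet_derivative f (at x) v) \<le> L * norm v" if "x \<in> cball x0 r" for x v
  proof -
    have "f differentiable (at x)" using assms that smooth_on_imp_differentiable by blast
    then have "norm (frechet_derivative f (at x) v)
        = norm (\<Sum>b\<in>Basis. (v \<bullet> b) *\<^sub>R frechet_derivative f (at x) b)"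
      using frechet_derivative_basis_expansion by metis
    also have "\<dots> \<le> (\<Sum>b\<in>Basis. norm ((v \<bullet> b) *\<^sub>R frechet_derivative f (at x) b))"
      by (rule norm_sum)
    also have "\<dots> \<le> (\<Sum>b\<in>(Basis::'a set). norm v * \<bar>C b\<bar>)"
    proof (rule sum_mono)
      fix b :: 'a assume b: "b \<in> Basis"
      have "norm (frechet_derivative f (at x) b) \<le> \<bar>C b\<bar>" using C[OF that, of b] by linarith
      then show "norm ((v \<bullet> b) *\<^sub>R frechet_derivative f (at x) b) \<le> norm v * \<bar>C b\<bar>"
        by (simp add: mult_mono Basis_le_norm[OF b])
    qed
    finally show ?thesis by (simp add: L_def sum_distrib_left mult.commute)
  qed
  have lip: "norm (f x - f y) \<le> L * norm (x - y)" if "x \<in> cball x0 r" "y \<in> cball x0 r" for x y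
  proof (rule differentiable_bound[where S = "cball x0 r" and f' = "\<lambda>x. frechet_derivative f (at x)"])
    show "convex (cball x0 r)" by simp
    show "(f has_derivative frechet_derivative f (at z)) (at z within cball x0 r)"
      if "z \<in> cball x0 r" for z
      using smooth_on_has_derivative[OF assms(1)] assms(2) that has_derivative_at_withinI by blast
    show "onorm (frechet_derivative f (at z)) \<le> L" if "z \<in> cball x0 r" for z
      using bound[OF that] L0 by (intro onorm_bound) auto
  qed (use that in auto)
  show ?thesis using L0 bound lip by blast
qed

text \<open>The preceding bound applies to each partial derivative as well as to \<open>f\<close>
  itself; expansion in the basis combines the Lipschitz constants of the partial derivatives into
  one for the derivative.\<close>

lemma smooth_on_second_order_bounds:
  fixes f :: "'a::euclidean_space \<Rightarrow> 'b::real_normed_vector"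
  assumes "open S" "smooth_on S f" "x0 \<in> S"
  shows "\<exists>r>0. \<exists>L>0. cball x0 r \<subseteq> S \<and>
    (\<forall>x\<in>cball x0 r. \<forall>y\<in>cball x0 r. norm (f x - f y) \<le> L * norm (x - y)) \<and>
    (\<forall>x\<in>cball x0 r. \<forall>y\<in>cball x0 r. \<forall>v.
       norm (frechet_derivative f (at x) v - frechet_derivative f (at y) v) \<le> L * norm (x - y) * norm v)"
proof -
  obtain r where r: "r > 0" "cball x0 r \<subseteq> S"
    using assms open_contains_cball by blast
  obtain L1 where L1: "L1 \<ge> 0"
    "\<forall>x\<in>cball x0 r. \<forall>y\<in>cball x0 r. norm (f x - f y) \<le> L1 * norm (x - y)"
    using smooth_on_bounded_derivative[OF assms(2) r(2)] by blast
  have "\<forall>b. \<exists>K\<ge>0. \<forall>x\<in>cball x0 r. \<forall>y\<in>cball x0 r.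
      norm (frechet_derivative f (at x) b - frechet_derivative f (at y) b) \<le> K * norm (x - y)"
    using smooth_on_bounded_derivative[OF smooth_on_derivative[OF assms(2)] r(2)] by blast
  then obtain K where K: "\<And>b. K b \<ge> 0" "\<And>b x y. x \<in> cball x0 r \<Longrightarrow> y \<in> cball x0 r \<Longrightarrow>
      norm (frechet_derivative f (at x) b - frechet_derivative f (at y) b) \<le> K b * norm (x - y)"
    by metis
  define L2 where "L2 = (\<Sum>b\<in>(Basis::'a set). K b)"
  have L2: "norm (frechet_derivative f (at x) v - frechet_derivative f (at y) v) \<le> L2 * norm (x - y) * norm v"
    if xy: "x \<in> cball x0 r" "y \<in> cball x0 r" for x y v
  proof -
    have d: "f differentiable (at x)" "f differentiable (at y)"
      using assms(2) r(2) xy smooth_on_imp_differentiable by blast+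
    have "norm (frechet_derivative f (at x) v - frechet_derivative f (at y) v) =
       norm (\<Sum>b\<in>Basis. (v \<bullet> b) *\<^sub>R (frechet_derivative f (at x) b - frechet_derivative f (at y) b))"
      using frechet_derivative_basis_expansion[OF d(1), of v] frechet_derivative_basis_expansion[OF d(2), of v]
      by (simp add: sum_subtractf scaleR_diff_right)
    also have "\<dots> \<le> (\<Sum>b\<in>Basis. norm ((v \<bullet> b) *\<^sub>R (frechet_derivative f (at x) b - frechet_derivative f (at y) b)))"
      by (rule norm_sum)
    also have "\<dots> \<le> (\<Sum>b\<in>(Basis::'a set). norm v * (K b * norm (x - y)))"
    proof (rule sum_mono)
      fix b :: 'a assume b: "b \<in> Basis"
      show "norm ((v \<bullet> b) *\<^sub>R (frechet_derivative f (at x) b - frechet_derivative f (at y) b))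
          \<le> norm v * (K b * norm (x - y))"
        using K(2)[OF xy, of b] by (simp add: mult_mono Basis_le_norm[OF b])
    qed
    also have "\<dots> = L2 * norm (x - y) * norm v"
      by (simp add: L2_def sum_distrib_left sum_distrib_right algebra_simps)
    finally show ?thesis .
  qed
  have L20: "L2 \<ge> 0" unfolding L2_def using K(1) by (simp add: sum_nonneg)
  define L where "L = L1 + L2 + 1"
  have "L > 0" using L1 L20 by (simp add: L_def)
  moreover have "norm (f x - f y) \<le> L * norm (x - y)" if "x \<in> cball x0 r" "y \<in> cball x0 r" for x y
  proof -
    have "norm (f x - f y) \<le> L1 * norm (x - y)" using L1 that by blast
    also have "\<dots> \<le> L * norm (x - y)" using L20 by (intro mult_right_mono) (auto simp: L_def)
    finally show ?thesis .
  qed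
  moreover have "norm (frechet_derivative f (at x) v - frechet_derivative f (at y) v) \<le> L * norm (x - y) * norm v"
    if "x \<in> cball x0 r" "y \<in> cball x0 r" for x y v
  proof -
    have "norm (frechet_derivative f (at x) v - frechet_derivative f (at y) v) \<le> L2 * norm (x - y) * norm v"
      using L2 that by blast
    also have "\<dots> \<le> L * norm (x - y) * norm v"
      using L1(1) by (intro mult_right_mono) (auto simp: L_def)
    finally show ?thesis .
  qed
  ultimately show ?thesis using r by blast
qed

lemma smooth_on_taylor:
  fixes f :: "'a::euclidean_space \<Rightarrow> 'b::real_normed_vector"
  assumes "open S" "smooth_on S f" "x0 \<in> S"
  shows "\<exists>r>0. \<exists>L>0. cball x0 r \<subseteq> S \<and>
    (\<forall>x\<in>cball x0 r. \<forall>y\<in>cball x0 r. norm (f x - f y) \<le> L * norm (x - y)) \<and>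
    (\<forall>x\<in>cball x0 r. \<forall>y\<in>cball x0 r.
       norm (f y - f x - frechet_derivative f (at x) (y - x)) \<le> L * (norm (y - x))\<^sup>2)"
proof -
  obtain r L where r: "r > 0" "L > 0" "cball x0 r \<subseteq> S"
    "\<forall>x\<in>cball x0 r. \<forall>y\<in>cball x0 r. norm (f x - f y) \<le> L * norm (x - y)" and
    D: "\<And>x y v. x \<in> cball x0 r \<Longrightarrow> y \<in> cball x0 r \<Longrightarrow>
       norm (frechet_derivative f (at x) v - frechet_derivative f (at y) v) \<le> L * norm (x - y) * norm v"
    using smooth_on_second_order_bounds[OF assms] by metis
  have "norm (f y - f x - frechet_derivative f (at x) (y - x)) \<le> L * (norm (y - x))\<^sup>2"
    if xy: "x \<in> cball x0 r" "y \<in> cball x0 r" for x y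
  proof -
    let ?D = "frechet_derivative f (at x)"
    \<comment> \<open>Subtracting the linear part at \<open>x\<close> leaves a function whose
      derivative on the segment from \<open>x\<close> to \<open>y\<close> has norm at most
      \<open>L * norm (y - x)\<close>; the mean value inequality then gives the quadratic
      remainder.\<close>
    let ?g = "\<lambda>z. f z - ?D z"
    have seg: "closed_segment x y \<subseteq> cball x0 r" using xy by (simp add: closed_segment_subset)
    have lin: "bounded_linear ?D"
      using smooth_on_has_derivative[OF assms(2)] r(3) xy(1) has_derivative_bounded_linear by blast
    have "norm (?g y - ?g x) \<le> (L * norm (y - x)) * norm (y - x)"
    proof (rule differentiable_bound[where S = "closed_segment x y" and
          f' = "\<lambda>z v. frechet_derivative f (at z) v - ?D v"])
      show "convex (closed_segment x y)" by simp
      show "(?g has_derivative (\<lambda>v. frechet_derivative f (at z) v - ?D v)) (at z within closed_segment x y)"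
        if "z \<in> closed_segment x y" for z
      proof -
        have "(f has_derivative frechet_derivative f (at z)) (at z within closed_segment x y)"
          using smooth_on_has_derivative[OF assms(2)] r(3) seg that has_derivative_at_withinI by blast
        moreover have "(?D has_derivative ?D) (at z within closed_segment x y)"
          using lin bounded_linear_imp_has_derivative by blast
        ultimately show ?thesis by (rule has_derivative_diff)
      qed
      show "onorm (\<lambda>v. frechet_derivative f (at z) v - ?D v) \<le> L * norm (y - x)"
        if z: "z \<in> closed_segment x y" for z
      proof (rule onorm_bound)
        show "0 \<le> L * norm (y - x)" using r by simp
        fix v
        have "norm (frechet_derivative f (at z) v - ?D v) \<le> L * norm (z - x) * norm v"
          using D[of z x v] seg z xy by blast
        also have "\<dots> \<le> L * norm (y - x) * norm v"
          using segment_bound1[OF z] r(2) by (intro mult_right_mono mult_left_mono) auto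
        finally show "norm (frechet_derivative f (at z) v - ?D v) \<le> L * norm (y - x) * norm v" .
      qed
    qed auto
    moreover have "?g y - ?g x = f y - f x - ?D (y - x)"
      using lin by (simp add: linear_simps)
    ultimately show ?thesis by (simp add: power2_eq_square mult.assoc)
  qed
  then show ?thesis using r by blast
qed

text \<open>The endpoints lie opposite to each other as seen from the midpoint, so the first-order
  terms cancel and smooth maps preserve midpoints to second order. This is how convexity in the
  chart survives conjugation and the passage from one factor of a product to the other.\<close>

lemma smooth_on_midpoint_bound:
  fixes f :: "'a::euclidean_space \<Rightarrow> 'b::real_normed_vector"
  assumes "open S" "smooth_on S f" "x0 \<in> S"
  shows "\<exists>r>0. \<exists>L>0. cball x0 r \<subseteq> S \<and>
    (\<forall>x\<in>cball x0 r. \<forall>y\<in>cball x0 r. norm (f x - f y) \<le> L * norm (x - y)) \<and>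
    (\<forall>x\<in>cball x0 r. \<forall>y\<in>cball x0 r.
       norm (f (midpoint x y) - midpoint (f x) (f y)) \<le> L * (norm (x - y))\<^sup>2)"
proof -
  obtain r L where r: "r > 0" "L > 0" "cball x0 r \<subseteq> S"
    "\<forall>x\<in>cball x0 r. \<forall>y\<in>cball x0 r. norm (f x - f y) \<le> L * norm (x - y)" and
    T: "\<And>x y. x \<in> cball x0 r \<Longrightarrow> y \<in> cball x0 r \<Longrightarrow>
       norm (f y - f x - frechet_derivative f (at x) (y - x)) \<le> L * (norm (y - x))\<^sup>2"
    using smooth_on_taylor[OF assms] by metis
  have "norm (f (midpoint x y) - midpoint (f x) (f y)) \<le> L * (norm (x - y))\<^sup>2"
    if xy: "x \<in> cball x0 r" "y \<in> cball x0 r" for x y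
  proof -
    define m where "m = midpoint x y"
    have m: "m \<in> cball x0 r"
      unfolding m_def using xy convex_cball[of x0 r]
      by (meson closed_segment_subset midpoint_in_closed_segment subset_iff)
    let ?D = "frechet_derivative f (at m)"
    have lin: "linear ?D"
      using smooth_on_imp_differentiable[OF assms(2)] r(3) m linear_frechet_derivative by blast
    have e1: "x - m = (1/2) *\<^sub>R (x - y)" "y - m = - ((1/2) *\<^sub>R (x - y))"
      unfolding m_def midpoint_def
      by (simp_all add: algebra_simps) (simp_all flip: scaleR_add_left)
    have n: "norm (x - m) = norm (x - y) / 2" "norm (y - m) = norm (x - y) / 2"
      unfolding e1 by simp_all
    have "?D (x - m) + ?D (y - m) = 0"
      unfolding e1 using lin by (simp add: linear_neg)
    then have "2 *\<^sub>R (midpoint (f x) (f y) - f m) =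
        (f x - f m - ?D (x - m)) + (f y - f m - ?D (y - m))"
      by (simp add: midpoint_def algebra_simps) (simp add: scaleR_2)
    then have "norm (2 *\<^sub>R (midpoint (f x) (f y) - f m)) \<le>
        L * (norm (x - m))\<^sup>2 + L * (norm (y - m))\<^sup>2"
      using T[OF m xy(1)] T[OF m xy(2)] norm_triangle_mono by metis
    also have "\<dots> \<le> 2 * (L * (norm (x - y))\<^sup>2)"
      unfolding n using r(2) by (simp add: power_divide)
    finally show ?thesis unfolding m_def[symmetric] by (simp add: norm_minus_commute)
  qed
  then show ?thesis using r by blast
qed

section \<open>Smooth maps from Euclidean domains into a manifold\<close>

text \<open>These conditions pass to \<open>prod_atlas\<close> by topology alone, and they are what
  composition with a smooth map between manifolds uses.\<close>

definition topological_atlas ::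
    "('m::topological_space, 'e::euclidean_space) atlas \<Rightarrow> bool" where
  "topological_atlas A \<longleftrightarrow>
     (\<forall>(U, \<phi>)\<in>A. openin (top_of_set (atlas_space A)) U \<and> open (\<phi> ` U) \<and>
        homeomorphism U (\<phi> ` U) \<phi> (inv_into U \<phi>))"

text \<open>Paths, families of conjugations and products in coordinates all have open Euclidean
  domains. For such maps smoothness of a group word follows from closure under multiplication,
  inversion and substitution.\<close>

definition smooth_into ::
    "('m::topological_space, 'e::euclidean_space) atlas \<Rightarrow> 'a::euclidean_space set \<Rightarrow>
     ('a \<Rightarrow> 'm) \<Rightarrow> bool" where
  "smooth_into A S f \<longleftrightarrow> open S \<and> continuous_on S f \<and> f ` S \<subseteq> atlas_space A \<and>
     (\<forall>(U, \<phi>)\<in>A. smooth_on (S \<inter> f -` U) (\<lambda>x. \<phi> (f x)))"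

lemma smooth_atlas_imp_topological: "smooth_atlas A \<Longrightarrow> topological_atlas A"
  unfolding smooth_atlas_def topological_atlas_def by blast

lemma chart_subset: "(U, \<phi>) \<in> A \<Longrightarrow> U \<subseteq> atlas_space A"
  unfolding atlas_space_def by auto

lemma chart_exists: "x \<in> atlas_space A \<Longrightarrow> \<exists>U \<phi>. (U, \<phi>) \<in> A \<and> x \<in> U"
  unfolding atlas_space_def by auto

lemma topological_atlasD:
  assumes "topological_atlas A" "(U, \<phi>) \<in> A"
  shows "openin (top_of_set (atlas_space A)) U" "open (\<phi> ` U)"
    "homeomorphism U (\<phi> ` U) \<phi> (inv_into U \<phi>)"
    "continuous_on U \<phi>" "continuous_on (\<phi> ` U) (inv_into U \<phi>)"
    "inj_on \<phi> U" "x \<in> U \<Longrightarrow> inv_into U \<phi> (\<phi> x) = x"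
    "v \<in> \<phi> ` U \<Longrightarrow> \<phi> (inv_into U \<phi> v) = v" "v \<in> \<phi> ` U \<Longrightarrow> inv_into U \<phi> v \<in> U"
proof -
  show 1: "openin (top_of_set (atlas_space A)) U" "open (\<phi> ` U)"
    and h: "homeomorphism U (\<phi> ` U) \<phi> (inv_into U \<phi>)"
    using assms unfolding topological_atlas_def by auto
  show "continuous_on U \<phi>" "continuous_on (\<phi> ` U) (inv_into U \<phi>)"
    using h unfolding homeomorphism_def by auto
  show i: "inj_on \<phi> U"
    using h unfolding homeomorphism_def by (metis inj_on_inverseI)
  show "x \<in> U \<Longrightarrow> inv_into U \<phi> (\<phi> x) = x" using i by simp
  show "v \<in> \<phi> ` U \<Longrightarrow> \<phi> (inv_into U \<phi> v) = v" by (rule f_inv_into_f)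
  show "v \<in> \<phi> ` U \<Longrightarrow> inv_into U \<phi> v \<in> U" by (rule inv_into_into)
qed

lemma topological_atlas_open_image:
  assumes "topological_atlas A" "(U, \<phi>) \<in> A" "openin (top_of_set (atlas_space A)) W"
  shows "open (\<phi> ` (U \<inter> W))"
proof -
  have "openin (top_of_set U) (U \<inter> W)"
  proof -
    obtain T where "open T" "W = atlas_space A \<inter> T" using assms(3) openin_open by blast
    then show ?thesis using chart_subset[OF assms(2)] openin_open by blast
  qed
  then have "openin (top_of_set (\<phi> ` U)) (\<phi> ` (U \<inter> W))"
    using topological_atlasD(3)[OF assms(1,2)] homeomorphism_imp_open_map by blast
  then show ?thesis using topological_atlasD(2)[OF assms(1,2)] by (rule openin_open_trans)
qed

lemma openin_atlas_space_vimage: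
  assumes "continuous_on S f" "openin (top_of_set T) W" "f ` S \<subseteq> T"
  shows "openin (top_of_set S) (S \<inter> f -` W)"
proof -
  have "f \<in> S \<rightarrow> T" using assms(3) by auto
  then show ?thesis using continuous_on_open_gen[of f S T] assms(1,2) by blast
qed

lemma smooth_into_open_vimage:
  assumes "smooth_into A S f" "openin (top_of_set (atlas_space A)) W"
  shows "open (S \<inter> f -` W)"
proof -
  have "open S" "continuous_on S f" "f ` S \<subseteq> atlas_space A"
    using assms(1) unfolding smooth_into_def by auto
  then show ?thesis
    using openin_open_trans[OF openin_atlas_space_vimage[OF _ assms(2)]] by blast
qed

lemma smooth_into_open: "smooth_into A S f \<Longrightarrow> open S"
  and smooth_into_continuous: "smooth_into A S f \<Longrightarrow> continuous_on S f"
  and smooth_into_space: "smooth_into A S f \<Longrightarrow> x \<in> S \<Longrightarrow> f x \<in> atlas_space A"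
  and smooth_into_chart: "smooth_into A S f \<Longrightarrow> (U, \<phi>) \<in> A \<Longrightarrow> smooth_on (S \<inter> f -` U) (\<lambda>x. \<phi> (f x))"
  unfolding smooth_into_def by auto

lemma smooth_into_subset:
  assumes "smooth_into A S f" "open T" "T \<subseteq> S" shows "smooth_into A T f"
proof -
  have "smooth_on (T \<inter> f -` U) (\<lambda>x. \<phi> (f x))" if "(U, \<phi>) \<in> A" for U \<phi>
    using smooth_into_chart[OF assms(1) that] assms(3) by (auto intro: smooth_on_subset)
  moreover have "f ` T \<subseteq> atlas_space A" using assms(3) smooth_into_space[OF assms(1)] by blast
  ultimately show ?thesis
    using assms(2) continuous_on_subset[OF smooth_into_continuous[OF assms(1)] assms(3)]
    unfolding smooth_into_def by blast
qed

lemma smooth_into_local: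
  assumes A: "topological_atlas A"
    and loc: "\<And>x. x \<in> S \<Longrightarrow> \<exists>T. x \<in> T \<and> T \<subseteq> S \<and> smooth_into A T f"
  shows "smooth_into A S f"
proof -
  have op: "open S"
  proof (rule Topological_Spaces.openI)
    fix x assume "x \<in> S"
    then obtain T where "x \<in> T" "T \<subseteq> S" "smooth_into A T f" using loc by blast
    then show "\<exists>T. open T \<and> x \<in> T \<and> T \<subseteq> S" using smooth_into_open[of A T f] by blast
  qed
  have "continuous_on S f"
  proof (rule continuous_at_imp_continuous_on, rule ballI)
    fix x assume "x \<in> S"
    then obtain T where "x \<in> T" "smooth_into A T f" using loc by blast
    then show "isCont f x"
      using continuous_on_eq_continuous_at[of T f] smooth_into_open[of A T f] smooth_into_continuous[of A T f] by blast
  qed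
  moreover have "f ` S \<subseteq> atlas_space A"
  proof
    fix y assume "y \<in> f ` S"
    then obtain x where x: "y = f x" "x \<in> S" by (rule imageE)
    from loc[OF x(2)] obtain T where "x \<in> T" "smooth_into A T f" by (elim exE conjE)
    then show "y \<in> atlas_space A" unfolding x(1) by (rule smooth_into_space[rotated])
  qed
  moreover have "smooth_on (S \<inter> f -` U) (\<lambda>x. \<phi> (f x))" if U: "(U, \<phi>) \<in> A" for U \<phi>
  proof (rule smooth_on_local)
    fix x assume x: "x \<in> S \<inter> f -` U"
    then obtain T where T: "x \<in> T" "T \<subseteq> S" "smooth_into A T f" using loc by blast
    show "\<exists>T'. open T' \<and> x \<in> T' \<and> smooth_on T' (\<lambda>x. \<phi> (f x))"
      using smooth_into_open_vimage[OF T(3) topological_atlasD(1)[OF A U]] smooth_into_chart[OF T(3) U] x T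
      by blast
  qed
  ultimately show ?thesis using op unfolding smooth_into_def by auto
qed

lemma smooth_into_cong:
  assumes "smooth_into A S f" "\<And>x. x \<in> S \<Longrightarrow> f x = g x" "topological_atlas A"
  shows "smooth_into A S g"
proof -
  have "smooth_on (S \<inter> g -` U) (\<lambda>x. \<phi> (g x))" if U: "(U, \<phi>) \<in> A" for U \<phi>
  proof -
    have e: "S \<inter> g -` U = S \<inter> f -` U" using assms(2) by auto
    show ?thesis unfolding e
      by (rule smooth_on_cong[OF smooth_into_open_vimage[OF assms(1) topological_atlasD(1)[OF assms(3) U]] _
            smooth_into_chart[OF assms(1) U]]) (use assms(2) in auto)
  qed
  moreover have "continuous_on S g"
    using assms(1,2) continuous_on_cong smooth_into_continuous by metis
  moreover have "g ` S \<subseteq> atlas_space A" using assms(1,2) smooth_into_space by fastforce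
  ultimately show ?thesis using smooth_into_open[OF assms(1)] unfolding smooth_into_def by auto
qed

lemma smooth_into_comp:
  assumes A: "topological_atlas A" and f: "smooth_into A S f" and T: "open T"
    and k: "smooth_on T k" "k ` T \<subseteq> S"
  shows "smooth_into A T (\<lambda>x. f (k x))"
proof -
  have kc: "continuous_on T k" using k smooth_on_imp_continuous_on by blast
  have "smooth_on (T \<inter> (\<lambda>x. f (k x)) -` U) (\<lambda>x. \<phi> (f (k x)))" if U: "(U, \<phi>) \<in> A" for U \<phi>
  proof -
    have o: "open (S \<inter> f -` U)"
      using smooth_into_open_vimage[OF f topological_atlasD(1)[OF A U]] .
    have e: "T \<inter> (\<lambda>x. f (k x)) -` U = T \<inter> k -` (S \<inter> f -` U)" using k(2) by auto
    have "open (T \<inter> k -` (S \<inter> f -` U))"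
      using kc T o by (rule continuous_open_preimage)
    then show ?thesis unfolding e
      by (intro smooth_on_comp[OF smooth_on_subset[OF k(1)] smooth_into_chart[OF f U] _ o]) auto
  qed
  moreover have "continuous_on T (\<lambda>x. f (k x))"
    using continuous_on_compose2[OF smooth_into_continuous[OF f] kc k(2)] .
  moreover have "(\<lambda>x. f (k x)) ` T \<subseteq> atlas_space A"
    using k(2) smooth_into_space[OF f] by blast
  ultimately show ?thesis using T unfolding smooth_into_def by auto
qed

lemma smooth_into_const:
  assumes "open S" "c \<in> atlas_space A" shows "smooth_into A S (\<lambda>x. c)"
  using assms unfolding smooth_into_def by (auto simp: smooth_on_const)

lemma smooth_into_chart_inv:
  assumes A: "smooth_atlas A" and U: "(U, \<phi>) \<in> A"
  shows "smooth_into A (\<phi> ` U) (inv_into U \<phi>)"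
proof -
  note t = topological_atlasD[OF smooth_atlas_imp_topological[OF A] U]
  have "smooth_on (\<phi> ` U \<inter> inv_into U \<phi> -` V) (\<lambda>x. \<psi> (inv_into U \<phi> x))" if V: "(V, \<psi>) \<in> A" for V \<psi>
  proof -
    have "\<phi> ` U \<inter> inv_into U \<phi> -` V = \<phi> ` (U \<inter> V)" using t(7) by auto
    moreover have "smooth_on (\<phi> ` (U \<inter> V)) (\<psi> \<circ> inv_into U \<phi>)"
      using A U V unfolding smooth_atlas_def by blast
    ultimately show ?thesis by (simp add: o_def)
  qed
  moreover have "inv_into U \<phi> ` \<phi> ` U \<subseteq> atlas_space A"
    using t(9) chart_subset[OF U] by blast
  ultimately show ?thesis using t(2,5) unfolding smooth_into_def by auto
qed

text \<open>One chart containing the whole image suffices, since the inverse chart is itself smooth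
  into the manifold by the smoothness of the transition maps.\<close>

lemma smooth_into_of_chart:
  assumes A: "smooth_atlas A" and U: "(U, \<phi>) \<in> A"
    and f: "open S" "f ` S \<subseteq> U" "smooth_on S (\<lambda>x. \<phi> (f x))"
  shows "smooth_into A S f"
proof -
  note t = smooth_atlas_imp_topological[OF A]
  have "smooth_into A S (\<lambda>x. inv_into U \<phi> (\<phi> (f x)))"
    by (rule smooth_into_comp[OF t smooth_into_chart_inv[OF A U] f(1,3)]) (use f(2) in auto)
  then show ?thesis
    by (rule smooth_into_cong[OF _ _ t]) (use topological_atlasD(7)[OF t U] f(2) in auto)
qed

text \<open>A source chart around each value of \<open>f\<close> splits the composite locally into
  two maps between Euclidean spaces.\<close>

lemma smooth_into_smooth_map:
  assumes A: "topological_atlas A" and B: "topological_atlas B"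
    and F: "smooth_map A B F" and f: "smooth_into A S f"
  shows "smooth_into B S (\<lambda>x. F (f x))"
proof -
  have Fc: "continuous_on (atlas_space A) F" "F ` atlas_space A \<subseteq> atlas_space B"
    using F unfolding smooth_map_def by auto
  have fs: "f ` S \<subseteq> atlas_space A" using smooth_into_space[OF f] by blast
  have "continuous_on S (\<lambda>x. F (f x))"
    using continuous_on_compose2[OF Fc(1) smooth_into_continuous[OF f] fs] .
  moreover have "smooth_on (S \<inter> (\<lambda>x. F (f x)) -` V) (\<lambda>x. \<psi> (F (f x)))" if V: "(V, \<psi>) \<in> B" for V \<psi>
  proof (rule smooth_on_local)
    fix x assume x: "x \<in> S \<inter> (\<lambda>x. F (f x)) -` V"
    then obtain U \<phi> where U: "(U, \<phi>) \<in> A" "f x \<in> U"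
      using chart_exists[OF smooth_into_space[OF f, of x]] by blast
    have W: "openin (top_of_set (atlas_space A)) (atlas_space A \<inter> F -` V)"
      using openin_atlas_space_vimage[OF Fc(1) topological_atlasD(1)[OF B V] Fc(2)] .
    have Uo: "openin (top_of_set (atlas_space A)) U" by (rule topological_atlasD(1)[OF A U(1)])
    have e: "U \<inter> (atlas_space A \<inter> F -` V) = U \<inter> F -` V" using chart_subset[OF U(1)] by auto
    let ?T = "S \<inter> f -` (U \<inter> F -` V)"
    have "openin (top_of_set (atlas_space A)) (U \<inter> F -` V)"
      using openin_Int[OF Uo W] e by simp
    then have T: "open ?T" by (rule smooth_into_open_vimage[OF f])
    have o: "open (\<phi> ` (U \<inter> F -` V))"
      using topological_atlas_open_image[OF A U(1) W] e by simp
    have s1: "smooth_on (\<phi> ` (U \<inter> F -` V)) (\<psi> \<circ> F \<circ> inv_into U \<phi>)"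
      using F U(1) V unfolding smooth_map_def by blast
    have s2: "smooth_on ?T (\<lambda>x. \<phi> (f x))"
      by (rule smooth_on_subset[OF smooth_into_chart[OF f U(1)]]) auto
    have "smooth_on ?T (\<lambda>x. (\<psi> \<circ> F \<circ> inv_into U \<phi>) (\<phi> (f x)))"
      by (rule smooth_on_comp[OF s2 s1 T o]) auto
    then have "smooth_on ?T (\<lambda>x. \<psi> (F (f x)))"
      by (rule smooth_on_cong[OF T, rotated]) (simp add: topological_atlasD(7)[OF A U(1)])
    then show "\<exists>T. open T \<and> x \<in> T \<and> smooth_on T (\<lambda>x. \<psi> (F (f x)))"
      using T x U(2) by blast
  qed
  moreover have "(\<lambda>x. F (f x)) ` S \<subseteq> atlas_space B" using fs Fc(2) by blast
  ultimately show ?thesis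
    using smooth_into_open[OF f] unfolding smooth_into_def by auto
qed

section \<open>Products of atlases\<close>

lemma atlas_space_prod: "atlas_space (prod_atlas A B) = atlas_space A \<times> atlas_space B"
proof
  show "atlas_space (prod_atlas A B) \<subseteq> atlas_space A \<times> atlas_space B"
  proof
    fix p assume "p \<in> atlas_space (prod_atlas A B)"
    then obtain U \<phi> V \<psi> where "(U, \<phi>) \<in> A" "(V, \<psi>) \<in> B" "p \<in> U \<times> V"
      unfolding atlas_space_def prod_atlas_def by auto
    then show "p \<in> atlas_space A \<times> atlas_space B"
      using chart_subset[of U \<phi> A] chart_subset[of V \<psi> B] by auto
  qed
  show "atlas_space A \<times> atlas_space B \<subseteq> atlas_space (prod_atlas A B)"
  proof
    fix p assume "p \<in> atlas_space A \<times> atlas_space B"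
    then obtain U \<phi> V \<psi> where c: "(U, \<phi>) \<in> A" "(V, \<psi>) \<in> B" "p \<in> U \<times> V"
      unfolding atlas_space_def by auto
    then have "(U \<times> V, map_prod \<phi> \<psi>) \<in> prod_atlas A B"
      unfolding prod_atlas_def by blast
    from chart_subset[OF this] c(3) show "p \<in> atlas_space (prod_atlas A B)" by blast
  qed
qed

lemma topological_atlas_prod:
  assumes A: "topological_atlas A" and B: "topological_atlas B"
  shows "topological_atlas (prod_atlas A B)"
  unfolding topological_atlas_def
proof (rule ballI, clarify)
  fix W \<eta> assume "(W, \<eta>) \<in> prod_atlas A B"
  then obtain U \<phi> V \<psi> where W: "W = U \<times> V" "\<eta> = map_prod \<phi> \<psi>" and U: "(U, \<phi>) \<in> A" and V: "(V, \<psi>) \<in> B"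
    unfolding prod_atlas_def by blast
  note a = topological_atlasD[OF A U] and b = topological_atlasD[OF B V]
  have "openin (top_of_set (atlas_space (prod_atlas A B))) W"
    unfolding atlas_space_prod W by (intro openin_Times a b)
  moreover have "open (\<eta> ` W)" unfolding W map_prod_image by (intro open_Times a b)
  moreover have "homeomorphism W (\<eta> ` W) \<eta> (inv_into W \<eta>)"
  proof -
    have inj: "inj_on \<eta> W" unfolding W using a(6) b(6) by (auto simp: inj_on_def)
    have c: "continuous_on W \<eta>"
    proof -
      have "continuous_on (U \<times> V) (\<lambda>p. \<phi> (fst p))" "continuous_on (U \<times> V) (\<lambda>p. \<psi> (snd p))"
        by (rule continuous_on_compose2[OF a(4) continuous_on_fst], auto)
          (rule continuous_on_compose2[OF b(4) continuous_on_snd], auto)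
      then show ?thesis unfolding W map_prod_def case_prod_unfold by (intro continuous_on_Pair)
    qed
    have e: "inv_into W \<eta> p = map_prod (inv_into U \<phi>) (inv_into V \<psi>) p" if p: "p \<in> \<eta> ` W" for p
    proof -
      obtain x y where xy: "x \<in> U" "y \<in> V" "p = \<eta> (x, y)" using p W by auto
      then have "inv_into W \<eta> p = (x, y)" using inv_into_f_f[OF inj, of "(x, y)"] W by simp
      then show ?thesis using xy a(7) b(7) W by simp
    qed
    have "continuous_on (\<phi> ` U \<times> \<psi> ` V) (map_prod (inv_into U \<phi>) (inv_into V \<psi>))"
    proof -
      have "continuous_on (\<phi> ` U \<times> \<psi> ` V) (\<lambda>p. inv_into U \<phi> (fst p))"
        "continuous_on (\<phi> ` U \<times> \<psi> ` V) (\<lambda>p. inv_into V \<psi> (snd p))"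
        by (rule continuous_on_compose2[OF a(5) continuous_on_fst], auto)
          (rule continuous_on_compose2[OF b(5) continuous_on_snd], auto)
      then show ?thesis unfolding map_prod_def case_prod_unfold by (intro continuous_on_Pair)
    qed
    moreover have "\<eta> ` W = \<phi> ` U \<times> \<psi> ` V" unfolding W by (rule map_prod_image)
    ultimately have "continuous_on (\<eta> ` W) (inv_into W \<eta>)"
      by (subst continuous_on_cong[OF refl e]) auto
    then show ?thesis
      using c inj unfolding homeomorphism_def by (auto simp: f_inv_into_f)
  qed
  ultimately show "openin (top_of_set (atlas_space (prod_atlas A B))) W \<and> open (\<eta> ` W) \<and>
      homeomorphism W (\<eta> ` W) \<eta> (inv_into W \<eta>)" by blast
qed

lemma smooth_into_Pair:
  assumes A: "topological_atlas A" and B: "topological_atlas B"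
    and f: "smooth_into A S f" and g: "smooth_into B S g"
  shows "smooth_into (prod_atlas A B) S (\<lambda>x. (f x, g x))"
proof -
  have "smooth_on (S \<inter> (\<lambda>x. (f x, g x)) -` W) (\<lambda>x. \<eta> (f x, g x))" if W\<eta>: "(W, \<eta>) \<in> prod_atlas A B" for W \<eta>
  proof -
    obtain U \<phi> V \<psi> where W: "W = U \<times> V" "\<eta> = map_prod \<phi> \<psi>" and U: "(U, \<phi>) \<in> A" and V: "(V, \<psi>) \<in> B"
      using W\<eta> unfolding prod_atlas_def by blast
    have e: "S \<inter> (\<lambda>x. (f x, g x)) -` W = (S \<inter> f -` U) \<inter> (S \<inter> g -` V)" using W by auto
    have "open (S \<inter> f -` U)" "open (S \<inter> g -` V)"
      using smooth_into_open_vimage[OF f topological_atlasD(1)[OF A U]]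
        smooth_into_open_vimage[OF g topological_atlasD(1)[OF B V]] by auto
    then have "smooth_on ((S \<inter> f -` U) \<inter> (S \<inter> g -` V)) (\<lambda>x. (\<phi> (f x), \<psi> (g x)))"
      using smooth_into_chart[OF f U] smooth_into_chart[OF g V]
      by (intro smooth_on_Pair) (auto intro: smooth_on_subset)
    then show ?thesis unfolding e using W by simp
  qed
  moreover have "continuous_on S (\<lambda>x. (f x, g x))"
    using smooth_into_continuous[OF f] smooth_into_continuous[OF g] by (rule continuous_on_Pair)
  ultimately show ?thesis
    using smooth_into_open[OF f] smooth_into_space[OF f] smooth_into_space[OF g]
    unfolding smooth_into_def atlas_space_prod by auto
qed

lemma smooth_map_line_iff: "smooth_map line_atlas A \<gamma> \<longleftrightarrow> smooth_into A UNIV \<gamma>"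
proof -
  have "atlas_space line_atlas = UNIV" by (simp add: atlas_space_def line_atlas_def)
  moreover have "inv_into UNIV id = (id :: real \<Rightarrow> real)" by (simp add: inv_id)
  ultimately show ?thesis
    unfolding smooth_map_def smooth_into_def by (auto simp: line_atlas_def o_def)
qed

section \<open>Lie groups\<close>

context lie_group
begin

lemma smooth_intoD: "smooth_into A S f \<Longrightarrow> x \<in> S \<Longrightarrow> f x \<in> carrier G"
  using smooth_into_space carrier_eq by metis

lemma topological_atlas: "topological_atlas A"
  using atlas smooth_atlas_imp_topological by blast

lemmas chartD = topological_atlasD[OF topological_atlas, unfolded carrier_eq]

lemma chart_carrier: "(U, \<phi>) \<in> A \<Longrightarrow> U \<subseteq> carrier G"
  using chart_subset carrier_eq by metis

lemma smooth_into_mult: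
  assumes "smooth_into A S f" "smooth_into A S h"
  shows "smooth_into A S (\<lambda>x. f x \<otimes> h x)"
  using smooth_into_smooth_map[OF topological_atlas_prod[OF topological_atlas topological_atlas]
      topological_atlas smooth_mult smooth_into_Pair[OF topological_atlas topological_atlas assms]]
  by simp

lemma smooth_into_inv:
  assumes "smooth_into A S f" shows "smooth_into A S (\<lambda>x. inv (f x))"
  using smooth_into_smooth_map[OF topological_atlas topological_atlas smooth_inv assms] .

lemma smooth_into_constant: "open S \<Longrightarrow> c \<in> carrier G \<Longrightarrow> smooth_into A S (\<lambda>x. c)"
  using smooth_into_const carrier_eq by metis

lemma smooth_into_chart_inverse: "(U, \<phi>) \<in> A \<Longrightarrow> smooth_into A (\<phi> ` U) (inv_into U \<phi>)"
  using smooth_into_chart_inv atlas by blast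

lemma smooth_into_compose:
  "smooth_into A S f \<Longrightarrow> open T \<Longrightarrow> smooth_on T k \<Longrightarrow> k ` T \<subseteq> S \<Longrightarrow> smooth_into A T (\<lambda>x. f (k x))"
  using smooth_into_comp topological_atlas by blast

lemma smooth_into_open_vimage_chart:
  "smooth_into A S f \<Longrightarrow> (U, \<phi>) \<in> A \<Longrightarrow> open (S \<inter> f -` U)"
  using smooth_into_open_vimage topological_atlasD(1)[OF topological_atlas] by metis

lemma continuous_on_mult': "continuous_on (carrier G \<times> carrier G) (\<lambda>(x, y). x \<otimes> y)"
  using smooth_mult unfolding smooth_map_def atlas_space_prod carrier_eq by blast

lemma continuous_on_inv': "continuous_on (carrier G) (\<lambda>x. inv x)"
  using smooth_inv unfolding smooth_map_def carrier_eq by blast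

lemma continuous_on_mult:
  assumes "continuous_on S f" "continuous_on S h" "f ` S \<subseteq> carrier G" "h ` S \<subseteq> carrier G"
  shows "continuous_on S (\<lambda>x. f x \<otimes> h x)"
  using continuous_on_compose2[OF continuous_on_mult' continuous_on_Pair[OF assms(1,2)]] assms(3,4)
  by auto

lemma continuous_on_inverse:
  assumes "continuous_on S f" "f ` S \<subseteq> carrier G"
  shows "continuous_on S (\<lambda>x. inv (f x))"
  using continuous_on_compose2[OF continuous_on_inv' assms] .

lemma tendsto_mult:
  assumes "(f \<longlongrightarrow> a) F" "(h \<longlongrightarrow> b) F" "\<forall>\<^sub>F x in F. f x \<in> carrier G" "\<forall>\<^sub>F x in F. h x \<in> carrier G"
    "a \<in> carrier G" "b \<in> carrier G"
  shows "((\<lambda>x. f x \<otimes> h x) \<longlongrightarrow> a \<otimes> b) F"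
proof -
  have "((\<lambda>x. (\<lambda>(x, y). x \<otimes> y) (f x, h x)) \<longlongrightarrow> (\<lambda>(x, y). x \<otimes> y) (a, b)) F"
  proof (rule continuous_on_tendsto_compose[OF continuous_on_mult'])
    show "((\<lambda>x. (f x, h x)) \<longlongrightarrow> (a, b)) F" using assms(1,2) by (rule tendsto_Pair)
    show "\<forall>\<^sub>F x in F. (f x, h x) \<in> carrier G \<times> carrier G"
      using assms(3,4) by eventually_elim auto
  qed (use assms in auto)
  then show ?thesis by simp
qed

lemma tendsto_inverse:
  assumes "(f \<longlongrightarrow> a) F" "\<forall>\<^sub>F x in F. f x \<in> carrier G" "a \<in> carrier G"
  shows "((\<lambda>x. inv (f x)) \<longlongrightarrow> inv a) F"
  using continuous_on_tendsto_compose[OF continuous_on_inv' assms(1,3,2)] .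

lemma chart_at: "x \<in> carrier G \<Longrightarrow> \<exists>U \<phi>. (U, \<phi>) \<in> A \<and> x \<in> U"
  using chart_exists carrier_eq by metis

end

text \<open>Turns constants valid near each point of a compact set into constants valid on all of
  it: the least radius and the greatest bound over a finite subcover work because of
  \<open>mono\<close>.\<close>

lemma compact_uniform_bounds:
  fixes P :: "'a::topological_space \<Rightarrow> real \<Rightarrow> real \<Rightarrow> bool"
  assumes K: "compact K"
    and loc: "\<And>x. x \<in> K \<Longrightarrow> \<exists>N. open N \<and> x \<in> N \<and> (\<exists>\<delta>>0. \<exists>L. \<forall>y\<in>N \<inter> K. P y \<delta> L)"
    and mono: "\<And>y \<delta> L \<delta>' L'. P y \<delta> L \<Longrightarrow> 0 < \<delta>' \<Longrightarrow> \<delta>' \<le> \<delta> \<Longrightarrow> L \<le> L' \<Longrightarrow> P y \<delta>' L'"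
  shows "\<exists>\<delta>>0. \<exists>L>0. \<forall>y\<in>K. P y \<delta> L"
proof -
  have "\<forall>x\<in>K. \<exists>N \<delta> L. open N \<and> x \<in> N \<and> \<delta> > 0 \<and> (\<forall>y\<in>N \<inter> K. P y \<delta> L)"
  proof
    fix x assume "x \<in> K"
    from loc[OF this] obtain N \<delta> L where "open N \<and> x \<in> N \<and> \<delta> > 0 \<and> (\<forall>y\<in>N \<inter> K. P y \<delta> L)"
      by (elim exE conjE) auto
    then show "\<exists>N \<delta> L. open N \<and> x \<in> N \<and> \<delta> > 0 \<and> (\<forall>y\<in>N \<inter> K. P y \<delta> L)" by (intro exI)
  qed
  from bchoice[OF this] obtain N where
    "\<forall>x\<in>K. \<exists>\<delta> L. open (N x) \<and> x \<in> N x \<and> \<delta> > 0 \<and> (\<forall>y\<in>N x \<inter> K. P y \<delta> L)" by (elim exE)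
  from bchoice[OF this] obtain \<delta> where
    "\<forall>x\<in>K. \<exists>L. open (N x) \<and> x \<in> N x \<and> \<delta> x > 0 \<and> (\<forall>y\<in>N x \<inter> K. P y (\<delta> x) L)" by (elim exE)
  from bchoice[OF this] obtain L where
    N: "\<forall>x\<in>K. open (N x) \<and> x \<in> N x \<and> \<delta> x > 0 \<and> (\<forall>y\<in>N x \<inter> K. P y (\<delta> x) (L x))" by (elim exE)
  have "K \<subseteq> (\<Union>x\<in>K. N x)" using N by blast
  from compactE_image[OF K _ this] N obtain C where C: "C \<subseteq> K" "finite C" "K \<subseteq> (\<Union>x\<in>C. N x)"
    by blast
  \<comment> \<open>The extra entry 1 covers the case of an empty subcover, and in \<open>M\<close>
    it also ensures positivity.\<close>
  define d where "d = Min (insert 1 (\<delta> ` C))"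
  define M where "M = Max (insert 1 (L ` C))"
  have d: "d > 0" "\<And>x. x \<in> C \<Longrightarrow> d \<le> \<delta> x"
    unfolding d_def using C N by auto
  have M: "M > 0" "\<And>x. x \<in> C \<Longrightarrow> L x \<le> M"
  proof -
    have "1 \<le> M" unfolding M_def using C(2) by (intro Max_ge) auto
    then show "M > 0" by simp
    show "L x \<le> M" if "x \<in> C" for x unfolding M_def using C(2) that by (intro Max_ge) auto
  qed
  have "P y d M" if y: "y \<in> K" for y
  proof -
    obtain x where x: "x \<in> C" "y \<in> N x" using C(3) y by blast
    then have "P y (\<delta> x) (L x)" using N C(1) y by blast
    then show ?thesis using mono[OF _ d(1) d(2)[OF x(1)] M(2)[OF x(1)]] by blast
  qed
  then show ?thesis using d(1) M(1) by blast
qed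

section \<open>The center of a compact simple Lie group\<close>

lemma (in group) group_centerD:
  assumes "z \<in> group_center G"
  shows "z \<in> carrier G" "\<And>g. g \<in> carrier G \<Longrightarrow> z \<otimes> g = g \<otimes> z"
    "\<And>g. g \<in> carrier G \<Longrightarrow> g \<otimes> z \<otimes> inv g = z"
proof -
  show z: "z \<in> carrier G" using assms unfolding group_center_def by blast
  show c: "z \<otimes> g = g \<otimes> z" if "g \<in> carrier G" for g using assms that unfolding group_center_def by blast
  show "g \<otimes> z \<otimes> inv g = z" if "g \<in> carrier G" for g
    using c[OF that, symmetric] z that by (simp add: m_assoc)
qed

lemma (in group) subgroup_group_center: "subgroup (group_center G) G"
proof
  show "group_center G \<subseteq> carrier G" using group_centerD(1) by blast
  show "\<one> \<in> group_center G" by (simp add: group_center_def)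
  fix x y assume x: "x \<in> group_center G" and y: "y \<in> group_center G"
  note xc = group_centerD(1,2)[OF x] and yc = group_centerD(1,2)[OF y]
  have "x \<otimes> y \<otimes> g = g \<otimes> (x \<otimes> y)" if g: "g \<in> carrier G" for g
  proof -
    have "x \<otimes> y \<otimes> g = x \<otimes> (g \<otimes> y)" using xc(1) yc(1) yc(2)[OF g] g by (simp add: m_assoc)
    also have "\<dots> = (x \<otimes> g) \<otimes> y" using xc(1) yc(1) g by (simp add: m_assoc)
    also have "\<dots> = g \<otimes> (x \<otimes> y)" using xc(1) yc(1) xc(2)[OF g] g by (simp add: m_assoc)
    finally show ?thesis .
  qed
  then show "x \<otimes> y \<in> group_center G" using xc(1) yc(1) by (simp add: group_center_def)
  have "inv x \<otimes> g = g \<otimes> inv x" if g: "g \<in> carrier G" for g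
  proof -
    have "inv x \<otimes> g = inv x \<otimes> (g \<otimes> x) \<otimes> inv x" using xc(1) g by (simp add: m_assoc)
    also have "\<dots> = inv x \<otimes> (x \<otimes> g) \<otimes> inv x" using xc(2)[OF g] by simp
    also have "\<dots> = (inv x \<otimes> x) \<otimes> g \<otimes> inv x" using xc(1) g by (simp only: m_assoc inv_closed m_closed)
    finally show ?thesis using xc(1) g by simp
  qed
  then show "inv x \<in> group_center G" using xc(1) by (simp add: group_center_def)
qed

context lie_group
begin

lemma conj_chart_differentiable:
  assumes U: "(U, \<phi>) \<in> A" "\<one> \<in> U" and g: "g \<in> carrier G"
  shows "(\<lambda>v. \<phi> (g \<otimes> inv_into U \<phi> v \<otimes> inv g)) differentiable (at (\<phi> \<one>))"
proof -
  have s: "smooth_into A (\<phi> ` U) (\<lambda>v. g \<otimes> inv_into U \<phi> v \<otimes> inv g)"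
    by (intro smooth_into_mult smooth_into_constant smooth_into_chart_inverse U(1) chartD(2)[OF U(1)] g inv_closed)
  have "\<phi> \<one> \<in> \<phi> ` U \<inter> (\<lambda>v. g \<otimes> inv_into U \<phi> v \<otimes> inv g) -` U"
    using U g chartD(7)[OF U(1) U(2)] by simp
  then show ?thesis
    using smooth_on_imp_differentiable[OF smooth_into_chart[OF s U(1)]] by blast
qed

text \<open>If every \<open>Ad_chart G U \<phi> g\<close> fixes \<open>v\<close>, then the bracket
  of anything with a multiple of \<open>v\<close> differentiates a constant and vanishes. The line
  through \<open>v\<close> is therefore a nonzero ideal, hence everything, and the bracket would be
  identically zero.\<close>

lemma fixed_direction_trivial:
  assumes U: "(U, \<phi>) \<in> A" "\<one> \<in> U" and simple: "simple_bracket (lie_bracket G U \<phi>)"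
    and v: "v \<noteq> 0" "\<And>g. g \<in> carrier G \<Longrightarrow> Ad_chart G U \<phi> g v = v"
  shows False
proof -
  have scaled: "Ad_chart G U \<phi> g (c *\<^sub>R v) = c *\<^sub>R v" if "g \<in> carrier G" for g c
    using linear_frechet_derivative[OF conj_chart_differentiable[OF U that]] v(2)[OF that]
    unfolding Ad_chart_def by (simp add: linear_cmul)
  have zero: "lie_bracket G U \<phi> X (c *\<^sub>R v) = 0" for X c
  proof -
    have "frechet_derivative (\<lambda>w. Ad_chart G U \<phi> (inv_into U \<phi> w) (c *\<^sub>R v)) (at (\<phi> \<one>))
        = frechet_derivative (\<lambda>w. c *\<^sub>R v) (at (\<phi> \<one>))"
    proof (rule frechet_derivative_cong_open[OF chartD(2)[OF U(1)]])
      show "\<phi> \<one> \<in> \<phi> ` U" using U(2) by simp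
      fix w assume "w \<in> \<phi> ` U"
      then show "Ad_chart G U \<phi> (inv_into U \<phi> w) (c *\<^sub>R v) = c *\<^sub>R v"
        using chartD(9)[OF U(1)] chart_carrier[OF U(1)] by (intro scaled) blast
    qed
    then show ?thesis by (simp add: lie_bracket_def frechet_derivative_const)
  qed
  obtain X Y where XY: "lie_bracket G U \<phi> X Y \<noteq> 0"
    and ideal: "\<And>I. subspace I \<Longrightarrow> (\<forall>X. \<forall>Y\<in>I. lie_bracket G U \<phi> X Y \<in> I) \<Longrightarrow> I = {0} \<or> I = UNIV"
    using simple unfolding simple_bracket_def by blast
  have el: "\<exists>c. w = c *\<^sub>R v" if "w \<in> span {v}" for w
    using that by (auto simp: span_singleton)
  have "\<forall>X. \<forall>Y\<in>span {v}. lie_bracket G U \<phi> X Y \<in> span {v}"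
    using el zero span_zero by metis
  then have "span {v} = {0} \<or> span {v} = UNIV" by (intro ideal) auto
  moreover have "v \<in> span {v}" by (simp add: span_base)
  ultimately have "Y \<in> span {v}" using v(1) by auto
  then show False using el zero XY by metis
qed

lemma chart_ball_openin:
  assumes U: "(U, \<phi>) \<in> A"
  shows "openin (top_of_set (carrier G)) {x \<in> U. dist p (\<phi> x) < r}"
proof -
  have "openin (top_of_set U) (U \<inter> \<phi> -` ball p r)"
    by (rule continuous_openin_preimage_gen[OF chartD(4)[OF U]]) simp
  then have "openin (top_of_set (carrier G)) (U \<inter> \<phi> -` ball p r)"
    using chartD(1)[OF U] openin_trans by blast
  moreover have "U \<inter> \<phi> -` ball p r = {x \<in> U. dist p (\<phi> x) < r}" by auto
  ultimately show ?thesis by simp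
qed

text \<open>Central elements converging to the identity would have directions with a cluster point
  \<open>v\<close> on the unit sphere of the chart. Conjugation fixes central elements, so its
  derivative fixes \<open>v\<close>, which the preceding lemma excludes.\<close>

lemma center_isolated:
  assumes U: "(U, \<phi>) \<in> A" "\<one> \<in> U" and simple: "simple_bracket (lie_bracket G U \<phi>)"
  shows "\<exists>W. openin (top_of_set (carrier G)) W \<and> \<one> \<in> W \<and> (\<forall>y\<in>W \<inter> group_center G. y = \<one>)"
proof (rule ccontr)
  assume neg: "\<not> ?thesis"
  define p where "p = \<phi> \<one>"
  have "\<exists>y. y \<in> U \<and> dist p (\<phi> y) < 1 / real (Suc n) \<and> y \<in> group_center G \<and> y \<noteq> \<one>" for n
  proof (rule ccontr)
    assume no: "\<not> ?thesis"
    let ?W = "{x \<in> U. dist p (\<phi> x) < 1 / real (Suc n)}"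
    have "\<forall>y\<in>?W \<inter> group_center G. y = \<one>" using no by blast
    moreover have "\<one> \<in> ?W" using U(2) by (simp add: p_def)
    ultimately show False using neg chart_ball_openin[OF U(1)] by blast
  qed
  then obtain y where y: "\<And>n. y n \<in> U" "\<And>n. dist p (\<phi> (y n)) < 1 / real (Suc n)"
    "\<And>n. y n \<in> group_center G" "\<And>n. y n \<noteq> \<one>" by metis
  define h where "h n = \<phi> (y n) - p" for n
  have h0: "h n \<noteq> 0" for n
    using y(1,4)[of n] chartD(6)[OF U(1)] U(2) unfolding h_def p_def inj_on_def by auto
  have hlim: "h \<longlonglongrightarrow> 0"
  proof (rule LIMSEQ_norm_0)
    show "norm (h n) < 1 / real (Suc n)" for n
      using y(2)[of n] by (simp add: h_def dist_norm norm_minus_commute)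
  qed
  define d where "d n = h n /\<^sub>R norm (h n)" for n
  have "d n \<in> sphere 0 1" for n using h0[of n] by (simp add: d_def)
  then obtain v r where v: "v \<in> sphere 0 1" and r: "strict_mono r" "(d \<circ> r) \<longlonglongrightarrow> v"
    using compact_sphere[of 0 1] unfolding compact_def by metis
  have "Ad_chart G U \<phi> g v = v" if g: "g \<in> carrier G" for g
  proof -
    define C where "C = (\<lambda>v. \<phi> (g \<otimes> inv_into U \<phi> v \<otimes> inv g))"
    define D where "D = Ad_chart G U \<phi> g"
    have D: "(C has_derivative D) (at p)"
      using conj_chart_differentiable[OF U g] frechet_derivative_works
      unfolding C_def D_def p_def Ad_chart_def by blast
    have Cp: "C p = p" using U g chartD(7)[OF U(1,2)] by (simp add: C_def p_def)
    have Ch: "C (p + h n) = p + h n" for n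
      using chartD(7)[OF U(1) y(1)[of n]] group_centerD(3)[OF y(3)[of n] g] by (simp add: C_def h_def)
    have lim: "((\<lambda>h. norm (C (p + h) - C p - D h) / norm h) \<longlongrightarrow> 0) (at 0)"
      and bl: "bounded_linear D"
      using D unfolding has_derivative_at by auto
    have "filterlim h (at 0) sequentially"
      using hlim h0 by (simp add: filterlim_at)
    from filterlim_compose[OF lim this]
    have "(\<lambda>n. norm (h n - D (h n)) / norm (h n)) \<longlonglongrightarrow> 0"
      by (simp add: Ch Cp)
    moreover have "norm (h n - D (h n)) / norm (h n) = norm (d n - D (d n))" for n
    proof -
      have "d n - D (d n) = (h n - D (h n)) /\<^sub>R norm (h n)"
        unfolding d_def using bl by (simp add: linear_simps algebra_simps)
      then show ?thesis by (simp add: divide_inverse mult.commute)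
    qed
    ultimately have "(\<lambda>n. d n - D (d n)) \<longlonglongrightarrow> 0"
      using tendsto_norm_zero_iff[of "\<lambda>n. d n - D (d n)"] by simp
    from LIMSEQ_subseq_LIMSEQ[OF this r(1)]
    have "(\<lambda>n. (d \<circ> r) n - D ((d \<circ> r) n)) \<longlonglongrightarrow> 0" by (simp add: o_def)
    moreover have "(\<lambda>n. (d \<circ> r) n - D ((d \<circ> r) n)) \<longlonglongrightarrow> v - D v"
      by (intro tendsto_diff r(2) bounded_linear.tendsto[OF bl])
    ultimately have "v - D v = 0" using LIMSEQ_unique by blast
    then show ?thesis by (simp add: D_def)
  qed
  moreover have "v \<noteq> 0" using v by auto
  ultimately show False
    using fixed_direction_trivial[OF U simple, of v] by blast
qed

text \<open>Infinitely many powers of \<open>z\<close> would accumulate somewhere in the compact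
  group. Two distinct powers close to the limit have a quotient that is central, close to the
  identity and different from it, against isolation.\<close>

lemma central_finite_order:
  assumes U: "(U, \<phi>) \<in> A" "\<one> \<in> U" and simple: "simple_bracket (lie_bracket G U \<phi>)"
    and comp: "compact (carrier G)" and z: "z \<in> group_center G"
  shows "\<exists>k\<ge>2. z [^] (k::nat) = \<one>"
proof -
  obtain W where W: "openin (top_of_set (carrier G)) W" "\<one> \<in> W" "\<And>y. y \<in> W \<Longrightarrow> y \<in> group_center G \<Longrightarrow> y = \<one>"
    using center_isolated[OF U simple] by blast
  interpret C: subgroup "group_center G" G by (rule subgroup_group_center)
  have zc: "z \<in> carrier G" using z by simp
  have pow: "z [^] (n::nat) \<in> group_center G" for n
    by (induction n) (auto simp: z)
  have "\<exists>m n. m < (n::nat) \<and> z [^] m = z [^] n"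
  proof (rule ccontr)
    assume "\<not> ?thesis"
    then have inj: "inj (\<lambda>n::nat. z [^] n)"
      by (intro linorder_injI) blast
    then have "infinite (range (\<lambda>n::nat. z [^] n))" by (simp add: range_inj_infinite)
    moreover have "range (\<lambda>n::nat. z [^] n) \<subseteq> carrier G" using zc by auto
    ultimately obtain x where x: "x \<in> carrier G" "x islimpt range (\<lambda>n::nat. z [^] n)"
      using Heine_Borel_imp_Bolzano_Weierstrass[OF comp] by blast
    have cont: "continuous_on (carrier G \<times> carrier G) (\<lambda>p. inv (fst p) \<otimes> snd p)"
      by (intro continuous_on_mult continuous_on_inverse continuous_on_fst continuous_on_snd continuous_on_id) auto
    have "openin (top_of_set (carrier G \<times> carrier G))
       ((carrier G \<times> carrier G) \<inter> (\<lambda>p. inv (fst p) \<otimes> snd p) -` W)"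
      by (rule openin_atlas_space_vimage[OF cont W(1)]) auto
    then obtain T where T: "open T"
      "(carrier G \<times> carrier G) \<inter> (\<lambda>p. inv (fst p) \<otimes> snd p) -` W = (carrier G \<times> carrier G) \<inter> T"
      using openin_open by blast
    have "(x, x) \<in> T" using T(2) x(1) W(2) by auto
    from open_prod_elim[OF T(1) this] obtain N1 N2
      where N: "open N1" "open N2" "(x, x) \<in> N1 \<times> N2" "N1 \<times> N2 \<subseteq> T" by blast
    define N where "N = N1 \<inter> N2"
    have No: "open N" "x \<in> N" using N by (auto simp: N_def)
    obtain a where a: "a \<in> range (\<lambda>n::nat. z [^] n)" "a \<in> N" "a \<noteq> x"
      using islimptE[OF x(2) No(2,1)] by blast
    have Na: "open (N - {a})" "x \<in> N - {a}" using No a(3) by auto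
    obtain b where b: "b \<in> range (\<lambda>n::nat. z [^] n)" "b \<in> N - {a}"
      using islimptE[OF x(2) Na(2,1)] by blast
    have ac: "a \<in> group_center G" "b \<in> group_center G" using a(1) b(1) pow by auto
    then have "(a, b) \<in> (carrier G \<times> carrier G) \<inter> T"
      using N(4) a(2) b(2) C.subset by (auto simp: N_def)
    then have "(a, b) \<in> (carrier G \<times> carrier G) \<inter> (\<lambda>p. inv (fst p) \<otimes> snd p) -` W"
      unfolding T(2) .
    then have "inv a \<otimes> b \<in> W" by simp
    moreover have "inv a \<otimes> b \<in> group_center G" using ac by simp
    ultimately have "inv a \<otimes> b = \<one>" by (rule W(3))
    moreover have "a \<otimes> (inv a \<otimes> b) = b" using ac C.subset by (simp add: m_assoc[symmetric] subsetD)
    ultimately have "a = b" using ac C.subset by (simp add: subsetD)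
    then show False using b(2) by simp
  qed
  then obtain m n where mn: "m < (n::nat)" "z [^] m = z [^] n" by blast
  have "z [^] m \<otimes> z [^] (n - m) = z [^] m \<otimes> \<one>"
    using nat_pow_mult[OF zc, of m "n - m"] mn zc by simp
  then have one: "z [^] (n - m) = \<one>" using zc by simp
  \<comment> \<open>Doubling makes the exponent at least 2, so that the weight 1 - 1/k given to the
    energies of the original rotations is at least one half.\<close>
  have "z [^] ((n - m) * 2) = \<one>" unfolding nat_pow_pow[OF zc, symmetric] one by (rule nat_pow_one)
  then show ?thesis using mn(1) by (intro exI[of _ "(n - m) * 2"]) auto
qed

end

section \<open>Roots of a central element close to the identity\<close>

context lie_group
begin

text \<open>The midpoint estimate on the product space restricts to slices with fixed parameter
  \<open>s\<close>, because there the midpoint of \<open>(s, v)\<close> and \<open>(s, w)\<close> is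
  \<open>(s, midpoint v w)\<close>. The constants are then uniform in the parameter.\<close>

lemma chart_family_bounds:
  fixes K :: "'p::euclidean_space \<times> 'f::euclidean_space \<Rightarrow> 'g"
  assumes U: "(U, \<phi>) \<in> A" and K: "smooth_into A S K" and s0: "(s0, v0) \<in> S" "K (s0, v0) \<in> U"
  shows "\<exists>r>0. \<exists>L>0. \<forall>s\<in>cball s0 r. \<forall>v\<in>cball v0 r. (s, v) \<in> S \<and> K (s, v) \<in> U \<and>
    (\<forall>w\<in>cball v0 r. norm (\<phi> (K (s, v)) - \<phi> (K (s, w))) \<le> L * norm (v - w) \<and>
      norm (\<phi> (K (s, midpoint v w)) - midpoint (\<phi> (K (s, v))) (\<phi> (K (s, w)))) \<le> L * (norm (v - w))\<^sup>2)"
proof -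
  let ?S = "S \<inter> K -` U"
  have o: "open ?S" by (rule smooth_into_open_vimage_chart[OF K U])
  have s: "smooth_on ?S (\<lambda>x. \<phi> (K x))" by (rule smooth_into_chart[OF K U])
  have mem0: "(s0, v0) \<in> ?S" using s0 by simp
  obtain r L where r: "r > 0" "L > 0" "cball (s0, v0) r \<subseteq> ?S"
    "\<forall>x\<in>cball (s0, v0) r. \<forall>y\<in>cball (s0, v0) r. norm (\<phi> (K x) - \<phi> (K y)) \<le> L * norm (x - y)"
    "\<forall>x\<in>cball (s0, v0) r. \<forall>y\<in>cball (s0, v0) r.
       norm (\<phi> (K (midpoint x y)) - midpoint (\<phi> (K x)) (\<phi> (K y))) \<le> L * (norm (x - y))\<^sup>2"
    using smooth_on_midpoint_bound[OF o s mem0] by (elim exE conjE) (rule that; assumption)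
  have mem: "(s, v) \<in> cball (s0, v0) r" if "s \<in> cball s0 (r/2)" "v \<in> cball v0 (r/2)" for s v
  proof -
    have "dist (s0, v0) (s, v) \<le> dist s0 s + dist v0 v"
      by (simp add: dist_Pair_Pair sqrt_sum_squares_le_sum)
    then show ?thesis using that by auto
  qed
  have n: "norm ((s, v) - (s, w)) = norm (v - w)" for s :: 'p and v w :: 'f
    by (simp add: norm_Pair)
  have m: "midpoint (s, v) (s, w) = (s, midpoint v w)" for s :: 'p and v w :: 'f
    by (simp add: midpoint_def scaleR_2[symmetric])
  show ?thesis
  proof (rule exI[of _ "r/2"], intro conjI, use r(1) in simp, rule exI[of _ L], intro conjI r(2) ballI)
    fix s v assume s: "s \<in> cball s0 (r/2)" and v: "v \<in> cball v0 (r/2)"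
    show "(s, v) \<in> S" "K (s, v) \<in> U" using mem[OF s v] r(3) by auto
    fix w assume w: "w \<in> cball v0 (r/2)"
    show "norm (\<phi> (K (s, v)) - \<phi> (K (s, w))) \<le> L * norm (v - w)"
      using r(4)[rule_format, OF mem[OF s v] mem[OF s w]] by (simp only: n)
    show "norm (\<phi> (K (s, midpoint v w)) - midpoint (\<phi> (K (s, v))) (\<phi> (K (s, w)))) \<le> L * (norm (v - w))\<^sup>2"
      using r(5)[rule_format, OF mem[OF s v] mem[OF s w]] by (simp only: n m)
  qed
qed

text \<open>If the first factor of a fixed product with coordinate \<open>u\<close> has coordinate
  \<open>v\<close>, the second factor is the inverse of the first times the product. Moving
  \<open>v\<close> thus moves both factors, and the two families describe these motions after
  conjugation by \<open>g\<close>. Compactness of the group makes the constants independent of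
  \<open>g\<close>.\<close>

lemma conj_family_bounds:
  assumes U: "(U, \<phi>) \<in> A" "\<one> \<in> U" and comp: "compact (carrier G)"
  shows "\<exists>\<delta>>0. \<exists>L>0. cball (\<phi> \<one>) \<delta> \<subseteq> \<phi> ` U \<and> (\<forall>g\<in>carrier G. \<forall>u\<in>cball (\<phi> \<one>) \<delta>.
    \<forall>v\<in>cball (\<phi> \<one>) \<delta>. \<forall>w\<in>cball (\<phi> \<one>) \<delta>. \<forall>K\<in>{\<lambda>v. g \<otimes> inv_into U \<phi> v \<otimes> inv g,
       \<lambda>v. g \<otimes> (inv (inv_into U \<phi> v) \<otimes> inv_into U \<phi> u) \<otimes> inv g}.
     K v \<in> U \<and> norm (\<phi> (K v) - \<phi> (K w)) \<le> L * norm (v - w) \<and>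
     norm (\<phi> (K (midpoint v w)) - midpoint (\<phi> (K v)) (\<phi> (K w))) \<le> L * (norm (v - w))\<^sup>2)"
proof -
  define p where "p = \<phi> \<one>"
  define \<iota> where "\<iota> = inv_into U \<phi>"
  define Q where "Q g \<delta> L \<longleftrightarrow> cball p \<delta> \<subseteq> \<phi> ` U \<and> (\<forall>u\<in>cball p \<delta>. \<forall>v\<in>cball p \<delta>. \<forall>w\<in>cball p \<delta>.
      \<forall>K\<in>{\<lambda>v. g \<otimes> \<iota> v \<otimes> inv g, \<lambda>v. g \<otimes> (inv (\<iota> v) \<otimes> \<iota> u) \<otimes> inv g}.
     K v \<in> U \<and> norm (\<phi> (K v) - \<phi> (K w)) \<le> L * norm (v - w) \<and>
     norm (\<phi> (K (midpoint v w)) - midpoint (\<phi> (K v)) (\<phi> (K w))) \<le> L * (norm (v - w))\<^sup>2)" for g \<delta> L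
  have pU: "p \<in> \<phi> ` U" using U(2) by (simp add: p_def)
  have \<iota>p: "\<iota> p = \<one>" using chartD(7)[OF U] by (simp add: \<iota>_def p_def)
  have \<phi>o: "open (\<phi> ` U)" by (rule chartD(2)[OF U(1)])
  have sm\<iota>: "smooth_into A (\<phi> ` U) \<iota>" unfolding \<iota>_def by (rule smooth_into_chart_inverse[OF U(1)])
  have "\<exists>\<delta>>0. \<exists>L>0. \<forall>g\<in>carrier G. Q g \<delta> L"
  proof (rule compact_uniform_bounds[OF comp])
    fix g0 assume g0: "g0 \<in> carrier G"
    then obtain V \<psi> where V: "(V, \<psi>) \<in> A" "g0 \<in> V" using chart_at by blast
    define \<kappa> where "\<kappa> = inv_into V \<psi>"
    have sm\<kappa>: "smooth_into A (\<psi> ` V) \<kappa>" unfolding \<kappa>_def by (rule smooth_into_chart_inverse[OF V(1)])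
    have \<psi>o: "open (\<psi> ` V)" by (rule chartD(2)[OF V(1)])
    have \<kappa>\<psi>: "\<kappa> (\<psi> g0) = g0" using chartD(7)[OF V] by (simp add: \<kappa>_def)
    \<comment> \<open>The first family is constant in \<open>u\<close>; the factor
      \<open>UNIV\<close> gives both families the same parameters.\<close>
    let ?S1 = "(\<psi> ` V \<times> UNIV) \<times> \<phi> ` U" and ?S2 = "(\<psi> ` V \<times> \<phi> ` U) \<times> \<phi> ` U"
    have o1: "open ?S1" and o2: "open ?S2" by (intro open_Times \<phi>o \<psi>o open_UNIV)+
    let ?K1 = "\<lambda>x. \<kappa> (fst (fst x)) \<otimes> \<iota> (snd x) \<otimes> inv (\<kappa> (fst (fst x)))"
    let ?K2 = "\<lambda>x. \<kappa> (fst (fst x)) \<otimes> (inv (\<iota> (snd x)) \<otimes> \<iota> (snd (fst x))) \<otimes> inv (\<kappa> (fst (fst x)))"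
    have K1: "smooth_into A ((\<psi> ` V \<times> (UNIV :: 'e set)) \<times> \<phi> ` U) ?K1"
      by (intro smooth_into_mult smooth_into_inv smooth_into_compose[OF sm\<kappa> o1] smooth_into_compose[OF sm\<iota> o1]
          smooth_on_fst smooth_on_snd smooth_on_id o1) auto
    have K2: "smooth_into A ?S2 ?K2"
      by (intro smooth_into_mult smooth_into_inv smooth_into_compose[OF sm\<kappa> o2] smooth_into_compose[OF sm\<iota> o2]
          smooth_on_fst smooth_on_snd smooth_on_id o2) auto
    have b1: "((\<psi> g0, p), p) \<in> ?S1" "?K1 ((\<psi> g0, p), p) \<in> U"
      using V(2) pU g0 U(2) by (auto simp: \<kappa>\<psi> \<iota>p)
    have b2: "((\<psi> g0, p), p) \<in> ?S2" "?K2 ((\<psi> g0, p), p) \<in> U"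
      using V(2) pU g0 U(2) by (auto simp: \<kappa>\<psi> \<iota>p)
    obtain r1 L1 where r1: "r1 > 0" "L1 > 0" "\<forall>s\<in>cball (\<psi> g0, p) r1. \<forall>v\<in>cball p r1. (s, v) \<in> ?S1 \<and> ?K1 (s, v) \<in> U \<and>
      (\<forall>w\<in>cball p r1. norm (\<phi> (?K1 (s, v)) - \<phi> (?K1 (s, w))) \<le> L1 * norm (v - w) \<and>
      norm (\<phi> (?K1 (s, midpoint v w)) - midpoint (\<phi> (?K1 (s, v))) (\<phi> (?K1 (s, w)))) \<le> L1 * (norm (v - w))\<^sup>2)"
      using chart_family_bounds[OF U(1) K1 b1] by (elim exE conjE) (rule that; assumption)
    obtain r2 L2 where r2: "r2 > 0" "L2 > 0" "\<forall>s\<in>cball (\<psi> g0, p) r2. \<forall>v\<in>cball p r2. (s, v) \<in> ?S2 \<and> ?K2 (s, v) \<in> U \<and>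
      (\<forall>w\<in>cball p r2. norm (\<phi> (?K2 (s, v)) - \<phi> (?K2 (s, w))) \<le> L2 * norm (v - w) \<and>
      norm (\<phi> (?K2 (s, midpoint v w)) - midpoint (\<phi> (?K2 (s, v))) (\<phi> (?K2 (s, w)))) \<le> L2 * (norm (v - w))\<^sup>2)"
      using chart_family_bounds[OF U(1) K2 b2] by (elim exE conjE) (rule that; assumption)
    obtain r0 where r0: "r0 > 0" "cball p r0 \<subseteq> \<phi> ` U"
      using open_contains_cball[of "\<phi> ` U"] \<phi>o pU by auto
    define r where "r = min r0 (min (r1/2) (r2/2))"
    define L where "L = max L1 L2"
    have r: "r > 0" "r \<le> r0" "r \<le> r1/2" "r \<le> r2/2" using r0 r1 r2 by (auto simp: r_def)
    define N where "N = {x \<in> V. dist (\<psi> g0) (\<psi> x) < r}"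
    have "openin (top_of_set (carrier G)) N" unfolding N_def by (rule chart_ball_openin[OF V(1)])
    then obtain T where T: "open T" "N = carrier G \<inter> T" using openin_open by blast
    have "g0 \<in> N" unfolding N_def using V(2) r(1) by simp
    then have "g0 \<in> T" using T(2) by blast
    moreover have "Q g r L" if g: "g \<in> T \<inter> carrier G" for g
      unfolding Q_def
    proof (intro conjI ballI)
      show "cball p r \<subseteq> \<phi> ` U" using r0(2) r(2) subset_cball by blast
      fix u v w K
      assume u: "u \<in> cball p r" and v: "v \<in> cball p r" and w: "w \<in> cball p r"
        and K: "K \<in> {\<lambda>v. g \<otimes> \<iota> v \<otimes> inv g, \<lambda>v. g \<otimes> (inv (\<iota> v) \<otimes> \<iota> u) \<otimes> inv g}"
      have "g \<in> N" using g T(2) by blast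
      then have gV: "g \<in> V" "dist (\<psi> g0) (\<psi> g) < r" by (simp_all add: N_def)
      have \<kappa>g: "\<kappa> (\<psi> g) = g" using chartD(7)[OF V(1) gV(1)] by (simp add: \<kappa>_def)
      have "dist (\<psi> g0, p) (\<psi> g, u) \<le> dist (\<psi> g0) (\<psi> g) + dist p u"
        by (simp add: dist_Pair_Pair sqrt_sum_squares_le_sum)
      then have s: "(\<psi> g, u) \<in> cball (\<psi> g0, p) r1" "(\<psi> g, u) \<in> cball (\<psi> g0, p) r2"
        using gV(2) u r by auto
      have vw: "v \<in> cball p r1" "w \<in> cball p r1" "v \<in> cball p r2" "w \<in> cball p r2"
        using v w r r1(1) r2(1) by auto
      have LL: "L1 * t \<le> L * t" "L2 * t \<le> L * t" if "t \<ge> 0" for t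
        using that by (auto simp: L_def intro: mult_right_mono)
      from r1(3)[rule_format, OF s(1) vw(1)] vw(2)
      have e1: "g \<otimes> \<iota> v \<otimes> inv g \<in> U"
        "norm (\<phi> (g \<otimes> \<iota> v \<otimes> inv g) - \<phi> (g \<otimes> \<iota> w \<otimes> inv g)) \<le> L1 * norm (v - w)"
        "norm (\<phi> (g \<otimes> \<iota> (midpoint v w) \<otimes> inv g) - midpoint (\<phi> (g \<otimes> \<iota> v \<otimes> inv g)) (\<phi> (g \<otimes> \<iota> w \<otimes> inv g)))
         \<le> L1 * (norm (v - w))\<^sup>2"
        by (simp_all add: \<kappa>g)
      from r2(3)[rule_format, OF s(2) vw(3)] vw(4)
      have e2: "g \<otimes> (inv (\<iota> v) \<otimes> \<iota> u) \<otimes> inv g \<in> U"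
        "norm (\<phi> (g \<otimes> (inv (\<iota> v) \<otimes> \<iota> u) \<otimes> inv g) - \<phi> (g \<otimes> (inv (\<iota> w) \<otimes> \<iota> u) \<otimes> inv g)) \<le> L2 * norm (v - w)"
        "norm (\<phi> (g \<otimes> (inv (\<iota> (midpoint v w)) \<otimes> \<iota> u) \<otimes> inv g) -
           midpoint (\<phi> (g \<otimes> (inv (\<iota> v) \<otimes> \<iota> u) \<otimes> inv g)) (\<phi> (g \<otimes> (inv (\<iota> w) \<otimes> \<iota> u) \<otimes> inv g)))
         \<le> L2 * (norm (v - w))\<^sup>2"
        by (simp_all add: \<kappa>g)
      consider "K = (\<lambda>v. g \<otimes> \<iota> v \<otimes> inv g)" | "K = (\<lambda>v. g \<otimes> (inv (\<iota> v) \<otimes> \<iota> u) \<otimes> inv g)" using K by blast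
      then have "K v \<in> U \<and> norm (\<phi> (K v) - \<phi> (K w)) \<le> L * norm (v - w) \<and>
        norm (\<phi> (K (midpoint v w)) - midpoint (\<phi> (K v)) (\<phi> (K w))) \<le> L * (norm (v - w))\<^sup>2"
      proof cases
        case 1
        show ?thesis unfolding 1
          using e1 order_trans[OF e1(2) LL(1)] order_trans[OF e1(3) LL(1)] by simp
      next
        case 2
        show ?thesis unfolding 2
          using e2 order_trans[OF e2(2) LL(2)] order_trans[OF e2(3) LL(2)] by simp
      qed
      then show "K v \<in> U" "norm (\<phi> (K v) - \<phi> (K w)) \<le> L * norm (v - w)"
        "norm (\<phi> (K (midpoint v w)) - midpoint (\<phi> (K v)) (\<phi> (K w))) \<le> L * (norm (v - w))\<^sup>2" by blast+
    qed
    ultimately show "\<exists>N. open N \<and> g0 \<in> N \<and> (\<exists>\<delta>>0. \<exists>L. \<forall>y\<in>N \<inter> carrier G. Q y \<delta> L)"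
      using T(1) r(1) by blast
  next
    fix g \<delta> L \<delta>' L' assume Q: "Q g \<delta> L" and \<delta>: "0 < \<delta>'" "\<delta>' \<le> (\<delta>::real)" and L: "L \<le> (L'::real)"
    have sub: "cball p \<delta>' \<subseteq> cball p \<delta>" using \<delta> by auto
    have LL: "x \<le> L' * t" if "x \<le> L * t" "t \<ge> 0" for x t
      using that mult_right_mono[OF L that(2)] by linarith
    show "Q g \<delta>' L'"
      unfolding Q_def
    proof (intro conjI ballI)
      show "cball p \<delta>' \<subseteq> \<phi> ` U" using Q sub unfolding Q_def by blast
      fix u v w K
      assume u: "u \<in> cball p \<delta>'" and v: "v \<in> cball p \<delta>'" and w: "w \<in> cball p \<delta>'"
        and K: "K \<in> {\<lambda>v. g \<otimes> \<iota> v \<otimes> inv g, \<lambda>v. g \<otimes> (inv (\<iota> v) \<otimes> \<iota> u) \<otimes> inv g}"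
      have "K v \<in> U \<and> norm (\<phi> (K v) - \<phi> (K w)) \<le> L * norm (v - w) \<and>
        norm (\<phi> (K (midpoint v w)) - midpoint (\<phi> (K v)) (\<phi> (K w))) \<le> L * (norm (v - w))\<^sup>2"
        by (rule bspec[OF bspec[OF bspec[OF bspec[OF conjunct2[OF Q[unfolded Q_def]]
                subsetD[OF sub u]] subsetD[OF sub v]] subsetD[OF sub w]] K])
      then show "K v \<in> U" "norm (\<phi> (K v) - \<phi> (K w)) \<le> L' * norm (v - w)"
        "norm (\<phi> (K (midpoint v w)) - midpoint (\<phi> (K v)) (\<phi> (K w))) \<le> L' * (norm (v - w))\<^sup>2"
        using LL by auto
    qed
  qed
  then obtain \<delta> L where dl: "\<delta> > 0" "L > 0" "\<And>g. g \<in> carrier G \<Longrightarrow> Q g \<delta> L" by (elim exE conjE) blast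
  have "cball p \<delta> \<subseteq> \<phi> ` U" using dl(3)[OF one_closed] unfolding Q_def by blast
  moreover have "\<forall>g\<in>carrier G. \<forall>u\<in>cball p \<delta>. \<forall>v\<in>cball p \<delta>. \<forall>w\<in>cball p \<delta>.
      \<forall>K\<in>{\<lambda>v. g \<otimes> \<iota> v \<otimes> inv g, \<lambda>v. g \<otimes> (inv (\<iota> v) \<otimes> \<iota> u) \<otimes> inv g}.
     K v \<in> U \<and> norm (\<phi> (K v) - \<phi> (K w)) \<le> L * norm (v - w) \<and>
     norm (\<phi> (K (midpoint v w)) - midpoint (\<phi> (K v)) (\<phi> (K w))) \<le> L * (norm (v - w))\<^sup>2"
    by (rule ballI, rule conjunct2[OF dl(3)[unfolded Q_def]])
  ultimately show ?thesis unfolding p_def \<iota>_def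
    by (intro exI[of _ \<delta>] exI[of _ L] conjI dl(1,2))
qed

end

text \<open>The parallelogram identity produces the negative term. The error in the midpoint adds a
  linear and a quadratic contribution, and \<open>t \<le> 2 * r\<close> bounds the fourth power of
  \<open>t\<close> in the latter by a multiple of its square.\<close>

lemma norm_midpoint_perturbation:
  fixes x y m :: "'a::real_inner"
  assumes x: "norm x \<le> r" and y: "norm y \<le> r" and m: "norm (m - midpoint x y) \<le> L * t\<^sup>2"
    and t: "0 \<le> t" "t \<le> 2 * r" and L: "0 \<le> L"
  shows "(norm m)\<^sup>2 \<le> (norm x)\<^sup>2 / 2 + (norm y)\<^sup>2 / 2 - (norm (x - y))\<^sup>2 / 4 + (2 * r * L + 4 * r\<^sup>2 * L\<^sup>2) * t\<^sup>2"
proof -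
  define c where "c = midpoint x y"
  have c2: "(norm c)\<^sup>2 = (norm x)\<^sup>2 / 2 + (norm y)\<^sup>2 / 2 - (norm (x - y))\<^sup>2 / 4"
    unfolding c_def midpoint_def power2_norm_eq_inner
    by (simp add: inner_add_left inner_add_right inner_diff_left inner_diff_right inner_commute field_simps)
  have cr: "norm c \<le> r"
  proof -
    have "norm (x + y) \<le> r + r" using x y norm_triangle_mono by blast
    then show ?thesis by (simp add: c_def midpoint_def)
  qed
  have "norm m = norm (c + (m - c))" by simp
  also have "\<dots> \<le> norm c + L * t\<^sup>2" using norm_triangle_ineq[of c "m - c"] m unfolding c_def by linarith
  finally have "(norm m)\<^sup>2 \<le> (norm c + L * t\<^sup>2)\<^sup>2" by (intro power_mono) auto
  also have "\<dots> = (norm c)\<^sup>2 + 2 * norm c * (L * t\<^sup>2) + L\<^sup>2 * (t\<^sup>2 * t\<^sup>2)"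
    by (simp add: power2_sum power_mult_distrib power2_eq_square algebra_simps)
  also have "\<dots> \<le> (norm c)\<^sup>2 + 2 * r * (L * t\<^sup>2) + L\<^sup>2 * ((2 * r)\<^sup>2 * t\<^sup>2)"
    using cr t L by (intro add_mono mult_left_mono mult_right_mono power_mono) auto
  finally show ?thesis unfolding c2 by (simp add: power_mult_distrib algebra_simps)
qed

section \<open>Ordered products of finite sequences\<close>

context monoid
begin

primrec list_product :: "(nat \<Rightarrow> 'a) \<Rightarrow> nat \<Rightarrow> 'a" where
  "list_product a 0 = \<one>"
| "list_product a (Suc n) = list_product a n \<otimes> a n"

lemma list_product_closed: "(\<And>i. i < n \<Longrightarrow> a i \<in> carrier G) \<Longrightarrow> list_product a n \<in> carrier G"
  by (induction n) auto

lemma list_product_cong: "(\<And>i. i < n \<Longrightarrow> a i = b i) \<Longrightarrow> list_product a n = list_product b n"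
  by (induction n) auto

lemma list_product_const: "list_product (\<lambda>i. w) n = w [^] n"
  by (induction n) auto

lemma list_product_swap:
  assumes "\<And>i. i < n \<Longrightarrow> a i \<in> carrier G" "x \<in> carrier G" "y \<in> carrier G"
    "x \<otimes> y = a j \<otimes> a (Suc j)" "Suc j < n"
  shows "list_product (a(j := x, Suc j := y)) n = list_product a n"
  using assms(1,5)
proof (induction n)
  case 0
  then show ?case by simp
next
  case (Suc n)
  let ?b = "a(j := x, Suc j := y)"
  show ?case
  proof (cases "Suc j = n")
    case True
    have e: "list_product ?b j = list_product a j" by (rule list_product_cong) auto
    have c: "list_product a j \<in> carrier G" using Suc.prems True by (intro list_product_closed) auto
    have m: "a j \<in> carrier G" "a (Suc j) \<in> carrier G" using Suc.prems True by auto
    have "list_product ?b (Suc (Suc j)) = list_product a j \<otimes> x \<otimes> y" using e by simp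
    also have "\<dots> = list_product a j \<otimes> (a j \<otimes> a (Suc j))" using c assms by (simp add: m_assoc)
    also have "\<dots> = list_product a (Suc (Suc j))" using c m by (simp add: m_assoc)
    finally show ?thesis unfolding True .
  next
    case False
    have "list_product ?b n = list_product a n" using Suc False by (intro Suc.IH) auto
    moreover have "?b n = a n" using False Suc.prems(2) by auto
    ultimately show ?thesis by (simp only: list_product.simps)
  qed
qed

end

text \<open>The numbers \<open>\<delta>\<close> and \<open>L\<close> are those supplied by
  \<open>conj_family_bounds\<close>, and \<open>r\<close> is a smaller working radius. With
  \<open>\<kappa>\<close> for the expression in \<open>small\<close>, the first condition makes the
  parallelogram gain \<open>t\<^sup>2 / (4 * L\<^sup>2)\<close> exceed the two midpoint errors
  \<open>\<kappa> * t\<^sup>2\<close>. The second keeps the new factors within radius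
  \<open>r\<close>, because \<open>r\<^sup>2 / 4 + 3 / 4 * r\<^sup>2 = r\<^sup>2\<close>.\<close>

locale convex_chart = lie_group G A
  for G :: "('g::t2_space, 'b) monoid_scheme" (structure) and A :: "('g, 'e::euclidean_space) atlas" +
  fixes U :: "'g set" and \<phi> :: "'g \<Rightarrow> 'e" and \<delta> L r :: real
  assumes chart: "(U, \<phi>) \<in> A" and one_U: "\<one> \<in> U" and compact: "compact (carrier G)"
    and pos: "0 < \<delta>" "0 < L" "0 < r" "r \<le> \<delta>"
    and ball: "cball (\<phi> \<one>) \<delta> \<subseteq> \<phi> ` U"
    and bounds: "\<And>g u v w K. g \<in> carrier G \<Longrightarrow> u \<in> cball (\<phi> \<one>) \<delta> \<Longrightarrow> v \<in> cball (\<phi> \<one>) \<delta> \<Longrightarrow>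
      w \<in> cball (\<phi> \<one>) \<delta> \<Longrightarrow> K \<in> {\<lambda>v. g \<otimes> inv_into U \<phi> v \<otimes> inv g,
       \<lambda>v. g \<otimes> (inv (inv_into U \<phi> v) \<otimes> inv_into U \<phi> u) \<otimes> inv g} \<Longrightarrow>
     K v \<in> U \<and> norm (\<phi> (K v) - \<phi> (K w)) \<le> L * norm (v - w) \<and>
     norm (\<phi> (K (midpoint v w)) - midpoint (\<phi> (K v)) (\<phi> (K w))) \<le> L * (norm (v - w))\<^sup>2"
    and small: "8 * L\<^sup>2 * (2 * r * L + 4 * r\<^sup>2 * L\<^sup>2) < 1" "2 * r * L + 4 * r\<^sup>2 * L\<^sup>2 \<le> 3 / 4"
    and product: "\<And>a b. a \<in> U \<Longrightarrow> b \<in> U \<Longrightarrow> \<phi> a \<in> cball (\<phi> \<one>) r \<Longrightarrow> \<phi> b \<in> cball (\<phi> \<one>) r \<Longrightarrow>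
      a \<otimes> b \<in> U \<and> \<phi> (a \<otimes> b) \<in> cball (\<phi> \<one>) \<delta>"
begin

definition displacement :: "'g \<Rightarrow> 'g \<Rightarrow> real" where
  "displacement g x = norm (\<phi> (g \<otimes> x \<otimes> inv g) - \<phi> \<one>)"

text \<open>A ball in the chart is not conjugation invariant. Imposing the bound on the whole
  conjugacy class makes the set so, and keeps every conjugate inside the chart.\<close>

definition small_conj :: "real \<Rightarrow> 'g set" where
  "small_conj s = {x \<in> carrier G. \<forall>g\<in>carrier G. g \<otimes> x \<otimes> inv g \<in> U \<and> displacement g x \<le> s}"

text \<open>A conjugation invariant size of elements near the identity; its square is strictly convex
  in the chart, which replaces a bi-invariant metric.\<close>

definition conj_size :: "'g \<Rightarrow> real" where
  "conj_size x = (SUP g\<in>carrier G. displacement g x)"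

lemma small_conj_carrier: "x \<in> small_conj s \<Longrightarrow> x \<in> carrier G"
  and small_conj_conj: "x \<in> small_conj s \<Longrightarrow> g \<in> carrier G \<Longrightarrow> g \<otimes> x \<otimes> inv g \<in> U"
  and small_conj_le: "x \<in> small_conj s \<Longrightarrow> g \<in> carrier G \<Longrightarrow> displacement g x \<le> s"
  unfolding small_conj_def by auto

lemma small_conj_mono: "s \<le> t \<Longrightarrow> small_conj s \<subseteq> small_conj t"
  unfolding small_conj_def by force

lemma small_conj_chart:
  assumes "x \<in> small_conj s"
  shows "x \<in> U" "\<phi> x \<in> cball (\<phi> \<one>) s" "inv_into U \<phi> (\<phi> x) = x"
proof -
  have "x \<in> carrier G" using assms by (rule small_conj_carrier)
  then show x: "x \<in> U" using small_conj_conj[OF assms one_closed] by simp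
  show "\<phi> x \<in> cball (\<phi> \<one>) s"
    using small_conj_le[OF assms one_closed] \<open>x \<in> carrier G\<close>
    by (simp add: displacement_def dist_norm norm_minus_commute)
  show "inv_into U \<phi> (\<phi> x) = x" by (rule chartD(7)[OF chart x])
qed

lemma displacement_le_size:
  assumes "x \<in> small_conj s" "g \<in> carrier G" shows "displacement g x \<le> conj_size x"
  unfolding conj_size_def
  by (rule cSUP_upper[OF assms(2)]) (rule bdd_aboveI2, rule small_conj_le[OF assms(1)])

lemma size_leI: "(\<And>g. g \<in> carrier G \<Longrightarrow> displacement g x \<le> c) \<Longrightarrow> conj_size x \<le> c"
  unfolding conj_size_def by (rule cSUP_least) auto

lemma size_nonneg: "x \<in> small_conj s \<Longrightarrow> 0 \<le> conj_size x"
  using displacement_le_size[OF _ one_closed] norm_ge_zero unfolding displacement_def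
  by (meson order_trans)

lemma norm_le_size: "x \<in> small_conj s \<Longrightarrow> norm (\<phi> x - \<phi> \<one>) \<le> conj_size x"
  using displacement_le_size[OF _ one_closed, of x s] small_conj_carrier[of x s]
  by (simp add: displacement_def)

lemma small_conjI_size:
  assumes "x \<in> small_conj s" "conj_size x \<le> t" shows "x \<in> small_conj t"
  unfolding small_conj_def
  using small_conj_carrier[OF assms(1)] small_conj_conj[OF assms(1)]
    order_trans[OF displacement_le_size[OF assms(1)] assms(2)] by blast

lemma conj_conj:
  assumes "x \<in> carrier G" "h \<in> carrier G" "g \<in> carrier G"
  shows "g \<otimes> (h \<otimes> x \<otimes> inv h) \<otimes> inv g = (g \<otimes> h) \<otimes> x \<otimes> inv (g \<otimes> h)"
  using assms by (simp add: m_assoc inv_mult_group)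

lemma conj_small:
  assumes x: "x \<in> small_conj s" and h: "h \<in> carrier G"
  shows "h \<otimes> x \<otimes> inv h \<in> small_conj s" "conj_size (h \<otimes> x \<otimes> inv h) = conj_size x"
proof -
  have xc: "x \<in> carrier G" using x by (rule small_conj_carrier)
  have d: "displacement g (h \<otimes> y \<otimes> inv h) = displacement (g \<otimes> h) y"
    if "g \<in> carrier G" "h \<in> carrier G" "y \<in> carrier G" for g h y
    unfolding displacement_def using conj_conj[OF that(3,2,1)] by simp
  have small: "h \<otimes> y \<otimes> inv h \<in> small_conj s" if "y \<in> small_conj s" "h \<in> carrier G" for y h
    unfolding small_conj_def
    using that small_conj_carrier[OF that(1)] d small_conj_conj[OF that(1)] small_conj_le[OF that(1)]
      conj_conj by simp
  show s: "h \<otimes> x \<otimes> inv h \<in> small_conj s" by (rule small[OF x h])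
  have le: "conj_size (h \<otimes> y \<otimes> inv h) \<le> conj_size y" if "y \<in> small_conj s" "h \<in> carrier G" for y h
    using that small_conj_carrier[OF that(1)] displacement_le_size[OF that(1)]
    by (intro size_leI) (simp add: d)
  have "inv h \<otimes> (h \<otimes> x \<otimes> inv h) \<otimes> inv (inv h) = x"
    unfolding conj_conj[OF xc h inv_closed[OF h]] using xc h by simp
  then show "conj_size (h \<otimes> x \<otimes> inv h) = conj_size x"
    using le[OF x h] le[OF s inv_closed[OF h]] by simp
qed

lemma conj_in_chart:
  assumes "x \<in> small_conj s" "g \<in> carrier G" "s \<le> \<delta>"
  shows "\<phi> (g \<otimes> x \<otimes> inv g) \<in> cball (\<phi> \<one>) s"
  using small_conj_le[OF assms(1,2)] by (simp add: displacement_def dist_norm norm_minus_commute)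

lemma size_lipschitz:
  assumes "x \<in> small_conj \<delta>" "y \<in> small_conj \<delta>"
  shows "\<bar>conj_size x - conj_size y\<bar> \<le> L * norm (\<phi> x - \<phi> y)"
proof -
  have "conj_size x \<le> conj_size y + L * norm (\<phi> x - \<phi> y)"
    if x: "x \<in> small_conj \<delta>" and y: "y \<in> small_conj \<delta>" for x y
  proof (rule size_leI)
    fix g assume g: "g \<in> carrier G"
    have "norm (\<phi> (g \<otimes> x \<otimes> inv g) - \<phi> (g \<otimes> y \<otimes> inv g)) \<le> L * norm (\<phi> x - \<phi> y)"
      using bounds[OF g small_conj_chart(2)[OF x] small_conj_chart(2)[OF x] small_conj_chart(2)[OF y], OF insertI1]
      by (simp add: small_conj_chart(3)[OF x] small_conj_chart(3)[OF y])
    moreover have "displacement g x \<le> displacement g y + norm (\<phi> (g \<otimes> x \<otimes> inv g) - \<phi> (g \<otimes> y \<otimes> inv g))"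
      unfolding displacement_def by norm
    ultimately show "displacement g x \<le> conj_size y + L * norm (\<phi> x - \<phi> y)"
      using displacement_le_size[OF y g] by linarith
  qed
  from this[OF assms] this[OF assms(2,1)] show ?thesis by (simp add: norm_minus_commute abs_le_iff)
qed

text \<open>Conjugation by \<open>g\<close> is undone by conjugation by \<open>inv g\<close>, whose
  Lipschitz bound reads as a lower bound for the former. It makes the convexity gain uniform over
  all conjugates, so that it survives the supremum in \<open>conj_size\<close>.\<close>

lemma conj_expand:
  assumes x: "x \<in> small_conj r" and y: "y \<in> small_conj r" and g: "g \<in> carrier G"
  shows "norm (\<phi> x - \<phi> y) \<le> L * norm (\<phi> (g \<otimes> x \<otimes> inv g) - \<phi> (g \<otimes> y \<otimes> inv g))"
proof -
  have xs: "g \<otimes> x \<otimes> inv g \<in> small_conj r" and ys: "g \<otimes> y \<otimes> inv g \<in> small_conj r"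
    using conj_small(1)[OF x g] conj_small(1)[OF y g] by auto
  have b: "\<phi> (g \<otimes> x \<otimes> inv g) \<in> cball (\<phi> \<one>) \<delta>" "\<phi> (g \<otimes> y \<otimes> inv g) \<in> cball (\<phi> \<one>) \<delta>"
    using conj_in_chart[OF x g] conj_in_chart[OF y g] pos by auto
  have undo: "inv g \<otimes> (g \<otimes> x \<otimes> inv g) \<otimes> inv (inv g) = x" "inv g \<otimes> (g \<otimes> y \<otimes> inv g) \<otimes> inv (inv g) = y"
    unfolding conj_conj[OF small_conj_carrier[OF x] g inv_closed[OF g]]
      conj_conj[OF small_conj_carrier[OF y] g inv_closed[OF g]]
    using small_conj_carrier[OF x] small_conj_carrier[OF y] g by simp_all
  show ?thesis
    using bounds[OF inv_closed[OF g] b(1) b(1) b(2), OF insertI1]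
    unfolding small_conj_chart(3)[OF xs] small_conj_chart(3)[OF ys] undo by blast
qed

text \<open>Take for \<open>x\<close> the chart midpoint of the two first factors and let
  \<open>y\<close> be the second factor that keeps the product. Then \<open>y\<close> is nearly the
  midpoint of the two second factors, since passing from first to second factor preserves midpoints
  to second order. In every conjugate \<open>x\<close> gains by the parallelogram identity, in
  proportion to the squared distance of the first factors, and this outweighs both midpoint
  errors.\<close>

lemma strictly_convex_pair:
  assumes a: "a \<in> small_conj (r/2)" and b: "b \<in> small_conj (r/2)"
    and a': "a' \<in> small_conj (r/2)" and b': "b' \<in> small_conj (r/2)"
    and eq: "a \<otimes> b = a' \<otimes> b'" and ne: "a \<noteq> a'"
  shows "\<exists>x\<in>small_conj r. \<exists>y\<in>small_conj r. x \<otimes> y = a \<otimes> b \<and>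
    (conj_size x)\<^sup>2 + (conj_size y)\<^sup>2 <
    ((conj_size a)\<^sup>2 + (conj_size a')\<^sup>2 + (conj_size b)\<^sup>2 + (conj_size b')\<^sup>2) / 2"
proof -
  have r2: "r / 2 \<le> r" using pos by simp
  note sm = subsetD[OF small_conj_mono[OF r2]]
  note ar = sm[OF a] and br = sm[OF b] and ar' = sm[OF a'] and br' = sm[OF b']
  define v where "v = \<phi> a"
  define w where "w = \<phi> a'"
  define m where "m = midpoint v w"
  define t where "t = norm (v - w)"
  define \<kappa> where "\<kappa> = 2 * r * L + 4 * r\<^sup>2 * L\<^sup>2"
  define \<iota> where "\<iota> = inv_into U \<phi>"
  define u where "u = \<phi> (a \<otimes> b)"
  define x where "x = \<iota> m"
  define y where "y = inv x \<otimes> (a \<otimes> b)"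
  have \<iota>v: "\<iota> v = a" "\<iota> w = a'" using small_conj_chart(3)[OF a] small_conj_chart(3)[OF a'] by (simp_all add: \<iota>_def v_def w_def)
  have vw: "v \<in> cball (\<phi> \<one>) (r/2)" "w \<in> cball (\<phi> \<one>) (r/2)"
    unfolding v_def w_def by (rule small_conj_chart(2)[OF a], rule small_conj_chart(2)[OF a'])
  have mb: "m \<in> cball (\<phi> \<one>) (r/2)"
    unfolding m_def using vw convex_cball[of "\<phi> \<one>" "r/2"] closed_segment_subset[of v "cball (\<phi> \<one>) (r/2)" w]
      midpoint_in_closed_segment[of v w] by blast
  have sub: "cball (\<phi> \<one>) (r/2) \<subseteq> cball (\<phi> \<one>) \<delta>" using pos by auto
  have vd: "v \<in> cball (\<phi> \<one>) \<delta>" "w \<in> cball (\<phi> \<one>) \<delta>" "m \<in> cball (\<phi> \<one>) \<delta>"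
    using vw mb sub by auto
  have prod: "a \<otimes> b \<in> U \<and> u \<in> cball (\<phi> \<one>) \<delta>"
    unfolding u_def
    by (rule product) (use small_conj_chart(1,2)[OF ar] small_conj_chart(1,2)[OF br] in auto)
  have ud: "u \<in> cball (\<phi> \<one>) \<delta>" using prod by blast
  have \<iota>u: "\<iota> u = a \<otimes> b" unfolding \<iota>_def u_def using prod chartD(7)[OF chart] by blast
  have carr: "a \<in> carrier G" "b \<in> carrier G" "a' \<in> carrier G" "b' \<in> carrier G"
    using small_conj_carrier[OF a] small_conj_carrier[OF b] small_conj_carrier[OF a'] small_conj_carrier[OF b'] by blast+
  have xU: "x \<in> U" unfolding x_def \<iota>_def
    by (rule chartD(9)[OF chart]) (use vd(3) ball in blast)
  have xc: "x \<in> carrier G" using xU chart_carrier[OF chart] by blast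
  have bv: "inv (\<iota> v) \<otimes> \<iota> u = b" unfolding \<iota>v \<iota>u using carr by (simp add: m_assoc[symmetric])
  have bw: "inv (\<iota> w) \<otimes> \<iota> u = b'" unfolding \<iota>v \<iota>u eq using carr by (simp add: m_assoc[symmetric])
  have ym: "inv (\<iota> m) \<otimes> \<iota> u = y" unfolding \<iota>u y_def x_def ..
  have t0: "0 \<le> t" by (simp add: t_def)
  have tr: "t \<le> r"
    using vw norm_triangle_ineq4[of "v - \<phi> \<one>" "w - \<phi> \<one>"]
    by (simp add: t_def dist_norm norm_minus_commute)
  have tpos: "0 < t"
    using ne \<iota>v by (auto simp: t_def)
  have \<kappa>: "0 \<le> \<kappa>" "8 * L\<^sup>2 * \<kappa> < 1" "\<kappa> \<le> 3/4" using pos small by (auto simp: \<kappa>_def)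
  have \<kappa>t: "2 * \<kappa> * t\<^sup>2 < t\<^sup>2 / (4 * L\<^sup>2)"
  proof -
    have "2 * \<kappa> < 1 / (4 * L\<^sup>2)" using \<kappa>(2) pos by (simp add: field_simps)
    then have "2 * \<kappa> * t\<^sup>2 < 1 / (4 * L\<^sup>2) * t\<^sup>2" using tpos by (intro mult_strict_right_mono) auto
    then show ?thesis by simp
  qed
  have midshift: "midpoint (p - c) (q - c) = midpoint p q - c" for p q c :: 'e
    by (simp add: midpoint_def algebra_simps) (simp add: scaleR_add_left[symmetric])
  have X: "g \<otimes> x \<otimes> inv g \<in> U"
    "(displacement g x)\<^sup>2 \<le> (conj_size a)\<^sup>2 / 2 + (conj_size a')\<^sup>2 / 2 - t\<^sup>2 / (4 * L\<^sup>2) + \<kappa> * t\<^sup>2"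
    if g: "g \<in> carrier G" for g
  proof -
    let ?K = "\<lambda>v. g \<otimes> \<iota> v \<otimes> inv g"
    have Kin: "?K \<in> {\<lambda>v. g \<otimes> \<iota> v \<otimes> inv g, \<lambda>v. g \<otimes> (inv (\<iota> v) \<otimes> \<iota> u) \<otimes> inv g}" by simp
    show "g \<otimes> x \<otimes> inv g \<in> U"
      using bounds[OF g ud vd(3) vd(3) Kin[unfolded \<iota>_def]] by (simp add: x_def \<iota>_def)
    have mid: "norm (\<phi> (g \<otimes> x \<otimes> inv g) - midpoint (\<phi> (g \<otimes> a \<otimes> inv g)) (\<phi> (g \<otimes> a' \<otimes> inv g))) \<le> L * t\<^sup>2"
      using bounds[OF g ud vd(1) vd(2) Kin[unfolded \<iota>_def]] \<iota>v by (simp add: x_def \<iota>_def m_def t_def)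
    have expand: "t \<le> L * norm (\<phi> (g \<otimes> a \<otimes> inv g) - \<phi> (g \<otimes> a' \<otimes> inv g))"
      using conj_expand[OF ar ar' g] by (simp add: t_def v_def w_def)
    have "(displacement g x)\<^sup>2 \<le> (displacement g a)\<^sup>2 / 2 + (displacement g a')\<^sup>2 / 2
        - (norm (\<phi> (g \<otimes> a \<otimes> inv g) - \<phi> (g \<otimes> a' \<otimes> inv g)))\<^sup>2 / 4 + \<kappa> * t\<^sup>2"
      using norm_midpoint_perturbation[of "\<phi> (g \<otimes> a \<otimes> inv g) - \<phi> \<one>" r "\<phi> (g \<otimes> a' \<otimes> inv g) - \<phi> \<one>"
          "\<phi> (g \<otimes> x \<otimes> inv g) - \<phi> \<one>" L t] small_conj_le[OF ar g] small_conj_le[OF ar' g] mid t0 tr pos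
      by (simp add: displacement_def midshift \<kappa>_def)
    moreover have "t\<^sup>2 / (4 * L\<^sup>2) \<le> (norm (\<phi> (g \<otimes> a \<otimes> inv g) - \<phi> (g \<otimes> a' \<otimes> inv g)))\<^sup>2 / 4"
    proof -
      have "t\<^sup>2 \<le> (L * norm (\<phi> (g \<otimes> a \<otimes> inv g) - \<phi> (g \<otimes> a' \<otimes> inv g)))\<^sup>2"
        using expand t0 by (intro power_mono)
      then show ?thesis using pos by (simp add: field_simps power_mult_distrib)
    qed
    moreover have "(displacement g a)\<^sup>2 \<le> (conj_size a)\<^sup>2" "(displacement g a')\<^sup>2 \<le> (conj_size a')\<^sup>2"
      using displacement_le_size[OF a g] displacement_le_size[OF a' g]
      by (auto intro!: power_mono simp: displacement_def)
    ultimately show "(displacement g x)\<^sup>2 \<le> (conj_size a)\<^sup>2 / 2 + (conj_size a')\<^sup>2 / 2 - t\<^sup>2 / (4 * L\<^sup>2) + \<kappa> * t\<^sup>2"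
      by linarith
  qed
  have Y: "g \<otimes> y \<otimes> inv g \<in> U"
    "(displacement g y)\<^sup>2 \<le> (conj_size b)\<^sup>2 / 2 + (conj_size b')\<^sup>2 / 2 + \<kappa> * t\<^sup>2"
    if g: "g \<in> carrier G" for g
  proof -
    let ?K = "\<lambda>v. g \<otimes> (inv (\<iota> v) \<otimes> \<iota> u) \<otimes> inv g"
    have Kin: "?K \<in> {\<lambda>v. g \<otimes> \<iota> v \<otimes> inv g, \<lambda>v. g \<otimes> (inv (\<iota> v) \<otimes> \<iota> u) \<otimes> inv g}" by simp
    have "?K m \<in> U"
      using bounds[OF g ud vd(3) vd(3) Kin[unfolded \<iota>_def]] by (simp add: \<iota>_def)
    then show "g \<otimes> y \<otimes> inv g \<in> U" unfolding ym .
    have "norm (\<phi> (?K (midpoint v w)) - midpoint (\<phi> (?K v)) (\<phi> (?K w))) \<le> L * (norm (v - w))\<^sup>2"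
      using bounds[OF g ud vd(1) vd(2) Kin[unfolded \<iota>_def]] by (simp add: \<iota>_def)
    then have mid: "norm (\<phi> (g \<otimes> y \<otimes> inv g) - midpoint (\<phi> (g \<otimes> b \<otimes> inv g)) (\<phi> (g \<otimes> b' \<otimes> inv g))) \<le> L * t\<^sup>2"
      unfolding bv bw m_def[symmetric] ym t_def .
    have "(displacement g y)\<^sup>2 \<le> (displacement g b)\<^sup>2 / 2 + (displacement g b')\<^sup>2 / 2
        - (norm (\<phi> (g \<otimes> b \<otimes> inv g) - \<phi> (g \<otimes> b' \<otimes> inv g)))\<^sup>2 / 4 + \<kappa> * t\<^sup>2"
      using norm_midpoint_perturbation[of "\<phi> (g \<otimes> b \<otimes> inv g) - \<phi> \<one>" r "\<phi> (g \<otimes> b' \<otimes> inv g) - \<phi> \<one>"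
          "\<phi> (g \<otimes> y \<otimes> inv g) - \<phi> \<one>" L t] small_conj_le[OF br g] small_conj_le[OF br' g] mid t0 tr pos
      by (simp add: displacement_def midshift \<kappa>_def)
    \<comment> \<open>For \<open>y\<close> the parallelogram term is bounded by zero: the gain of
      \<open>x\<close> pays for both errors.\<close>
    moreover have "0 \<le> (norm (\<phi> (g \<otimes> b \<otimes> inv g) - \<phi> (g \<otimes> b' \<otimes> inv g)))\<^sup>2 / 4" by simp
    moreover have "(displacement g b)\<^sup>2 \<le> (conj_size b)\<^sup>2" "(displacement g b')\<^sup>2 \<le> (conj_size b')\<^sup>2"
      using displacement_le_size[OF b g] displacement_le_size[OF b' g]
      by (auto intro!: power_mono simp: displacement_def)
    ultimately show "(displacement g y)\<^sup>2 \<le> (conj_size b)\<^sup>2 / 2 + (conj_size b')\<^sup>2 / 2 + \<kappa> * t\<^sup>2"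
      by linarith
  qed
  have szle: "(conj_size c)\<^sup>2 \<le> r\<^sup>2 / 4" if c: "c \<in> small_conj (r/2)" for c
  proof -
    have "conj_size c \<le> r / 2" using small_conj_le[OF c] by (rule size_leI)
    then have "(conj_size c)\<^sup>2 \<le> (r / 2)\<^sup>2" using size_nonneg[OF c] by (intro power_mono)
    then show ?thesis by (simp add: power_divide)
  qed
  have \<kappa>tr: "\<kappa> * t\<^sup>2 \<le> 3 / 4 * r\<^sup>2"
    using \<kappa> tr t0 by (intro mult_mono power_mono) auto
  have t2: "0 \<le> t\<^sup>2 / (4 * L\<^sup>2)" by simp
  have aux: "F \<le> R" if "F \<le> c/2 + c'/2 - s + k" "c \<le> R/4" "c' \<le> R/4" "k \<le> 3/4 * R" "0 \<le> s"
    for F R c c' s k :: real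
    using that by linarith
  have dx: "displacement g x \<le> r" if g: "g \<in> carrier G" for g
  proof -
    have "(displacement g x)\<^sup>2 \<le> r\<^sup>2" by (rule aux[OF X(2)[OF g] szle[OF a] szle[OF a'] \<kappa>tr t2])
    then show ?thesis by (rule power2_le_imp_le) (use pos(3) in simp)
  qed
  have dy: "displacement g y \<le> r" if g: "g \<in> carrier G" for g
  proof -
    have "(displacement g y)\<^sup>2 \<le> r\<^sup>2" 
      using aux[OF _ szle[OF b] szle[OF b'] \<kappa>tr order_refl] Y(2)[OF g] by simp
    then show ?thesis by (rule power2_le_imp_le) (use pos(3) in simp)
  qed
  have yc: "y \<in> carrier G" unfolding y_def using xc carr by simp
  have xs: "x \<in> small_conj r" unfolding small_conj_def using xc X(1) dx by blast
  have ys: "y \<in> small_conj r" unfolding small_conj_def using yc Y(1) dy by blast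
  have size_sq: "(conj_size c)\<^sup>2 \<le> B"
    if c: "c \<in> small_conj r" and B: "\<And>g. g \<in> carrier G \<Longrightarrow> (displacement g c)\<^sup>2 \<le> B" for c B
  proof -
    have B0: "0 \<le> B" using B[OF one_closed] zero_le_power2 order_trans by blast
    have "conj_size c \<le> sqrt B" using B by (intro size_leI) (simp add: real_le_rsqrt)
    then have "(conj_size c)\<^sup>2 \<le> (sqrt B)\<^sup>2" using size_nonneg[OF c] by (intro power_mono)
    then show ?thesis using B0 by simp
  qed
  have aux2: "p + q < (c + c' + d + d') / 2" if "p \<le> c/2 + c'/2 - s + k * l" "q \<le> d/2 + d'/2 + k * l" "2 * k * l < s"
    for p q c c' d d' s k l :: real
    using that by (simp add: field_simps)
  have "(conj_size x)\<^sup>2 + (conj_size y)\<^sup>2 <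
      ((conj_size a)\<^sup>2 + (conj_size a')\<^sup>2 + (conj_size b)\<^sup>2 + (conj_size b')\<^sup>2) / 2"
    by (rule aux2[OF size_sq[OF xs X(2)] size_sq[OF ys Y(2)] \<kappa>t])
  moreover have "x \<otimes> y = a \<otimes> b" unfolding y_def using xc carr by (simp add: m_assoc[symmetric])
  ultimately show ?thesis using xs ys by blast
qed

end

lemma compact_Pi_UNIV:
  fixes B :: "'i \<Rightarrow> 'a::topological_space set"
  assumes "\<And>i. compact (B i)" shows "compact (Pi UNIV B)"
proof -
  have "compactin (product_topology (\<lambda>i. euclidean) UNIV) (PiE UNIV B)"
    using assms by (simp add: compactin_PiE)
  then show ?thesis by (simp add: euclidean_product_topology PiE_UNIV_domain)
qed

section \<open>Minimisers of the total squared size\<close>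

context convex_chart
begin

lemma chart_inv_one: "inv_into U \<phi> (\<phi> \<one>) = \<one>"
  by (rule chartD(7)[OF chart one_U])

text \<open>Each element \<open>g\<close> imposes a closed condition, that the conjugate lie in the
  compact image of a coordinate ball; the set is their intersection inside the compact
  group.\<close>

lemma compact_small_conj:
  assumes s: "s \<le> \<delta>" shows "compact (small_conj s)"
proof -
  define C where "C = inv_into U \<phi> ` cball (\<phi> \<one>) s"
  have sub: "cball (\<phi> \<one>) s \<subseteq> \<phi> ` U" using ball s by (meson order_trans subset_cball)
  have "compact C" unfolding C_def
    by (rule compact_continuous_image[OF continuous_on_subset[OF chartD(5)[OF chart] sub] compact_cball])
  then have Cc: "closed C" by (rule compact_imp_closed)
  have C: "x \<in> C \<longleftrightarrow> x \<in> U \<and> \<phi> x \<in> cball (\<phi> \<one>) s" for x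
  proof
    assume "x \<in> C"
    then obtain v where v: "v \<in> cball (\<phi> \<one>) s" "x = inv_into U \<phi> v" unfolding C_def by (rule imageE)
    then have "v \<in> \<phi> ` U" using sub by blast
    then show "x \<in> U \<and> \<phi> x \<in> cball (\<phi> \<one>) s" unfolding v(2) using v(1) chartD(8,9)[OF chart] by simp
  next
    assume x: "x \<in> U \<and> \<phi> x \<in> cball (\<phi> \<one>) s"
    then have "x = inv_into U \<phi> (\<phi> x)" using chartD(7)[OF chart] by simp
    then show "x \<in> C" unfolding C_def using x by blast
  qed
  have cl: "closed (carrier G \<inter> (\<lambda>x. g \<otimes> x \<otimes> inv g) -` C)" if g: "g \<in> carrier G" for g
  proof -
    have "continuous_on (carrier G) (\<lambda>x. g \<otimes> x \<otimes> inv g)"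
      using g by (intro continuous_on_mult continuous_on_const continuous_on_id) auto
    from continuous_closedin_preimage[OF this Cc]
    have "compact (carrier G \<inter> (\<lambda>x. g \<otimes> x \<otimes> inv g) -` C)"
      by (rule closedin_compact[OF compact])
    then show ?thesis by (rule compact_imp_closed)
  qed
  have "small_conj s = carrier G \<inter> (\<Inter>g\<in>carrier G. carrier G \<inter> (\<lambda>x. g \<otimes> x \<otimes> inv g) -` C)"
    unfolding small_conj_def by (auto simp: C displacement_def dist_norm norm_minus_commute)
  moreover have "closed (\<Inter>g\<in>carrier G. carrier G \<inter> (\<lambda>x. g \<otimes> x \<otimes> inv g) -` C)"
    by (rule closed_INT) (use cl in blast)
  ultimately show ?thesis by (simp only: compact_Int_closed[OF compact])
qed

lemma continuous_on_size: "continuous_on (small_conj \<delta>) conj_size"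
  unfolding continuous_on_def
proof
  fix x assume x: "x \<in> small_conj \<delta>"
  have "small_conj \<delta> \<subseteq> U" using small_conj_chart(1) by blast
  then have "continuous_on (small_conj \<delta>) \<phi>" using chartD(4)[OF chart] continuous_on_subset by blast
  then have "(\<phi> \<longlongrightarrow> \<phi> x) (at x within small_conj \<delta>)" using x by (simp add: continuous_on_def)
  then have l: "((\<lambda>y. \<phi> y - \<phi> x) \<longlongrightarrow> 0) (at x within small_conj \<delta>)" by (simp add: LIM_zero)
  have "((\<lambda>y. conj_size y - conj_size x) \<longlongrightarrow> 0) (at x within small_conj \<delta>)"
  proof (rule tendsto_0_le[OF l, where K = L])
    have "\<forall>\<^sub>F y in at x within small_conj \<delta>. y \<in> small_conj \<delta>"
      by (simp add: eventually_at_filter)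
    then show "\<forall>\<^sub>F y in at x within small_conj \<delta>. norm (conj_size y - conj_size x) \<le> norm (\<phi> y - \<phi> x) * L"
    proof eventually_elim
      case (elim y)
      then show ?case using size_lipschitz[OF elim x] by (simp add: mult.commute)
    qed
  qed
  then show "(conj_size \<longlongrightarrow> conj_size x) (at x within small_conj \<delta>)" by (rule LIM_zero_cancel)
qed

text \<open>Conjugation fixes the identity, so its Lipschitz bound at the base point of the chart
  controls all conjugates of an element at once.\<close>

lemma small_conj_of_chart:
  assumes x: "x \<in> U" "norm (\<phi> x - \<phi> \<one>) \<le> \<rho>" and \<rho>: "\<rho> \<le> \<delta>" "L * \<rho> \<le> r"
  shows "x \<in> small_conj r" "conj_size x \<le> L * \<rho>"
proof -
  have xc: "x \<in> carrier G" using x chart_carrier[OF chart] by blast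
  have v: "\<phi> x \<in> cball (\<phi> \<one>) \<delta>" using x \<rho> by (simp add: dist_norm norm_minus_commute)
  have p: "\<phi> \<one> \<in> cball (\<phi> \<one>) \<delta>" using pos by simp
  have b: "g \<otimes> x \<otimes> inv g \<in> U \<and> displacement g x \<le> L * \<rho>" if g: "g \<in> carrier G" for g
  proof -
    have "g \<otimes> x \<otimes> inv g \<in> U \<and> norm (\<phi> (g \<otimes> x \<otimes> inv g) - \<phi> \<one>) \<le> L * norm (\<phi> x - \<phi> \<one>)"
      using bounds[OF g p v p insertI1] chartD(7)[OF chart x(1)] chart_inv_one g by simp
    moreover have "L * norm (\<phi> x - \<phi> \<one>) \<le> L * \<rho>" using x(2) pos by simp
    ultimately show ?thesis by (simp add: displacement_def)
  qed
  then show "conj_size x \<le> L * \<rho>" by (intro size_leI) blast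
  show "x \<in> small_conj r" unfolding small_conj_def using xc b \<rho>(2) by force
qed

lemma continuous_on_list_product:
  assumes "\<And>a i. a \<in> S \<Longrightarrow> a i \<in> carrier G"
  shows "continuous_on S (\<lambda>a. list_product a n)"
proof (induction n)
  case 0
  then show ?case by (simp add: continuous_on_const)
next
  case (Suc n)
  have "continuous_on S (\<lambda>a. a n)"
    by (rule continuous_on_subset[OF continuous_on_product_coordinates]) simp
  then show ?case unfolding list_product.simps
    using Suc assms by (intro continuous_on_mult) (auto intro: list_product_closed)
qed

text \<open>A minimiser of the total squared size among factorisations of \<open>z\<close> into \<open>n\<close> small factors has equal
  factors: exchanging two neighbours \<open>(a, b)\<close> for \<open>(b, b\<^sup>-\<^sup>1 a b)\<close> changes neither the product nor the total, so strict
  convexity forces \<open>a = b\<close>.\<close>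

lemma root_exists:
  assumes n: "0 < n" and a0: "\<And>i. i < n \<Longrightarrow> a0 i \<in> small_conj r \<and> conj_size (a0 i) \<le> c"
    and prod: "list_product a0 n = z" and c: "real n * c\<^sup>2 \<le> (r/2)\<^sup>2" "0 \<le> c"
  shows "\<exists>w\<in>small_conj r. w [^] n = z \<and> conj_size w \<le> c"
proof -
  \<comment> \<open>Factorisations are encoded as sequences on all of \<open>nat\<close>; pinning
    the entries from \<open>n\<close> on to the identity makes the space of candidates
    compact.\<close>
  define B where "B = (\<lambda>i. if i < n then small_conj r else {\<one>})"
  define K where "K = Pi UNIV B"
  have B: "compact (B i)" for i using compact_small_conj[OF pos(4)] by (simp add: B_def)
  have K: "compact K" unfolding K_def by (rule compact_Pi_UNIV[OF B])
  have Kr: "a i \<in> small_conj r" if "a \<in> K" "i < n" for a i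
    using that by (auto simp: K_def B_def Pi_def split: if_splits)
  have Kc: "a i \<in> carrier G" if "a \<in> K" for a i
    using that small_conj_carrier[of "a i" r] one_closed by (auto simp: K_def B_def Pi_def split: if_splits dest!: spec[of _ i])
  define T where "T = {a \<in> K. list_product a n = z}"
  have "continuous_on K (\<lambda>a. list_product a n)" by (rule continuous_on_list_product) (rule Kc)
  from closedin_compact[OF K continuous_closedin_preimage_constant[OF this]]
  have T: "compact T" unfolding T_def .
  define E where "E = (\<lambda>a. \<Sum>i<n. (conj_size (a i))\<^sup>2)"
  have "continuous_on K E" unfolding E_def
  proof (intro continuous_on_sum continuous_on_power)
    fix i assume i: "i \<in> {..<n}"
    have "small_conj r \<subseteq> small_conj \<delta>" by (rule small_conj_mono[OF pos(4)])
    then have "(\<lambda>a. a i) ` K \<subseteq> small_conj \<delta>" using Kr i by auto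
    then show "continuous_on K (\<lambda>a. conj_size (a i))"
      by (rule continuous_on_compose2[OF continuous_on_size
            continuous_on_subset[OF continuous_on_product_coordinates subset_UNIV]])
  qed
  then have Ec: "continuous_on T E" by (rule continuous_on_subset) (auto simp: T_def)
  define a1 where "a1 = (\<lambda>i. if i < n then a0 i else \<one>)"
  have "list_product a1 n = list_product a0 n" by (rule list_product_cong) (simp add: a1_def)
  then have a1: "a1 \<in> T" using a0 prod by (auto simp: T_def K_def B_def a1_def)
  then have "T \<noteq> {}" by blast
  from continuous_attains_inf[OF T this Ec] obtain a where a: "a \<in> T" "\<And>b. b \<in> T \<Longrightarrow> E a \<le> E b" by blast
  have aK: "a \<in> K" using a(1) by (simp add: T_def)
  have "E a1 \<le> (\<Sum>i<n. c\<^sup>2)" unfolding E_def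
  proof (rule sum_mono)
    fix i assume "i \<in> {..<n}"
    then have "a0 i \<in> small_conj r \<and> conj_size (a0 i) \<le> c" "a1 i = a0 i" using a0 by (auto simp: a1_def)
    then show "(conj_size (a1 i))\<^sup>2 \<le> c\<^sup>2" using size_nonneg[of "a0 i" r] by (simp add: power_mono)
  qed
  then have Ea: "E a \<le> real n * c\<^sup>2" using a(2)[OF a1] by simp
  \<comment> \<open>The given factorisation bounds the minimum by \<open>real n * c\<^sup>2\<close>,
    so every factor of the minimiser has size at most \<open>r/2\<close>. This is the range in which
    two factors may be averaged.\<close>
  have half: "a i \<in> small_conj (r/2)" if i: "i < n" for i
  proof (rule small_conjI_size[OF Kr[OF aK i]])
    have "(conj_size (a i))\<^sup>2 \<le> E a" unfolding E_def
      using i by (intro member_le_sum[where f = "\<lambda>i. (conj_size (a i))\<^sup>2"]) auto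
    then have "(conj_size (a i))\<^sup>2 \<le> (r/2)\<^sup>2" using Ea c(1) by linarith
    then show "conj_size (a i) \<le> r/2" by (rule power2_le_imp_le) (use pos in simp)
  qed
  have adj: "a j = a (Suc j)" if j: "Suc j < n" for j
  proof (rule ccontr)
    assume ne: "a j \<noteq> a (Suc j)"
    have aj: "a j \<in> small_conj (r/2)" "a (Suc j) \<in> small_conj (r/2)" using half j by auto
    have cj: "a j \<in> carrier G" "a (Suc j) \<in> carrier G" using Kc[OF aK] by auto
    define b' where "b' = inv (a (Suc j)) \<otimes> a j \<otimes> inv (inv (a (Suc j)))"
    have b': "b' \<in> small_conj (r/2)" "conj_size b' = conj_size (a j)"
      unfolding b'_def using conj_small[OF aj(1) inv_closed[OF cj(2)]] by auto
    have "a j \<otimes> a (Suc j) = a (Suc j) \<otimes> b'"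
      unfolding b'_def using cj by (simp add: m_assoc[symmetric])
    from strictly_convex_pair[OF aj(1,2) aj(2) b'(1) this ne] obtain x y where
      xy: "x \<in> small_conj r" "y \<in> small_conj r" "x \<otimes> y = a j \<otimes> a (Suc j)"
      "(conj_size x)\<^sup>2 + (conj_size y)\<^sup>2 < (conj_size (a j))\<^sup>2 + (conj_size (a (Suc j)))\<^sup>2"
      using b'(2) by auto
    define b where "b = a(j := x, Suc j := y)"
    have "list_product b n = list_product a n" unfolding b_def
      using Kc[OF aK] small_conj_carrier[OF xy(1)] small_conj_carrier[OF xy(2)] xy(3) j
      by (intro list_product_swap) auto
    moreover have "b \<in> K" unfolding K_def
    proof (rule Pi_I)
      fix i
      have "a i \<in> B i" using aK by (auto simp: K_def)
      then show "b i \<in> B i" using xy(1,2) j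
        by (cases "i = j"; cases "i = Suc j") (auto simp: b_def B_def)
    qed
    ultimately have bT: "b \<in> T" using a(1) by (simp add: T_def)
    define R where "R = {..<n} - {j, Suc j}"
    have R: "{..<n} = insert j (insert (Suc j) R)" "finite R" "j \<notin> insert (Suc j) R" "Suc j \<notin> R"
      using j by (auto simp: R_def)
    have split: "E h = (conj_size (h j))\<^sup>2 + ((conj_size (h (Suc j)))\<^sup>2 + (\<Sum>i\<in>R. (conj_size (h i))\<^sup>2))" for h
      unfolding E_def R(1) using R by simp
    have "(\<Sum>i\<in>R. (conj_size (b i))\<^sup>2) = (\<Sum>i\<in>R. (conj_size (a i))\<^sup>2)"
      by (rule sum.cong) (auto simp: b_def R_def)
    moreover have "b j = x" "b (Suc j) = y" by (auto simp: b_def)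
    ultimately have "E b < E a" using xy(4) unfolding split by simp
    then show False using a(2)[OF bT] by simp
  qed
  have const: "a i = a 0" if "i < n" for i using that by (induction i) (auto simp: adj[symmetric])
  have "list_product a n = list_product (\<lambda>i. a 0) n" by (rule list_product_cong) (rule const)
  then have pw: "a 0 [^] n = z" using a(1) by (simp add: T_def list_product_const)
  have "E a = (\<Sum>i<n. (conj_size (a 0))\<^sup>2)" unfolding E_def
  proof (rule sum.cong[OF refl])
    fix i assume "i \<in> {..<n}"
    then have "a i = a 0" by (intro const) simp
    then show "(conj_size (a i))\<^sup>2 = (conj_size (a 0))\<^sup>2" by (simp only:)
  qed
  then have "E a = real n * (conj_size (a 0))\<^sup>2" by simp
  then have "(conj_size (a 0))\<^sup>2 \<le> c\<^sup>2" using Ea n by simp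
  then have "conj_size (a 0) \<le> c" by (rule power2_le_imp_le) (rule c(2))
  then show ?thesis using pw Kr[OF aK n] by blast
qed

end

section \<open>Second-order estimates for products and the existence of small roots\<close>

context lie_group
begin

text \<open>The product in coordinates is exactly \<open>v\<close> when the first argument is the
  base point and exactly \<open>u\<close> when the second is. Its deviation from
  \<open>u + v - \<phi> \<one>\<close> therefore vanishes on both axes and is bounded by the product
  of the two distances.\<close>

lemma chart_product_bounds:
  assumes U: "(U, \<phi>) \<in> A" "\<one> \<in> U"
  shows "\<exists>r>0. \<exists>M>0. cball (\<phi> \<one>) r \<subseteq> \<phi> ` U \<and> (\<forall>u\<in>cball (\<phi> \<one>) r. \<forall>v\<in>cball (\<phi> \<one>) r.
    inv_into U \<phi> u \<otimes> inv_into U \<phi> v \<in> U \<and>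
    norm (\<phi> (inv_into U \<phi> u \<otimes> inv_into U \<phi> v) - u - v + \<phi> \<one>) \<le> M * norm (u - \<phi> \<one>) * norm (v - \<phi> \<one>))"
proof -
  define p where "p = \<phi> \<one>"
  define \<iota> where "\<iota> = inv_into U \<phi>"
  define f where "f = (\<lambda>x. \<phi> (\<iota> (fst x) \<otimes> \<iota> (snd x)))"
  let ?K = "\<lambda>x. \<iota> (fst x) \<otimes> \<iota> (snd x)"
  let ?S = "(\<phi> ` U \<times> \<phi> ` U) \<inter> ?K -` U"
  have sm\<iota>: "smooth_into A (\<phi> ` U) \<iota>" unfolding \<iota>_def by (rule smooth_into_chart_inverse[OF U(1)])
  have o: "open (\<phi> ` U \<times> \<phi> ` U)" by (intro open_Times chartD(2)[OF U(1)])
  have K: "smooth_into A (\<phi> ` U \<times> \<phi> ` U) ?K"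
    by (intro smooth_into_mult smooth_into_compose[OF sm\<iota> o] smooth_on_fst smooth_on_snd smooth_on_id o) auto
  have \<iota>p: "\<iota> p = \<one>" using chartD(7)[OF U] by (simp add: \<iota>_def p_def)
  have "p \<in> \<phi> ` U" using U(2) by (simp add: p_def)
  then have pS: "(p, p) \<in> ?S" using U(2) by (simp add: \<iota>p)
  have So: "open ?S" by (rule smooth_into_open_vimage_chart[OF K U(1)])
  have Sf: "smooth_on ?S f" unfolding f_def by (rule smooth_into_chart[OF K U(1)])
  obtain r M where r: "r > 0" "M > 0" "cball (p, p) r \<subseteq> ?S" and
    D: "\<forall>x\<in>cball (p, p) r. \<forall>y\<in>cball (p, p) r. \<forall>v.
       norm (frechet_derivative f (at x) v - frechet_derivative f (at y) v) \<le> M * norm (x - y) * norm v"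
    using smooth_on_second_order_bounds[OF So Sf pS] by (elim exE conjE) (rule that; assumption)
  have mem: "(u, v) \<in> cball (p, p) r" if "u \<in> cball p (r/2)" "v \<in> cball p (r/2)" for u v
  proof -
    have "dist (p, p) (u, v) \<le> dist p u + dist p v"
      by (simp add: dist_Pair_Pair sqrt_sum_squares_le_sum)
    then show ?thesis using that by auto
  qed
  have sub: "cball p (r/2) \<subseteq> \<phi> ` U"
  proof
    fix u assume "u \<in> cball p (r/2)"
    from mem[OF this this] r(3) show "u \<in> \<phi> ` U" by blast
  qed
  have left: "f (p, v) = v" if "v \<in> cball p (r/2)" for v
  proof -
    have "v \<in> \<phi> ` U" using sub that by blast
    then have "\<iota> v \<in> U" "\<phi> (\<iota> v) = v" using chartD(8,9)[OF U(1)] by (auto simp: \<iota>_def)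
    then show ?thesis using chart_carrier[OF U(1)] by (auto simp: f_def \<iota>p subset_iff)
  qed
  have right: "f (u, p) = u" if "u \<in> cball p (r/2)" for u
  proof -
    have "u \<in> \<phi> ` U" using sub that by blast
    then have "\<iota> u \<in> U" "\<phi> (\<iota> u) = u" using chartD(8,9)[OF U(1)] by (auto simp: \<iota>_def)
    then show ?thesis using chart_carrier[OF U(1)] by (auto simp: f_def \<iota>p subset_iff)
  qed
  have est: "norm (f (u, v) - u - v + p) \<le> M * norm (u - p) * norm (v - p)"
    if u: "u \<in> cball p (r/2)" and v: "v \<in> cball p (r/2)" for u v
  proof -
    have pc: "p \<in> cball p (r/2)" using r by simp
    \<comment> \<open>The derivative of this difference in \<open>v\<close> is small of order
      \<open>norm (u - p)\<close> by the Lipschitz bound on the derivative of \<open>f\<close>; the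
      mean value inequality supplies the factor \<open>norm (v - p)\<close>.\<close>
    let ?h = "\<lambda>v. f (u, v) - f (p, v)"
    let ?h' = "\<lambda>v x. frechet_derivative f (at (u, v)) (0, x) - frechet_derivative f (at (p, v)) (0, x)"
    have d: "((\<lambda>v. f (a, v)) has_derivative (\<lambda>x. frechet_derivative f (at (a, v)) (0, x))) (at v)"
      if "a \<in> cball p (r/2)" "v \<in> cball p (r/2)" for a v
    proof -
      have F: "(f has_derivative frechet_derivative f (at (a, v))) (at (a, v))"
        using smooth_on_has_derivative[OF Sf] mem[OF that] r(3) by blast
      have "((\<lambda>v. (a, v)) has_derivative (\<lambda>x. (0, x))) (at v)"
        by (intro has_derivative_Pair has_derivative_const has_derivative_ident)
      from diff_chain_at[OF this F] show ?thesis by (simp add: o_def)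
    qed
    have "norm (?h v - ?h p) \<le> (M * norm (u - p)) * norm (v - p)"
    proof (rule differentiable_bound[where S = "cball p (r/2)" and f' = ?h'])
      show "convex (cball p (r/2))" by simp
      show "(?h has_derivative ?h' v) (at v within cball p (r/2))" if "v \<in> cball p (r/2)" for v
        by (rule has_derivative_at_withinI) (intro has_derivative_diff d u pc that)
      show "onorm (?h' v) \<le> M * norm (u - p)" if v: "v \<in> cball p (r/2)" for v
      proof (rule onorm_bound)
        show "0 \<le> M * norm (u - p)" using r by simp
        fix x
        have "norm (?h' v x) \<le> M * norm ((u, v) - (p, v)) * norm (0 :: 'e, x)"
          using D mem[OF u v] mem[OF pc v] by blast
        then show "norm (?h' v x) \<le> M * norm (u - p) * norm x" by (simp add: norm_Pair)
      qed
    qed (use v pc in auto)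
    moreover have "?h v - ?h p = f (u, v) - u - v + p"
      using left[OF v] left[OF pc] right[OF u] by (simp add: algebra_simps)
    ultimately show ?thesis by simp
  qed
  have inU: "\<iota> u \<otimes> \<iota> v \<in> U" if "u \<in> cball p (r/2)" "v \<in> cball p (r/2)" for u v
    using subsetD[OF r(3) mem[OF that]] by simp
  show ?thesis unfolding p_def[symmetric] \<iota>_def[symmetric]
    by (intro exI[of _ "r/2"] exI[of _ M] conjI ballI r(2) sub inU)
      (use r(1) est in \<open>simp_all add: f_def\<close>)
qed

text \<open>Used to cut a path into many factors: increments over steps of length 1/n lie in the
  chart with coordinates of order 1/n, uniformly along the interval.\<close>

lemma chart_path_increments:
  assumes U: "(U, \<phi>) \<in> A" "\<one> \<in> U" and \<zeta>: "smooth_into A UNIV (\<zeta> :: real \<Rightarrow> 'g)"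
  shows "\<exists>\<eta>>0. \<exists>L>0. \<forall>x\<in>{a..b}. \<forall>y. \<bar>x - y\<bar> \<le> \<eta> \<longrightarrow>
    inv (\<zeta> x) \<otimes> \<zeta> y \<in> U \<and> norm (\<phi> (inv (\<zeta> x) \<otimes> \<zeta> y) - \<phi> \<one>) \<le> L * \<bar>x - y\<bar>"
proof (rule compact_uniform_bounds[OF compact_Icc])
  fix x0 :: real
  let ?K = "\<lambda>q. inv (\<zeta> (fst q)) \<otimes> \<zeta> (snd q)"
  have K: "smooth_into A (UNIV :: (real \<times> real) set) ?K"
    by (intro smooth_into_mult smooth_into_inv smooth_into_compose[OF \<zeta>] smooth_on_fst smooth_on_snd smooth_on_id) auto
  have c: "\<zeta> x \<in> carrier G" for x using smooth_intoD[OF \<zeta>] by simp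
  have 0: "(x0, x0) \<in> UNIV" "?K (x0, x0) \<in> U" using U(2) c by auto
  obtain r L where r: "r > 0" "L > 0" and b: "\<forall>s\<in>cball x0 r. \<forall>v\<in>cball x0 r. (s, v) \<in> UNIV \<and> ?K (s, v) \<in> U \<and>
    (\<forall>w\<in>cball x0 r. norm (\<phi> (?K (s, v)) - \<phi> (?K (s, w))) \<le> L * norm (v - w) \<and>
      norm (\<phi> (?K (s, midpoint v w)) - midpoint (\<phi> (?K (s, v))) (\<phi> (?K (s, w)))) \<le> L * (norm (v - w))\<^sup>2)"
    using chart_family_bounds[OF U(1) K 0] by (elim exE conjE) (rule that; assumption)
  have "\<forall>y. \<bar>x - y\<bar> \<le> r/2 \<longrightarrow> inv (\<zeta> x) \<otimes> \<zeta> y \<in> U \<and> norm (\<phi> (inv (\<zeta> x) \<otimes> \<zeta> y) - \<phi> \<one>) \<le> L * \<bar>x - y\<bar>"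
    if x: "x \<in> ball x0 (r/2)" for x
  proof (intro allI impI)
    fix y assume "\<bar>x - y\<bar> \<le> r/2"
    moreover have "\<bar>x0 - x\<bar> < r/2" using x by (simp add: dist_real_def)
    ultimately have "\<bar>x0 - x\<bar> \<le> r" "\<bar>x0 - y\<bar> \<le> r" using r(1) by linarith+
    then have m: "x \<in> cball x0 r" "y \<in> cball x0 r" by (simp_all add: dist_real_def)
    show "inv (\<zeta> x) \<otimes> \<zeta> y \<in> U \<and> norm (\<phi> (inv (\<zeta> x) \<otimes> \<zeta> y) - \<phi> \<one>) \<le> L * \<bar>x - y\<bar>"
      using bspec[OF conjunct2[OF conjunct2[OF b[rule_format, OF m(1,2)]]] m(1)] b[rule_format, OF m(1,2)] c[of x]
      by (simp add: abs_minus_commute)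
  qed
  then have "\<forall>x\<in>ball x0 (r/2) \<inter> {a..b}. \<forall>y. \<bar>x - y\<bar> \<le> r/2 \<longrightarrow> inv (\<zeta> x) \<otimes> \<zeta> y \<in> U \<and>
      norm (\<phi> (inv (\<zeta> x) \<otimes> \<zeta> y) - \<phi> \<one>) \<le> L * \<bar>x - y\<bar>" by blast
  then show "\<exists>N. open N \<and> x0 \<in> N \<and> (\<exists>\<delta>>0. \<exists>L. \<forall>x\<in>N \<inter> {a..b}. \<forall>y. \<bar>x - y\<bar> \<le> \<delta> \<longrightarrow>
      inv (\<zeta> x) \<otimes> \<zeta> y \<in> U \<and> norm (\<phi> (inv (\<zeta> x) \<otimes> \<zeta> y) - \<phi> \<one>) \<le> L * \<bar>x - y\<bar>)"
    using r by (intro exI[of _ "ball x0 (r/2)"] conjI exI[of _ "r/2"] exI[of _ L]) auto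
next
  fix x \<delta> L \<delta>' L' :: real
  assume h: "\<forall>y. \<bar>x - y\<bar> \<le> \<delta> \<longrightarrow> inv (\<zeta> x) \<otimes> \<zeta> y \<in> U \<and> norm (\<phi> (inv (\<zeta> x) \<otimes> \<zeta> y) - \<phi> \<one>) \<le> L * \<bar>x - y\<bar>"
    and "0 < \<delta>'" "\<delta>' \<le> \<delta>" and L: "L \<le> L'"
  show "\<forall>y. \<bar>x - y\<bar> \<le> \<delta>' \<longrightarrow> inv (\<zeta> x) \<otimes> \<zeta> y \<in> U \<and> norm (\<phi> (inv (\<zeta> x) \<otimes> \<zeta> y) - \<phi> \<one>) \<le> L' * \<bar>x - y\<bar>"
  proof (intro allI impI)
    fix y assume "\<bar>x - y\<bar> \<le> \<delta>'"
    then have "\<bar>x - y\<bar> \<le> \<delta>" using \<open>\<delta>' \<le> \<delta>\<close> by linarith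
    then have "inv (\<zeta> x) \<otimes> \<zeta> y \<in> U \<and> norm (\<phi> (inv (\<zeta> x) \<otimes> \<zeta> y) - \<phi> \<one>) \<le> L * \<bar>x - y\<bar>" using h by blast
    then show "inv (\<zeta> x) \<otimes> \<zeta> y \<in> U \<and> norm (\<phi> (inv (\<zeta> x) \<otimes> \<zeta> y) - \<phi> \<one>) \<le> L' * \<bar>x - y\<bar>"
      using mult_right_mono[OF L, of "\<bar>x - y\<bar>"] by auto
  qed
qed

text \<open>Cutting the path into n pieces gives a factorisation of \<open>z\<close> into n factors
  of size of order 1/n. Its total squared size is of order 1/n, hence small enough for
  \<open>root_exists\<close> when n is large, and the equal factors of the minimiser inherit the
  bound of order 1/n.\<close>

lemma small_roots:
  assumes U: "(U, \<phi>) \<in> A" "\<one> \<in> U" and comp: "compact (carrier G)"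
    and \<zeta>: "smooth_into A UNIV (\<zeta> :: real \<Rightarrow> 'g)" and z: "inv (\<zeta> 0) \<otimes> \<zeta> 1 = z"
  shows "\<exists>C\<ge>0. \<exists>n0>0. \<forall>n\<ge>n0. \<exists>w\<in>U. w [^] (n::nat) = z \<and> norm (\<phi> w - \<phi> \<one>) \<le> C / real n"
proof -
  obtain \<delta> L where dl: "\<delta> > 0" "L > 0" "cball (\<phi> \<one>) \<delta> \<subseteq> \<phi> ` U" and b: "\<forall>g\<in>carrier G. \<forall>u\<in>cball (\<phi> \<one>) \<delta>.
    \<forall>v\<in>cball (\<phi> \<one>) \<delta>. \<forall>w\<in>cball (\<phi> \<one>) \<delta>. \<forall>K\<in>{\<lambda>v. g \<otimes> inv_into U \<phi> v \<otimes> inv g,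
       \<lambda>v. g \<otimes> (inv (inv_into U \<phi> v) \<otimes> inv_into U \<phi> u) \<otimes> inv g}.
     K v \<in> U \<and> norm (\<phi> (K v) - \<phi> (K w)) \<le> L * norm (v - w) \<and>
     norm (\<phi> (K (midpoint v w)) - midpoint (\<phi> (K v)) (\<phi> (K w))) \<le> L * (norm (v - w))\<^sup>2"
    using conj_family_bounds[OF U comp] by (elim exE conjE) (rule that; assumption)
  obtain r1 M where r1: "r1 > 0" "M > 0" and pr: "\<forall>u\<in>cball (\<phi> \<one>) r1. \<forall>v\<in>cball (\<phi> \<one>) r1.
    inv_into U \<phi> u \<otimes> inv_into U \<phi> v \<in> U \<and>
    norm (\<phi> (inv_into U \<phi> u \<otimes> inv_into U \<phi> v) - u - v + \<phi> \<one>) \<le> M * norm (u - \<phi> \<one>) * norm (v - \<phi> \<one>)"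
    using chart_product_bounds[OF U] by (elim exE conjE) (rule that; assumption)
  \<comment> \<open>For \<open>r \<le> 1\<close> the quantity
    \<open>2 * r * L + 4 * r\<^sup>2 * L\<^sup>2\<close> is at most \<open>r * Q\<close>, so both
    conditions in \<open>small\<close> become upper bounds on \<open>r\<close>.\<close>
  define Q where "Q = 2 * L + 4 * L\<^sup>2"
  have Q: "Q > 0" using dl(2) by (simp add: Q_def add_pos_pos)
  \<comment> \<open>The fourth entry makes \<open>8 * L\<^sup>2 * (r * Q)\<close> at most 1/2, the
    fifth makes \<open>r * Q\<close> at most 3/4, and the last makes \<open>(2 + M) * r\<close> at
    most \<open>\<delta>\<close>, which keeps products of two small elements in the ball.\<close>
  define r where "r = Min {\<delta>, r1, 1, 1 / (16 * L\<^sup>2 * Q), 3 / (4 * Q), \<delta> / (2 + M)}"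
  have r: "0 < r" "r \<le> \<delta>" "r \<le> r1" "r \<le> 1" "r \<le> 1 / (16 * L\<^sup>2 * Q)" "r \<le> 3 / (4 * Q)" "r \<le> \<delta> / (2 + M)"
    using dl r1 Q by (auto simp: r_def)
  have rQ: "2 * r * L + 4 * r\<^sup>2 * L\<^sup>2 \<le> r * Q"
  proof -
    have "r\<^sup>2 \<le> r" using r(1,4) by (simp add: power2_eq_square mult_left_le)
    then have "4 * r\<^sup>2 * L\<^sup>2 \<le> 4 * r * L\<^sup>2" by (intro mult_right_mono) auto
    then show ?thesis by (simp add: Q_def algebra_simps)
  qed
  interpret C: convex_chart G A U \<phi> \<delta> L r
  proof
    show "(U, \<phi>) \<in> A" "\<one> \<in> U" "compact (carrier G)" "0 < \<delta>" "0 < L" "0 < r" "r \<le> \<delta>" "cball (\<phi> \<one>) \<delta> \<subseteq> \<phi> ` U"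
      using U comp dl r by auto
    show "K v \<in> U \<and> norm (\<phi> (K v) - \<phi> (K w)) \<le> L * norm (v - w) \<and>
     norm (\<phi> (K (midpoint v w)) - midpoint (\<phi> (K v)) (\<phi> (K w))) \<le> L * (norm (v - w))\<^sup>2"
      if "g \<in> carrier G" "u \<in> cball (\<phi> \<one>) \<delta>" "v \<in> cball (\<phi> \<one>) \<delta>" "w \<in> cball (\<phi> \<one>) \<delta>"
       "K \<in> {\<lambda>v. g \<otimes> inv_into U \<phi> v \<otimes> inv g, \<lambda>v. g \<otimes> (inv (inv_into U \<phi> v) \<otimes> inv_into U \<phi> u) \<otimes> inv g}"
      for g u v w K
      by (rule bspec[OF bspec[OF bspec[OF bspec[OF bspec[OF b that(1)] that(2)] that(3)] that(4)] that(5)])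
    have "8 * L\<^sup>2 * (2 * r * L + 4 * r\<^sup>2 * L\<^sup>2) \<le> 8 * L\<^sup>2 * (r * Q)" using rQ by (intro mult_left_mono) auto
    also have "\<dots> = 8 * L\<^sup>2 * Q * r" by simp
    also have "\<dots> \<le> 8 * L\<^sup>2 * Q * (1 / (16 * L\<^sup>2 * Q))" using Q by (intro mult_left_mono r(5)) auto
    also have "\<dots> < 1" using Q dl(2) by simp
    finally show "8 * L\<^sup>2 * (2 * r * L + 4 * r\<^sup>2 * L\<^sup>2) < 1" .
    have "r * Q \<le> 3 / 4" using r(6) Q by (simp add: field_simps)
    then show "2 * r * L + 4 * r\<^sup>2 * L\<^sup>2 \<le> 3 / 4" using rQ by linarith
    show "a \<otimes> c \<in> U \<and> \<phi> (a \<otimes> c) \<in> cball (\<phi> \<one>) \<delta>"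
      if "a \<in> U" "c \<in> U" "\<phi> a \<in> cball (\<phi> \<one>) r" "\<phi> c \<in> cball (\<phi> \<one>) r" for a c
    proof -
      have m: "\<phi> a \<in> cball (\<phi> \<one>) r1" "\<phi> c \<in> cball (\<phi> \<one>) r1" using that(3,4) r(3) by auto
      have n: "norm (\<phi> a - \<phi> \<one>) \<le> r" "norm (\<phi> c - \<phi> \<one>) \<le> r"
        using that(3,4) by (auto simp: dist_norm norm_minus_commute)
      have e: "a \<otimes> c \<in> U" "norm (\<phi> (a \<otimes> c) - \<phi> a - \<phi> c + \<phi> \<one>) \<le> M * norm (\<phi> a - \<phi> \<one>) * norm (\<phi> c - \<phi> \<one>)"
        using pr[rule_format, OF m] chartD(7)[OF U(1) that(1)] chartD(7)[OF U(1) that(2)] by auto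
      have "M * norm (\<phi> a - \<phi> \<one>) * norm (\<phi> c - \<phi> \<one>) \<le> M * r * 1"
        using n r(1,4) r1(2) by (intro mult_mono) auto
      moreover have "norm (\<phi> (a \<otimes> c) - \<phi> \<one>) \<le> norm (\<phi> (a \<otimes> c) - \<phi> a - \<phi> c + \<phi> \<one>) + norm (\<phi> a - \<phi> \<one>) + norm (\<phi> c - \<phi> \<one>)"
        by norm
      ultimately have "norm (\<phi> (a \<otimes> c) - \<phi> \<one>) \<le> M * r + r + r" using e(2) n by linarith
      also have "\<dots> = (2 + M) * r" by (simp add: algebra_simps)
      also have "\<dots> \<le> \<delta>" using r(7) r1(2) by (simp add: field_simps)
      finally show ?thesis using e(1) by (simp add: dist_norm norm_minus_commute)
    qed
  qed
  obtain \<eta> L' where \<eta>: "\<eta> > 0" "L' > 0" and inc: "\<forall>x\<in>{0..1}. \<forall>y. \<bar>x - y\<bar> \<le> \<eta> \<longrightarrow>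
    inv (\<zeta> x) \<otimes> \<zeta> y \<in> U \<and> norm (\<phi> (inv (\<zeta> x) \<otimes> \<zeta> y) - \<phi> \<one>) \<le> L' * \<bar>x - y\<bar>"
    using chart_path_increments[OF U \<zeta>, of 0 1] by (elim exE conjE) (rule that; assumption)
  define Cc where "Cc = L * L'"
  have Cc: "Cc > 0" using dl \<eta> by (simp add: Cc_def)
  \<comment> \<open>In turn: steps shorter than \<open>\<eta>\<close>, coordinates of the increments
    within \<open>\<delta>\<close>, their sizes within \<open>r\<close>, and the total squared size
    within \<open>(r/2)\<^sup>2\<close>.\<close>
  obtain n0 :: nat where n0: "real n0 > 1 / \<eta>" "real n0 > L' / \<delta>" "real n0 > Cc / r" "real n0 > Cc\<^sup>2 / (r/2)\<^sup>2"
  proof -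
    obtain n0 :: nat where "real n0 > max (max (1/\<eta>) (L'/\<delta>)) (max (Cc/r) (Cc\<^sup>2 / (r/2)\<^sup>2))"
      using reals_Archimedean2 by blast
    then show ?thesis by (intro that[of n0]) auto
  qed
  have "1 / \<eta> > 0" using \<eta> by simp
  then have n0p: "n0 > 0" using n0(1) by (cases n0) auto
  have "\<exists>w\<in>U. w [^] n = z \<and> norm (\<phi> w - \<phi> \<one>) \<le> Cc / real n" if n: "n \<ge> n0" for n
  proof -
    have np: "n > 0" "real n > 0" "real n0 \<le> real n" using n n0p by auto
    have big: "1 / real n \<le> \<eta>" "L' / real n \<le> \<delta>" "Cc / real n \<le> r" "Cc\<^sup>2 / real n \<le> (r/2)\<^sup>2"
    proof -
      have g: "x / real n \<le> y" if "real n0 > x / y" "y > 0" for x y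
      proof -
        have "x < real n0 * y" using that by (simp add: field_simps)
        also have "\<dots> \<le> real n * y" using np(3) that(2) by simp
        finally show ?thesis using np(2) by (simp add: field_simps)
      qed
      show "1 / real n \<le> \<eta>" "L' / real n \<le> \<delta>" "Cc / real n \<le> r" "Cc\<^sup>2 / real n \<le> (r/2)\<^sup>2"
        using g[OF n0(1)] g[OF n0(2)] g[OF n0(3)] g[OF n0(4)] \<eta> dl r by auto
    qed
    define a0 where "a0 = (\<lambda>i. inv (\<zeta> (real i / real n)) \<otimes> \<zeta> (real (Suc i) / real n))"
    have zc: "\<zeta> x \<in> carrier G" for x using smooth_intoD[OF \<zeta>] by simp
    have "a0 i \<in> C.small_conj r \<and> C.conj_size (a0 i) \<le> Cc / real n" if i: "i < n" for i
    proof -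
      have x: "real i / real n \<in> {0..1}" using i by simp
      have d: "\<bar>real i / real n - real (Suc i) / real n\<bar> = 1 / real n"
        using np by (simp add: diff_divide_distrib[symmetric])
      then have "a0 i \<in> U \<and> norm (\<phi> (a0 i) - \<phi> \<one>) \<le> L' / real n"
        using inc[rule_format, OF x, of "real (Suc i) / real n"] big(1) by (simp add: a0_def)
      then show ?thesis
        using C.small_conj_of_chart[of "a0 i" "L' / real n"] big(2,3) by (simp add: Cc_def)
    qed
    moreover have "list_product a0 m = inv (\<zeta> 0) \<otimes> \<zeta> (real m / real n)" for m
    proof (induction m)
      case 0
      then show ?case using zc by simp
    next
      case (Suc m)
      have "list_product a0 (Suc m) = (inv (\<zeta> 0) \<otimes> \<zeta> (real m / real n)) \<otimes>
         (inv (\<zeta> (real m / real n)) \<otimes> \<zeta> (real (Suc m) / real n))" using Suc by (simp add: a0_def)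
      also have "\<dots> = inv (\<zeta> 0) \<otimes> ((\<zeta> (real m / real n) \<otimes> inv (\<zeta> (real m / real n))) \<otimes> \<zeta> (real (Suc m) / real n))"
        using zc by (simp only: m_assoc m_closed inv_closed)
      also have "\<dots> = inv (\<zeta> 0) \<otimes> \<zeta> (real (Suc m) / real n)" using zc by simp
      finally show ?case .
    qed
    then have "list_product a0 n = z" using z np by simp
    moreover have "real n * (Cc / real n)\<^sup>2 \<le> (r/2)\<^sup>2" "0 \<le> Cc / real n"
      using big(4) np Cc by (auto simp: power2_eq_square)
    ultimately obtain w where w: "w \<in> C.small_conj r" "w [^] n = z" "C.conj_size w \<le> Cc / real n"
      using C.root_exists[OF np(1), of a0 "Cc / real n" z] by blast
    then show ?thesis using C.small_conj_chart(1)[OF w(1)] C.norm_le_size[OF w(1)] by force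
  qed
  then show ?thesis using Cc n0p by (intro exI[of _ Cc] conjI exI[of _ n0]) auto
qed

end

section \<open>One-parameter subgroups\<close>

context lie_group
begin

text \<open>Near the identity the product is addition up to a bilinear error, so the coordinates of
  powers grow linearly. The smallness conditions on \<open>J\<close> keep all powers up to
  \<open>J\<close> inside the ball where the product estimate applies.\<close>

lemma chart_power_bounds:
  assumes U: "(U, \<phi>) \<in> A" "\<one> \<in> U"
    and M: "M > 0" "cball (\<phi> \<one>) r \<subseteq> \<phi> ` U"
      "\<And>u v. u \<in> cball (\<phi> \<one>) r \<Longrightarrow> v \<in> cball (\<phi> \<one>) r \<Longrightarrow> inv_into U \<phi> u \<otimes> inv_into U \<phi> v \<in> U \<and>
       norm (\<phi> (inv_into U \<phi> u \<otimes> inv_into U \<phi> v) - u - v + \<phi> \<one>) \<le> M * norm (u - \<phi> \<one>) * norm (v - \<phi> \<one>)"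
    and w: "w \<in> U" "norm (\<phi> w - \<phi> \<one>) = e" and J: "2 * real J * e \<le> r" "M * real J * e \<le> 1" "e \<le> r" and j: "j \<le> J"
  shows "w [^] j \<in> U \<and> norm (\<phi> (w [^] j) - \<phi> \<one>) \<le> r \<and>
    norm (\<phi> (w [^] j) - \<phi> \<one> - real j *\<^sub>R (\<phi> w - \<phi> \<one>)) \<le> M * (real j * e)\<^sup>2"
  using j
proof (induction j)
  case 0
  have "0 \<le> e" using w(2) by auto
  then show ?case using U(2) J(3) by simp
next
  case (Suc j)
  define d where "d = \<phi> w - \<phi> \<one>"
  define x where "x = \<phi> (w [^] j)"
  have e0: "0 \<le> e" using w(2) by auto
  have jJ: "j \<le> J" "real j \<le> real J" "real (Suc j) \<le> real J" using Suc.prems by auto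
  have IH: "w [^] j \<in> U" "norm (x - \<phi> \<one>) \<le> r" "norm (x - \<phi> \<one> - real j *\<^sub>R d) \<le> M * (real j * e)\<^sup>2"
    using Suc.IH[OF jJ(1)] by (auto simp: x_def d_def)
  have bnd: "norm (y - \<phi> \<one>) \<le> 2 * (real k * e)"
    if "norm (y - \<phi> \<one> - real k *\<^sub>R d) \<le> M * (real k * e)\<^sup>2" "real k \<le> real J" for y k
  proof -
    have t: "norm (y - \<phi> \<one>) \<le> norm (y - \<phi> \<one> - real k *\<^sub>R d) + norm (real k *\<^sub>R d)"
      using norm_triangle_ineq[of "y - \<phi> \<one> - real k *\<^sub>R d" "real k *\<^sub>R d"] by simp
    have nd: "norm (real k *\<^sub>R d) = real k * e" using w(2) by (simp add: d_def[symmetric])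
    have "M * real k * e \<le> M * real J * e" using M(1) e0 that(2) by (intro mult_right_mono mult_left_mono) auto
    then have "(M * real k * e) * (real k * e) \<le> 1 * (real k * e)"
      using J(2) e0 by (intro mult_right_mono) auto
    then have "M * (real k * e)\<^sup>2 \<le> real k * e" by (simp add: power2_eq_square mult_ac)
    then show ?thesis using t that(1) unfolding nd by linarith
  qed
  have xr: "x \<in> cball (\<phi> \<one>) r" "\<phi> w \<in> cball (\<phi> \<one>) r"
    using IH(2) w(2) J(3) by (auto simp: dist_norm norm_minus_commute)
  have \<iota>: "inv_into U \<phi> x = w [^] j" "inv_into U \<phi> (\<phi> w) = w"
    unfolding x_def by (rule chartD(7)[OF U(1) IH(1)], rule chartD(7)[OF U(1) w(1)])
  define y where "y = \<phi> (w [^] Suc j)"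
  have y: "w [^] Suc j \<in> U" "norm (y - x - \<phi> w + \<phi> \<one>) \<le> M * norm (x - \<phi> \<one>) * e"
    using M(3)[OF xr] w(2) by (auto simp: \<iota> y_def)
  have 1: "M * norm (x - \<phi> \<one>) * e \<le> M * (2 * (real j * e)) * e"
    using bnd[OF IH(3) jJ(2)] M(1) e0 by (intro mult_right_mono mult_left_mono) auto
  have 2: "y - \<phi> \<one> - real (Suc j) *\<^sub>R d = (y - x - \<phi> w + \<phi> \<one>) + (x - \<phi> \<one> - real j *\<^sub>R d)"
    by (simp add: d_def algebra_simps)
  have "norm (y - \<phi> \<one> - real (Suc j) *\<^sub>R d) \<le> norm (y - x - \<phi> w + \<phi> \<one>) + norm (x - \<phi> \<one> - real j *\<^sub>R d)"
    unfolding 2 by (rule norm_triangle_ineq)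
  also have "\<dots> \<le> M * (2 * (real j * e)) * e + M * (real j * e)\<^sup>2" using 1 y(2) IH(3) by linarith
  \<comment> \<open>The accumulated error closes up because the square of \<open>j + 1\<close> is at
    least the square of \<open>j\<close> plus \<open>2 * j\<close>.\<close>
  also have "\<dots> \<le> M * (real (Suc j) * e)\<^sup>2"
    using M(1) by (simp add: power2_eq_square algebra_simps)
  finally have est: "norm (y - \<phi> \<one> - real (Suc j) *\<^sub>R d) \<le> M * (real (Suc j) * e)\<^sup>2" .
  have "norm (y - \<phi> \<one>) \<le> 2 * (real (Suc j) * e)" by (rule bnd[OF est jJ(3)])
  also have "\<dots> \<le> 2 * (real J * e)" using jJ(3) e0 by (intro mult_left_mono mult_right_mono) auto
  finally have "norm (y - \<phi> \<one>) \<le> r" using J(1) by simp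
  then show ?case using y(1) est by (simp add: y_def d_def)
qed

text \<open>The powers \<open>w\<^sub>n\<^bsup>\<lfloor>n t\<rfloor>\<^esup>\<close>, together with the rescaled coordinates of \<open>w\<^sub>n\<close>, have a cluster point in the product
  topology; it is a one-parameter subgroup with a derivative at \<open>0\<close>.\<close>

lemma cluster_homomorphism:
  assumes U: "(U, \<phi>) \<in> A" "\<one> \<in> U" and comp: "compact (carrier G)"
    and roots: "\<forall>n\<ge>n0. \<exists>w\<in>U. w [^] (n::nat) = z \<and> norm (\<phi> w - \<phi> \<one>) \<le> C / real n" and C: "0 \<le> C" and n0: "n0 > 0"
  shows "\<exists>g X \<eta> M. (\<forall>t. g t \<in> carrier G) \<and> (\<forall>s t. g (s + t) = g s \<otimes> g t) \<and> g 1 = z \<and>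
    \<eta> > (0::real) \<and> (\<forall>t\<in>{0..\<eta>}. g t \<in> U \<and> norm (\<phi> (g t) - \<phi> \<one> - t *\<^sub>R X) \<le> M * t\<^sup>2)"
proof -
  define p where "p = \<phi> \<one>"
  obtain w where w: "\<And>n. n \<ge> n0 \<Longrightarrow> w n \<in> U \<and> w n [^] n = z \<and> norm (\<phi> (w n) - p) \<le> C / real n"
    using roots unfolding p_def by metis
  obtain r M where r: "r > 0" "M > 0" "cball p r \<subseteq> \<phi> ` U" and pr: "\<And>u v. u\<in>cball p r \<Longrightarrow> v\<in>cball p r \<Longrightarrow>
    inv_into U \<phi> u \<otimes> inv_into U \<phi> v \<in> U \<and>
    norm (\<phi> (inv_into U \<phi> u \<otimes> inv_into U \<phi> v) - u - v + p) \<le> M * norm (u - p) * norm (v - p)"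
    using chart_product_bounds[OF U] unfolding p_def by blast
  \<comment> \<open>The identity is a default value that puts the whole sequence into the compact
    space \<open>K\<close>; only large indices matter for the limit.\<close>
  define v where "v n = (if n \<ge> n0 then w n else \<one>)" for n
  have vc: "v n \<in> carrier G" for n using w[of n] chart_carrier[OF U(1)] by (auto simp: v_def)
  define f where "f n t = v n [^] \<lfloor>real n * t\<rfloor>" for n and t :: real
  define d where "d n = real n *\<^sub>R (\<phi> (v n) - p)" for n
  have dC: "norm (d n) \<le> C" for n
  proof (cases "n \<ge> n0")
    case True
    then have "n > 0" using n0 by simp
    then have "real n * norm (\<phi> (w n) - p) \<le> C" using w[OF True] by (simp add: field_simps)
    then show ?thesis using True by (simp add: d_def v_def)
  next
    case False
    then show ?thesis using C by (simp add: d_def v_def p_def)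
  qed
  define K where "K = Pi UNIV (\<lambda>t::real. carrier G) \<times> cball (0::'e) C"
  have K: "compact K" unfolding K_def
    by (intro compact_Times compact_cball compact_Pi_UNIV comp)
  \<comment> \<open>The product is indexed by all real times, so a cluster point is obtained from
    compactness by filters; a convergent subsequence need not exist in such a product. Joining the
    rescaled coordinates \<open>d n\<close> to the functions makes both converge along the same
    filter \<open>Q\<close>.\<close>
  define F where "F = filtermap (\<lambda>n. (f n, d n)) sequentially"
  have "F \<noteq> bot" by (simp add: F_def filtermap_bot_iff)
  moreover have "eventually (\<lambda>x. x \<in> K) F"
    unfolding F_def eventually_filtermap K_def
    using dC vc by (auto simp: f_def)
  ultimately have "\<exists>x\<in>K. inf (nhds x) F \<noteq> bot" using K[unfolded compact_filter] by blast
  then obtain g X where gX: "(g, X) \<in> K" "inf (nhds (g, X)) F \<noteq> bot" by auto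
  define Q where "Q = inf (nhds (g, X)) F"
  have Qb: "Q \<noteq> bot" using gX(2) by (simp add: Q_def)
  have QF: "Q \<le> F" and Qn: "Q \<le> nhds (g, X)" by (simp_all add: Q_def)
  have gc: "g t \<in> carrier G" for t using gX(1) by (auto simp: K_def)
  have ev: "eventually P Q" if "\<forall>\<^sub>F n in sequentially. P (f n, d n)" for P
    using that QF by (auto simp: F_def eventually_filtermap intro: filter_leD)
  have ht: "((\<lambda>x. fst x t) \<longlongrightarrow> g t) Q" for t
  proof -
    have "((\<lambda>x. x) \<longlongrightarrow> (g, X)) Q"
      using Qn by (simp add: filterlim_def)
    from tendsto_fst[OF this] have "(fst \<longlongrightarrow> g) Q" by simp
    from continuous_on_tendsto_compose[OF continuous_on_product_coordinates this] show ?thesis by simp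
  qed
  have hX: "(snd \<longlongrightarrow> X) Q"
    using tendsto_snd[of "\<lambda>x. x" "(g, X)" Q] Qn by (simp add: filterlim_def)
  have hc: "\<forall>\<^sub>F x in Q. fst x t \<in> carrier G" for t
    by (rule ev) (use vc in \<open>simp add: f_def\<close>)
  have v1: "v \<longlonglongrightarrow> \<one>"
  proof -
    have "(\<lambda>n. \<phi> (v n) - p) \<longlonglongrightarrow> 0"
    proof (rule tendsto_0_le[where K = C])
      show "(\<lambda>n. inverse (real n)) \<longlonglongrightarrow> 0" by (rule lim_inverse_n)
      show "\<forall>\<^sub>F n in sequentially. norm (\<phi> (v n) - p) \<le> norm (inverse (real n)) * C"
        using eventually_ge_at_top[of n0]
        by eventually_elim (use w in \<open>simp add: v_def divide_inverse mult.commute\<close>)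
    qed
    from LIM_zero_cancel[OF this] have l: "(\<lambda>n. \<phi> (v n)) \<longlonglongrightarrow> \<phi> \<one>" unfolding p_def .
    have vU: "v n \<in> U" for n using w[of n] U(2) by (auto simp: v_def)
    have "(\<lambda>n. inv_into U \<phi> (\<phi> (v n))) \<longlonglongrightarrow> inv_into U \<phi> (\<phi> \<one>)"
      by (rule continuous_on_tendsto_compose[OF chartD(5)[OF U(1)] l]) (use vU U(2) in auto)
    then show ?thesis using chartD(7)[OF U(1) vU] chartD(7)[OF U] by simp
  qed
  have hom: "g (s + t) = g s \<otimes> g t" for s t
  proof -
    \<comment> \<open>The integer part of \<open>n * (s + t)\<close> exceeds the sum of the integer
      parts of \<open>n * s\<close> and \<open>n * t\<close> by 0 or 1. On the approximants this
      defect is the identity or the root itself, and the roots tend to the identity.\<close>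
    let ?q = "\<lambda>h. inv (h s \<otimes> h t) \<otimes> h (s + t)"
    have "((\<lambda>x. ?q (fst x)) \<longlongrightarrow> ?q g) Q"
    proof (intro tendsto_mult tendsto_inverse ht gc hc m_closed inv_closed)
      show "\<forall>\<^sub>F x in Q. fst x s \<otimes> fst x t \<in> carrier G"
        using hc[of s] hc[of t] by eventually_elim simp
      then show "\<forall>\<^sub>F x in Q. inv (fst x s \<otimes> fst x t) \<in> carrier G" by eventually_elim simp
    qed
    moreover have "((\<lambda>x. ?q (fst x)) \<longlongrightarrow> \<one>) Q"
    proof (rule topological_tendstoI)
      fix S :: "'g set" assume S: "open S" "\<one> \<in> S"
      show "\<forall>\<^sub>F x in Q. ?q (fst x) \<in> S"
      proof (rule ev)
        have "\<forall>\<^sub>F n in sequentially. v n \<in> S" using v1 S by (rule topological_tendstoD)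
        then show "\<forall>\<^sub>F n in sequentially. ?q (fst (f n, d n)) \<in> S"
        proof eventually_elim
          case (elim n)
          define a where "a = \<lfloor>real n * s\<rfloor>"
          define b where "b = \<lfloor>real n * t\<rfloor>"
          have c: "\<lfloor>real n * (s + t)\<rfloor> = a + b \<or> \<lfloor>real n * (s + t)\<rfloor> = a + b + 1"
            unfolding a_def b_def by (simp add: distrib_left) linarith
          have m: "f n s \<otimes> f n t = v n [^] (a + b)"
            unfolding f_def a_def b_def by (rule int_pow_mult[OF vc, symmetric])
          have "?q (f n) = v n [^] (- (a + b)) \<otimes> v n [^] \<lfloor>real n * (s + t)\<rfloor>"
            unfolding m int_pow_neg[OF vc] unfolding f_def by (rule refl)
          then have "?q (f n) = v n [^] (- (a + b) + \<lfloor>real n * (s + t)\<rfloor>)"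
            unfolding int_pow_mult[OF vc, of n "- (a + b)"] .
          then have "?q (f n) = \<one> \<or> ?q (f n) = v n"
            using c vc[of n] by auto
          then show ?case using elim S(2) by auto
        qed
      qed
    qed
    ultimately have q: "?q g = \<one>" by (rule tendsto_unique[OF Qb])
    have c: "g s \<otimes> g t \<in> carrier G" using gc by simp
    have "g (s + t) = ((g s \<otimes> g t) \<otimes> inv (g s \<otimes> g t)) \<otimes> g (s + t)"
      unfolding r_inv[OF c] by (rule l_one[OF gc, symmetric])
    also have "\<dots> = (g s \<otimes> g t) \<otimes> ?q g" by (rule m_assoc[OF c inv_closed[OF c] gc])
    also have "\<dots> = g s \<otimes> g t" unfolding q by (rule r_one[OF c])
    finally show ?thesis .
  qed
  have g1: "g 1 = z"
  proof -
    have "\<forall>\<^sub>F x in Q. fst x 1 = z"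
    proof (rule ev)
      show "\<forall>\<^sub>F n in sequentially. fst (f n, d n) 1 = z"
        using eventually_ge_at_top[of n0]
        by eventually_elim (use w in \<open>simp add: f_def v_def int_pow_int\<close>)
    qed
    from tendsto_cong[OF this, of "g 1"] ht[of 1] have "((\<lambda>x. z) \<longlongrightarrow> g 1) Q" by simp
    then show ?thesis using tendsto_unique[OF Qb _ tendsto_const[of z Q]] by blast
  qed
  \<comment> \<open>At times up to \<open>\<eta>\<close> the exponent \<open>j\<close> is at most
    \<open>n * \<eta>\<close> and the root has size at most \<open>C / n\<close>. The choice makes
    \<open>2 * \<eta> * C \<le> r\<close> and \<open>M * \<eta> * C \<le> 1\<close>, the first two
    smallness conditions of \<open>chart_power_bounds\<close>.\<close>
  define \<eta> where "\<eta> = min (r / (2 * C + 1)) (1 / (M * C + 1))"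
  have \<eta>: "\<eta> > 0" "2 * \<eta> * C \<le> r" "M * \<eta> * C \<le> 1"
  proof -
    have a: "2 * C + 1 > 0" "M * C + 1 > 0" using C r by (auto intro: add_nonneg_pos)
    show "\<eta> > 0" using a r by (simp add: \<eta>_def)
    have "\<eta> * (2 * C) \<le> r / (2 * C + 1) * (2 * C)" using C by (intro mult_right_mono) (auto simp: \<eta>_def)
    also have "\<dots> \<le> r" using a r C by (simp add: field_simps)
    finally show "2 * \<eta> * C \<le> r" by (simp add: mult.commute mult.left_commute)
    have "\<eta> * (M * C) \<le> 1 / (M * C + 1) * (M * C)" using C r by (intro mult_right_mono) (auto simp: \<eta>_def)
    also have "\<dots> \<le> 1" using a by (simp add: field_simps)
    finally show "M * \<eta> * C \<le> 1" by (simp add: mult.commute mult.left_commute)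
  qed
  \<comment> \<open>A closed set contained in the chart domain: it prevents the limit
    \<open>g t\<close> from leaving the chart.\<close>
  define B where "B = inv_into U \<phi> ` cball p r"
  have Bc: "closed B" unfolding B_def
    by (intro compact_imp_closed compact_continuous_image[OF continuous_on_subset[OF chartD(5)[OF U(1)] r(3)] compact_cball])
  have B: "x \<in> U \<and> \<phi> x \<in> cball p r" if xB: "x \<in> B" for x
  proof -
    obtain a where a: "a \<in> cball p r" "x = inv_into U \<phi> a" using xB unfolding B_def by blast
    then have "a \<in> \<phi> ` U" using r(3) by blast
    then show ?thesis unfolding a(2) using a(1) chartD(8,9)[OF U(1)] by simp
  qed
  have near: "g t \<in> U \<and> norm (\<phi> (g t) - p - t *\<^sub>R X) \<le> M * C\<^sup>2 * t\<^sup>2" if t: "t \<in> {0..\<eta>}" for t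
  proof -
    have fin: "f n t \<in> B \<and> norm (\<phi> (f n t) - p - t *\<^sub>R d n) \<le> M * C\<^sup>2 * t\<^sup>2 + C / real n"
      if n: "n \<ge> n0" "C / real n \<le> r" for n
    proof -
      have np: "real n > 0" using n n0 by simp
      define j where "j = nat \<lfloor>real n * t\<rfloor>"
      have jt: "\<lfloor>real n * t\<rfloor> = int j" using t np by (simp add: j_def)
      have jl: "real j \<le> real n * t" "real n * t < real j + 1"
        using floor_correct[of "real n * t"] unfolding jt by auto
      define e where "e = norm (\<phi> (v n) - p)"
      have e: "0 \<le> e" "e \<le> C / real n" using w[OF n(1)] n(1) by (auto simp: e_def v_def)
      have je: "real j * e \<le> t * C"
      proof -
        have "real j * e \<le> (real n * t) * (C / real n)" using jl e t np by (intro mult_mono) auto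
        then show ?thesis using np by simp
      qed
      have tc: "t * C \<le> \<eta> * C" using t C by (intro mult_right_mono) auto
      have vU: "v n \<in> U" using w[OF n(1)] n(1) by (simp add: v_def)
      have J: "2 * real j * e \<le> r" "M * real j * e \<le> 1" "e \<le> r"
      proof -
        show "2 * real j * e \<le> r" using je tc \<eta>(2) by linarith
        have "M * (real j * e) \<le> M * (\<eta> * C)" using je tc r by (intro mult_left_mono) auto
        then show "M * real j * e \<le> 1" using \<eta>(3) by (simp add: mult.assoc)
        show "e \<le> r" using e n(2) by linarith
      qed
      have pw: "v n [^] j \<in> U \<and> norm (\<phi> (v n [^] j) - p) \<le> r \<and>
          norm (\<phi> (v n [^] j) - p - real j *\<^sub>R (\<phi> (v n) - p)) \<le> M * (real j * e)\<^sup>2"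
        unfolding p_def
        by (rule chart_power_bounds[OF U r(2) r(3)[unfolded p_def] pr[unfolded p_def] vU e_def[unfolded p_def, symmetric] J order_refl])
      have fj: "f n t = v n [^] j" unfolding f_def jt by (simp add: int_pow_int)
      have inB: "f n t \<in> B"
        unfolding B_def fj
        by (rule image_eqI[of _ _ "\<phi> (v n [^] j)"]) (use pw chartD(7)[OF U(1)] in \<open>auto simp: dist_norm norm_minus_commute\<close>)
      have "norm (real j *\<^sub>R (\<phi> (v n) - p) - t *\<^sub>R d n) = \<bar>real j - t * real n\<bar> * e"
        unfolding d_def e_def by (simp add: scaleR_diff_left[symmetric] scaleR_left_diff_distrib[symmetric])
      also have "\<dots> \<le> 1 * (C / real n)" using jl e by (intro mult_mono) (auto simp: algebra_simps)
      finally have "norm (real j *\<^sub>R (\<phi> (v n) - p) - t *\<^sub>R d n) \<le> C / real n" by simp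
      moreover have "M * (real j * e)\<^sup>2 \<le> M * (t * C)\<^sup>2"
        using je e r by (intro mult_left_mono power_mono) auto
      moreover have "norm (\<phi> (f n t) - p - t *\<^sub>R d n) \<le> norm (\<phi> (f n t) - p - real j *\<^sub>R (\<phi> (v n) - p))
         + norm (real j *\<^sub>R (\<phi> (v n) - p) - t *\<^sub>R d n)"
        using norm_triangle_ineq[of "\<phi> (f n t) - p - real j *\<^sub>R (\<phi> (v n) - p)"
            "real j *\<^sub>R (\<phi> (v n) - p) - t *\<^sub>R d n"] by simp
      moreover have "M * (t * C)\<^sup>2 = M * C\<^sup>2 * t\<^sup>2" by (simp add: power_mult_distrib)
      moreover have "norm (\<phi> (f n t) - p - real j *\<^sub>R (\<phi> (v n) - p)) \<le> M * (real j * e)\<^sup>2"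
        using pw unfolding fj by blast
      ultimately have "norm (\<phi> (f n t) - p - t *\<^sub>R d n) \<le> M * C\<^sup>2 * t\<^sup>2 + C / real n"
        by linarith
      then show ?thesis using inB by blast
    qed
    have CN: "(\<lambda>n. C / real n) \<longlonglongrightarrow> 0" by (rule lim_const_over_n)
    have evr: "\<forall>\<^sub>F n in sequentially. n \<ge> n0 \<and> C / real n < \<epsilon>" if "\<epsilon> > 0" for \<epsilon>
      using eventually_conj[OF eventually_ge_at_top[of n0] order_tendstoD(2)[OF CN that]] .
    have inB: "\<forall>\<^sub>F x in Q. fst x t \<in> B"
      by (rule ev) (use evr[OF r(1)] fin in \<open>auto elim!: eventually_mono\<close>)
    have gB: "g t \<in> B" by (rule Lim_in_closed_set[OF Bc inB Qb ht])
    have "((\<lambda>x. \<phi> (fst x t)) \<longlongrightarrow> \<phi> (g t)) Q"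
      by (rule continuous_on_tendsto_compose[OF chartD(4)[OF U(1)] ht])
        (use gB B inB in \<open>auto elim!: eventually_mono\<close>)
    then have lim: "((\<lambda>x. norm (\<phi> (fst x t) - p - t *\<^sub>R snd x)) \<longlongrightarrow> norm (\<phi> (g t) - p - t *\<^sub>R X)) Q"
      using hX by (intro tendsto_intros)
    have "norm (\<phi> (g t) - p - t *\<^sub>R X) \<le> M * C\<^sup>2 * t\<^sup>2 + \<epsilon>" if \<epsilon>: "\<epsilon> > 0" for \<epsilon>
    proof (rule tendsto_upperbound[OF lim _ Qb])
      show "\<forall>\<^sub>F x in Q. norm (\<phi> (fst x t) - p - t *\<^sub>R snd x) \<le> M * C\<^sup>2 * t\<^sup>2 + \<epsilon>"
      proof (rule ev)
        show "\<forall>\<^sub>F n in sequentially. norm (\<phi> (fst (f n, d n) t) - p - t *\<^sub>R snd (f n, d n)) \<le> M * C\<^sup>2 * t\<^sup>2 + \<epsilon>"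
          using evr[OF \<epsilon>] evr[OF r(1)] by eventually_elim (use fin in force)
      qed
    qed
    then have "norm (\<phi> (g t) - p - t *\<^sub>R X) \<le> M * C\<^sup>2 * t\<^sup>2" by (rule field_le_epsilon)
    then show ?thesis using gB B by blast
  qed
  show ?thesis unfolding p_def[symmetric]
    by (intro exI[of _ g] exI[of _ X] exI[of _ \<eta>] exI[of _ "M * C\<^sup>2"])
      (use gc hom g1 \<eta>(1) near in blast)
qed

text \<open>At negative times \<open>g\<close> is the inverse of its value at the opposite time.
  Applying the product estimate to an element and its inverse, whose product has coordinate
  \<open>\<phi> \<one>\<close>, shows that their displacements are opposite up to second
  order.\<close>

lemma homomorphism_two_sided:
  assumes U: "(U, \<phi>) \<in> A" "\<one> \<in> U"
    and g: "\<And>t. g t \<in> carrier G" "\<And>s t. g (s + t) = g s \<otimes> g t"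
    and \<eta>: "\<eta> > (0::real)" and d: "\<And>t. t \<in> {0..\<eta>} \<Longrightarrow> g t \<in> U \<and> norm (\<phi> (g t) - \<phi> \<one> - t *\<^sub>R X) \<le> M * t\<^sup>2"
  shows "\<exists>\<eta>>0. \<exists>M. \<forall>t. \<bar>t\<bar> \<le> \<eta> \<longrightarrow> g t \<in> U \<and> norm (\<phi> (g t) - \<phi> \<one> - t *\<^sub>R X) \<le> M * t\<^sup>2"
proof -
  define p where "p = \<phi> \<one>"
  define \<iota> where "\<iota> = inv_into U \<phi>"
  have g0: "g 0 = \<one>"
  proof -
    have "g 0 \<otimes> g 0 = g 0" using g(2)[of 0 0] by simp
    then show ?thesis using g(1)[of 0] by simp
  qed
  have gneg: "g (- t) = inv (g t)" for t
  proof -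
    have "g (- t) \<otimes> g t = \<one>" using g(2)[of "- t" t] g0 by simp
    then show ?thesis using g(1) by (intro inv_equality[symmetric])
  qed
  obtain r K where r: "r > 0" "K > 0" "cball p r \<subseteq> \<phi> ` U" and pr: "\<forall>u\<in>cball p r. \<forall>v\<in>cball p r.
    \<iota> u \<otimes> \<iota> v \<in> U \<and> norm (\<phi> (\<iota> u \<otimes> \<iota> v) - u - v + p) \<le> K * norm (u - p) * norm (v - p)"
    using chart_product_bounds[OF U, folded p_def, folded \<iota>_def] by (elim exE conjE) (rule that; assumption)
  have sm\<iota>: "smooth_into A (\<phi> ` U) \<iota>" unfolding \<iota>_def by (rule smooth_into_chart_inverse[OF U(1)])
  \<comment> \<open>A real parameter on which nothing depends brings inversion into the form of a
    parametrised family, so that \<open>chart_family_bounds\<close> yields its Lipschitz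
    constant.\<close>
  have o: "open (UNIV \<times> \<phi> ` U)" by (intro open_Times open_UNIV chartD(2)[OF U(1)])
  have I: "smooth_into A ((UNIV :: real set) \<times> \<phi> ` U) (\<lambda>x. inv (\<iota> (snd x)))"
    by (intro smooth_into_inv smooth_into_compose[OF sm\<iota> o] smooth_on_snd smooth_on_id o) auto
  have \<iota>p: "\<iota> p = \<one>" using chartD(7)[OF U] by (simp add: \<iota>_def p_def)
  have "p \<in> \<phi> ` U" using U(2) by (simp add: p_def)
  then have 0: "((0::real), p) \<in> UNIV \<times> \<phi> ` U" "inv (\<iota> (snd (0::real, p))) \<in> U" using U(2) by (simp_all add: \<iota>p)
  obtain \<rho> L where \<rho>: "\<rho> > 0" "L > 0" and lip: "\<forall>s\<in>cball (0::real) \<rho>. \<forall>v\<in>cball p \<rho>. (s, v) \<in> UNIV \<times> \<phi> ` U \<and>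
    inv (\<iota> (snd (s, v))) \<in> U \<and>
    (\<forall>w\<in>cball p \<rho>. norm (\<phi> (inv (\<iota> (snd (s, v)))) - \<phi> (inv (\<iota> (snd (s, w))))) \<le> L * norm (v - w) \<and>
      norm (\<phi> (inv (\<iota> (snd (s, midpoint v w)))) - midpoint (\<phi> (inv (\<iota> (snd (s, v))))) (\<phi> (inv (\<iota> (snd (s, w))))))
      \<le> L * (norm (v - w))\<^sup>2)"
    using chart_family_bounds[OF U(1) I 0] by (elim exE conjE) (rule that; assumption)
  have inv_bd: "inv (\<iota> v) \<in> U \<and> norm (\<phi> (inv (\<iota> v)) - p) \<le> L * norm (v - p)" if v: "v \<in> cball p \<rho>" for v
  proof -
    have z: "(0::real) \<in> cball 0 \<rho>" and pp: "p \<in> cball p \<rho>" using \<rho> by auto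
    have "(0, v) \<in> UNIV \<times> \<phi> ` U \<and> inv (\<iota> (snd (0::real, v))) \<in> U" using lip[rule_format, OF z v] by simp
    moreover have "norm (\<phi> (inv (\<iota> (snd (0::real, v)))) - \<phi> (inv (\<iota> (snd (0::real, p))))) \<le> L * norm (v - p)"
      using bspec[OF conjunct2[OF conjunct2[OF lip[rule_format, OF z v]]] pp] by blast
    ultimately show ?thesis using \<iota>p by (simp add: p_def)
  qed
  define B where "B = norm X + \<bar>M\<bar>"
  have B0: "0 \<le> B" by (simp add: B_def)
  define \<eta>' where "\<eta>' = Min {\<eta>, 1, \<rho> / (B + 1), r / (B + 1), r / (L * (B + 1))}"
  have B1: "0 < B + 1" using B0 by linarith
  have \<eta>': "\<eta>' > 0" "\<eta>' \<le> \<eta>" "\<eta>' \<le> 1" "\<eta>' \<le> \<rho> / (B + 1)" "\<eta>' \<le> r / (B + 1)" "\<eta>' \<le> r / (L * (B + 1))"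
    using \<eta> \<rho> r B1 by (auto simp: \<eta>'_def)
  have b: "B * \<eta>' \<le> \<rho>" "B * \<eta>' \<le> r" "L * (B * \<eta>') \<le> r"
  proof -
    have "(B + 1) * \<eta>' \<le> \<rho>" "(B + 1) * \<eta>' \<le> r" "(L * (B + 1)) * \<eta>' \<le> r"
      using \<eta>'(4-6) B1 \<rho>(2) by (simp_all add: pos_le_divide_eq mult.commute)
    moreover have "B * \<eta>' \<le> (B + 1) * \<eta>'" "L * (B * \<eta>') \<le> (L * (B + 1)) * \<eta>'"
      using \<eta>'(1) \<rho>(2) by (auto simp: algebra_simps)
    ultimately show "B * \<eta>' \<le> \<rho>" "B * \<eta>' \<le> r" "L * (B * \<eta>') \<le> r" by linarith+
  qed
  define M' where "M' = \<bar>M\<bar> + K * L * B\<^sup>2"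
  have pos: "g t \<in> U \<and> norm (\<phi> (g t) - p - t *\<^sub>R X) \<le> \<bar>M\<bar> * t\<^sup>2 \<and> norm (\<phi> (g t) - p) \<le> B * t" if t: "t \<in> {0..\<eta>'}" for t
  proof -
    have t': "t \<in> {0..\<eta>}" "0 \<le> t" "t \<le> 1" using t \<eta>' by auto
    have 1: "norm (\<phi> (g t) - p - t *\<^sub>R X) \<le> \<bar>M\<bar> * t\<^sup>2"
    proof -
      have "norm (\<phi> (g t) - p - t *\<^sub>R X) \<le> M * t\<^sup>2" using d[OF t'(1)] by (simp add: p_def)
      also have "\<dots> \<le> \<bar>M\<bar> * t\<^sup>2" by (intro mult_right_mono) auto
      finally show ?thesis .
    qed
    have "norm (\<phi> (g t) - p) \<le> norm (\<phi> (g t) - p - t *\<^sub>R X) + norm (t *\<^sub>R X)"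
      using norm_triangle_ineq[of "\<phi> (g t) - p - t *\<^sub>R X" "t *\<^sub>R X"] by simp
    moreover have "\<bar>M\<bar> * t\<^sup>2 \<le> \<bar>M\<bar> * t" using t' by (intro mult_left_mono) (auto simp: power2_eq_square mult_left_le)
    ultimately have "norm (\<phi> (g t) - p) \<le> B * t" using 1 t'(2) by (simp add: B_def algebra_simps)
    then show ?thesis using 1 d[OF t'(1)] by blast
  qed
  have main: "g t \<in> U \<and> norm (\<phi> (g t) - p - t *\<^sub>R X) \<le> M' * t\<^sup>2" if t: "\<bar>t\<bar> \<le> \<eta>'" for t
  proof (cases "0 \<le> t")
    case True
    have "\<bar>M\<bar> * t\<^sup>2 \<le> M' * t\<^sup>2" unfolding M'_def using r \<rho> by (intro mult_right_mono) auto
    then show ?thesis using pos[of t] t True by auto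
  next
    case False
    define s where "s = - t"
    have s: "s \<in> {0..\<eta>'}" "0 \<le> s" "s \<le> \<eta>'" using False t by (auto simp: s_def)
    note ps = pos[OF s(1)]
    have Bs: "B * s \<le> B * \<eta>'" using s B0 by (intro mult_left_mono) auto
    have u1: "\<phi> (g s) \<in> cball p \<rho>" "\<phi> (g s) \<in> cball p r"
      using ps Bs b by (auto simp: dist_norm norm_minus_commute)
    have \<iota>g: "\<iota> (\<phi> (g s)) = g s" unfolding \<iota>_def using ps chartD(7)[OF U(1)] by blast
    have iv: "inv (g s) \<in> U" "norm (\<phi> (inv (g s)) - p) \<le> L * norm (\<phi> (g s) - p)"
      using inv_bd[OF u1(1)] unfolding \<iota>g by auto
    have ivB: "norm (\<phi> (inv (g s)) - p) \<le> L * (B * s)"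
      using iv(2) ps \<rho>(2) mult_left_mono[of "norm (\<phi> (g s) - p)" "B * s" L] by linarith
    have "L * (B * s) \<le> L * (B * \<eta>')" using mult_left_mono[OF Bs, of L] \<rho>(2) by linarith
    then have u2: "\<phi> (inv (g s)) \<in> cball p r" using ivB b(3) by (simp add: dist_norm norm_minus_commute)
    have \<iota>i: "\<iota> (\<phi> (inv (g s))) = inv (g s)" unfolding \<iota>_def by (rule chartD(7)[OF U(1) iv(1)])
    have "norm (\<phi> (g s \<otimes> inv (g s)) - \<phi> (g s) - \<phi> (inv (g s)) + p) \<le> K * norm (\<phi> (g s) - p) * norm (\<phi> (inv (g s)) - p)"
      using pr[rule_format, OF u1(2) u2] unfolding \<iota>g \<iota>i by blast
    also have "\<dots> \<le> K * (B * s) * (L * (B * s))"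
      using ps ivB r(2) B0 s(2) by (intro mult_mono) auto
    also have "\<dots> = K * L * B\<^sup>2 * s\<^sup>2" by (simp add: power2_eq_square)
    finally have e: "norm (p - \<phi> (g s) - \<phi> (inv (g s)) + p) \<le> K * L * B\<^sup>2 * s\<^sup>2"
      using g(1)[of s] by (simp add: p_def)
    have "\<phi> (inv (g s)) - p + s *\<^sub>R X = - (p - \<phi> (g s) - \<phi> (inv (g s)) + p) - (\<phi> (g s) - p - s *\<^sub>R X)"
      by (simp add: algebra_simps)
    then have "norm (\<phi> (inv (g s)) - p + s *\<^sub>R X) \<le> K * L * B\<^sup>2 * s\<^sup>2 + \<bar>M\<bar> * s\<^sup>2"
      using e ps norm_triangle_ineq4[of "- (p - \<phi> (g s) - \<phi> (inv (g s)) + p)" "\<phi> (g s) - p - s *\<^sub>R X"]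
      by (simp only: norm_minus_cancel) linarith
    moreover have "g t = inv (g s)" using gneg[of s] by (simp add: s_def)
    ultimately show ?thesis using iv(1) by (simp add: s_def M'_def algebra_simps)
  qed
  show ?thesis unfolding p_def[symmetric] using \<eta>'(1) main by blast
qed

text \<open>Differentiability at 0 and the homomorphism property give an ordinary differential
  equation for the coordinates \<open>u\<close>, with a smooth right-hand side \<open>V\<close>.
  Each order of differentiability of \<open>u\<close> then passes to \<open>V\<close> composed with
  \<open>u\<close>, that is, to the derivative of \<open>u\<close>.\<close>

lemma homomorphism_smooth:
  assumes U: "(U, \<phi>) \<in> A" "\<one> \<in> U"
    and g: "\<And>t. g t \<in> carrier G" "\<And>s t. g (s + t) = g s \<otimes> g t"
    and \<eta>: "\<eta> > (0::real)" and d: "\<And>t. \<bar>t\<bar> \<le> \<eta> \<Longrightarrow> g t \<in> U \<and> norm (\<phi> (g t) - \<phi> \<one> - t *\<^sub>R X) \<le> M * t\<^sup>2"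
  shows "smooth_into A UNIV g"
proof -
  define p where "p = \<phi> \<one>"
  define \<iota> where "\<iota> = inv_into U \<phi>"
  define f where "f = (\<lambda>x. \<phi> (\<iota> (fst x) \<otimes> \<iota> (snd x)))"
  let ?K = "\<lambda>x. \<iota> (fst x) \<otimes> \<iota> (snd x)"
  define S where "S = (\<phi> ` U \<times> \<phi> ` U) \<inter> ?K -` U"
  have sm\<iota>: "smooth_into A (\<phi> ` U) \<iota>" unfolding \<iota>_def by (rule smooth_into_chart_inverse[OF U(1)])
  have o: "open (\<phi> ` U \<times> \<phi> ` U)" by (intro open_Times chartD(2)[OF U(1)])
  have K: "smooth_into A (\<phi> ` U \<times> \<phi> ` U) ?K"
    by (intro smooth_into_mult smooth_into_compose[OF sm\<iota> o] smooth_on_fst smooth_on_snd smooth_on_id o) auto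
  have \<iota>p: "\<iota> p = \<one>" using chartD(7)[OF U] by (simp add: \<iota>_def p_def)
  have So: "open S" unfolding S_def by (rule smooth_into_open_vimage_chart[OF K U(1)])
  have Sf: "smooth_on S f" unfolding S_def f_def by (rule smooth_into_chart[OF K U(1)])
  define I where "I = ball (0::real) \<eta>"
  define u where "u = (\<lambda>t. \<phi> (g t))"
  have g0: "g 0 = \<one>"
  proof -
    have "g 0 \<otimes> g 0 = g 0" using g(2)[of 0 0] by simp
    then show ?thesis using g(1)[of 0] by simp
  qed
  have gI: "g t \<in> U" if "t \<in> I" for t using d[of t] that by (auto simp: I_def)
  have u0: "u 0 = p" by (simp add: u_def g0 p_def)
  have \<iota>u: "\<iota> (u t) = g t" if "t \<in> I" for t
    unfolding \<iota>_def u_def by (rule chartD(7)[OF U(1) gI[OF that]])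
  have pU: "p \<in> \<phi> ` U" using U(2) by (simp add: p_def)
  have uS: "(u t, p) \<in> S" if "t \<in> I" for t
  proof -
    have "u t \<in> \<phi> ` U" using gI[OF that] by (simp add: u_def)
    moreover have "\<iota> (u t) \<otimes> \<iota> p \<in> U" unfolding \<iota>p \<iota>u[OF that] using gI[OF that] g(1) by simp
    ultimately show ?thesis unfolding S_def using pU by simp
  qed
  have M0: "0 \<le> M"
  proof -
    have "norm (\<phi> (g \<eta>) - \<phi> \<one> - \<eta> *\<^sub>R X) \<le> M * \<eta>\<^sup>2" using d[of \<eta>] \<eta> by simp
    then have "0 \<le> M * \<eta>\<^sup>2" using norm_ge_zero[of "\<phi> (g \<eta>) - \<phi> \<one> - \<eta> *\<^sub>R X"] by linarith
    then show ?thesis using \<eta> by (simp add: zero_le_mult_iff)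
  qed
  have du0: "(u has_derivative (\<lambda>h. h *\<^sub>R X)) (at 0)"
  proof (rule has_derivativeI_sandwich[of \<eta>, where H = "\<lambda>y. M * \<bar>y\<bar>"])
    show "0 < \<eta>" by (rule \<eta>)
    show "bounded_linear (\<lambda>h. h *\<^sub>R X)" by (rule bounded_linear_scaleR_left)
    show "((\<lambda>y. M * \<bar>y\<bar>) \<longlongrightarrow> 0) (at 0)"
      by (rule tendsto_eq_intros refl | simp)+
    fix y :: real assume y: "y \<noteq> 0" "dist y 0 < \<eta>"
    have "norm (u y - p - y *\<^sub>R X) \<le> M * y\<^sup>2" using d[of y] y by (simp add: u_def p_def)
    then have "norm (u y - p - y *\<^sub>R X) \<le> (M * \<bar>y\<bar>) * \<bar>y\<bar>" by (simp add: power2_eq_square abs_mult_self_eq mult.assoc)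
    then show "norm (u y - u 0 - (y - 0) *\<^sub>R X) / norm (y - 0) \<le> M * \<bar>y\<bar>"
      using y(1) by (simp add: u0 divide_le_eq)
  qed
  \<comment> \<open>The left-invariant vector field with value \<open>X\<close> at the identity, in
    coordinates.\<close>
  define V where "V = (\<lambda>v. frechet_derivative f (at (v, p)) (0, X))"
  define W where "W = (\<lambda>v. (v, p)) -` S"
  have Wo: "open W" unfolding W_def
    by (rule open_vimage[OF So]) (intro continuous_on_Pair continuous_on_id continuous_on_const)
  have Vs: "smooth_on W V" unfolding V_def
    by (rule smooth_on_comp[OF _ smooth_on_derivative[OF Sf] Wo So])
      (auto simp: W_def intro!: smooth_on_Pair smooth_on_id smooth_on_const Wo[unfolded W_def])
  have du: "(u has_derivative (\<lambda>h. h *\<^sub>R V (u t))) (at t)" if t: "t \<in> I" for t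
  proof -
    have F: "(f has_derivative frechet_derivative f (at (u t, p))) (at (u t, p))"
      by (rule smooth_on_has_derivative[OF Sf uS[OF t]])
    have P: "((\<lambda>h. (u t, u h)) has_derivative (\<lambda>h. (0, h *\<^sub>R X))) (at 0)"
      by (intro has_derivative_Pair has_derivative_const du0)
    have lin: "linear (frechet_derivative f (at (u t, p)))"
      using F has_derivative_linear by blast
    have "((\<lambda>h. f (u t, u h)) has_derivative (\<lambda>h. frechet_derivative f (at (u t, p)) (0, h *\<^sub>R X))) (at 0)"
      using diff_chain_at[OF P, of f] F by (simp add: u0 o_def)
    moreover have "frechet_derivative f (at (u t, p)) (0, h *\<^sub>R X) = h *\<^sub>R V (u t)" for h
      unfolding V_def using linear_cmul[OF lin, of h "(0, X)"] by simp
    ultimately have D: "((\<lambda>h. f (u t, u h)) has_derivative (\<lambda>h. h *\<^sub>R V (u t))) (at 0)" by simp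
    have "((\<lambda>s. s - t) has_derivative (\<lambda>h. h)) (at t)"
      by (rule has_derivative_eq_rhs[OF has_derivative_diff[OF has_derivative_ident has_derivative_const]]) simp
    from diff_chain_at[OF this, of "\<lambda>h. f (u t, u h)"] D
    have D': "((\<lambda>s. f (u t, u (s - t))) has_derivative (\<lambda>h. h *\<^sub>R V (u t))) (at t)" by (simp add: o_def)
    show ?thesis
    proof (rule has_derivative_transform_within_open[OF D', of "ball t \<eta>"])
      show "open (ball t \<eta>)" "t \<in> ball t \<eta>" using \<eta> by auto
      fix s assume "s \<in> ball t \<eta>"
      then have s: "s - t \<in> I" by (auto simp: I_def dist_real_def)
      show "f (u t, u (s - t)) = u s"
      proof -
        have e: "g t \<otimes> g (s - t) = g s" using g(2)[of t "s - t"] by simp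
        show ?thesis unfolding f_def fst_conv snd_conv \<iota>u[OF t] \<iota>u[OF s] e by (simp add: u_def)
      qed
    qed
  qed
  have Io: "open I" by (simp add: I_def)
  have uW: "u ` I \<subseteq> W" using uS by (auto simp: W_def)
  have "times_cont_diff_on k I u" for k
  proof (induction k)
    case 0
    show ?case unfolding times_cont_diff_on.simps
      by (rule continuous_at_imp_continuous_on) (use du has_derivative_continuous in blast)
  next
    case (Suc k)
    have "times_cont_diff_on k W V" using Vs by (simp add: smooth_on_def)
    from times_cont_diff_on_comp[OF Io Wo uW Suc this]
    have c: "times_cont_diff_on k I (\<lambda>t. V (u t))" .
    show ?case
      by (rule times_cont_diff_on_SucI[OF Io du], assumption)
        (rule times_cont_diff_on_linear[OF Io bounded_linear_scaleR_right c])
  qed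
  then have su: "smooth_on I (\<lambda>t. \<phi> (g t))" by (simp add: smooth_on_def u_def)
  have sI: "smooth_into A I g"
    by (rule smooth_into_of_chart[OF atlas U(1) Io _ su]) (use gI in auto)
  show ?thesis
  proof (rule smooth_into_local[OF topological_atlas])
    fix t :: real
    have to: "open (ball t \<eta>)" by simp
    \<comment> \<open>Near any time \<open>t\<close> the homomorphism is the left translate by
      \<open>g t\<close> of its restriction to a neighbourhood of 0.\<close>
    have "smooth_into A (ball t \<eta>) (\<lambda>s. g t \<otimes> g (s - t))"
      by (intro smooth_into_mult smooth_into_constant to g(1) smooth_into_compose[OF sI to]
          smooth_on_diff smooth_on_id smooth_on_const) (auto simp: I_def dist_real_def)
    then have "smooth_into A (ball t \<eta>) g"
      by (rule smooth_into_cong[OF _ _ topological_atlas]) (simp add: g(2)[symmetric])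
    then show "\<exists>T. t \<in> T \<and> T \<subseteq> UNIV \<and> smooth_into A T g" using \<eta> by (intro exI[of _ "ball t \<eta>"]) auto
  qed
qed

lemma one_parameter_subgroup_exists:
  assumes U: "(U, \<phi>) \<in> A" "\<one> \<in> U" and comp: "compact (carrier G)"
    and \<zeta>: "smooth_into A UNIV (\<zeta> :: real \<Rightarrow> 'g)" and z: "inv (\<zeta> 0) \<otimes> \<zeta> a = z" and a: "a \<noteq> 0"
  shows "\<exists>g. smooth_into A UNIV g \<and> (\<forall>s t. g (s + t) = g s \<otimes> g t) \<and> g a = z"
proof -
  have ma: "smooth_on UNIV (\<lambda>t. a * t)"
    by (rule smooth_on_bounded_linear[OF open_UNIV bounded_linear_mult_right])
  have mb: "smooth_on UNIV (\<lambda>t. t / a)"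
    by (rule smooth_on_bounded_linear[OF open_UNIV bounded_linear_divide])
  have s: "smooth_into A UNIV (\<lambda>t. \<zeta> (a * t))"
    by (rule smooth_into_compose[OF \<zeta> open_UNIV ma]) simp
  have z': "inv (\<zeta> (a * 0)) \<otimes> \<zeta> (a * 1) = z" using z by simp
  from small_roots[OF U comp s z'] obtain C n0 where "0 \<le> C" "n0 > 0"
    "\<forall>n\<ge>n0. \<exists>w\<in>U. w [^] (n::nat) = z \<and> norm (\<phi> w - \<phi> \<one>) \<le> C / real n" by (elim exE conjE) (rule that; assumption)
  from cluster_homomorphism[OF U comp this(3,1,2)] obtain g \<eta> X M where
    g: "\<forall>t. g t \<in> carrier G" "\<forall>s t. g (s + t) = g s \<otimes> g t" "g 1 = z" "\<eta> > (0::real)"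
    "\<forall>t\<in>{0..\<eta>}. g t \<in> U \<and> norm (\<phi> (g t) - \<phi> \<one> - t *\<^sub>R X) \<le> M * t\<^sup>2" by (elim exE conjE) (rule that; assumption)
  have "\<exists>\<eta>>0. \<exists>M. \<forall>t. \<bar>t\<bar> \<le> \<eta> \<longrightarrow> g t \<in> U \<and> norm (\<phi> (g t) - \<phi> \<one> - t *\<^sub>R X) \<le> M * t\<^sup>2"
    by (rule homomorphism_two_sided[OF U _ _ g(4)]) (use g in blast)+
  then obtain \<eta>' M' where \<eta>': "\<eta>' > 0" "\<forall>t. \<bar>t\<bar> \<le> \<eta>' \<longrightarrow> g t \<in> U \<and> norm (\<phi> (g t) - \<phi> \<one> - t *\<^sub>R X) \<le> M' * t\<^sup>2"
    by (elim exE conjE) (rule that; assumption)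
  have gs: "smooth_into A UNIV g"
    by (rule homomorphism_smooth[OF U _ _ \<eta>'(1)]) (use g \<eta>'(2) in blast)+
  have "smooth_into A UNIV (\<lambda>t. g (t / a))" by (rule smooth_into_compose[OF gs open_UNIV mb]) simp
  then show ?thesis using g a by (intro exI[of _ "\<lambda>t. g (t / a)"]) (simp add: add_divide_distrib)
qed

end

section \<open>Convergence of all derivatives\<close>

text \<open>The derivatives in \<open>loop_nhd\<close> are two-sided also at the ends of the
  interval, so smoothness has to hold on an open set around it.\<close>

definition smooth_near :: "real set \<Rightarrow> (real \<Rightarrow> 'v::real_normed_vector) \<Rightarrow> bool" where
  "smooth_near I f \<longleftrightarrow> (\<exists>S. open S \<and> I \<subseteq> S \<and> smooth_on S f)"

definition eq_near :: "real set \<Rightarrow> (real \<Rightarrow> 'v) \<Rightarrow> (real \<Rightarrow> 'v) \<Rightarrow> bool" where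
  "eq_near I f g \<longleftrightarrow> (\<exists>S. open S \<and> I \<subseteq> S \<and> (\<forall>t\<in>S. f t = g t))"

text \<open>Convergence in C^k on \<open>I\<close>, written recursively so that the sum, product and
  chain rules pass by induction from a function to its derivative. \<open>deriv_conv_iter\<close>
  translates it into the iterated derivatives of the loop topology.\<close>

fun deriv_conv :: "nat \<Rightarrow> real set \<Rightarrow> 'i filter \<Rightarrow> ('i \<Rightarrow> real \<Rightarrow> 'v::real_normed_vector) \<Rightarrow> (real \<Rightarrow> 'v) \<Rightarrow> bool" where
  "deriv_conv 0 I F f l \<longleftrightarrow> uniform_limit I f l F"
| "deriv_conv (Suc k) I F f l \<longleftrightarrow> uniform_limit I f l F \<and>
     deriv_conv k I F (\<lambda>i t. vector_derivative (f i) (at t)) (\<lambda>t. vector_derivative l (at t))"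

abbreviation vderiv :: "(real \<Rightarrow> 'v::real_normed_vector) \<Rightarrow> real \<Rightarrow> 'v" where
  "vderiv f \<equiv> \<lambda>t. vector_derivative f (at t)"

lemma smooth_nearI: "open S \<Longrightarrow> I \<subseteq> S \<Longrightarrow> smooth_on S f \<Longrightarrow> smooth_near I f"
  unfolding smooth_near_def by blast

lemma smooth_near_derivative:
  "smooth_near I f \<Longrightarrow> smooth_near I (\<lambda>t. vector_derivative f (at t))"
  unfolding smooth_near_def using smooth_on_vector_derivative by blast

lemma smooth_near_const: "smooth_near I (\<lambda>t. c)"
  by (rule smooth_nearI[OF open_UNIV subset_UNIV smooth_on_const])

lemma smooth_near_bilinear:
  assumes "bounded_bilinear B" "smooth_near I f" "smooth_near I g"
  shows "smooth_near I (\<lambda>t. B (f t) (g t))"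
proof -
  obtain S T where S: "open S" "I \<subseteq> S" "smooth_on S f" and T: "open T" "I \<subseteq> T" "smooth_on T g"
    using assms(2,3) unfolding smooth_near_def by blast
  show ?thesis
    by (rule smooth_nearI[of "S \<inter> T"])
      (use S T in \<open>auto intro!: smooth_on_bilinear[OF _ assms(1)] intro: smooth_on_subset\<close>)
qed

lemma smooth_near_add:
  assumes "smooth_near I f" "smooth_near I g"
  shows "smooth_near I (\<lambda>t. f t + g t)"
proof -
  obtain S T where S: "open S" "I \<subseteq> S" "smooth_on S f" and T: "open T" "I \<subseteq> T" "smooth_on T g"
    using assms unfolding smooth_near_def by blast
  show ?thesis
    by (rule smooth_nearI[of "S \<inter> T"])
      (use S T in \<open>auto intro!: smooth_on_add intro: smooth_on_subset\<close>)
qed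

lemma smooth_near_sum:
  "finite J \<Longrightarrow> (\<And>j. j \<in> J \<Longrightarrow> smooth_near I (f j)) \<Longrightarrow> smooth_near I (\<lambda>t. \<Sum>j\<in>J. f j t)"
  by (induction J rule: finite_induct) (simp_all add: smooth_near_const smooth_near_add)

lemma smooth_near_continuous: "smooth_near I f \<Longrightarrow> continuous_on I f"
  unfolding smooth_near_def using smooth_on_imp_continuous_on continuous_on_subset by blast

lemma smooth_near_bounded: "smooth_near I f \<Longrightarrow> compact I \<Longrightarrow> bounded (f ` I)"
  by (intro compact_imp_bounded compact_continuous_image smooth_near_continuous)

lemma eq_near_derivative:
  assumes "eq_near I f g" shows "eq_near I (\<lambda>t. vector_derivative f (at t)) (\<lambda>t. vector_derivative g (at t))"
proof -
  obtain S where S: "open S" "I \<subseteq> S" "\<And>t. t \<in> S \<Longrightarrow> f t = g t" using assms unfolding eq_near_def by blast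
  have "(f has_vector_derivative D) (at t) \<longleftrightarrow> (g has_vector_derivative D) (at t)" if t: "t \<in> S" for D t
    using has_vector_derivative_transform_within_open[OF _ S(1) t, of f D g]
      has_vector_derivative_transform_within_open[OF _ S(1) t, of g D f] S(3) by auto
  then have "vector_derivative f (at t) = vector_derivative g (at t)" if "t \<in> S" for t
    using that unfolding vector_derivative_def by simp
  then show ?thesis using S(1,2) unfolding eq_near_def by blast
qed

lemma deriv_conv_uniform: "deriv_conv k I F f l \<Longrightarrow> uniform_limit I f l F"
  by (cases k) auto

lemma deriv_conv_Suc: "deriv_conv (Suc k) I F f l \<Longrightarrow> deriv_conv k I F f l"
  by (induction k arbitrary: f l) auto

lemma uniform_limit_eq_near:
  assumes "uniform_limit I f l F" "\<forall>\<^sub>F i in F. eq_near I (f i) (f' i)" "eq_near I l l'"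
  shows "uniform_limit I f' l' F"
proof -
  have "\<forall>\<^sub>F i in F. \<forall>t\<in>I. f i t = f' i t" using assms(2)
    by (rule eventually_mono) (auto simp: eq_near_def)
  moreover have "l t = l' t" if "t \<in> I" for t using assms(3) that by (auto simp: eq_near_def)
  ultimately show ?thesis using uniform_limit_cong[of I f f' F l l'] assms(1) by blast
qed

text \<open>Agreement on an open neighbourhood of \<open>I\<close> passes to the derivatives;
  agreement on \<open>I\<close> alone would not.\<close>

lemma deriv_conv_cong:
  "deriv_conv k I F f l \<Longrightarrow> \<forall>\<^sub>F i in F. eq_near I (f i) (f' i) \<Longrightarrow> eq_near I l l' \<Longrightarrow> deriv_conv k I F f' l'"
proof (induction k arbitrary: f l f' l')
  case 0
  then show ?case using uniform_limit_eq_near by auto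
next
  case (Suc k)
  have "deriv_conv k I F (\<lambda>i. vderiv (f' i)) (vderiv l')"
  proof (rule Suc.IH)
    show "deriv_conv k I F (\<lambda>i. vderiv (f i)) (vderiv l)"
      using Suc.prems(1) by simp
    show "\<forall>\<^sub>F i in F. eq_near I (vderiv (f i)) (vderiv (f' i))"
      using Suc.prems(2) by (rule eventually_mono) (rule eq_near_derivative)
    show "eq_near I (vderiv l) (vderiv l')"
      by (rule eq_near_derivative[OF Suc.prems(3)])
  qed
  moreover have "uniform_limit I f l F" using Suc.prems(1) by simp
  ultimately show ?case using uniform_limit_eq_near[OF _ Suc.prems(2,3)] by simp
qed

lemma deriv_conv_const: "deriv_conv k I F (\<lambda>i t. c) (\<lambda>t. c)"
proof (induction k arbitrary: c)
  case 0
  then show ?case by (simp add: uniform_limit_const)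
next
  case (Suc k)
  have "vector_derivative (\<lambda>t. c) (at s) = 0" for s :: real
    by (rule vector_derivative_at) (rule has_vector_derivative_const)
  then show ?case using Suc by (simp add: uniform_limit_const)
qed

lemma deriv_conv_add:
  "deriv_conv k I F f l \<Longrightarrow> deriv_conv k I F g m \<Longrightarrow>
    \<forall>\<^sub>F i in F. smooth_near I (f i) \<Longrightarrow> \<forall>\<^sub>F i in F. smooth_near I (g i) \<Longrightarrow> smooth_near I l \<Longrightarrow> smooth_near I m \<Longrightarrow>
    deriv_conv k I F (\<lambda>i t. f i t + g i t) (\<lambda>t. l t + m t)"
proof (induction k arbitrary: f g l m)
  case 0
  then show ?case by (simp add: uniform_limit_add)
next
  case (Suc k)
  have e: "eq_near I (\<lambda>t. vector_derivative a (at t) + vector_derivative b (at t)) (\<lambda>t. vector_derivative (\<lambda>t. a t + b t) (at t))"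
    if ab: "smooth_near I a" "smooth_near I b" for a b :: "real \<Rightarrow> 'b"
  proof -
    obtain S T where S: "open S" "I \<subseteq> S" "smooth_on S a" and T: "open T" "I \<subseteq> T" "smooth_on T b"
      using ab unfolding smooth_near_def by blast
    have "vector_derivative a (at t) + vector_derivative b (at t) = vector_derivative (\<lambda>t. a t + b t) (at t)" if "t \<in> S \<inter> T" for t
      by (rule vector_derivative_at[symmetric], rule has_vector_derivative_add)
        (use that S T smooth_on_has_vector_derivative in blast)+
    then show ?thesis using S T unfolding eq_near_def by (intro exI[of _ "S \<inter> T"]) auto
  qed
  have "deriv_conv k I F (\<lambda>i t. vector_derivative (\<lambda>t. f i t + g i t) (at t)) (\<lambda>t. vector_derivative (\<lambda>t. l t + m t) (at t))"
  proof (rule deriv_conv_cong[OF Suc.IH])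
    show "deriv_conv k I F (\<lambda>i t. vector_derivative (f i) (at t)) (\<lambda>t. vector_derivative l (at t))"
      "deriv_conv k I F (\<lambda>i t. vector_derivative (g i) (at t)) (\<lambda>t. vector_derivative m (at t))"
      using Suc.prems by simp_all
    show "\<forall>\<^sub>F i in F. smooth_near I (\<lambda>t. vector_derivative (f i) (at t))"
      "\<forall>\<^sub>F i in F. smooth_near I (\<lambda>t. vector_derivative (g i) (at t))"
      by (rule eventually_mono[OF Suc.prems(3) smooth_near_derivative], assumption,
          rule eventually_mono[OF Suc.prems(4) smooth_near_derivative], assumption)
    show "smooth_near I (vderiv l)" "smooth_near I (vderiv m)"
      by (rule smooth_near_derivative[OF Suc.prems(5)], rule smooth_near_derivative[OF Suc.prems(6)])
    show "\<forall>\<^sub>F i in F. eq_near I (\<lambda>t. vector_derivative (f i) (at t) + vector_derivative (g i) (at t))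
         (\<lambda>t. vector_derivative (\<lambda>t. f i t + g i t) (at t))"
      using Suc.prems(3,4) by eventually_elim (rule e)
    show "eq_near I (\<lambda>t. vector_derivative l (at t) + vector_derivative m (at t)) (\<lambda>t. vector_derivative (\<lambda>t. l t + m t) (at t))"
      by (rule e[OF Suc.prems(5,6)])
  qed
  then show ?case using Suc.prems by (simp add: uniform_limit_add)
qed

text \<open>By the Leibniz rule the derivative is a sum of two terms of the same form, so the
  induction runs over all \<open>f\<close> and \<open>g\<close>. Compactness of \<open>I\<close>
  bounds the limits, which uniform convergence of products requires.\<close>

lemma deriv_conv_bilinear:
  assumes B: "bounded_bilinear B" and I: "compact I"
  shows "deriv_conv k I F f l \<Longrightarrow> deriv_conv k I F g m \<Longrightarrow>
    \<forall>\<^sub>F i in F. smooth_near I (f i) \<Longrightarrow> \<forall>\<^sub>F i in F. smooth_near I (g i) \<Longrightarrow> smooth_near I l \<Longrightarrow> smooth_near I m \<Longrightarrow>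
    deriv_conv k I F (\<lambda>i t. B (f i t) (g i t)) (\<lambda>t. B (l t) (m t))"
proof (induction k arbitrary: f g l m)
  case 0
  then have "uniform_limit I f l F" "uniform_limit I g m F" "bounded (m ` I)" "bounded (l ` I)"
    using smooth_near_bounded[OF _ I] by auto
  from bounded_bilinear.bounded_uniform_limit[OF B this] show ?case by simp
next
  case (Suc k)
  have e: "eq_near I (\<lambda>t. B (a t) (vderiv b t) + B (vderiv a t) (b t)) (vderiv (\<lambda>t. B (a t) (b t)))"
    if ab: "smooth_near I a" "smooth_near I b" for a b
  proof -
    obtain S T where S: "open S" "I \<subseteq> S" "smooth_on S a" and T: "open T" "I \<subseteq> T" "smooth_on T b"
      using ab unfolding smooth_near_def by blast
    have "B (a t) (vderiv b t) + B (vderiv a t) (b t) = vderiv (\<lambda>t. B (a t) (b t)) t" if "t \<in> S \<inter> T" for t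
      by (rule vector_derivative_at[symmetric], rule bounded_bilinear.has_vector_derivative[OF B])
        (use that S T smooth_on_has_vector_derivative in blast)+
    then show ?thesis using S T unfolding eq_near_def by (intro exI[of _ "S \<inter> T"]) auto
  qed
  note fs = Suc.prems(3) and gs = Suc.prems(4) and ls = Suc.prems(5) and ms = Suc.prems(6)
  have fd: "\<forall>\<^sub>F i in F. smooth_near I (vderiv (f i))" and gd: "\<forall>\<^sub>F i in F. smooth_near I (vderiv (g i))"
    by (rule eventually_mono[OF fs smooth_near_derivative], assumption,
        rule eventually_mono[OF gs smooth_near_derivative], assumption)
  note ld = smooth_near_derivative[OF ls] and md = smooth_near_derivative[OF ms]
  note c = deriv_conv_Suc[OF Suc.prems(1)] deriv_conv_Suc[OF Suc.prems(2)]
  have d: "deriv_conv k I F (\<lambda>i. vderiv (f i)) (vderiv l)" "deriv_conv k I F (\<lambda>i. vderiv (g i)) (vderiv m)"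
    using Suc.prems by simp_all
  have sm: "\<forall>\<^sub>F i in F. smooth_near I (\<lambda>t. B (f i t) (vderiv (g i) t))"
    using fs gd by eventually_elim (rule smooth_near_bilinear[OF B])
  have sm2: "\<forall>\<^sub>F i in F. smooth_near I (\<lambda>t. B (vderiv (f i) t) (g i t))"
    using fd gs by eventually_elim (rule smooth_near_bilinear[OF B])
  have "deriv_conv k I F (\<lambda>i t. B (f i t) (vderiv (g i) t) + B (vderiv (f i) t) (g i t)) (\<lambda>t. B (l t) (vderiv m t) + B (vderiv l t) (m t))"
    by (rule deriv_conv_add[OF Suc.IH[OF c(1) d(2) fs gd ls md] Suc.IH[OF d(1) c(2) fd gs ld ms] sm sm2
          smooth_near_bilinear[OF B ls md] smooth_near_bilinear[OF B ld ms]])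
  then have "deriv_conv k I F (\<lambda>i t. vderiv (\<lambda>t. B (f i t) (g i t)) t) (\<lambda>t. vderiv (\<lambda>t. B (l t) (m t)) t)"
  proof (rule deriv_conv_cong)
    show "\<forall>\<^sub>F i in F. eq_near I (\<lambda>t. B (f i t) (vderiv (g i) t) + B (vderiv (f i) t) (g i t)) (\<lambda>t. vderiv (\<lambda>t. B (f i t) (g i t)) t)"
      using fs gs by eventually_elim (rule e)
    show "eq_near I (\<lambda>t. B (l t) (vderiv m t) + B (vderiv l t) (m t)) (\<lambda>t. vderiv (\<lambda>t. B (l t) (m t)) t)"
      by (rule e[OF ls ms])
  qed
  moreover have "uniform_limit I (\<lambda>i t. B (f i t) (g i t)) (\<lambda>t. B (l t) (m t)) F"
    using bounded_bilinear.bounded_uniform_limit[OF B deriv_conv_uniform[OF c(1)] deriv_conv_uniform[OF c(2)]]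
      smooth_near_bounded[OF ls I] smooth_near_bounded[OF ms I] by blast
  ultimately show ?case by simp
qed

lemma deriv_conv_sum:
  assumes "finite J" "\<And>j. j \<in> J \<Longrightarrow> deriv_conv k I F (f j) (l j)"
    "\<And>j. j \<in> J \<Longrightarrow> \<forall>\<^sub>F i in F. smooth_near I (f j i)" "\<And>j. j \<in> J \<Longrightarrow> smooth_near I (l j)"
  shows "deriv_conv k I F (\<lambda>i t. \<Sum>j\<in>J. f j i t) (\<lambda>t. \<Sum>j\<in>J. l j t)"
  using assms
proof (induction J rule: finite_induct)
  case empty
  then show ?case by (simp add: deriv_conv_const)
next
  case (insert x J)
  have "\<forall>\<^sub>F i in F. \<forall>j\<in>J. smooth_near I (f j i)"
    using insert by (intro eventually_ball_finite) auto
  then have "\<forall>\<^sub>F i in F. smooth_near I (\<lambda>t. \<Sum>j\<in>J. f j i t)"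
    by (rule eventually_mono) (rule smooth_near_sum[OF insert.hyps(1)], blast)
  moreover have "smooth_near I (\<lambda>t. \<Sum>j\<in>J. l j t)"
    by (rule smooth_near_sum) (use insert in auto)
  ultimately show ?case
    using insert by (simp add: deriv_conv_add)
qed

lemma smooth_near_graph_comp:
  fixes f :: "real \<Rightarrow> 'e::euclidean_space" and m :: "real \<times> 'e \<Rightarrow> 'c::real_normed_vector"
  assumes W: "open W" "smooth_on W m" and f: "smooth_near I f" "\<And>t. t \<in> I \<Longrightarrow> (t, f t) \<in> W"
  shows "\<exists>S. open S \<and> I \<subseteq> S \<and> smooth_on S f \<and> (\<forall>t\<in>S. (t, f t) \<in> W) \<and> smooth_on S (\<lambda>t. m (t, f t))"
proof -
  obtain S where S: "open S" "I \<subseteq> S" "smooth_on S f" using f(1) unfolding smooth_near_def by blast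
  let ?S = "S \<inter> (\<lambda>t. (t, f t)) -` W"
  have o: "open ?S"
    by (rule continuous_open_preimage[OF _ S(1) W(1)])
      (intro continuous_on_Pair continuous_on_id smooth_on_imp_continuous_on[OF S(3)])
  have sf: "smooth_on ?S f" by (rule smooth_on_subset[OF S(3)]) auto
  have "smooth_on ?S (\<lambda>t. m (t, f t))"
    by (rule smooth_on_comp[OF smooth_on_Pair[OF o smooth_on_id[OF o] sf] W(2) o W(1)]) auto
  then show ?thesis using o sf S(2) f(2) by (intro exI[of _ ?S]) auto
qed

text \<open>The graph of \<open>l\<close> over \<open>I\<close> is compact, so a closed tube
  \<open>B\<close> around it lies in \<open>W\<close>. The graphs of nearby functions lie in this
  tube, and \<open>m\<close> is uniformly continuous there.\<close>

lemma uniform_limit_graph_comp: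
  fixes l :: "real \<Rightarrow> 'e::euclidean_space" and m :: "real \<times> 'e \<Rightarrow> 'c::real_normed_vector"
  assumes I: "compact I" and W: "open W" "continuous_on W m" and l: "continuous_on I l" "\<And>t. t \<in> I \<Longrightarrow> (t, l t) \<in> W"
    and u: "uniform_limit I f l F"
  shows "(\<forall>\<^sub>F i in F. \<forall>t\<in>I. (t, f i t) \<in> W) \<and> uniform_limit I (\<lambda>i t. m (t, f i t)) (\<lambda>t. m (t, l t)) F"
proof -
  let ?K = "(\<lambda>t. (t, l t)) ` I"
  have K: "compact ?K"
    by (intro compact_continuous_image continuous_on_Pair continuous_on_id l(1) I)
  obtain \<epsilon> where \<epsilon>: "\<epsilon> > 0" "(\<Union>x\<in>?K. cball x \<epsilon>) \<subseteq> W"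
    using compact_subset_open_imp_cball_epsilon_subset[OF K W(1)] l(2) by blast
  define B where "B = {x + y |x y. x \<in> ?K \<and> y \<in> cball 0 \<epsilon>}"
  have Bc: "compact B" unfolding B_def by (rule compact_sums[OF K compact_cball])
  have Beq: "x \<in> B" if "y \<in> ?K" "dist y x \<le> \<epsilon>" for x y
    unfolding B_def using that by (intro CollectI exI[of _ y] exI[of _ "x - y"]) (auto simp: dist_norm norm_minus_commute)
  have BW: "B \<subseteq> W"
  proof
    fix x assume "x \<in> B"
    then obtain a b where "a \<in> ?K" "b \<in> cball 0 \<epsilon>" "x = a + b" unfolding B_def by blast
    then have "x \<in> cball a \<epsilon>" by (simp add: dist_norm)
    then show "x \<in> W" using \<epsilon>(2) \<open>a \<in> ?K\<close> by blast
  qed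
  have dist: "dist (t, a) (t, b) = dist a b" for t :: real and a b :: 'e
    by (simp add: dist_Pair_Pair)
  have ev: "\<forall>\<^sub>F i in F. \<forall>t\<in>I. (t, f i t) \<in> B"
    using uniform_limitD[OF u \<epsilon>(1)]
  proof eventually_elim
    case (elim i)
    show ?case
    proof
      fix t assume t: "t \<in> I"
      show "(t, f i t) \<in> B"
        by (rule Beq[of "(t, l t)"]) (use t elim in \<open>auto simp: dist dist_commute less_imp_le\<close>)
    qed
  qed
  have ug: "uniform_limit I (\<lambda>i t. (t, f i t)) (\<lambda>t. (t, l t)) F"
    using u unfolding uniform_limit_iff by (simp add: dist)
  have uc: "uniformly_continuous_on B m"
    by (rule compact_uniformly_continuous[OF continuous_on_subset[OF W(2) BW] Bc])
  have "uniform_limit I (\<lambda>i t. m (t, f i t)) (\<lambda>t. m (t, l t)) F"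
    by (rule uniform_limit_compose_uniformly_continuous_on[OF ug uc ev compact_imp_closed[OF Bc]])
  moreover have "\<forall>\<^sub>F i in F. \<forall>t\<in>I. (t, f i t) \<in> W"
    using ev by (rule eventually_mono) (use BW in blast)
  ultimately show ?thesis by blast
qed

text \<open>Differentiating \<open>t \<mapsto> m (t, f t)\<close> once leaves terms of the same kind, multiplied by components of \<open>f'\<close>;
  hence the induction over all \<open>m\<close>.\<close>

lemma deriv_conv_graph_comp:
  fixes l :: "real \<Rightarrow> 'e::euclidean_space" and m :: "real \<times> 'e \<Rightarrow> 'c::real_normed_vector"
  assumes I: "compact I" and W: "open W" and f: "\<forall>\<^sub>F i in F. smooth_near I (f i)" and l: "smooth_near I l"
    "\<And>t. t \<in> I \<Longrightarrow> (t, l t) \<in> W" and conv: "\<And>k. deriv_conv k I F f l"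
  shows "smooth_on W m \<Longrightarrow> deriv_conv k I F (\<lambda>i t. m (t, f i t)) (\<lambda>t. m (t, l t))"
proof (induction k arbitrary: m)
  case 0
  from uniform_limit_graph_comp[OF I W smooth_on_imp_continuous_on[OF 0] smooth_near_continuous[OF l(1)] l(2) deriv_conv_uniform[OF conv]]
  show ?case by simp
next
  case (Suc k)
  have evW: "\<forall>\<^sub>F i in F. \<forall>t\<in>I. (t, f i t) \<in> W"
    and u: "uniform_limit I (\<lambda>i t. m (t, f i t)) (\<lambda>t. m (t, l t)) F"
    using uniform_limit_graph_comp[OF I W smooth_on_imp_continuous_on[OF Suc.prems] smooth_near_continuous[OF l(1)] l(2) deriv_conv_uniform[OF conv]]
    by auto
  define m0 where "m0 = (\<lambda>x. frechet_derivative m (at x) (1, 0))"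
  define mb where "mb = (\<lambda>b x. frechet_derivative m (at x) (0, b))"
  have m0: "smooth_on W m0" and mb: "smooth_on W (mb b)" for b
    unfolding m0_def mb_def by (rule smooth_on_derivative[OF Suc.prems])+
  let ?D = "\<lambda>f t. m0 (t, f t) + (\<Sum>b\<in>Basis. (vderiv f t \<bullet> b) *\<^sub>R mb b (t, f t))"
  have e: "eq_near I (?D a) (vderiv (\<lambda>t. m (t, a t)))"
    if a: "smooth_near I a" "\<And>t. t \<in> I \<Longrightarrow> (t, a t) \<in> W" for a
  proof -
    obtain S where S: "open S" "I \<subseteq> S" "smooth_on S a" "\<And>t. t \<in> S \<Longrightarrow> (t, a t) \<in> W"
      using smooth_near_graph_comp[OF W Suc.prems a] by blast
    have "?D a t = vderiv (\<lambda>t. m (t, a t)) t" if t: "t \<in> S" for t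
    proof -
      let ?m = "frechet_derivative m (at (t, a t))"
      have md: "(m has_derivative ?m) (at (t, a t))" by (rule smooth_on_has_derivative[OF Suc.prems S(4)[OF t]])
      have ad: "(a has_vector_derivative vderiv a t) (at t)" by (rule smooth_on_has_vector_derivative[OF S(3) t])
      have "((\<lambda>t. (t, a t)) has_derivative (\<lambda>h. (h, h *\<^sub>R vderiv a t))) (at t)"
        using ad unfolding has_vector_derivative_def by (intro has_derivative_Pair has_derivative_ident)
      from diff_chain_at[OF this md]
      have D: "((\<lambda>t. m (t, a t)) has_derivative (\<lambda>h. ?m (h, h *\<^sub>R vderiv a t))) (at t)" by (simp add: o_def)
      have lin: "linear ?m" using md has_derivative_linear by blast
      have "?m (h, h *\<^sub>R vderiv a t) = h *\<^sub>R ?m (1, vderiv a t)" for h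
        using linear_cmul[OF lin, of h "(1, vderiv a t)"] by simp
      then have "((\<lambda>t. m (t, a t)) has_vector_derivative ?m (1, vderiv a t)) (at t)"
        using D unfolding has_vector_derivative_def by simp
      then have v: "vderiv (\<lambda>t. m (t, a t)) t = ?m (1, vderiv a t)" by (rule vector_derivative_at)
      have lin2: "linear (\<lambda>w. ?m (0, w))"
      proof (rule linearI)
        show "?m (0, v + w) = ?m (0, v) + ?m (0, w)" for v w
          using linear_add[OF lin, of "(0, v)" "(0, w)"] by simp
        show "?m (0, c *\<^sub>R v) = c *\<^sub>R ?m (0, v)" for c v
          using linear_cmul[OF lin, of c "(0, v)"] by simp
      qed
      have "?m (1, vderiv a t) = ?m ((1, 0) + (0, vderiv a t))" by simp
      also have "\<dots> = ?m (1, 0) + ?m (0, vderiv a t)" by (rule linear_add[OF lin])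
      also have "?m (0, vderiv a t) = ?m (0, \<Sum>b\<in>Basis. (vderiv a t \<bullet> b) *\<^sub>R b)" by (simp add: euclidean_representation)
      also have "\<dots> = (\<Sum>b\<in>Basis. (vderiv a t \<bullet> b) *\<^sub>R ?m (0, b))"
        by (simp add: linear_sum[OF lin2] linear_cmul[OF lin2])
      finally show ?thesis unfolding v m0_def mb_def by simp
    qed
    then show ?thesis using S(1,2) unfolding eq_near_def by blast
  qed
  have smm: "smooth_near I (\<lambda>t. n (t, a t))" if "smooth_near I a" "\<And>t. t \<in> I \<Longrightarrow> (t, a t) \<in> W" "smooth_on W n"
    for a and n :: "real \<times> 'e \<Rightarrow> 'c"
    using smooth_near_graph_comp[OF W that(3,1,2)] unfolding smooth_near_def by blast
  have smb: "smooth_near I (\<lambda>t. vderiv a t \<bullet> b)" if "smooth_near I a" for a :: "real \<Rightarrow> 'e" and b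
    by (rule smooth_near_bilinear[OF bounded_bilinear_inner smooth_near_derivative[OF that] smooth_near_const])
  have fW: "\<forall>\<^sub>F i in F. smooth_near I (f i) \<and> (\<forall>t\<in>I. (t, f i t) \<in> W)"
    using f evW by eventually_elim blast
  have fd: "\<forall>\<^sub>F i in F. smooth_near I (vderiv (f i))"
    using f by (rule eventually_mono) (rule smooth_near_derivative)
  have trm: "deriv_conv k I F (\<lambda>i t. (vderiv (f i) t \<bullet> b) *\<^sub>R mb b (t, f i t)) (\<lambda>t. (vderiv l t \<bullet> b) *\<^sub>R mb b (t, l t))" for b
  proof (rule deriv_conv_bilinear[OF bounded_bilinear_scaleR I _ Suc.IH[OF mb]])
    show "deriv_conv k I F (\<lambda>i t. vderiv (f i) t \<bullet> b) (\<lambda>t. vderiv l t \<bullet> b)"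
      by (rule deriv_conv_bilinear[OF bounded_bilinear_inner I _ deriv_conv_const fd _ smooth_near_derivative[OF l(1)] smooth_near_const])
        (use conv[of "Suc k"] in \<open>simp_all add: smooth_near_const\<close>)
    show "\<forall>\<^sub>F i in F. smooth_near I (\<lambda>t. vderiv (f i) t \<bullet> b)" using f by (rule eventually_mono) (rule smb)
    show "\<forall>\<^sub>F i in F. smooth_near I (\<lambda>t. mb b (t, f i t))" using fW by (rule eventually_mono) (use smm mb in blast)
    show "smooth_near I (\<lambda>t. vderiv l t \<bullet> b)" by (rule smb[OF l(1)])
    show "smooth_near I (\<lambda>t. mb b (t, l t))" by (rule smm[OF l mb])
  qed
  have smt: "smooth_near I (\<lambda>t. (vderiv a t \<bullet> b) *\<^sub>R mb b (t, a t))" if "smooth_near I a" "\<And>t. t \<in> I \<Longrightarrow> (t, a t) \<in> W" for a b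
    by (rule smooth_near_bilinear[OF bounded_bilinear_scaleR smb[OF that(1)] smm[OF that mb]])
  have "deriv_conv k I F (\<lambda>i. ?D (f i)) (?D l)"
  proof (rule deriv_conv_add[OF Suc.IH[OF m0] deriv_conv_sum[OF finite_Basis trm]])
    show "\<forall>\<^sub>F i in F. smooth_near I (\<lambda>t. (vderiv (f i) t \<bullet> b) *\<^sub>R mb b (t, f i t))" for b
      using fW by (rule eventually_mono) (use smt in blast)
    show "smooth_near I (\<lambda>t. (vderiv l t \<bullet> b) *\<^sub>R mb b (t, l t))" for b by (rule smt[OF l])
    show "\<forall>\<^sub>F i in F. smooth_near I (\<lambda>t. m0 (t, f i t))" using fW by (rule eventually_mono) (use smm m0 in blast)
    show "smooth_near I (\<lambda>t. m0 (t, l t))" by (rule smm[OF l m0])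
    show "\<forall>\<^sub>F i in F. smooth_near I (\<lambda>t. \<Sum>b\<in>Basis. (vderiv (f i) t \<bullet> b) *\<^sub>R mb b (t, f i t))"
      using fW by (rule eventually_mono) (rule smooth_near_sum[OF finite_Basis], use smt in blast)
    show "smooth_near I (\<lambda>t. \<Sum>b\<in>Basis. (vderiv l t \<bullet> b) *\<^sub>R mb b (t, l t))"
      by (rule smooth_near_sum[OF finite_Basis]) (rule smt[OF l])
  qed
  then have "deriv_conv k I F (\<lambda>i. vderiv (\<lambda>t. m (t, f i t))) (vderiv (\<lambda>t. m (t, l t)))"
  proof (rule deriv_conv_cong)
    show "\<forall>\<^sub>F i in F. eq_near I (?D (f i)) (vderiv (\<lambda>t. m (t, f i t)))"
      using fW by (rule eventually_mono) (use e in blast)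
    show "eq_near I (?D l) (vderiv (\<lambda>t. m (t, l t)))" by (rule e[OF l])
  qed
  then show ?case using u by simp
qed

lemma iter_vector_derivative_0: "iter_vector_derivative 0 f = f"
  and iter_vector_derivative_Suc: "iter_vector_derivative (Suc k) f = iter_vector_derivative k (\<lambda>t. vector_derivative f (at t))"
  unfolding iter_vector_derivative_def by (simp_all add: funpow_Suc_right del: funpow.simps)

lemma deriv_conv_iter:
  "deriv_conv k I F f l \<longleftrightarrow>
    (\<forall>j\<le>k. uniform_limit I (\<lambda>i. iter_vector_derivative j (f i)) (iter_vector_derivative j l) F)"
proof (induction k arbitrary: f l)
  case 0
  then show ?case by (simp add: iter_vector_derivative_0)
next
  case (Suc k)
  have split: "(\<forall>j\<le>Suc k. P j) \<longleftrightarrow> P 0 \<and> (\<forall>j\<le>k. P (Suc j))" for P :: "nat \<Rightarrow> bool"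
    by (metis Suc_le_mono not0_implies_Suc zero_le)
  show ?case unfolding deriv_conv.simps Suc split by (simp add: iter_vector_derivative_0 iter_vector_derivative_Suc)
qed

lemma smooth_near_iter: "smooth_near I f \<Longrightarrow> smooth_near I (iter_vector_derivative k f)"
  by (induction k arbitrary: f) (simp_all add: iter_vector_derivative_0 iter_vector_derivative_Suc smooth_near_derivative)

lemma deriv_conv_consts: "(c \<longlongrightarrow> l) F \<Longrightarrow> deriv_conv k I F (\<lambda>i t. c i) (\<lambda>t. l)"
proof (induction k)
  case 0
  then show ?case by (simp add: uniform_limit_iff tendsto_iff)
next
  case (Suc k)
  have "vector_derivative (\<lambda>t. c) (at s) = 0" for s :: real and c :: 'b
    by (rule vector_derivative_at) (rule has_vector_derivative_const)
  then show ?case using Suc by (simp add: deriv_conv_const uniform_limit_iff tendsto_iff)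
qed

section \<open>The loop group\<close>

lemma periodic_of_int:
  fixes f :: "real \<Rightarrow> 'c"
  assumes period: "\<And>x. f (x + p) = f x"
  shows "f (x + p * of_int n) = f x"
proof -
  have nat: "f (y + p * real m) = f y" for y m
  proof (induction m)
    case (Suc m)
    have "y + p * real (Suc m) = (y + p * real m) + p" by (simp add: algebra_simps)
    then show ?case using Suc by (simp only: period)
  qed simp
  show ?thesis
  proof (cases "n \<ge> 0")
    case True
    then show ?thesis using nat[of x "nat n"] by simp
  next
    case False
    then show ?thesis using nat[of "x + p * of_int n" "nat (- n)"] by simp
  qed
qed

context lie_group
begin

abbreviation "LG \<equiv> loop_group G A"

lemma loop_carrier_iff:
  "\<gamma> \<in> carrier LG \<longleftrightarrow> smooth_into A UNIV \<gamma> \<and> (\<forall>x. \<gamma> (x + 2 * pi) = \<gamma> x)"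
  by (simp add: loop_group_def smooth_map_line_iff)

lemma loop_mult: "\<gamma> \<otimes>\<^bsub>LG\<^esub> \<eta> = (\<lambda>x. \<gamma> x \<otimes> \<eta> x)"
  and loop_one: "\<one>\<^bsub>LG\<^esub> = (\<lambda>x. \<one>)"
  by (simp_all add: loop_group_def)

lemma loop_value: "\<gamma> \<in> carrier LG \<Longrightarrow> \<gamma> x \<in> carrier G"
  using smooth_intoD[of UNIV \<gamma> x] by (simp add: loop_carrier_iff)

lemma loop_inverse_closed: "\<gamma> \<in> carrier LG \<Longrightarrow> (\<lambda>x. inv (\<gamma> x)) \<in> carrier LG"
  by (simp add: loop_carrier_iff smooth_into_inv)

lemma loop_mult_closed: "\<gamma> \<in> carrier LG \<Longrightarrow> \<eta> \<in> carrier LG \<Longrightarrow> (\<lambda>x. \<gamma> x \<otimes> \<eta> x) \<in> carrier LG"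
  by (simp add: loop_carrier_iff smooth_into_mult)

lemma constant_loop: "p \<in> carrier G \<Longrightarrow> (\<lambda>x. p) \<in> carrier LG"
  by (simp add: loop_carrier_iff smooth_into_constant)

lemma group_loop_group: "group LG"
proof (rule groupI)
  fix \<gamma> assume \<gamma>: "\<gamma> \<in> carrier LG"
  show "\<exists>y\<in>carrier LG. y \<otimes>\<^bsub>LG\<^esub> \<gamma> = \<one>\<^bsub>LG\<^esub>"
    by (rule bexI[OF _ loop_inverse_closed[OF \<gamma>]]) (simp add: loop_mult loop_one loop_value[OF \<gamma>])
next
  fix x y assume "x \<in> carrier LG" "y \<in> carrier LG"
  then show "x \<otimes>\<^bsub>LG\<^esub> y \<in> carrier LG" unfolding loop_mult by (rule loop_mult_closed)
next
  show "\<one>\<^bsub>LG\<^esub> \<in> carrier LG" unfolding loop_one by (rule constant_loop[OF one_closed])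
next
  fix x y z assume "x \<in> carrier LG" "y \<in> carrier LG" "z \<in> carrier LG"
  then show "x \<otimes>\<^bsub>LG\<^esub> y \<otimes>\<^bsub>LG\<^esub> z = x \<otimes>\<^bsub>LG\<^esub> (y \<otimes>\<^bsub>LG\<^esub> z)"
    unfolding loop_mult by (simp add: loop_value m_assoc)
next
  fix x assume "x \<in> carrier LG"
  then show "\<one>\<^bsub>LG\<^esub> \<otimes>\<^bsub>LG\<^esub> x = x" unfolding loop_mult loop_one by (simp add: loop_value)
qed

lemma loop_smooth: "\<gamma> \<in> carrier LG \<Longrightarrow> smooth_into A UNIV \<gamma>"
  and loop_periodic: "\<gamma> \<in> carrier LG \<Longrightarrow> \<gamma> (x + 2 * pi) = \<gamma> x"
  by (simp_all add: loop_carrier_iff)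

lemma shift_loop: assumes "\<gamma> \<in> carrier LG" shows "(\<lambda>x. \<gamma> (x - \<theta>)) \<in> carrier LG"
proof -
  have s: "smooth_on UNIV (\<lambda>x. x - \<theta>)" by (intro smooth_on_diff smooth_on_id smooth_on_const open_UNIV)
  have 1: "smooth_into A UNIV (\<lambda>x. \<gamma> (x - \<theta>))"
    by (rule smooth_into_compose[OF loop_smooth[OF assms] open_UNIV s]) simp
  have 2: "\<gamma> (x + 2 * pi - \<theta>) = \<gamma> (x - \<theta>)" for x
  proof -
    have "x + 2 * pi - \<theta> = (x - \<theta>) + 2 * pi" by simp
    then show ?thesis by (simp only: loop_periodic[OF assms])
  qed
  show ?thesis unfolding loop_carrier_iff using 1 2 by blast
qed

lemma periodic_int: assumes "\<gamma> \<in> carrier LG" shows "\<gamma> (x + 2 * pi * of_int n) = \<gamma> x"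
  by (rule periodic_of_int) (rule loop_periodic[OF assms])

lemma rotate_loop_cis: assumes "\<gamma> \<in> carrier LG" shows "rotate_loop (cis \<theta>) \<gamma> = (\<lambda>x. \<gamma> (x - \<theta>))"
proof
  fix x
  have "cis (Arg (cis \<theta>)) = cis \<theta>" using cis_Arg[of "cis \<theta>"] by (simp add: sgn_cis)
  then have "cos (Arg (cis \<theta>)) = cos \<theta>" "sin (Arg (cis \<theta>)) = sin \<theta>" by (simp_all add: cis.ctr)
  then obtain n :: int where "Arg (cis \<theta>) = \<theta> + 2 * pi * of_int n"
    using sin_cos_eq_iff[of "Arg (cis \<theta>)" \<theta>] by auto
  then have e: "x - \<theta> = (x - Arg (cis \<theta>)) + 2 * pi * of_int n" by simp
  show "rotate_loop (cis \<theta>) \<gamma> x = \<gamma> (x - \<theta>)"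
    unfolding rotate_loop_def e by (rule periodic_int[OF assms, symmetric])
qed

lemma topspace_loop_topology: "topspace (loop_topology G A) = carrier LG"
proof -
  define S where "S = {loop_nhd G A \<gamma> U \<phi> a b k \<epsilon> |\<gamma> U \<phi> a b k \<epsilon>.
        \<gamma> \<in> carrier LG \<and> (U, \<phi>) \<in> A \<and> \<gamma> ` {a..b} \<subseteq> U \<and> 0 < \<epsilon>}"
  have 1: "\<Union>S \<subseteq> carrier LG" unfolding S_def loop_nhd_def by blast
  have 2: "\<gamma> \<in> \<Union>S" if \<gamma>: "\<gamma> \<in> carrier LG" for \<gamma>
  proof -
    obtain U \<phi> where U: "(U, \<phi>) \<in> A" using chart_at[OF one_closed] by blast
    \<comment> \<open>The interval from 1 to 0 is empty, so this neighbourhood imposes no condition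
      on a loop.\<close>
    have "loop_nhd G A \<gamma> U \<phi> 1 0 0 1 \<in> S" unfolding S_def
      by (rule CollectI, intro exI conjI, rule refl) (use U \<gamma> in auto)
    moreover have "\<gamma> \<in> loop_nhd G A \<gamma> U \<phi> 1 0 0 1" using \<gamma> by (simp add: loop_nhd_def)
    ultimately show ?thesis by (rule UnionI)
  qed
  have "\<Union>S = carrier LG" 
    by (intro subset_antisym subsetI) (rule subsetD[OF 1], assumption, rule 2, assumption)
  then show ?thesis unfolding loop_topology_def S_def topology_generated_by_topspace .
qed

section \<open>Convergence of loops through charts\<close>

lemma smooth_near_chart:
  assumes "smooth_into A UNIV \<gamma>" "(U, \<phi>) \<in> A" "\<gamma> ` I \<subseteq> U"
  shows "smooth_near I (\<lambda>x. \<phi> (\<gamma> x))"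
  by (rule smooth_nearI[OF smooth_into_open_vimage_chart[OF assms(1,2)] _ smooth_into_chart[OF assms(1,2)]])
    (use assms(3) in auto)

lemma limitin_loopD:
  assumes lim: "limitin (loop_topology G A) f \<gamma> F" and U: "(U, \<phi>) \<in> A" "\<gamma> ` {a..b} \<subseteq> U"
  shows "\<forall>\<^sub>F i in F. f i \<in> carrier LG \<and> f i ` {a..b} \<subseteq> U"
    "deriv_conv k {a..b} F (\<lambda>i x. \<phi> (f i x)) (\<lambda>x. \<phi> (\<gamma> x))"
proof -
  have \<gamma>: "\<gamma> \<in> carrier LG" using limitin_topspace[OF lim] topspace_loop_topology by simp
  have ev: "\<forall>\<^sub>F i in F. f i \<in> loop_nhd G A \<gamma> U \<phi> a b j \<epsilon>" if "0 < \<epsilon>" for j \<epsilon>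
  proof (rule limitinD[OF lim])
    show "openin (loop_topology G A) (loop_nhd G A \<gamma> U \<phi> a b j \<epsilon>)"
      unfolding loop_topology_def by (rule topology_generated_by_Basis) (use \<gamma> U that in blast)
    show "\<gamma> \<in> loop_nhd G A \<gamma> U \<phi> a b j \<epsilon>" using \<gamma> U that by (simp add: loop_nhd_def)
  qed
  show "\<forall>\<^sub>F i in F. f i \<in> carrier LG \<and> f i ` {a..b} \<subseteq> U"
    using ev[OF zero_less_one, of 0] by (rule eventually_mono) (auto simp: loop_nhd_def)
  show "deriv_conv k {a..b} F (\<lambda>i x. \<phi> (f i x)) (\<lambda>x. \<phi> (\<gamma> x))"
    unfolding deriv_conv_iter
  proof (intro allI impI uniform_limitI)
    fix j and \<epsilon> :: real assume \<epsilon>: "0 < \<epsilon>"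
    show "\<forall>\<^sub>F i in F. \<forall>x\<in>{a..b}. dist (iter_vector_derivative j (\<lambda>x. \<phi> (f i x)) x)
        (iter_vector_derivative j (\<lambda>x. \<phi> (\<gamma> x)) x) < \<epsilon>"
      using ev[OF \<epsilon>, of j] by (rule eventually_mono) (simp add: loop_nhd_def o_def dist_norm)
  qed
qed

text \<open>One chart around each point suffices because changes of charts preserve convergence of all derivatives.\<close>

lemma limitin_loopI:
  assumes \<gamma>: "\<gamma> \<in> carrier LG" and f: "\<forall>\<^sub>F i in F. f i \<in> carrier LG"
    and loc: "\<And>t. \<exists>U \<phi> \<delta>. (U, \<phi>) \<in> A \<and> \<delta> > 0 \<and> (\<forall>I. compact I \<longrightarrow> I \<subseteq> {t-\<delta>..t+\<delta>} \<longrightarrow> \<gamma> ` I \<subseteq> U \<and>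
      (\<forall>\<^sub>F i in F. f i ` I \<subseteq> U) \<and> (\<forall>k. deriv_conv k I F (\<lambda>i x. \<phi> (f i x)) (\<lambda>x. \<phi> (\<gamma> x))))"
  shows "limitin (loop_topology G A) f \<gamma> F"
proof -
  have \<gamma>s: "smooth_into A UNIV \<gamma>" using \<gamma> by (simp add: loop_carrier_iff)
  have fs: "\<forall>\<^sub>F i in F. smooth_into A UNIV (f i)" using f by (rule eventually_mono) (simp add: loop_carrier_iff)
  have chart: "(\<forall>\<^sub>F i in F. f i ` {a..b} \<subseteq> V) \<and>
      uniform_limit {a..b} (\<lambda>i. iter_vector_derivative k (\<lambda>x. \<psi> (f i x))) (iter_vector_derivative k (\<lambda>x. \<psi> (\<gamma> x))) F"
    if V: "(V, \<psi>) \<in> A" and ab: "\<gamma> ` {a..b} \<subseteq> V" for V \<psi> a b k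
  proof -
    have "\<exists>d>0. (\<forall>\<^sub>F i in F. f i ` {t-d..t+d} \<subseteq> V) \<and>
      uniform_limit {t-d..t+d} (\<lambda>i. iter_vector_derivative k (\<lambda>x. \<psi> (f i x))) (iter_vector_derivative k (\<lambda>x. \<psi> (\<gamma> x))) F"
      if t: "t \<in> {a..b}" for t
    proof -
      obtain U \<phi> \<delta> where U: "(U, \<phi>) \<in> A" "\<delta> > 0" and I: "\<And>I. compact I \<Longrightarrow> I \<subseteq> {t-\<delta>..t+\<delta>} \<Longrightarrow> \<gamma> ` I \<subseteq> U \<and>
      (\<forall>\<^sub>F i in F. f i ` I \<subseteq> U) \<and> (\<forall>k. deriv_conv k I F (\<lambda>i x. \<phi> (f i x)) (\<lambda>x. \<phi> (\<gamma> x)))"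
        using loc[of t] by (elim exE conjE) blast
      have "open (UNIV \<inter> \<gamma> -` V)" by (rule smooth_into_open_vimage_chart[OF \<gamma>s V])
      moreover have "t \<in> UNIV \<inter> \<gamma> -` V" using ab t by blast
      ultimately obtain e where e: "e > 0" "cball t e \<subseteq> UNIV \<inter> \<gamma> -` V"
        unfolding open_contains_cball by blast
      define d where "d = min \<delta> e"
      define J where "J = {t-d..t+d}"
      have d: "d > 0" using U e by (simp add: d_def)
      have Jc: "compact J" by (simp add: J_def)
      have J\<delta>: "J \<subseteq> {t-\<delta>..t+\<delta>}" by (auto simp: J_def d_def)
      have "J \<subseteq> cball t e" by (auto simp: J_def d_def dist_real_def)
      then have JV: "\<gamma> ` J \<subseteq> V" using e(2) by blast
      note IJ = I[OF Jc J\<delta>]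
      define \<iota> where "\<iota> = inv_into U \<phi>"
      have sm\<iota>: "smooth_into A (\<phi> ` U) \<iota>" unfolding \<iota>_def by (rule smooth_into_chart_inverse[OF U(1)])
      have o: "open (UNIV \<times> \<phi> ` U)" by (intro open_Times open_UNIV chartD(2)[OF U(1)])
      have K: "smooth_into A ((UNIV :: real set) \<times> \<phi> ` U) (\<lambda>x. \<iota> (snd x))"
        by (rule smooth_into_compose[OF sm\<iota> o]) (auto intro!: smooth_on_snd smooth_on_id o)
      define W where "W = (UNIV \<times> \<phi> ` U) \<inter> (\<lambda>x::real \<times> 'e. \<iota> (snd x)) -` V"
      \<comment> \<open>The change of charts, viewed as a function of time and position that is
        constant in time, so that the composition lemma for graphs applies.\<close>
      define m where "m = (\<lambda>x::real \<times> 'e. \<psi> (\<iota> (snd x)))"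
      have Wo: "open W" unfolding W_def by (rule smooth_into_open_vimage_chart[OF K V])
      have ms: "smooth_on W m" unfolding W_def m_def by (rule smooth_into_chart[OF K V])
      have undo: "\<iota> (\<phi> x) = x" if "x \<in> U" for x unfolding \<iota>_def by (rule chartD(7)[OF U(1) that])
      have lW: "(x, \<phi> (\<gamma> x)) \<in> W" if "x \<in> J" for x
      proof -
        have "\<gamma> x \<in> U" "\<gamma> x \<in> V" using IJ JV that by blast+
        then show ?thesis unfolding W_def by (simp add: undo)
      qed
      have evU: "\<forall>\<^sub>F i in F. smooth_into A UNIV (f i) \<and> f i ` J \<subseteq> U"
        using fs IJ by (auto intro: eventually_conj)
      have fn: "\<forall>\<^sub>F i in F. smooth_near J (\<lambda>x. \<phi> (f i x))"
        using evU by (rule eventually_mono) (auto intro: smooth_near_chart[OF _ U(1)])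
      have ln: "smooth_near J (\<lambda>x. \<phi> (\<gamma> x))" by (rule smooth_near_chart[OF \<gamma>s U(1)]) (use IJ in blast)
      have conv: "deriv_conv k J F (\<lambda>i x. \<phi> (f i x)) (\<lambda>x. \<phi> (\<gamma> x))" for k using IJ by blast
      have dc: "deriv_conv k J F (\<lambda>i x. m (x, \<phi> (f i x))) (\<lambda>x. m (x, \<phi> (\<gamma> x)))"
        by (rule deriv_conv_graph_comp[OF Jc Wo fn ln lW conv ms])
      have evW: "\<forall>\<^sub>F i in F. \<forall>x\<in>J. (x, \<phi> (f i x)) \<in> W"
        using uniform_limit_graph_comp[OF Jc Wo smooth_on_imp_continuous_on[OF ms] smooth_near_continuous[OF ln] lW deriv_conv_uniform[OF conv]]
        by blast
      have evV: "\<forall>\<^sub>F i in F. f i ` J \<subseteq> V"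
        using evU evW
      proof eventually_elim
        case (elim i)
        show ?case
        proof
          fix y assume "y \<in> f i ` J"
          then obtain x where x: "x \<in> J" "y = f i x" by blast
          have "\<iota> (\<phi> (f i x)) \<in> V" using elim(2) x(1) unfolding W_def by auto
          moreover have "f i x \<in> U" using elim(1) x(1) by blast
          ultimately show "y \<in> V" using undo x(2) by simp
        qed
      qed
      have eqn: "eq_near J (\<lambda>x. m (x, \<phi> (h x))) (\<lambda>x. \<psi> (h x))" if h: "smooth_into A UNIV h" "h ` J \<subseteq> U" for h
        unfolding eq_near_def
        by (rule exI[of _ "UNIV \<inter> h -` U"], intro conjI smooth_into_open_vimage_chart[OF h(1) U(1)])
          (use h(2) in \<open>auto simp: m_def undo\<close>)
      have "deriv_conv k J F (\<lambda>i x. \<psi> (f i x)) (\<lambda>x. \<psi> (\<gamma> x))"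
      proof (rule deriv_conv_cong[OF dc])
        show "\<forall>\<^sub>F i in F. eq_near J (\<lambda>x. m (x, \<phi> (f i x))) (\<lambda>x. \<psi> (f i x))"
          using evU by (rule eventually_mono) (use eqn in blast)
        show "eq_near J (\<lambda>x. m (x, \<phi> (\<gamma> x))) (\<lambda>x. \<psi> (\<gamma> x))" using eqn[OF \<gamma>s] IJ by blast
      qed
      then have "uniform_limit J (\<lambda>i. iter_vector_derivative k (\<lambda>x. \<psi> (f i x))) (iter_vector_derivative k (\<lambda>x. \<psi> (\<gamma> x))) F"
        unfolding deriv_conv_iter by blast
      then show ?thesis using d evV unfolding J_def by blast
    qed
    then have "\<forall>t\<in>{a..b}. \<exists>d>0. (\<forall>\<^sub>F i in F. f i ` {t-d..t+d} \<subseteq> V) \<and>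
      uniform_limit {t-d..t+d} (\<lambda>i. iter_vector_derivative k (\<lambda>x. \<psi> (f i x))) (iter_vector_derivative k (\<lambda>x. \<psi> (\<gamma> x))) F"
      by blast
    from bchoice[OF this] obtain d where d: "\<forall>t\<in>{a..b}. d t > 0 \<and> (\<forall>\<^sub>F i in F. f i ` {t-d t..t+d t} \<subseteq> V) \<and>
      uniform_limit {t-d t..t+d t} (\<lambda>i. iter_vector_derivative k (\<lambda>x. \<psi> (f i x))) (iter_vector_derivative k (\<lambda>x. \<psi> (\<gamma> x))) F"
      by (elim exE)
    have "{a..b} \<subseteq> (\<Union>t\<in>{a..b}. ball t (d t))" using d by force
    from compactE_image[OF compact_Icc _ this] obtain C where
      C: "C \<subseteq> {a..b}" "finite C" "{a..b} \<subseteq> (\<Union>t\<in>C. ball t (d t))" by auto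
    have cov: "\<exists>t\<in>C. x \<in> {t-d t..t+d t}" if xab: "x \<in> {a..b}" for x
    proof -
      obtain t where "t \<in> C" "x \<in> ball t (d t)" using C(3) xab by blast
      then show ?thesis by (intro bexI[of _ t]) (auto simp: dist_real_def)
    qed
    have "\<forall>\<^sub>F i in F. \<forall>t\<in>C. f i ` {t-d t..t+d t} \<subseteq> V"
      using C d by (intro eventually_ball_finite) auto
    then have 1: "\<forall>\<^sub>F i in F. f i ` {a..b} \<subseteq> V"
      by (rule eventually_mono) (use cov in blast)
    have 2: "uniform_limit {a..b} (\<lambda>i. iter_vector_derivative k (\<lambda>x. \<psi> (f i x))) (iter_vector_derivative k (\<lambda>x. \<psi> (\<gamma> x))) F"
    proof (rule uniform_limitI)
      fix e :: real assume e: "0 < e"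
      have "\<forall>\<^sub>F i in F. \<forall>t\<in>C. \<forall>x\<in>{t-d t..t+d t}. dist (iter_vector_derivative k (\<lambda>x. \<psi> (f i x)) x) (iter_vector_derivative k (\<lambda>x. \<psi> (\<gamma> x)) x) < e"
      proof (rule eventually_ball_finite[OF C(2)], rule ballI)
        fix t assume "t \<in> C"
        then have "uniform_limit {t-d t..t+d t} (\<lambda>i. iter_vector_derivative k (\<lambda>x. \<psi> (f i x))) (iter_vector_derivative k (\<lambda>x. \<psi> (\<gamma> x))) F"
          using C(1) d by blast
        from uniform_limitD[OF this e] show "\<forall>\<^sub>F i in F. \<forall>x\<in>{t-d t..t+d t}. dist (iter_vector_derivative k (\<lambda>x. \<psi> (f i x)) x) (iter_vector_derivative k (\<lambda>x. \<psi> (\<gamma> x)) x) < e" .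
      qed
      then show "\<forall>\<^sub>F i in F. \<forall>x\<in>{a..b}. dist (iter_vector_derivative k (\<lambda>x. \<psi> (f i x)) x) (iter_vector_derivative k (\<lambda>x. \<psi> (\<gamma> x)) x) < e"
        by (rule eventually_mono) (use cov in blast)
    qed
    show ?thesis using 1 2 by blast
  qed
  have basic: "\<forall>\<^sub>F i in F. f i \<in> loop_nhd G A \<gamma>0 V \<psi> a b k \<epsilon>"
    if N: "\<gamma> \<in> loop_nhd G A \<gamma>0 V \<psi> a b k \<epsilon>" and V: "(V, \<psi>) \<in> A" and \<gamma>0: "\<gamma>0 \<in> carrier LG" "\<gamma>0 ` {a..b} \<subseteq> V" and \<epsilon>: "0 < \<epsilon>"
    for \<gamma>0 V \<psi> a b k \<epsilon>
  proof -
    let ?D = "\<lambda>h. iter_vector_derivative k (\<lambda>x. \<psi> (h x))"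
    have ab: "\<gamma> ` {a..b} \<subseteq> V" and lt: "\<And>x. x \<in> {a..b} \<Longrightarrow> norm (?D \<gamma> x - ?D \<gamma>0 x) < \<epsilon>"
      using N by (auto simp: loop_nhd_def o_def)
    \<comment> \<open>The neighbourhood is centred at some other loop \<open>\<gamma>0\<close>. By
      compactness the strict inequalities satisfied by \<open>\<gamma>\<close> leave a uniform
      margin \<open>\<epsilon> - \<epsilon>'\<close>, which absorbs the distance from
      \<open>f i\<close> to \<open>\<gamma>\<close>.\<close>
    have "\<exists>\<epsilon>'<\<epsilon>. \<forall>x\<in>{a..b}. norm (?D \<gamma> x - ?D \<gamma>0 x) \<le> \<epsilon>'"
    proof (cases "{a..b} = {}")
      case True
      then show ?thesis using \<epsilon> by (intro exI[of _ 0]) auto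
    next
      case False
      have "smooth_into A UNIV \<gamma>0" using \<gamma>0 by (simp add: loop_carrier_iff)
      then have "continuous_on {a..b} (?D \<gamma>)" "continuous_on {a..b} (?D \<gamma>0)"
        using smooth_near_chart[OF \<gamma>s V ab] smooth_near_chart[OF _ V \<gamma>0(2)]
        by (auto intro: smooth_near_continuous smooth_near_iter)
      then have "continuous_on {a..b} (\<lambda>x. norm (?D \<gamma> x - ?D \<gamma>0 x))"
        by (intro continuous_on_norm continuous_on_diff)
      from continuous_attains_sup[OF compact_Icc False this] obtain x0 where
        x0: "x0 \<in> {a..b}" "\<forall>x\<in>{a..b}. norm (?D \<gamma> x - ?D \<gamma>0 x) \<le> norm (?D \<gamma> x0 - ?D \<gamma>0 x0)"
        by (elim bexE) (rule that; assumption)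
      show ?thesis 
        by (rule exI[of _ "norm (?D \<gamma> x0 - ?D \<gamma>0 x0)"], rule conjI, rule lt[OF x0(1)], rule x0(2))
    qed
    then obtain \<epsilon>' where e0: "\<epsilon>' < \<epsilon>" "\<forall>x\<in>{a..b}. norm (?D \<gamma> x - ?D \<gamma>0 x) \<le> \<epsilon>'"
      by (elim exE conjE) (rule that; assumption)
    note \<epsilon>' = e0(1) bspec[OF e0(2)]
    note c = chart[OF V ab, of k]
    have "\<forall>\<^sub>F i in F. \<forall>x\<in>{a..b}. dist (?D (f i) x) (?D \<gamma> x) < \<epsilon> - \<epsilon>'"
      using uniform_limitD[OF conjunct2[OF c], of "\<epsilon> - \<epsilon>'"] \<epsilon>' by simp
    moreover have "\<forall>\<^sub>F i in F. f i ` {a..b} \<subseteq> V" using c by blast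
    ultimately show ?thesis using f
    proof eventually_elim
      case (elim i)
      have "norm (?D (f i) x - ?D \<gamma>0 x) < \<epsilon>" if x: "x \<in> {a..b}" for x
      proof -
        have "norm (?D (f i) x - ?D \<gamma> x) < \<epsilon> - \<epsilon>'" using elim(1) x by (simp add: dist_norm)
        moreover have "norm (?D (f i) x - ?D \<gamma>0 x) \<le> norm (?D (f i) x - ?D \<gamma> x) + norm (?D \<gamma> x - ?D \<gamma>0 x)"
          by (rule order_trans[OF _ norm_triangle_ineq]) simp
        ultimately show ?thesis using \<epsilon>'(2)[OF x] by linarith
      qed
      then show ?case using elim(2,3) by (simp add: loop_nhd_def o_def)
    qed
  qed
  have gen: "\<gamma> \<in> W \<longrightarrow> (\<forall>\<^sub>F i in F. f i \<in> W)"
    if "generate_topology_on {loop_nhd G A \<gamma> U \<phi> a b k \<epsilon> |\<gamma> U \<phi> a b k \<epsilon>.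
        \<gamma> \<in> carrier LG \<and> (U, \<phi>) \<in> A \<and> \<gamma> ` {a..b} \<subseteq> U \<and> 0 < \<epsilon>} W" for W
    using that
  proof (induction rule: generate_topology_on.induct)
    case Empty
    then show ?case by simp
  next
    case (Int a b)
    then show ?case by (auto intro: eventually_conj)
  next
    case (UN K)
    show ?case
    proof
      assume "\<gamma> \<in> \<Union>K"
      then obtain W where W: "W \<in> K" "\<gamma> \<in> W" by blast
      then have "\<forall>\<^sub>F i in F. f i \<in> W" using UN.IH by blast
      then show "\<forall>\<^sub>F i in F. f i \<in> \<Union>K" by (rule eventually_mono) (use W in blast)
    qed
  next
    case (Basis s)
    then obtain \<gamma>0 V \<psi> a b k \<epsilon> where s: "s = loop_nhd G A \<gamma>0 V \<psi> a b k \<epsilon>" "\<gamma>0 \<in> carrier LG" "(V, \<psi>) \<in> A"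
      "\<gamma>0 ` {a..b} \<subseteq> V" "0 < \<epsilon>" by (elim CollectE exE conjE) (rule that; assumption)
    show ?case unfolding s(1) using basic[OF _ s(3,2,4,5)] by (rule impI)
  qed
  show ?thesis
    unfolding limitin_def topspace_loop_topology
  proof (intro conjI allI impI \<gamma>)
    fix W assume W: "openin (loop_topology G A) W \<and> \<gamma> \<in> W"
    then have "openin (topology_generated_by {loop_nhd G A \<gamma> U \<phi> a b k \<epsilon> |\<gamma> U \<phi> a b k \<epsilon>.
        \<gamma> \<in> carrier LG \<and> (U, \<phi>) \<in> A \<and> \<gamma> ` {a..b} \<subseteq> U \<and> 0 < \<epsilon>}) W"
      unfolding loop_topology_def by (rule conjunct1)
    from gen[OF openin_topology_generated_by[OF this]] W show "\<forall>\<^sub>F i in F. f i \<in> W" by (rule mp[OF _ conjunct2])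
  qed
qed

text \<open>Radial contraction in the chart joins a loop with values near the identity to the
  constant loop, along a path that is continuous for the topology of all derivatives.\<close>

lemma limitin_scaled_loops:
  assumes U: "(U, \<phi>) \<in> A" "\<one> \<in> U" and r: "0 < r" "ball (\<phi> \<one>) r \<subseteq> \<phi> ` U"
    and \<gamma>: "\<gamma> \<in> carrier LG" "\<And>x. \<gamma> x \<in> U \<and> \<phi> (\<gamma> x) \<in> ball (\<phi> \<one>) r"
  defines "\<sigma> \<equiv> \<lambda>s x. inv_into U \<phi> (\<phi> \<one> + s *\<^sub>R (\<phi> (\<gamma> x) - \<phi> \<one>))"
  assumes s: "s \<in> {0..1}"
  shows "\<sigma> s \<in> carrier LG" "limitin (loop_topology G A) \<sigma> (\<sigma> s) (at s within {0..1})"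
proof -
  have \<gamma>s: "smooth_into A UNIV \<gamma>" using \<gamma> by (simp add: loop_carrier_iff)
  have e: "UNIV \<inter> \<gamma> -` U = UNIV" using \<gamma>(2) by auto
  have u: "smooth_on UNIV (\<lambda>x. \<phi> (\<gamma> x))" using smooth_into_chart[OF \<gamma>s U(1)] unfolding e .
  have inb: "\<phi> \<one> + s *\<^sub>R (\<phi> (\<gamma> x) - \<phi> \<one>) \<in> \<phi> ` U" if s: "s \<in> {0..1}" for s x
  proof -
    have "norm (s *\<^sub>R (\<phi> (\<gamma> x) - \<phi> \<one>)) \<le> 1 * norm (\<phi> (\<gamma> x) - \<phi> \<one>)"
      using s by (simp add: mult_left_le_one_le)
    moreover have "norm (\<phi> (\<gamma> x) - \<phi> \<one>) < r" using \<gamma>(2)[of x] by (simp add: dist_norm norm_minus_commute)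
    ultimately have "\<phi> \<one> + s *\<^sub>R (\<phi> (\<gamma> x) - \<phi> \<one>) \<in> ball (\<phi> \<one>) r" by (simp add: dist_norm)
    then show ?thesis using r(2) by blast
  qed
  have sms: "smooth_on UNIV (\<lambda>x. \<phi> \<one> + s *\<^sub>R (\<phi> (\<gamma> x) - \<phi> \<one>))" for s
    by (intro smooth_on_add smooth_on_const smooth_on_linear[OF open_UNIV bounded_linear_scaleR_right] smooth_on_diff u open_UNIV)
  have \<sigma>c: "\<sigma> s \<in> carrier LG" if s: "s \<in> {0..1}" for s
  proof -
    have "smooth_into A UNIV (\<sigma> s)" unfolding \<sigma>_def
      by (rule smooth_into_compose[OF smooth_into_chart_inverse[OF U(1)] open_UNIV sms]) (use inb[OF s] in blast)
    moreover have "\<sigma> s (x + 2 * pi) = \<sigma> s x" for x using \<gamma>(1) by (simp add: \<sigma>_def loop_carrier_iff)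
    ultimately show ?thesis by (simp add: loop_carrier_iff)
  qed
  show "\<sigma> s \<in> carrier LG" by (rule \<sigma>c[OF s])
  let ?F = "at s within {0..1}"
  have ev01: "\<forall>\<^sub>F i in ?F. i \<in> {0..1}" by (simp add: eventually_at_filter)
  have \<phi>\<sigma>: "\<sigma> i x \<in> U" "\<phi> (\<sigma> i x) = \<phi> \<one> + i *\<^sub>R (\<phi> (\<gamma> x) - \<phi> \<one>)" if "i \<in> {0..1}" for i x
    unfolding \<sigma>_def using chartD(8,9)[OF U(1) inb[OF that, of x]] by auto
  show "limitin (loop_topology G A) \<sigma> (\<sigma> s) ?F"
  proof (rule limitin_loopI[OF \<sigma>c[OF s]])
    show "\<forall>\<^sub>F i in ?F. \<sigma> i \<in> carrier LG" using ev01 by (rule eventually_mono) (rule \<sigma>c)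
    fix t
    have dc: "deriv_conv k I ?F (\<lambda>i x. \<phi> (\<sigma> i x)) (\<lambda>x. \<phi> (\<sigma> s x))" if I: "compact I" for k I
    proof -
      have un: "smooth_near I (\<lambda>x. \<phi> (\<gamma> x) - \<phi> \<one>)"
        by (rule smooth_nearI[OF open_UNIV subset_UNIV]) (intro smooth_on_diff u smooth_on_const open_UNIV)
      have un': "deriv_conv k I ?F (\<lambda>i x. \<phi> (\<gamma> x) - \<phi> \<one>) (\<lambda>x. \<phi> (\<gamma> x) - \<phi> \<one>)"
        unfolding deriv_conv_iter by (auto intro!: uniform_limitI)
      have "deriv_conv k I ?F (\<lambda>i x. i *\<^sub>R (\<phi> (\<gamma> x) - \<phi> \<one>)) (\<lambda>x. s *\<^sub>R (\<phi> (\<gamma> x) - \<phi> \<one>))"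
        by (rule deriv_conv_bilinear[OF bounded_bilinear_scaleR I deriv_conv_consts[OF tendsto_ident_at] un'])
          (simp_all add: un smooth_near_const)
      then have "deriv_conv k I ?F (\<lambda>i x. \<phi> \<one> + i *\<^sub>R (\<phi> (\<gamma> x) - \<phi> \<one>)) (\<lambda>x. \<phi> \<one> + s *\<^sub>R (\<phi> (\<gamma> x) - \<phi> \<one>))"
        by (rule deriv_conv_add[OF deriv_conv_const])
          (auto intro!: always_eventually smooth_near_const smooth_near_bilinear[OF bounded_bilinear_scaleR smooth_near_const un])
      then show ?thesis
      proof (rule deriv_conv_cong)
        show "\<forall>\<^sub>F i in ?F. eq_near I (\<lambda>x. \<phi> \<one> + i *\<^sub>R (\<phi> (\<gamma> x) - \<phi> \<one>)) (\<lambda>x. \<phi> (\<sigma> i x))"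
          using ev01 by (rule eventually_mono) (auto simp: eq_near_def \<phi>\<sigma>)
        show "eq_near I (\<lambda>x. \<phi> \<one> + s *\<^sub>R (\<phi> (\<gamma> x) - \<phi> \<one>)) (\<lambda>x. \<phi> (\<sigma> s x))"
          using s by (auto simp: eq_near_def \<phi>\<sigma>)
      qed
    qed
    have im: "\<sigma> s ` I \<subseteq> U \<and> (\<forall>\<^sub>F i in ?F. \<sigma> i ` I \<subseteq> U)" for I
      using \<phi>\<sigma>(1) s eventually_mono[OF ev01, of "\<lambda>i. \<sigma> i ` I \<subseteq> U"] by blast
    show "\<exists>U \<phi> \<delta>. (U, \<phi>) \<in> A \<and> \<delta> > 0 \<and> (\<forall>I. compact I \<longrightarrow> I \<subseteq> {t-\<delta>..t+\<delta>} \<longrightarrow> \<sigma> s ` I \<subseteq> U \<and>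
      (\<forall>\<^sub>F i in ?F. \<sigma> i ` I \<subseteq> U) \<and> (\<forall>k. deriv_conv k I ?F (\<lambda>i x. \<phi> (\<sigma> i x)) (\<lambda>x. \<phi> (\<sigma> s x))))"
      using U(1) dc im by (intro exI[of _ U] exI[of _ \<phi>] exI[of _ 1]) auto
  qed
qed

text \<open>The path \<open>g\<close> need not close up, so this is not an inner operation of the
  loop group. In charts it sends coordinates \<open>v\<close> at time \<open>x\<close> to a smooth
  function of \<open>(x, v)\<close>; its explicit dependence on time is the reason for working with
  graphs.\<close>

lemma continuous_map_conj_loop:
  assumes g: "smooth_into A UNIV (g :: real \<Rightarrow> 'g)"
    and closed: "\<And>\<gamma>. \<gamma> \<in> carrier LG \<Longrightarrow> (\<lambda>x. inv (g x) \<otimes> \<gamma> x \<otimes> g x) \<in> carrier LG"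
  shows "continuous_map (loop_topology G A) (loop_topology G A) (\<lambda>\<gamma> x. inv (g x) \<otimes> \<gamma> x \<otimes> g x)"
  unfolding continuous_map_atin topspace_loop_topology
proof
  fix \<gamma> assume \<gamma>: "\<gamma> \<in> carrier LG"
  let ?T = "\<lambda>\<gamma> x. inv (g x) \<otimes> \<gamma> x \<otimes> g x" and ?F = "atin (loop_topology G A) \<gamma>"
  have lim: "limitin (loop_topology G A) (\<lambda>\<gamma>. \<gamma>) \<gamma> ?F"
    using \<gamma> continuous_map_id[of "loop_topology G A"] unfolding continuous_map_atin topspace_loop_topology by (simp add: id_def)
  have \<gamma>s: "smooth_into A UNIV \<gamma>" using \<gamma> by (simp add: loop_carrier_iff)
  have evc: "\<forall>\<^sub>F \<eta> in ?F. \<eta> \<in> carrier LG"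
    using limitinD[OF lim openin_topspace] \<gamma> by (simp add: topspace_loop_topology)
  show "limitin (loop_topology G A) ?T (?T \<gamma>) ?F"
  proof (rule limitin_loopI[OF closed[OF \<gamma>]])
    show "\<forall>\<^sub>F \<eta> in ?F. ?T \<eta> \<in> carrier LG" using evc by (rule eventually_mono) (rule closed)
    fix t
    obtain V \<psi> where V: "(V, \<psi>) \<in> A" "\<gamma> t \<in> V" using chart_at[OF loop_value[OF \<gamma>, of t]] by blast
    obtain U \<phi> where U: "(U, \<phi>) \<in> A" "?T \<gamma> t \<in> U" using chart_at[OF loop_value[OF closed[OF \<gamma>], of t]] by blast
    define \<iota> where "\<iota> = inv_into V \<psi>"
    have sm\<iota>: "smooth_into A (\<psi> ` V) \<iota>" unfolding \<iota>_def by (rule smooth_into_chart_inverse[OF V(1)])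
    have o: "open (UNIV \<times> \<psi> ` V)" by (intro open_Times open_UNIV chartD(2)[OF V(1)])
    let ?K = "\<lambda>x. inv (g (fst x)) \<otimes> \<iota> (snd x) \<otimes> g (fst x)"
    have K: "smooth_into A ((UNIV :: real set) \<times> \<psi> ` V) ?K"
      by (intro smooth_into_mult smooth_into_inv smooth_into_compose[OF sm\<iota> o] smooth_into_compose[OF g o]
          smooth_on_fst smooth_on_snd smooth_on_id o) auto
    define W where "W = (UNIV \<times> \<psi> ` V) \<inter> ?K -` U"
    define m where "m = (\<lambda>x. \<phi> (?K x))"
    have Wo: "open W" unfolding W_def by (rule smooth_into_open_vimage_chart[OF K U(1)])
    have ms: "smooth_on W m" unfolding W_def m_def by (rule smooth_into_chart[OF K U(1)])
    have undo: "\<iota> (\<psi> x) = x" if "x \<in> V" for x unfolding \<iota>_def by (rule chartD(7)[OF V(1) that])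
    have Ts: "smooth_into A UNIV (?T \<gamma>)" using closed[OF \<gamma>] by (simp add: loop_carrier_iff)
    have "open ((UNIV \<inter> \<gamma> -` V) \<inter> (UNIV \<inter> ?T \<gamma> -` U))"
      by (intro open_Int smooth_into_open_vimage_chart[OF \<gamma>s V(1)] smooth_into_open_vimage_chart[OF Ts U(1)])
    moreover have "t \<in> (UNIV \<inter> \<gamma> -` V) \<inter> (UNIV \<inter> ?T \<gamma> -` U)" using U(2) V(2) by simp
    ultimately obtain \<delta> where \<delta>: "\<delta> > 0" "cball t \<delta> \<subseteq> (UNIV \<inter> \<gamma> -` V) \<inter> (UNIV \<inter> ?T \<gamma> -` U)"
      unfolding open_contains_cball by blast
    have "?T \<gamma> ` I \<subseteq> U \<and> (\<forall>\<^sub>F \<eta> in ?F. ?T \<eta> ` I \<subseteq> U) \<and> (\<forall>k. deriv_conv k I ?F (\<lambda>\<eta> x. \<phi> (?T \<eta> x)) (\<lambda>x. \<phi> (?T \<gamma> x)))"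
      if I: "compact I" "I \<subseteq> {t-\<delta>..t+\<delta>}" for I
    proof -
      have sub: "x \<in> I \<Longrightarrow> \<gamma> x \<in> V \<and> ?T \<gamma> x \<in> U" for x
      proof -
        assume "x \<in> I"
        then have "x \<in> {t-\<delta>..t+\<delta>}" using I(2) by blast
        then have "x \<in> cball t \<delta>" by (auto simp: dist_real_def)
        then show ?thesis using \<delta>(2) by blast
      qed
      have imV: "\<gamma> ` {t-\<delta>..t+\<delta>} \<subseteq> V"
      proof
        fix y assume "y \<in> \<gamma> ` {t-\<delta>..t+\<delta>}"
        then obtain x where "x \<in> {t-\<delta>..t+\<delta>}" "y = \<gamma> x" by blast
        then have "x \<in> cball t \<delta>" by (auto simp: dist_real_def)
        then show "y \<in> V" using \<delta>(2) \<open>y = \<gamma> x\<close> by blast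
      qed
      have evV: "\<forall>\<^sub>F \<eta> in ?F. \<eta> \<in> carrier LG \<and> \<eta> ` {t-\<delta>..t+\<delta>} \<subseteq> V" by (rule limitin_loopD(1)[OF lim V(1) imV])
      have conv0: "deriv_conv k {t-\<delta>..t+\<delta>} ?F (\<lambda>\<eta> x. \<psi> (\<eta> x)) (\<lambda>x. \<psi> (\<gamma> x))" for k by (rule limitin_loopD(2)[OF lim V(1) imV])
      have conv: "deriv_conv k I ?F (\<lambda>\<eta> x. \<psi> (\<eta> x)) (\<lambda>x. \<psi> (\<gamma> x))" for k
        using conv0[of k] I(2) unfolding deriv_conv_iter by (blast intro: uniform_limit_on_subset)
      have fn: "\<forall>\<^sub>F \<eta> in ?F. smooth_near I (\<lambda>x. \<psi> (\<eta> x))"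
        using evV
      proof eventually_elim
        case (elim \<eta>)
        then show ?case using I(2) by (intro smooth_near_chart[OF _ V(1)]) (auto simp: loop_carrier_iff)
      qed
      have ln: "smooth_near I (\<lambda>x. \<psi> (\<gamma> x))" by (rule smooth_near_chart[OF \<gamma>s V(1)]) (use sub in blast)
      have lW: "(x, \<psi> (\<gamma> x)) \<in> W" if "x \<in> I" for x
        using sub[OF that] unfolding W_def by (simp add: undo)
      have dc: "deriv_conv k I ?F (\<lambda>\<eta> x. m (x, \<psi> (\<eta> x))) (\<lambda>x. m (x, \<psi> (\<gamma> x)))" for k
        by (rule deriv_conv_graph_comp[OF I(1) Wo fn ln lW conv ms])
      have evW: "\<forall>\<^sub>F \<eta> in ?F. \<forall>x\<in>I. (x, \<psi> (\<eta> x)) \<in> W"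
        using uniform_limit_graph_comp[OF I(1) Wo smooth_on_imp_continuous_on[OF ms] smooth_near_continuous[OF ln] lW deriv_conv_uniform[OF conv]]
        by blast
      have evU: "\<forall>\<^sub>F \<eta> in ?F. ?T \<eta> ` I \<subseteq> U"
        using evV evW
      proof eventually_elim
        case (elim \<eta>)
        show ?case
        proof
          fix y assume "y \<in> ?T \<eta> ` I"
          then obtain x where x: "x \<in> I" "y = ?T \<eta> x" by blast
          have "\<eta> x \<in> V" using elim(1) x(1) I(2) by blast
          then show "y \<in> U" using elim(2) x undo[of "\<eta> x"] unfolding W_def by auto
        qed
      qed
      have eqn: "eq_near I (\<lambda>x. m (x, \<psi> (\<eta> x))) (\<lambda>x. \<phi> (?T \<eta> x))" if h: "\<eta> \<in> carrier LG" "\<eta> ` I \<subseteq> V" for \<eta>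
        unfolding eq_near_def
      proof (intro exI conjI)
        show "open (UNIV \<inter> \<eta> -` V)" 
          by (rule smooth_into_open_vimage_chart[OF loop_smooth[OF h(1)] V(1)])
        show "I \<subseteq> UNIV \<inter> \<eta> -` V" using h(2) by blast
        show "\<forall>x\<in>UNIV \<inter> \<eta> -` V. m (x, \<psi> (\<eta> x)) = \<phi> (?T \<eta> x)" by (simp add: m_def undo)
      qed
      have "deriv_conv k I ?F (\<lambda>\<eta> x. \<phi> (?T \<eta> x)) (\<lambda>x. \<phi> (?T \<gamma> x))" for k
      proof (rule deriv_conv_cong[OF dc])
        show "\<forall>\<^sub>F \<eta> in ?F. eq_near I (\<lambda>x. m (x, \<psi> (\<eta> x))) (\<lambda>x. \<phi> (?T \<eta> x))"
          using evV
        proof eventually_elim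
          case (elim \<eta>)
          then have "\<eta> ` I \<subseteq> V" using I(2) by blast
          then show ?case using eqn elim by blast
        qed
        show "eq_near I (\<lambda>x. m (x, \<psi> (\<gamma> x))) (\<lambda>x. \<phi> (?T \<gamma> x))" 
          by (rule eqn[OF \<gamma>]) (use sub in blast)
      qed
      moreover have "?T \<gamma> ` I \<subseteq> U" using sub by blast
      ultimately show ?thesis using evU by blast
    qed
    then show "\<exists>U \<phi> \<delta>. (U, \<phi>) \<in> A \<and> \<delta> > 0 \<and> (\<forall>I. compact I \<longrightarrow> I \<subseteq> {t-\<delta>..t+\<delta>} \<longrightarrow> ?T \<gamma> ` I \<subseteq> U \<and>
      (\<forall>\<^sub>F \<eta> in ?F. ?T \<eta> ` I \<subseteq> U) \<and> (\<forall>k. deriv_conv k I ?F (\<lambda>\<eta> x. \<phi> (?T \<eta> x)) (\<lambda>x. \<phi> (?T \<gamma> x))))"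
      using U(1) \<delta>(1) by (intro exI[of _ U] exI[of _ \<phi>] exI[of _ \<delta>]) blast
  qed
qed

end

section \<open>Complex Hilbert spaces and unitary operators\<close>

abbreviation "cspan \<equiv> complex_vector.span"
abbreviation "csubspace \<equiv> complex_vector.subspace"
abbreviation "unitaries \<equiv> carrier unitary_group"
abbreviation "proj \<equiv> projective_class"
abbreviation "PU \<equiv> projective_unitary_group"
abbreviation PU_mult (infixl "\<odot>" 70) where "p \<odot> q \<equiv> p \<otimes>\<^bsub>PU\<^esub> q"

context complex_hilbert_space
begin

lemma cinner_add_left: "cinner (x + y) z = cinner x z + cinner y z"
  by (metis cinner_add_right cinner_commute complex_cnj_add)

lemma cinner_scaleC_left: "cinner (c *\<^sub>C x) y = cnj c * cinner x y"
  by (metis cinner_scaleC_right cinner_commute complex_cnj_mult)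

lemma cinner_zero_right: "cinner x 0 = 0"
proof -
  have "cinner x 0 + cinner x 0 = cinner x 0" using cinner_add_right[of x 0 0] by simp
  then show ?thesis by simp
qed

lemma cinner_diff_right: "cinner x (y - z) = cinner x y - cinner x z"
  using cinner_add_right[of x "y - z" z] by simp

lemma cinner_self: "cinner x x = complex_of_real ((norm x)\<^sup>2)"
proof (rule complex_eqI)
  show "Re (cinner x x) = Re (complex_of_real ((norm x)\<^sup>2))"
    by (simp add: Re_cinner power2_norm_eq_inner)
  have "Im (cinner x x) = - Im (cinner x x)" using arg_cong[OF cinner_commute[of x x], of Im] by simp
  then show "Im (cinner x x) = Im (complex_of_real ((norm x)\<^sup>2))" by simp
qed

lemma cinner_self_zero: "cinner x x = 0 \<longleftrightarrow> x = 0"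
  by (simp add: cinner_self)

lemma norm_scaleC: "norm (c *\<^sub>C x) = cmod c * norm x"
proof -
  have "cinner (c *\<^sub>C x) (c *\<^sub>C x) = (c * cnj c) * cinner x x"
    by (simp add: cinner_scaleC_left cinner_scaleC_right mult_ac)
  then have "complex_of_real ((norm (c *\<^sub>C x))\<^sup>2) = complex_of_real ((cmod c)\<^sup>2 * (norm x)\<^sup>2)"
    unfolding cinner_self complex_norm_square[symmetric] by simp
  then have "(norm (c *\<^sub>C x))\<^sup>2 = (cmod c * norm x)\<^sup>2"
    by (simp only: of_real_eq_iff power_mult_distrib)
  then show ?thesis by (simp add: power2_eq_iff_nonneg)
qed

lemma scaleC_zero: "c *\<^sub>C 0 = (0::'a)"
  using scaleC_add_right[of c 0 0] by simp

lemma scaleC_diff: "c *\<^sub>C (x - y) = c *\<^sub>C x - c *\<^sub>C y"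
  using scaleC_add_right[of c "x - y" y] by simp

lemma scaleC_minus_left: "(- c) *\<^sub>C x = - (c *\<^sub>C x)"
proof -
  have "0 *\<^sub>C x = (0::'a)" using norm_scaleC[of 0 x] by simp
  then have "(- c) *\<^sub>C x + c *\<^sub>C x = 0" using scaleC_add_left[of "- c" c x] by simp
  then show ?thesis by (simp add: eq_neg_iff_add_eq_0)
qed

end

lemma scaleC_diff_left: "(c - d) *\<^sub>C x = c *\<^sub>C x - d *\<^sub>C (x::'h::complex_hilbert_space)"
  using scaleC_add_left[of c "- d" x] by (simp add: scaleC_minus_left)

lemma scaleC_cancel: "c *\<^sub>C x = d *\<^sub>C (x::'h::complex_hilbert_space) \<Longrightarrow> x \<noteq> 0 \<Longrightarrow> c = d"
  using norm_scaleC[of "c - d" x] by (simp add: scaleC_diff_left)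

lemma bounded_linear_scaleC: "bounded_linear (\<lambda>x. c *\<^sub>C (x::'h::complex_hilbert_space))"
proof (rule bounded_linear_intro)
  show "c *\<^sub>C (x + y) = c *\<^sub>C x + c *\<^sub>C y" for x y :: 'h by (rule scaleC_add_right)
  show "c *\<^sub>C r *\<^sub>R x = r *\<^sub>R c *\<^sub>C x" for r and x :: 'h
    by (simp add: scaleC_of_real[symmetric] scaleC_scaleC mult.commute)
  show "norm (c *\<^sub>C x) \<le> norm x * cmod c" for x :: 'h by (simp add: norm_scaleC mult.commute)
qed

text \<open>A complex number vanishes when its real part and that of its product with
  \<open>\<i>\<close> vanish, which reduces the claim to the continuous real inner product.\<close>

lemma closed_cinner_zero: "closed {x. cinner \<xi> x = (0::complex)}" for \<xi> :: "'h::complex_hilbert_space"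
proof -
  have "cinner \<xi> x = 0 \<longleftrightarrow> inner \<xi> x = 0 \<and> inner (\<i> *\<^sub>C \<xi>) x = 0" for x
    unfolding Re_cinner[symmetric] cinner_scaleC_left by (simp add: complex_eq_iff)
  then have "{x. cinner \<xi> x = 0} = {x. inner \<xi> x = 0} \<inter> {x. inner (\<i> *\<^sub>C \<xi>) x = 0}" by auto
  then show ?thesis by (simp add: closed_Int closed_Collect_eq continuous_on_inner continuous_on_const continuous_on_id)
qed

lemma orthogonal_closure_span:
  assumes "\<And>x. x \<in> S \<Longrightarrow> cinner \<xi> x = 0" "y \<in> closure (cspan S)"
  shows "cinner \<xi> (y::'h::complex_hilbert_space) = 0"
proof -
  have "cinner \<xi> x = 0" if "x \<in> cspan S" for x
    using that
    by (induction rule: complex_vector.span_induct_alt)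
      (simp_all add: cinner_zero_right cinner_add_right cinner_scaleC_right assms(1))
  then have "cspan S \<subseteq> {x. cinner \<xi> x = 0}" by blast
  then have "closure (cspan S) \<subseteq> {x. cinner \<xi> x = 0}"
    using closed_cinner_zero closure_minimal by blast
  then show ?thesis using assms(2) by blast
qed

lemma orthogonal_dense_zero:
  assumes "\<And>x. x \<in> S \<Longrightarrow> cinner \<xi> x = 0" "closure (cspan S) = UNIV"
  shows "\<xi> = (0::'h::complex_hilbert_space)"
proof -
  have "cinner \<xi> \<xi> = 0" by (rule orthogonal_closure_span[of S]) (simp_all add: assms)
  then show ?thesis by (simp add: cinner_self_zero)
qed

text \<open>A Gram-Schmidt step: the part \<open>d\<close> of the new vector orthogonal to the old
  span contributes one further component to the projection of \<open>x\<close>.\<close>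

lemma finite_projection:
  assumes "finite B"
  shows "\<exists>y\<in>cspan B. \<forall>b\<in>cspan B. cinner b (x - y) = (0::complex)"
  using assms
proof (induction B arbitrary: x rule: finite_induct)
  case empty
  then show ?case by (auto simp: cinner_zero_right cinner_scaleC_left complex_vector.span_empty intro!: bexI[of _ 0])
      (metis cinner_commute cinner_zero_right complex_cnj_zero)
next
  case (insert a B)
  let ?sp = "cspan"
  obtain p where p: "p \<in> ?sp B" "\<And>b. b \<in> ?sp B \<Longrightarrow> cinner b (a - p) = 0" using insert.IH[of a] by blast
  obtain q where q: "q \<in> ?sp B" "\<And>b. b \<in> ?sp B \<Longrightarrow> cinner b (x - q) = 0" using insert.IH[of x] by blast
  define d where "d = a - p"
  define t where "t = (if d = 0 then 0 else cinner d (x - q) / cinner d d)"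
  define y where "y = q + t *\<^sub>C d"
  have sub: "?sp B \<subseteq> ?sp (insert a B)" by (rule complex_vector.span_mono) blast
  have a: "a \<in> ?sp (insert a B)" by (rule complex_vector.span_base) simp
  have d: "d \<in> ?sp (insert a B)" unfolding d_def using a p(1) sub by (blast intro: complex_vector.span_diff)
  have y: "y \<in> ?sp (insert a B)" unfolding y_def
    using q(1) sub d by (blast intro: complex_vector.span_add complex_vector.span_scale)
  have dz: "cinner d (x - y) = 0"
  proof (cases "d = 0")
    case True
    then show ?thesis by (metis cinner_commute cinner_zero_right complex_cnj_zero)
  next
    case False
    have "x - y = (x - q) - t *\<^sub>C d" by (simp add: y_def)
    then have "cinner d (x - y) = cinner d (x - q) - t * cinner d d"
      by (simp only: cinner_diff_right[of d "x - q"] cinner_scaleC_right)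
    then show ?thesis using False by (simp add: t_def cinner_self_zero)
  qed
  have bz: "cinner b (x - y) = 0" if "b \<in> ?sp B" for b :: 'a
  proof -
    have "x - y = (x - q) - t *\<^sub>C d" by (simp add: y_def)
    then have "cinner b (x - y) = cinner b (x - q) - t * cinner b d"
      by (simp only: cinner_diff_right[of b "x - q"] cinner_scaleC_right)
    then show ?thesis using p(2)[OF that] q(2)[OF that] by (simp add: d_def)
  qed
  have "cinner b (x - y) = 0" if b: "b \<in> ?sp (insert a B)" for b
  proof -
    obtain k where k: "b - k *\<^sub>C a \<in> ?sp B"
      using b complex_vector.span_breakdown_eq[of b a B] by blast
    have "b - k *\<^sub>C a + k *\<^sub>C p \<in> ?sp B" 
      by (rule complex_vector.span_add[OF k complex_vector.span_scale[OF p(1)]])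
    from bz[OF this] have "cinner (b - k *\<^sub>C d) (x - y) = 0" by (simp add: d_def scaleC_diff algebra_simps)
    then have "cinner (b - k *\<^sub>C d) (x - y) + cinner (k *\<^sub>C d) (x - y) = 0" using dz by (simp add: cinner_scaleC_left)
    then show ?thesis unfolding cinner_add_left[symmetric] by simp
  qed
  then show ?case using y by blast
qed

text \<open>\<open>finite_dimensional\<close> asks only for containment in a finite span. A maximal
  independent subset of \<open>W\<close> spans \<open>W\<close> itself, and the exchange bound makes
  it finite.\<close>

lemma finite_dimensional_span:
  assumes "csubspace W" "finite_dimensional W"
  shows "\<exists>B. finite B \<and> cspan B = (W :: 'h::complex_hilbert_space set)"
proof -
  obtain C where C: "finite C" "W \<subseteq> cspan C" using assms(2) unfolding finite_dimensional_def by blast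
  obtain B where B: "B \<subseteq> W" "complex_vector.independent B" "W \<subseteq> cspan B"
    using complex_vector.maximal_independent_subset[of W] by blast
  have "finite B" using complex_vector.independent_span_bound[OF C(1) B(2)] B(1) C(2) by blast
  moreover have "cspan B \<subseteq> W" using complex_vector.span_minimal[OF B(1) assms(1)] .
  ultimately show ?thesis using B(3) by blast
qed

lemma subspace_projection:
  assumes "csubspace W" "finite_dimensional W"
  shows "\<exists>y\<in>W. \<forall>b\<in>W. cinner b (x - y) = (0::complex)"
proof -
  obtain B where B: "finite B" "cspan B = W" using finite_dimensional_span[OF assms] by blast
  from finite_projection[OF B(1), of x] show ?thesis unfolding B(2) .
qed

section \<open>Unitary operators and phases\<close>

lemma unitaryD:
  assumes "u \<in> unitaries"
  shows "u (x + y) = u x + u y" "u (c *\<^sub>C x) = c *\<^sub>C u x" "cinner (u x) (u y) = cinner x y" "surj u"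
    "norm (u x) = norm x" "u (x - y) = u x - u y" "inj u" "bij u"
proof -
  have u: "\<And>x y. u (x + y) = u x + u y" "\<And>c x. u (c *\<^sub>C x) = c *\<^sub>C u x" "\<And>x y. cinner (u x) (u y) = cinner x y" "surj u"
    using assms unfolding unitary_group_def by auto
  show "u (x + y) = u x + u y" "u (c *\<^sub>C x) = c *\<^sub>C u x" "cinner (u x) (u y) = cinner x y" "surj u"
    by (rule u)+
  have n: "norm (u x) = norm x" for x
  proof -
    have "complex_of_real ((norm (u x))\<^sup>2) = complex_of_real ((norm x)\<^sup>2)" using u(3)[of x x] unfolding cinner_self .
    then show ?thesis by (simp only: of_real_eq_iff power2_eq_iff_nonneg[OF norm_ge_zero norm_ge_zero])
  qed
  show "norm (u x) = norm x" by (rule n)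
  have d: "u (x - y) = u x - u y" for x y using u(1)[of "x - y" y] by simp
  show "u (x - y) = u x - u y" by (rule d)
  show i: "inj u"
  proof (rule injI)
    fix x y assume "u x = u y"
    then have "norm (u (x - y)) = 0" unfolding d by simp
    then show "x = y" unfolding n by simp
  qed
  show "bij u" using i u(4) by (simp add: bij_def)
qed

lemma unitary_mult: "u \<otimes>\<^bsub>unitary_group\<^esub> v = u \<circ> v" and unitary_one: "\<one>\<^bsub>unitary_group\<^esub> = id"
  unfolding unitary_group_def by simp_all

lemma unitary_comp: "u \<in> unitaries \<Longrightarrow> v \<in> unitaries \<Longrightarrow> u \<circ> v \<in> unitaries"
  unfolding unitary_group_def using comp_surj[of v u] by auto

lemma unitary_id: "id \<in> unitaries"
  unfolding unitary_group_def by simp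

lemma unitary_inv:
  assumes u: "u \<in> unitaries" shows "inv_into UNIV u \<in> unitaries"
proof -
  let ?v = "inv_into UNIV u"
  note d = unitaryD[OF u]
  have uv: "u (?v x) = x" for x by (rule surj_f_inv_f[OF d(4)])
  have vu: "?v (u x) = x" for x by (rule inv_f_f[OF d(7)])
  have "?v (x + y) = ?v x + ?v y" for x y
    using vu[of "?v x + ?v y"] unfolding d(1) uv .
  moreover have "?v (c *\<^sub>C x) = c *\<^sub>C ?v x" for c x
    using vu[of "c *\<^sub>C ?v x"] unfolding d(2) uv .
  moreover have "cinner (?v x) (?v y) = cinner x y" for x y
    using d(3)[of "?v x" "?v y"] unfolding uv by simp
  moreover have "surj ?v" using vu by (rule surjI)
  ultimately show ?thesis unfolding unitary_group_def by simp
qed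

lemma group_unitary_group: "group (unitary_group :: ('h::complex_hilbert_space \<Rightarrow> 'h) monoid)"
proof (rule groupI)
  fix u v w :: "'h \<Rightarrow> 'h"
  show "u \<otimes>\<^bsub>unitary_group\<^esub> v \<in> unitaries" if "u \<in> unitaries" "v \<in> unitaries"
    unfolding unitary_mult by (rule unitary_comp[OF that])
  show "u \<otimes>\<^bsub>unitary_group\<^esub> v \<otimes>\<^bsub>unitary_group\<^esub> w = u \<otimes>\<^bsub>unitary_group\<^esub> (v \<otimes>\<^bsub>unitary_group\<^esub> w)"
    unfolding unitary_mult by (rule o_assoc[symmetric])
  show "\<one>\<^bsub>unitary_group\<^esub> \<otimes>\<^bsub>unitary_group\<^esub> u = u" unfolding unitary_mult unitary_one by simp
  show "\<exists>v\<in>unitaries. v \<otimes>\<^bsub>unitary_group\<^esub> u = \<one>\<^bsub>unitary_group\<^esub>" if u: "u \<in> unitaries"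
    by (rule bexI[OF _ unitary_inv[OF u]]) (simp add: unitary_mult unitary_one inv_o_cancel[OF unitaryD(7)[OF u]])
qed (simp add: unitary_one unitary_id)

lemma unitary_scaleC:
  assumes "c \<in> sphere 0 1" shows "(\<lambda>x. c *\<^sub>C x) \<in> unitaries"
proof -
  have c: "cmod c = 1" using assms by simp
  have c0: "c \<noteq> 0" using c by auto
  have cc: "cnj c * c = 1" using c complex_norm_square[of c] by (simp add: mult.commute)
  have "surj (\<lambda>x. c *\<^sub>C x)"
    by (rule surjI[of _ "\<lambda>x. inverse c *\<^sub>C x"]) (simp add: scaleC_scaleC scaleC_one c0)
  then show ?thesis unfolding unitary_group_def
    using cc by (auto simp: scaleC_add_right scaleC_scaleC mult.commute cinner_scaleC_left cinner_scaleC_right mult.assoc[symmetric])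
qed

lemma phases_iff: "p \<in> phases \<longleftrightarrow> (\<exists>c\<in>sphere 0 1. p = (\<lambda>x. c *\<^sub>C x))"
  unfolding phases_def by auto

lemma class_iff:
  fixes u w :: "'h::complex_hilbert_space \<Rightarrow> 'h"
  shows "w \<in> proj u \<longleftrightarrow> (\<exists>c\<in>sphere 0 1. w = (\<lambda>x. c *\<^sub>C u x))"
proof -
  have "w \<in> proj u \<longleftrightarrow> (\<exists>p\<in>phases. w = p \<circ> u)"
    unfolding projective_class_def r_coset_def unitary_mult by auto
  also have "\<dots> \<longleftrightarrow> (\<exists>c\<in>sphere 0 1. w = (\<lambda>x::'h. c *\<^sub>C x) \<circ> u)"
  proof
    assume "\<exists>p\<in>phases. w = p \<circ> u"
    then obtain p where p: "p \<in> phases" "w = p \<circ> u" by blast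
    then obtain c where "c \<in> sphere 0 1" "p = (\<lambda>x. c *\<^sub>C x)" unfolding phases_iff by blast
    then show "\<exists>c\<in>sphere 0 1. w = (\<lambda>x. c *\<^sub>C x) \<circ> u" using p(2) by blast
  next
    assume "\<exists>c\<in>sphere 0 1. w = (\<lambda>x. c *\<^sub>C x) \<circ> u"
    then obtain c where c: "c \<in> sphere 0 1" "w = (\<lambda>x. c *\<^sub>C x) \<circ> u" by blast
    then have "(\<lambda>x::'h. c *\<^sub>C x) \<in> phases" unfolding phases_iff by blast
    then show "\<exists>p\<in>phases. w = p \<circ> u" using c(2) by blast
  qed
  finally show ?thesis unfolding o_def .
qed

lemma normal_phases: "phases \<lhd> (unitary_group :: ('h::complex_hilbert_space \<Rightarrow> 'h) monoid)"
proof -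
  interpret group "unitary_group :: ('h \<Rightarrow> 'h) monoid" by (rule group_unitary_group)
  have sub: "subgroup phases (unitary_group :: ('h \<Rightarrow> 'h) monoid)"
  proof (rule subgroupI)
    show "phases \<subseteq> unitaries" using unitary_scaleC unfolding phases_def by blast
    show "phases \<noteq> {}" unfolding phases_def by (auto intro!: exI[of _ 1])
  next
    fix p :: "'h \<Rightarrow> 'h" assume "p \<in> phases"
    then obtain c where c: "c \<in> sphere 0 1" "p = (\<lambda>x. c *\<^sub>C x)" unfolding phases_iff by blast
    have c0: "c \<noteq> 0" using c(1) by auto
    have i: "inverse c \<in> sphere 0 1" using c(1) by (simp add: norm_inverse)
    have "inv\<^bsub>unitary_group\<^esub> p = (\<lambda>x. inverse c *\<^sub>C x)"
      by (rule inv_equality)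
        (use c unitary_scaleC[OF c(1)] unitary_scaleC[OF i] c0 in \<open>auto simp: unitary_mult unitary_one o_def scaleC_scaleC scaleC_one id_def\<close>)
    then show "inv\<^bsub>unitary_group\<^esub> p \<in> phases" using i unfolding phases_iff by blast
  next
    fix p q :: "'h \<Rightarrow> 'h" assume "p \<in> phases" "q \<in> phases"
    then obtain c d where c: "c \<in> sphere 0 1" "p = (\<lambda>x. c *\<^sub>C x)" "d \<in> sphere 0 1" "q = (\<lambda>x. d *\<^sub>C x)"
      unfolding phases_iff by blast
    have cd: "c * d \<in> sphere 0 1" using c by (simp add: norm_mult)
    then show "p \<otimes>\<^bsub>unitary_group\<^esub> q \<in> phases"
      unfolding phases_iff unitary_mult c(2,4) o_def scaleC_scaleC by blast
  qed
  show ?thesis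
  proof (rule normalI[OF sub], rule ballI)
    fix u :: "'h \<Rightarrow> 'h" assume u: "u \<in> unitaries"
    show "phases #>\<^bsub>unitary_group\<^esub> u = u <#\<^bsub>unitary_group\<^esub> phases"
      unfolding r_coset_def l_coset_def phases_def unitary_mult
      using unitaryD(2)[OF u] by (auto simp: o_def)
  qed
qed

lemma PU_mult:
  assumes "u \<in> unitaries" "v \<in> unitaries"
  shows "proj u \<odot> proj v = proj (u \<circ> v)"
  using normal.rcos_sum[OF normal_phases assms]
  unfolding projective_class_def projective_unitary_group_def FactGroup_def unitary_mult by simp

lemma PU_carrier_iff:
  "q \<in> carrier PU \<longleftrightarrow> (\<exists>u\<in>unitaries. q = proj u)"
  unfolding projective_unitary_group_def FactGroup_def RCOSETS_def projective_class_def by auto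

lemma PU_carrier: "u \<in> unitaries \<Longrightarrow> proj u \<in> carrier PU"
  using PU_carrier_iff by blast

lemma group_PU: "group (PU :: ('h::complex_hilbert_space \<Rightarrow> 'h) set monoid)"
  unfolding projective_unitary_group_def by (rule normal.factorgroup_is_group[OF normal_phases])

lemma self_in_class: "u \<in> proj u"
  unfolding class_iff by (rule bexI[of _ 1]) (simp_all add: scaleC_one)

lemma class_eq_iff:
  "proj u = proj v \<longleftrightarrow> (\<exists>c\<in>sphere 0 1. u = (\<lambda>x. c *\<^sub>C v x))"
proof
  assume "proj u = proj v"
  then show "\<exists>c\<in>sphere 0 1. u = (\<lambda>x. c *\<^sub>C v x)" using self_in_class[of u] class_iff by blast
next
  assume "\<exists>c\<in>sphere 0 1. u = (\<lambda>x. c *\<^sub>C v x)"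
  then obtain c where c: "c \<in> sphere 0 1" "u = (\<lambda>x. c *\<^sub>C v x)" by blast
  have c0: "c \<noteq> 0" using c(1) by auto
  have "w \<in> proj u \<longleftrightarrow> w \<in> proj v" for w
  proof
    assume "w \<in> proj u"
    then obtain d where d: "d \<in> sphere 0 1" "w = (\<lambda>x. d *\<^sub>C u x)" unfolding class_iff by blast
    show "w \<in> proj v" unfolding class_iff
      by (rule bexI[of _ "d * c"]) (use c d in \<open>auto simp: scaleC_scaleC norm_mult\<close>)
  next
    assume "w \<in> proj v"
    then obtain d where d: "d \<in> sphere 0 1" "w = (\<lambda>x. d *\<^sub>C v x)" unfolding class_iff by blast
    show "w \<in> proj u" unfolding class_iff
      by (rule bexI[of _ "d / c"]) (use c d c0 in \<open>auto simp: scaleC_scaleC norm_divide\<close>)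
  qed
  then show "proj u = proj v" by blast
qed

lemma class_memD: "u \<in> unitaries \<Longrightarrow> w \<in> proj u
    \<Longrightarrow> w \<in> unitaries \<and> proj w = proj u"
proof -
  assume u: "u \<in> unitaries" and w: "w \<in> proj u"
  obtain c where c: "c \<in> sphere 0 1" "w = (\<lambda>x. c *\<^sub>C u x)" using w unfolding class_iff by blast
  have "w = (\<lambda>x. c *\<^sub>C x) \<circ> u" using c(2) by (simp add: o_def)
  then have "w \<in> unitaries" using unitary_comp[OF unitary_scaleC[OF c(1)] u] by simp
  moreover have "proj w = proj u" unfolding class_eq_iff using c by blast
  ultimately show ?thesis by blast
qed

section \<open>The topology of the projective unitary group\<close>

lemma topspace_unitary: "topspace unitary_topology = unitaries"
  unfolding unitary_topology_def by simp

lemma topspace_quotient: "topspace (quotient_topology X f) = f ` topspace X"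
proof
  show "topspace (quotient_topology X f) \<subseteq> f ` topspace X"
    using openin_topspace[of "quotient_topology X f"] unfolding openin_quotient_topology by blast
  have "{x \<in> topspace X. f x \<in> f ` topspace X} = topspace X" by blast
  then have "openin (quotient_topology X f) (f ` topspace X)" unfolding openin_quotient_topology by simp
  then show "f ` topspace X \<subseteq> topspace (quotient_topology X f)" by (rule openin_subset)
qed

lemma topspace_PU: "topspace projective_unitary_topology = carrier PU"
  unfolding projective_unitary_topology_def topspace_quotient topspace_unitary using PU_carrier_iff by blast

text \<open>Product-open sets restrict only finitely many coordinates, which gives the usual basis
  of the strong operator topology.\<close>

lemma unitary_nhd_basis:
  fixes T :: "('h::complex_hilbert_space \<Rightarrow> 'h) set"
  assumes "open T" "u \<in> T"
  shows "\<exists>X \<epsilon>. finite X \<and> \<epsilon> > 0 \<and> {v. \<forall>x\<in>X. norm (v x - u x) < \<epsilon>} \<subseteq> T"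
proof -
  have "openin (product_topology (\<lambda>i. euclidean) UNIV) T"
    using assms(1) unfolding euclidean_product_topology by simp
  from product_topology_open_contains_basis[OF this assms(2)]
  have "\<exists>Y. u \<in> (\<Pi>\<^sub>E i\<in>UNIV. Y i) \<and> (\<forall>i. open (Y i)) \<and> finite {i. Y i \<noteq> UNIV} \<and> (\<Pi>\<^sub>E i\<in>UNIV. Y i) \<subseteq> T"
    by simp
  then obtain Y where "u \<in> (\<Pi>\<^sub>E i\<in>UNIV. Y i)" and oY: "\<forall>i. open (Y i)" and fY: "finite {i. Y i \<noteq> UNIV}"
    and "(\<Pi>\<^sub>E i\<in>UNIV. Y i) \<subseteq> T" by (elim exE conjE) (rule that; assumption)
  then have uY: "\<And>i. u i \<in> Y i" and YT: "\<And>v. (\<And>i. v i \<in> Y i) \<Longrightarrow> v \<in> T"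
    by (auto simp: PiE_UNIV_domain)
  define X where "X = {i. Y i \<noteq> UNIV}"
  have "\<exists>e>0. ball (u x) e \<subseteq> Y x" for x
    using oY[rule_format, of x] uY[of x] unfolding open_contains_ball by blast
  then obtain e where e: "\<And>x. e x > 0" "\<And>x. ball (u x) (e x) \<subseteq> Y x" by metis
  define \<epsilon> where "\<epsilon> = Min (insert 1 (e ` X))"
  have \<epsilon>: "\<epsilon> > 0" "\<And>x. x \<in> X \<Longrightarrow> \<epsilon> \<le> e x" using fY e(1) by (auto simp: \<epsilon>_def X_def)
  have "v \<in> T" if v: "\<forall>x\<in>X. norm (v x - u x) < \<epsilon>" for v
  proof -
    have "v x \<in> Y x" for x
    proof (cases "x \<in> X")
      case True
      then have "v x \<in> ball (u x) (e x)" using v \<epsilon>(2)[OF True] by (force simp: dist_norm norm_minus_commute)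
      then show ?thesis using e(2) by blast
    qed (simp add: X_def)
    then show ?thesis by (rule YT)
  qed
  then show ?thesis using \<epsilon>(1) fY unfolding X_def[symmetric] by blast
qed

text \<open>The passage to nearby representatives rests on the openness of the quotient map:
  saturating a basic strong neighbourhood by phases gives a union of open sets. The converse follows
  from the neighbourhood basis of the strong topology.\<close>

lemma PU_limit_iff:
  assumes u0: "u0 \<in> unitaries"
  shows "limitin projective_unitary_topology q (proj u0) F \<longleftrightarrow>
    (\<forall>X \<epsilon>. finite X \<longrightarrow> \<epsilon> > 0 \<longrightarrow> (\<forall>\<^sub>F i in F. \<exists>u\<in>unitaries. q i = proj u \<and> (\<forall>x\<in>X. norm (u x - u0 x) < \<epsilon>)))"
proof
  assume lim: "limitin projective_unitary_topology q (proj u0) F"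
  show "\<forall>X \<epsilon>. finite X \<longrightarrow> \<epsilon> > 0 \<longrightarrow> (\<forall>\<^sub>F i in F. \<exists>u\<in>unitaries. q i = proj u \<and> (\<forall>x\<in>X. norm (u x - u0 x) < \<epsilon>))"
  proof (intro allI impI)
    fix X :: "'a set" and \<epsilon> :: real assume X: "finite X" and \<epsilon>: "\<epsilon> > 0"
    define N where "N = proj ` {u \<in> unitaries. \<forall>x\<in>X. norm (u x - u0 x) < \<epsilon>}"
    have pre: "{u \<in> unitaries. proj u \<in> N} =
      unitaries \<inter> (\<Union>c\<in>sphere 0 1. \<Inter>x\<in>X. {u. norm (c *\<^sub>C u x - u0 x) < \<epsilon>})" (is "?L = ?R")
    proof
      show "?L \<subseteq> ?R"
      proof
        fix u assume u: "u \<in> ?L"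
        then obtain v where v: "v \<in> unitaries" "\<forall>x\<in>X. norm (v x - u0 x) < \<epsilon>" "proj v = proj u"
          unfolding N_def by auto
        obtain c where "c \<in> sphere 0 1" "v = (\<lambda>x. c *\<^sub>C u x)" using v(3) unfolding class_eq_iff by blast
        then show "u \<in> ?R" using u v(2) by auto
      qed
      show "?R \<subseteq> ?L"
      proof
        fix u assume "u \<in> ?R"
        then obtain c where c: "u \<in> unitaries" "c \<in> sphere 0 1" "\<forall>x\<in>X. norm (c *\<^sub>C u x - u0 x) < \<epsilon>" by auto
        let ?v = "\<lambda>x. c *\<^sub>C u x"
        have "?v = (\<lambda>x. c *\<^sub>C x) \<circ> u" by (simp add: o_def)
        then have v: "?v \<in> unitaries" using unitary_comp[OF unitary_scaleC[OF c(2)] c(1)] by simp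
        have e: "proj ?v = proj u" unfolding class_eq_iff using c(2) by blast
        have "proj ?v \<in> N" unfolding N_def by (rule imageI) (use v c(3) in simp)
        then show "u \<in> ?L" using c(1) e by simp
      qed
    qed
    have ev: "continuous_on UNIV (\<lambda>u. norm (c *\<^sub>C u x - u0 x))" for c x
      by (intro continuous_on_norm continuous_on_diff continuous_on_const
          continuous_on_compose2[OF linear_continuous_on[OF bounded_linear_scaleC] continuous_on_product_coordinates]) auto
    have op: "open (\<Union>c\<in>sphere 0 1. \<Inter>x\<in>X. {u. norm (c *\<^sub>C u x - u0 x) < \<epsilon>})"
      by (intro open_UN ballI open_INT X open_Collect_less[OF ev continuous_on_const])
    have "N \<subseteq> proj ` unitaries" unfolding N_def by blast
    then have "openin projective_unitary_topology N"
      unfolding projective_unitary_topology_def openin_quotient_topology topspace_unitary pre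
      unfolding unitary_topology_def using op by (simp add: openin_open_Int)
    moreover have "proj u0 \<in> N" unfolding N_def by (rule imageI) (use u0 \<epsilon> in simp)
    ultimately have "\<forall>\<^sub>F i in F. q i \<in> N" by (rule limitinD[OF lim])
    then show "\<forall>\<^sub>F i in F. \<exists>u\<in>unitaries. q i = proj u \<and> (\<forall>x\<in>X. norm (u x - u0 x) < \<epsilon>)"
      by (rule eventually_mono) (auto simp: N_def)
  qed
next
  assume R: "\<forall>X \<epsilon>. finite X \<longrightarrow> \<epsilon> > 0 \<longrightarrow> (\<forall>\<^sub>F i in F. \<exists>u\<in>unitaries. q i = proj u \<and> (\<forall>x\<in>X. norm (u x - u0 x) < \<epsilon>))"
  show "limitin projective_unitary_topology q (proj u0) F"
    unfolding limitin_def topspace_PU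
  proof (intro conjI allI impI PU_carrier[OF u0])
    fix W assume W: "openin projective_unitary_topology W \<and> proj u0 \<in> W"
    then have "openin unitary_topology {u \<in> unitaries. proj u \<in> W}"
      unfolding projective_unitary_topology_def openin_quotient_topology topspace_unitary by blast
    then obtain T where T: "open T" "{u \<in> unitaries. proj u \<in> W} = unitaries \<inter> T"
      unfolding unitary_topology_def openin_open by blast
    have "u0 \<in> T" using T(2) W u0 by blast
    from unitary_nhd_basis[OF T(1) this] obtain X \<epsilon> where X: "finite X" "\<epsilon> > 0" "{v. \<forall>x\<in>X. norm (v x - u0 x) < \<epsilon>} \<subseteq> T"
      by blast
    show "\<forall>\<^sub>F i in F. q i \<in> W"
      using R[rule_format, OF X(1,2)]
    proof eventually_elim
      case (elim i)
      then obtain u where u: "u \<in> unitaries" "q i = proj u" "\<forall>x\<in>X. norm (u x - u0 x) < \<epsilon>" by blast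
      then have "u \<in> {u \<in> unitaries. proj u \<in> W}" using X(3) unfolding T(2) by blast
      then show ?case using u(2) by simp
    qed
  qed
qed

text \<open>Multiplication is jointly continuous in the strong topology because the operators are
  isometric: the change of the product splits into \<open>a (b x - v x)\<close>, of the norm of
  \<open>b x - v x\<close>, and the change of the first factor at the fixed vector
  \<open>v x\<close>.\<close>

lemma PU_limit_mult:
  assumes u: "u \<in> unitaries" and v: "v \<in> unitaries"
    and q: "limitin projective_unitary_topology q (proj u) F"
    and r: "limitin projective_unitary_topology r (proj v) F"
  shows "limitin projective_unitary_topology (\<lambda>i. q i \<odot> r i) (proj (u \<circ> v)) F"
  unfolding PU_limit_iff[OF unitary_comp[OF u v]]
proof (intro allI impI)
  fix X :: "'a set" and \<epsilon> :: real assume X: "finite X" and \<epsilon>: "\<epsilon> > 0"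
  have fin: "finite (v ` X)" and e2: "\<epsilon>/2 > 0" using X \<epsilon> by auto
  show "\<forall>\<^sub>F i in F. \<exists>w\<in>unitaries. q i \<odot> r i = proj w \<and>
      (\<forall>x\<in>X. norm (w x - (u \<circ> v) x) < \<epsilon>)"
    using q[unfolded PU_limit_iff[OF u], rule_format, OF fin e2] r[unfolded PU_limit_iff[OF v], rule_format, OF X e2]
  proof eventually_elim
    case (elim i)
    obtain a where a: "a \<in> unitaries" "q i = proj a" "\<forall>x\<in>v ` X. norm (a x - u x) < \<epsilon>/2"
      using elim(1) by blast
    obtain b where b: "b \<in> unitaries" "r i = proj b" "\<forall>x\<in>X. norm (b x - v x) < \<epsilon>/2"
      using elim(2) by blast
    have "norm ((a \<circ> b) x - (u \<circ> v) x) < \<epsilon>" if x: "x \<in> X" for x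
    proof -
      have "(a \<circ> b) x - (u \<circ> v) x = a (b x - v x) + (a (v x) - u (v x))" by (simp add: unitaryD(6)[OF a(1)])
      then have "norm ((a \<circ> b) x - (u \<circ> v) x) \<le> norm (b x - v x) + norm (a (v x) - u (v x))"
        using norm_triangle_ineq[of "a (b x - v x)"] unitaryD(5)[OF a(1)] by metis
      moreover have "norm (b x - v x) < \<epsilon>/2" "norm (a (v x) - u (v x)) < \<epsilon>/2" using a(3) b(3) x by auto
      ultimately show ?thesis by linarith
    qed
    then show ?case using unitary_comp[OF a(1) b(1)] PU_mult[OF a(1) b(1)] a(2) b(2) by (intro bexI[of _ "a \<circ> b"]) auto
  qed
qed

lemma continuous_map_PU_mult:
  assumes "continuous_map X projective_unitary_topology f" "continuous_map X projective_unitary_topology g"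
  shows "continuous_map X projective_unitary_topology (\<lambda>x. f x \<odot> g x)"
  unfolding continuous_map_atin
proof
  fix x assume x: "x \<in> topspace X"
  have "f x \<in> carrier PU" "g x \<in> carrier PU"
    using x assms continuous_map_image_subset_topspace[of X projective_unitary_topology] unfolding topspace_PU by blast+
  then obtain u v where u: "u \<in> unitaries" "f x = proj u" and v: "v \<in> unitaries" "g x = proj v"
    unfolding PU_carrier_iff by blast
  have "limitin projective_unitary_topology f (proj u) (atin X x)" "limitin projective_unitary_topology g (proj v) (atin X x)"
    using assms x unfolding continuous_map_atin u(2)[symmetric] v(2)[symmetric] by blast+
  from PU_limit_mult[OF u(1) v(1) this]
  show "limitin projective_unitary_topology (\<lambda>x. f x \<odot> g x) (f x \<odot> g x) (atin X x)"
    unfolding u(2) v(2) PU_mult[OF u(1) v(1)] .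
qed

lemma continuous_map_class: "continuous_map unitary_topology projective_unitary_topology proj"
  unfolding continuous_map_def projective_unitary_topology_def topspace_quotient openin_quotient_topology by auto

lemma continuous_map_unitary_iff:
  "continuous_map (top_of_set S) unitary_topology V \<longleftrightarrow>
    V ` S \<subseteq> unitaries \<and> (\<forall>x. continuous_on S (\<lambda>z. V z x))"
proof -
  have "continuous_on S V \<longleftrightarrow> (\<forall>x. continuous_on S (\<lambda>z. V z x))"
    using continuous_on_coordinatewise_then_product[of S V] continuous_on_product_then_coordinatewise[of S V] by blast
  then show ?thesis unfolding unitary_topology_def by (auto simp: image_subset_iff_funcset)
qed

section \<open>Energy decompositions\<close>

lemma unitary_bounded_linear:
  assumes "u \<in> unitaries" shows "bounded_linear u"
proof (rule bounded_linear_intro)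
  show "u (x + y) = u x + u y" for x y by (rule unitaryD(1)[OF assms])
  show "u (r *\<^sub>R x) = r *\<^sub>R u x" for r x
    unfolding scaleC_of_real[symmetric] by (rule unitaryD(2)[OF assms])
  show "norm (u x) \<le> norm x * 1" for x using unitaryD(5)[OF assms, of x] by simp
qed

lemma hom_circleD:
  assumes "U \<in> hom circle_group (unitary_group :: ('h::complex_hilbert_space \<Rightarrow> 'h) monoid)"
  shows "z \<in> sphere 0 1 \<Longrightarrow> U z \<in> unitaries"
    "z \<in> sphere 0 1 \<Longrightarrow> w \<in> sphere 0 1 \<Longrightarrow> U (z * w) = U z \<circ> U w"
    "U 1 = id"
    "U (cis \<theta>) \<in> unitaries"
    "U (cis (s + t)) x = U (cis s) (U (cis t) x)"
proof -
  have u: "U z \<in> unitaries" if "z \<in> sphere 0 1" for z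
    using assms that unfolding hom_def circle_group_def by auto
  have m: "U (z * w) = U z \<circ> U w" if "z \<in> sphere 0 1" "w \<in> sphere 0 1" for z w
    using assms that unfolding hom_def circle_group_def unitary_mult by auto
  show "z \<in> sphere 0 1 \<Longrightarrow> U z \<in> unitaries"
    "z \<in> sphere 0 1 \<Longrightarrow> w \<in> sphere 0 1 \<Longrightarrow> U (z * w) = U z \<circ> U w"
    by (rule u m; assumption)+
  show "U (cis \<theta>) \<in> unitaries" by (rule u) simp
  show "U (cis (s + t)) x = U (cis s) (U (cis t) x)"
    using m[of "cis s" "cis t"] by (simp add: cis_mult)
  show "U 1 = id"
  proof
    fix x
    have "U 1 (U 1 x) = U 1 x" using m[of 1 1] by (simp add: fun_eq_iff)
    then show "U 1 x = id x" using unitaryD(7)[OF u[of 1]] by (simp add: inj_eq)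
  qed
qed

lemma energy_spaceD: "x \<in> energy_space U n \<Longrightarrow> U (cis \<theta>) x = cis (of_int n * \<theta>) *\<^sub>C x"
  unfolding energy_space_def by blast

lemma subspace_energy_space:
  assumes "\<And>\<theta>. U (cis \<theta>) \<in> unitaries"
  shows "csubspace (energy_space U n)" "closed (energy_space U n)"
proof -
  have bl: "bounded_linear (U (cis \<theta>))" for \<theta> by (rule unitary_bounded_linear[OF assms])
  show "csubspace (energy_space U n)"
  proof (rule complex_vector.subspaceI)
    show "0 \<in> energy_space U n"
      unfolding energy_space_def by (auto simp: scaleC_zero linear_simps(3)[OF bl])
  next
    fix x y assume "x \<in> energy_space U n" "y \<in> energy_space U n"
    then show "x + y \<in> energy_space U n"
      unfolding energy_space_def by (auto simp: unitaryD(1)[OF assms] scaleC_add_right)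
  next
    fix c x assume "x \<in> energy_space U n"
    then show "c *\<^sub>C x \<in> energy_space U n"
      unfolding energy_space_def by (auto simp: unitaryD(2)[OF assms] scaleC_scaleC mult.commute)
  qed
  have "energy_space U n = (\<Inter>\<theta>. {x. U (cis \<theta>) x = cis (of_int n * \<theta>) *\<^sub>C x})"
    unfolding energy_space_def by auto
  then show "closed (energy_space U n)"
    by (simp add: closed_INT closed_Collect_eq linear_continuous_on bl bounded_linear_scaleC)
qed

lemma energy_space_orthogonal:
  assumes "\<And>\<theta>. U (cis \<theta>) \<in> unitaries" "x \<in> energy_space U n" "y \<in> energy_space U m" "n \<noteq> m"
  shows "cinner x y = 0"
proof -
  \<comment> \<open>At this angle the two eigenvalues differ by the factor -1, so invariance of the
    inner product forces it to vanish.\<close>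
  define \<theta> where "\<theta> = pi / (of_int m - of_int n)"
  have t: "- (of_int n * \<theta>) + of_int m * \<theta> = pi"
  proof -
    have "real_of_int m - real_of_int n \<noteq> 0" using assms(4) by simp
    then have "(of_int m - of_int n) * \<theta> = pi" unfolding \<theta>_def by simp
    then show ?thesis by (simp add: left_diff_distrib)
  qed
  have "cinner x y = cinner (U (cis \<theta>) x) (U (cis \<theta>) y)" using unitaryD(3)[OF assms(1)] by simp
  also have "\<dots> = cis (- (of_int n * \<theta>)) * cis (of_int m * \<theta>) * cinner x y"
    by (simp add: energy_spaceD[OF assms(2)] energy_spaceD[OF assms(3)] cinner_scaleC_left cinner_scaleC_right cis_cnj)
  also have "\<dots> = - cinner x y" unfolding cis_mult t by simp
  finally have e: "cinner x y = - cinner x y" .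
  from arg_cong[OF e, of "\<lambda>t. t + cinner x y"] show ?thesis by simp
qed

text \<open>Energy spaces of unitaries are automatically closed subspaces and mutually orthogonal,
  so density is the condition left to check.\<close>

lemma energy_direct_sum_iff:
  assumes "\<And>\<theta>. U (cis \<theta>) \<in> unitaries"
  shows "hilbert_direct_sum I (energy_space U) \<longleftrightarrow> closure (cspan (\<Union>i\<in>I. energy_space U i)) = UNIV"
  unfolding hilbert_direct_sum_def
  by (intro iffI; (elim conjE)?; (intro conjI ballI impI)?)
    (simp_all add: subspace_energy_space[where U=U, OF assms] energy_space_orthogonal[where U=U, OF assms])

text \<open>A nonzero vector cannot be orthogonal to all energy spaces. Comparing its eigenvalue
  with that of an energy vector not orthogonal to it, through invariance of their inner product,
  identifies the two.\<close>

lemma eigenvector_energy: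
  assumes U: "\<And>\<theta>. U (cis \<theta>) \<in> unitaries"
    and sum: "hilbert_direct_sum {n0..} (energy_space U)"
    and nz: "\<xi> \<noteq> 0" and ev: "\<And>\<theta>. U (cis \<theta>) \<xi> = f \<theta> *\<^sub>C \<xi>"
  shows "\<exists>n\<ge>n0. \<forall>\<theta>. f \<theta> = cis (of_int n * \<theta>)"
proof -
  let ?S = "\<Union>n\<in>{n0..}. energy_space U n"
  have "\<exists>x\<in>?S. cinner \<xi> x \<noteq> 0"
  proof (rule ccontr)
    assume z: "\<not> (\<exists>x\<in>?S. cinner \<xi> x \<noteq> 0)"
    have "\<xi> = 0"
    proof (rule orthogonal_dense_zero[of ?S])
      show "closure (cspan ?S) = UNIV"
        using sum unfolding hilbert_direct_sum_def by (elim conjE)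
      show "cinner \<xi> x = 0" if x: "x \<in> ?S" for x using z x by (rule_tac ccontr) (rule notE, assumption, rule bexI)
    qed
    then show False using nz by simp
  qed
  then obtain x where xS: "x \<in> ?S" "cinner \<xi> x \<noteq> 0" by (elim bexE) (rule that)
  obtain n where n: "n \<ge> n0" and xn: "x \<in> energy_space U n" using xS(1) by auto
  note x = xn xS(2)
  have "f \<theta> = cis (of_int n * \<theta>)" for \<theta>
  proof -
    have "cinner \<xi> x = cinner (U (cis \<theta>) \<xi>) (U (cis \<theta>) x)" using unitaryD(3)[OF U] by simp
    also have "\<dots> = cnj (f \<theta>) * cis (of_int n * \<theta>) * cinner \<xi> x"
      unfolding ev energy_spaceD[OF x(1)] cinner_scaleC_left cinner_scaleC_right by simp
    finally have "cnj (f \<theta>) * cis (of_int n * \<theta>) = 1" using x(2) by simp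
    then have "cnj (cnj (f \<theta>) * cis (of_int n * \<theta>)) = 1" by simp
    then have "f \<theta> * cis (- (of_int n * \<theta>)) * cis (of_int n * \<theta>) = cis (of_int n * \<theta>)" by (simp add: cis_cnj)
    then show ?thesis by (simp add: mult.assoc cis_mult)
  qed
  then show ?thesis using n by blast
qed

lemma span_image_subset:
  assumes "u \<in> unitaries"
  shows "u ` cspan S \<subseteq> cspan (u ` S)"
proof
  fix y assume "y \<in> u ` cspan S"
  then obtain x where x: "x \<in> cspan S" "y = u x" by blast
  have "u x \<in> cspan (u ` S)" using x(1)
  proof (induction rule: complex_vector.span_induct_alt)
    case base
    have "u 0 = 0" using unitaryD(5)[OF assms, of 0] by simp
    then show ?case by (simp add: complex_vector.span_zero)
  next
    case (step c x y)
    then show ?case unfolding unitaryD(1,2)[OF assms]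
      by (intro complex_vector.span_add[OF complex_vector.span_scale[OF complex_vector.span_base[OF imageI]]])
  qed
  then show "y \<in> cspan (u ` S)" using x(2) by simp
qed

lemma energy_conjugate:
  fixes U :: "complex \<Rightarrow> 'h \<Rightarrow> 'h::complex_hilbert_space"
  assumes U: "U \<in> hom circle_group unitary_group" and P: "P \<in> unitaries"
    and V: "V = (\<lambda>z. inv_into UNIV P \<circ> U z \<circ> P)"
    and sum: "hilbert_direct_sum I (energy_space U)"
    and fin: "\<And>n. n \<in> I \<Longrightarrow> finite_dimensional (energy_space U n)"
  shows "V \<in> hom circle_group unitary_group" "hilbert_direct_sum I (energy_space V)"
    "\<And>n. n \<in> I \<Longrightarrow> finite_dimensional (energy_space V n)"
proof -
  let ?Q = "inv_into UNIV P"
  have Q: "?Q \<in> unitaries" by (rule unitary_inv[OF P])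
  have PQ: "P (?Q x) = x" for x by (rule surj_f_inv_f[OF unitaryD(4)[OF P]])
  have QP: "?Q (P x) = x" for x by (rule inv_f_f[OF unitaryD(7)[OF P]])
  have Vc: "V z \<in> unitaries" if "z \<in> sphere 0 1" for z
    unfolding V by (intro unitary_comp Q P hom_circleD(1)[OF U that])
  show hom: "V \<in> hom circle_group unitary_group"
  proof (rule homI)
    show "V z \<in> unitaries" if "z \<in> carrier circle_group" for z
      using Vc that unfolding circle_group_def by simp
    show "V (z \<otimes>\<^bsub>circle_group\<^esub> w) = V z \<otimes>\<^bsub>unitary_group\<^esub> V w"
      if "z \<in> carrier circle_group" "w \<in> carrier circle_group" for z w
      using that hom_circleD(2)[OF U, of z w] unfolding circle_group_def unitary_mult V
      by (simp add: fun_eq_iff PQ)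
  qed
  have Vcis: "\<And>\<theta>. V (cis \<theta>) \<in> unitaries" by (rule Vc) simp
  have E: "energy_space V n = ?Q ` energy_space U n" for n
  proof
    show "energy_space V n \<subseteq> ?Q ` energy_space U n"
    proof
      fix x assume x: "x \<in> energy_space V n"
      have "U (cis \<theta>) (P x) = cis (of_int n * \<theta>) *\<^sub>C P x" for \<theta>
        using arg_cong[OF energy_spaceD[OF x, of \<theta>], of P] unfolding V unitaryD(2)[OF P] by (simp add: PQ)
      then have "P x \<in> energy_space U n" unfolding energy_space_def by blast
      then show "x \<in> ?Q ` energy_space U n" using QP by (metis image_eqI)
    qed
    show "?Q ` energy_space U n \<subseteq> energy_space V n"
      by (auto simp: energy_space_def V PQ unitaryD(2)[OF Q])
  qed
  let ?S = "\<Union>i\<in>I. energy_space U i" and ?T = "\<Union>i\<in>I. energy_space V i"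
  have "?Q ` cspan ?S \<subseteq> cspan (?Q ` ?S)" by (rule span_image_subset[OF Q])
  also have "?Q ` ?S = ?T" by (simp only: E image_UN)
  also have "cspan ?T \<subseteq> closure (cspan ?T)" by (rule closure_subset)
  finally have 1: "cspan ?S \<subseteq> ?Q -` closure (cspan ?T)"
    by (simp only: image_subset_iff_subset_vimage)
  have "closed (?Q -` closure (cspan ?T))"
    by (rule continuous_closed_vimage[OF closed_closure])
      (rule allI[OF linear_continuous_at[OF unitary_bounded_linear[OF Q]]] linear_continuous_at[OF unitary_bounded_linear[OF Q]])
  from closure_minimal[OF 1 this] have "?Q -` closure (cspan ?T) = UNIV"
    using sum unfolding hilbert_direct_sum_def by (elim conjE) (simp only: top.extremum_unique)
  then have "?Q (P x) \<in> closure (cspan ?T)" for x by (simp only: set_eq_iff vimage_eq UNIV_I simp_thms)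
  then have "closure (cspan ?T) = UNIV" unfolding QP by (simp only: set_eq_iff UNIV_I simp_thms)
  then show "hilbert_direct_sum I (energy_space V)" unfolding energy_direct_sum_iff[where U=V, OF Vcis] .
  show "finite_dimensional (energy_space V n)" if n: "n \<in> I" for n
  proof -
    obtain B where B: "finite B" "energy_space U n \<subseteq> cspan B"
      using fin[OF n] unfolding finite_dimensional_def by blast
    have "energy_space V n \<subseteq> cspan (?Q ` B)"
      unfolding E by (rule order_trans[OF image_mono[OF B(2)] span_image_subset[OF Q]])
    then show ?thesis using B(1) unfolding finite_dimensional_def by (intro exI[of _ "?Q ` B"]) simp
  qed
qed

section \<open>Joint energies of two commuting circle representations\<close>

locale commuting_energies =
  fixes U U' :: "complex \<Rightarrow> 'h \<Rightarrow> 'h::complex_hilbert_space" and n0 m0 :: int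
  assumes U: "U \<in> hom circle_group unitary_group" and U': "U' \<in> hom circle_group unitary_group"
    and sum: "hilbert_direct_sum {n0..} (energy_space U)" and sum': "hilbert_direct_sum {m0..} (energy_space U')"
    and fin: "\<And>n. n \<ge> n0 \<Longrightarrow> finite_dimensional (energy_space U n)"
    and comm: "\<And>z w. z \<in> sphere 0 1 \<Longrightarrow> w \<in> sphere 0 1 \<Longrightarrow> U z \<circ> U' w = U' w \<circ> U z"
begin

definition joint :: "int \<Rightarrow> int \<Rightarrow> 'h set" where
  "joint n m = energy_space U n \<inter> energy_space U' m"

lemma Uc: "U (cis \<theta>) \<in> unitaries" and Uc': "U' (cis \<theta>) \<in> unitaries"
  by (rule hom_circleD(4)[OF U] hom_circleD(4)[OF U'])+

lemma energy_space_invariant: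
  assumes "x \<in> energy_space U n" shows "U' (cis t) x \<in> energy_space U n"
proof -
  have "U (cis \<theta>) (U' (cis t) x) = U' (cis t) (U (cis \<theta>) x)" for \<theta>
    using comm[of "cis \<theta>" "cis t"] by (simp add: fun_eq_iff)
  then show ?thesis using assms by (simp add: energy_space_def unitaryD(2)[OF Uc'])
qed

text \<open>\<open>U'\<close> preserves the finite-dimensional space \<open>energy_space U n\<close>
  and hence commutes with the orthogonal projection onto it. The projection of an eigenvector of
  \<open>U'\<close> is thus an eigenvector with the same energy.\<close>

lemma joint_projection:
  assumes n: "n \<ge> n0" and x: "x \<in> energy_space U' m"
  shows "\<exists>y\<in>joint n m. \<forall>b\<in>energy_space U n. cinner b (x - y) = 0"
proof -
  have sub: "csubspace (energy_space U n)" by (rule subspace_energy_space[where U=U, OF Uc])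
  obtain y where y: "y \<in> energy_space U n" "\<And>b. b \<in> energy_space U n \<Longrightarrow> cinner b (x - y) = 0"
    using subspace_projection[OF sub fin[OF n], of x] by blast
  have "U' (cis t) y = cis (of_int m * t) *\<^sub>C y" for t
  proof -
    let ?c = "cis (of_int m * t)"
    \<comment> \<open>The failure of the eigenvalue equation lies in the energy space and is also a
      combination of vectors orthogonal to it.\<close>
    define d where "d = U' (cis t) y - ?c *\<^sub>C y"
    have d: "d \<in> energy_space U n" unfolding d_def
      by (intro complex_vector.subspace_diff[OF sub] complex_vector.subspace_scale[OF sub] y(1) energy_space_invariant)
    define b' where "b' = U' (cis (- t)) d"
    have b': "b' \<in> energy_space U n" unfolding b'_def by (rule energy_space_invariant[OF d])
    have db: "d = U' (cis t) b'" unfolding b'_def using hom_circleD(5)[OF U', of t "- t" d] hom_circleD(3)[OF U'] by simp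
    have "d = ?c *\<^sub>C (x - y) - U' (cis t) (x - y)"
      unfolding d_def unitaryD(6)[OF Uc'] scaleC_diff energy_spaceD[OF x] by simp
    then have "cinner d d = ?c * cinner d (x - y) - cinner d (U' (cis t) (x - y))"
      using cinner_diff_right[of d "?c *\<^sub>C (x - y)" "U' (cis t) (x - y)"] by (simp add: cinner_scaleC_right)
    also have "cinner d (U' (cis t) (x - y)) = cinner b' (x - y)"
      by (subst db) (rule unitaryD(3)[OF Uc'])
    finally have "cinner d d = 0" using y(2)[OF d] y(2)[OF b'] by simp
    then show ?thesis unfolding cinner_self_zero d_def by simp
  qed
  then have "y \<in> joint n m" using y(1) unfolding joint_def energy_space_def by blast
  then show ?thesis using y(2) by blast
qed

text \<open>The remainder \<open>r\<close> after projecting onto the joint vectors lies in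
  \<open>energy_space U n\<close>. It is orthogonal to every energy vector of \<open>U'\<close>,
  since the component of that vector in \<open>energy_space U n\<close> is a joint vector. These
  energy vectors are dense in span, so \<open>r\<close> vanishes; finite dimension spares taking a
  closure.\<close>

lemma energy_space_joint:
  assumes n: "n \<ge> n0"
  shows "energy_space U n \<subseteq> cspan (\<Union>m\<in>{m0..}. joint n m)" (is "_ \<subseteq> ?W")
proof
  fix x assume x: "x \<in> energy_space U n"
  have sub: "csubspace (energy_space U n)" by (rule subspace_energy_space[where U=U, OF Uc])
  have W: "?W \<subseteq> energy_space U n" by (rule complex_vector.span_minimal[OF _ sub]) (auto simp: joint_def)
  have "finite_dimensional ?W" using fin[OF n] W unfolding finite_dimensional_def by blast
  from subspace_projection[OF complex_vector.subspace_span this, of x]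
  obtain y where y: "y \<in> ?W" "\<And>b. b \<in> ?W \<Longrightarrow> cinner b (x - y) = 0" by blast
  define r where "r = x - y"
  have r: "r \<in> energy_space U n" unfolding r_def using complex_vector.subspace_diff[OF sub x] y(1) W by blast
  have "cinner r x' = 0" if "x' \<in> (\<Union>m\<in>{m0..}. energy_space U' m)" for x'
  proof -
    from that obtain m where m: "m \<ge> m0" "x' \<in> energy_space U' m" by auto
    obtain p where p: "p \<in> joint n m" "\<And>b. b \<in> energy_space U n \<Longrightarrow> cinner b (x' - p) = 0"
      using joint_projection[OF n m(2)] by blast
    have "p \<in> ?W" by (rule complex_vector.span_base) (use p(1) m(1) in auto)
    then have "cinner p r = 0" unfolding r_def by (rule y(2))
    then have "cinner r p = 0" using cinner_commute[of r p] by simp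
    then show ?thesis using p(2)[OF r] unfolding cinner_diff_right by simp
  qed
  from orthogonal_dense_zero[OF this] sum' have "r = 0" unfolding hilbert_direct_sum_def by blast
  then show "x \<in> ?W" using y(1) unfolding r_def by simp
qed

lemma joint_dense: "closure (cspan (\<Union>n\<in>{n0..}. \<Union>m\<in>{m0..}. joint n m)) = UNIV"
proof -
  let ?S = "\<Union>n\<in>{n0..}. \<Union>m\<in>{m0..}. joint n m"
  have "energy_space U n \<subseteq> cspan ?S" if "n \<ge> n0" for n
    by (rule order_trans[OF energy_space_joint[OF that] complex_vector.span_mono]) (use that in auto)
  then have "cspan (\<Union>n\<in>{n0..}. energy_space U n) \<subseteq> cspan ?S"
    by (intro complex_vector.span_minimal complex_vector.subspace_span) auto
  from closure_mono[OF this] show ?thesis using sum unfolding hilbert_direct_sum_def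
    by (elim conjE) (simp only: top.extremum_unique)
qed

lemma joint_orthogonal_zero:
  assumes "\<And>n m x. n \<ge> n0 \<Longrightarrow> m \<ge> m0 \<Longrightarrow> x \<in> joint n m \<Longrightarrow> cinner \<xi> x = 0"
  shows "\<xi> = 0"
  by (rule orthogonal_dense_zero[OF _ joint_dense]) (use assms in auto)

text \<open>\<open>V\<close> acts on \<open>joint n m\<close> with energy \<open>e n m\<close>, an
  integer whenever that space is nonzero because \<open>V\<close> closes up after a full turn. A
  vector of energy \<open>j\<close> for \<open>V\<close> is orthogonal to all joint vectors with
  \<open>n > N\<close>, so it lies in the span of finitely many energy spaces of \<open>U\<close>,
  each of finite dimension.\<close>

lemma combination_energy:
  fixes k :: nat and \<tau> :: real
  assumes k: "k \<ge> 2" and V: "V \<in> hom circle_group unitary_group"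
    and Vdef: "\<And>\<theta> x. V (cis \<theta>) x = cis (\<tau> * \<theta>) *\<^sub>C U' (cis (\<theta> / k)) (U (cis (\<theta> - \<theta> / k)) x)"
  shows "\<exists>j0. hilbert_direct_sum {j0..} (energy_space V) \<and> (\<forall>j\<ge>j0. finite_dimensional (energy_space V j))"
proof -
  define e :: "int \<Rightarrow> int \<Rightarrow> real" where "e n m = \<tau> + of_int m / k + of_int n * (1 - 1 / k)" for n m
  have Vc: "\<And>\<theta>. V (cis \<theta>) \<in> unitaries" by (rule hom_circleD(4)[OF V])
  have k0: "real k > 0" and k1: "1 - 1 / real k \<ge> 1/2" using k by (auto simp: field_simps)
  have eig: "V (cis \<theta>) x = cis (e n m * \<theta>) *\<^sub>C x" if "x \<in> joint n m" for n m x \<theta>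
  proof -
    have x: "x \<in> energy_space U n" "x \<in> energy_space U' m" using that unfolding joint_def by auto
    have "\<tau> * \<theta> + (of_int n * (\<theta> - \<theta> / k) + of_int m * (\<theta> / k)) = e n m * \<theta>"
      unfolding e_def by (simp add: algebra_simps)
    then show ?thesis
      unfolding Vdef energy_spaceD[OF x(1)] unitaryD(2)[OF Uc'] energy_spaceD[OF x(2)] scaleC_scaleC cis_mult by simp
  qed
  have int: "\<exists>j. e n m = of_int j" if x: "x \<in> joint n m" "x \<noteq> 0" for n m x
  proof -
    have "cis (2 * pi) = 1" by (simp add: cis.ctr complex_eq_iff)
    then have "cis (e n m * (2 * pi)) *\<^sub>C x = 1 *\<^sub>C x" using eig[OF x(1), of "2 * pi"] hom_circleD(3)[OF V] by (simp add: scaleC_one)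
    from scaleC_cancel[OF this x(2)] have "cos (e n m * (2 * pi)) = 1" by (simp add: complex_eq_iff)
    then obtain j :: int where "e n m * (2 * pi) = of_int j * 2 * pi" using cos_one_2pi_int by blast
    then have "e n m = of_int j" using pi_gt_zero by simp
    then show ?thesis by blast
  qed
  have jointV: "x \<in> energy_space V j" if "x \<in> joint n m" "e n m = of_int j" for n m j x
    using eig[OF that(1)] unfolding energy_space_def that(2) by blast
  have mono: "e n m \<ge> e n' m'" if "n \<ge> n'" "m \<ge> m'" for n m n' m'
    unfolding e_def using that k0 k1 by (intro add_mono divide_right_mono mult_right_mono) auto
  define j0 where "j0 = \<lfloor>e n0 m0\<rfloor>"
  have "x \<in> cspan (\<Union>j\<in>{j0..}. energy_space V j)" if g: "n \<ge> n0" "m \<ge> m0" "x \<in> joint n m" for n m x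
  proof (cases "x = 0")
    case True
    then show ?thesis by (simp add: complex_vector.span_zero)
  next
    case False
    obtain j where j: "e n m = of_int j" using int[OF g(3) False] by blast
    have "j \<ge> j0" using mono[OF g(1,2)] unfolding j j0_def by linarith
    then show ?thesis using jointV[OF g(3) j] by (intro complex_vector.span_base) auto
  qed
  then have "cspan (\<Union>n\<in>{n0..}. \<Union>m\<in>{m0..}. joint n m) \<subseteq> cspan (\<Union>j\<in>{j0..}. energy_space V j)"
    by (intro complex_vector.span_minimal complex_vector.subspace_span) auto
  from closure_mono[OF this] have "closure (cspan (\<Union>j\<in>{j0..}. energy_space V j)) = UNIV"
    unfolding joint_dense
    by (simp only: top.extremum_unique)
  then have 1: "hilbert_direct_sum {j0..} (energy_space V)" unfolding energy_direct_sum_iff[where U=V, OF Vc] .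
  have 2: "finite_dimensional (energy_space V j)" for j
  proof -
    \<comment> \<open>For \<open>m \<ge> m0\<close> and nonnegative \<open>n\<close> the bound 1 -
      1/k \<ge> 1/2 gives \<open>e n m \<ge> \<tau> + m0 / k + n / 2\<close>, which exceeds
      \<open>j\<close> beyond this \<open>N\<close>. The maximum with 0 supplies the sign for that
      estimate.\<close>
    define N where "N = max 0 (\<lceil>2 * (of_int j - \<tau> - of_int m0 / k)\<rceil>)"
    have big: "e n m \<noteq> of_int j" if "n > N" "m \<ge> m0" for n m
    proof -
      have n0: "of_int n \<ge> (0::real)" and n1: "of_int n > 2 * (of_int j - \<tau> - of_int m0 / k)"
        using that(1) unfolding N_def by linarith+
      have "of_int n * (1/2) \<le> of_int n * (1 - 1 / real k)" by (rule mult_left_mono[OF k1 n0])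
      moreover have "of_int m0 / real k \<le> of_int m / real k" using that(2) k0 by (simp add: divide_right_mono)
      ultimately have "\<tau> + of_int m0 / k + of_int n * (1/2) \<le> e n m"
        unfolding e_def by (intro add_mono order_refl)
      moreover have "J < E" if le: "\<tau> + t + n' * (1/2) \<le> E" and lt: "2 * (J - \<tau> - t) < n'" for J E t n' :: real
      proof -
        have "J - \<tau> - t < n' / 2" using lt by simp
        then show ?thesis using le by simp
      qed
      ultimately have "of_int j < e n m" using n1 by blast
      then show ?thesis by simp
    qed
    let ?S0 = "cspan (\<Union>n\<in>{n0..N}. energy_space U n)"
    have "\<forall>n\<in>{n0..N}. \<exists>B. finite B \<and> energy_space U n \<subseteq> cspan B"
      using fin unfolding finite_dimensional_def by simp
    from bchoice[OF this] obtain B where "\<forall>n\<in>{n0..N}. finite (B n) \<and> energy_space U n \<subseteq> cspan (B n)" ..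
    then have B: "\<And>n. n \<in> {n0..N} \<Longrightarrow> finite (B n)" "\<And>n. n \<in> {n0..N} \<Longrightarrow> energy_space U n \<subseteq> cspan (B n)"
      by simp_all
    have "energy_space U n \<subseteq> cspan (\<Union>n\<in>{n0..N}. B n)" if "n \<in> {n0..N}" for n
      by (rule order_trans[OF B(2)[OF that] complex_vector.span_mono]) (use that in auto)
    then have "?S0 \<subseteq> cspan (\<Union>n\<in>{n0..N}. B n)"
      by (intro complex_vector.span_minimal complex_vector.subspace_span UN_least)
    moreover have "finite (\<Union>n\<in>{n0..N}. B n)" using B(1) by blast
    ultimately have fS: "finite_dimensional ?S0" unfolding finite_dimensional_def by blast
    have "energy_space V j \<subseteq> ?S0"
    proof
      fix v assume v: "v \<in> energy_space V j"
      obtain y where y: "y \<in> ?S0" "\<And>b. b \<in> ?S0 \<Longrightarrow> cinner b (v - y) = 0"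
        using subspace_projection[OF complex_vector.subspace_span fS, of v] by blast
      have "v - y = 0"
      proof (rule joint_orthogonal_zero)
        fix n m x assume n: "n \<ge> n0" and m: "m \<ge> m0" and x: "x \<in> joint n m"
        have xU: "x \<in> energy_space U n" using x unfolding joint_def by blast
        have "cinner x (v - y) = 0"
        proof (cases "n \<le> N")
          case True
          then have "x \<in> ?S0" using n xU by (intro complex_vector.span_base) auto
          then show ?thesis by (rule y(2))
        next
          case False
          have "cinner x v = 0"
          proof (cases "x = 0")
            case True
            have "cinner v 0 = 0" by (rule cinner_zero_right)
            then show ?thesis using cinner_commute[of x v] True by simp
          next
            case xn: False
            obtain j' where j': "e n m = of_int j'" using int[OF x xn] by blast
            then have "j' \<noteq> j" using big[of n m] False m by auto
            then show ?thesis using energy_space_orthogonal[where U=V, OF Vc jointV[OF x j'] v] by blast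
          qed
          moreover have "cinner x y = 0"
          proof (rule orthogonal_closure_span[of "\<Union>n\<in>{n0..N}. energy_space U n"])
            show "y \<in> closure ?S0" using y(1) closure_subset by blast
            fix z assume "z \<in> (\<Union>n\<in>{n0..N}. energy_space U n)"
            then obtain n' where "n' \<le> N" "z \<in> energy_space U n'" by auto
            then show "cinner x z = 0" using energy_space_orthogonal[where U=U, OF Uc xU, of z n'] False by auto
          qed
          ultimately show ?thesis by (simp add: cinner_diff_right)
        qed
        then show "cinner (v - y) x = 0" using cinner_commute[of "v - y" x] by simp
      qed
      then show "v \<in> ?S0" using y(1) by simp
    qed
    then show ?thesis using fS unfolding finite_dimensional_def by blast
  qed
  from 1 2 show ?thesis by blast
qed

end

section \<open>A smooth step function\<close>

text \<open>The derivatives of exp (- 1/x), extended by zero, are combinations of these functions.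
  The family is closed under differentiation, so smoothness follows by an induction over all
  \<open>m\<close>.\<close>

definition flat :: "nat \<Rightarrow> real \<Rightarrow> real" where
  "flat m x = (if x \<le> 0 then 0 else inverse x ^ m * exp (- inverse x))"

lemma inverse_power_has_derivative:
  assumes "(x::real) \<noteq> 0"
  shows "((\<lambda>x. inverse x ^ m) has_real_derivative - real m * inverse x ^ (m + 1)) (at x)"
proof -
  have "((\<lambda>x. inverse x ^ m) has_real_derivative real m * (- (inverse x ^ Suc (Suc 0)) * inverse x ^ (m - Suc 0))) (at x)"
    using DERIV_power[OF DERIV_inverse[OF assms], of m] by simp
  moreover have "real m * (- (inverse x ^ Suc (Suc 0)) * inverse x ^ (m - Suc 0)) = - real m * inverse x ^ (m + 1)"
    by (cases m) (simp_all add: algebra_simps)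
  ultimately show ?thesis by (simp only:)
qed

lemma flat_has_derivative:
  "(flat m has_real_derivative flat (m + 2) x - real m * flat (m + 1) x) (at x)"
proof -
  consider "x < 0" | "x = 0" | "x > 0" by linarith
  then show ?thesis
  proof cases
    case 1
    have "((\<lambda>x. 0) has_real_derivative 0) (at x)" by simp
    then have "(flat m has_real_derivative 0) (at x)"
      by (rule has_field_derivative_transform_within_open[of _ _ _ "{..<0}"]) (use 1 in \<open>auto simp: flat_def\<close>)
    then show ?thesis using 1 by (simp add: flat_def)
  next
    case 3
    have "((\<lambda>x. exp (- inverse x)) has_real_derivative exp (- inverse x) * (inverse x * inverse x)) (at x)"
      using 3 by (auto intro!: derivative_eq_intros simp: power2_eq_square)
    from DERIV_mult[OF inverse_power_has_derivative[of x m] this] 3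
    have "((\<lambda>x. inverse x ^ m * exp (- inverse x)) has_real_derivative flat (m + 2) x - real m * flat (m + 1) x) (at x)"
      by (simp add: flat_def algebra_simps)
    then show ?thesis
      by (rule has_field_derivative_transform_within_open[of _ _ _ "{0<..}"]) (use 3 in \<open>auto simp: flat_def\<close>)
  next
    case 2
    have r: "((\<lambda>h. (flat m (0 + h) - flat m 0) / h) \<longlongrightarrow> 0) (at_right 0)"
    proof -
      \<comment> \<open>With 1/h as variable the difference quotient at the origin is a power
        divided by the exponential.\<close>
      have "((\<lambda>h. inverse h ^ (m + 1) / exp (inverse h)) \<longlongrightarrow> (0::real)) (at_right 0)"
        by (rule filterlim_compose[OF tendsto_power_div_exp_0 filterlim_inverse_at_top_right])
      moreover have "\<forall>\<^sub>F h in at_right 0. inverse h ^ (m + 1) / exp (inverse h) = (flat m (0 + h) - flat m 0) / h"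
        using eventually_at_right_less[of "0::real"]
        by eventually_elim (simp add: flat_def exp_minus divide_simps)
      ultimately show ?thesis by (rule Lim_transform_eventually)
    qed
    have l: "((\<lambda>h. (flat m (0 + h) - flat m 0) / h) \<longlongrightarrow> 0) (at_left 0)"
    proof (rule Lim_transform_eventually[OF tendsto_const])
      show "\<forall>\<^sub>F h in at_left 0. 0 = (flat m (0 + h) - flat m 0) / h"
        unfolding eventually_at_filter by (rule always_eventually) (auto simp: flat_def)
    qed
    have "(flat m has_real_derivative 0) (at 0)"
      unfolding DERIV_def by (rule filterlim_split_at[OF l r])
    then show ?thesis using 2 by (simp add: flat_def)
  qed
qed

lemma times_cont_diff_on_flat: "times_cont_diff_on k UNIV (flat m)"
proof (induction k arbitrary: m)
  case 0
  then show ?case using DERIV_isCont[OF flat_has_derivative] by (simp add: continuous_on_eq_continuous_at)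
next
  case (Suc k)
  show ?case
  proof (rule times_cont_diff_on_SucI)
    show "(flat m has_derivative (\<lambda>v. (flat (m + 2) x - real m * flat (m + 1) x) * v)) (at x)" for x
      using flat_has_derivative[of m x] unfolding has_field_derivative_def .
    fix v
    have "times_cont_diff_on k UNIV (\<lambda>x. flat (m + 2) x * v + flat (m + 1) x * (- real m * v))"
      by (intro times_cont_diff_on_add times_cont_diff_on_linear[OF _ bounded_linear_mult_left] Suc.IH open_UNIV)
    then show "times_cont_diff_on k UNIV (\<lambda>x. (flat (m + 2) x - real m * flat (m + 1) x) * v)"
      by (simp add: algebra_simps)
  qed simp
qed

lemma times_cont_diff_on_inverse_power: "times_cont_diff_on k {0<..} (\<lambda>x::real. inverse x ^ m)"
proof (induction k arbitrary: m)
  case 0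
  then show ?case by (auto intro!: continuous_intros)
next
  case (Suc k)
  show ?case
  proof (rule times_cont_diff_on_SucI)
    fix x :: real assume "x \<in> {0<..}"
    then have "x \<noteq> 0" by simp
    from inverse_power_has_derivative[OF this, of m] show "((\<lambda>x. inverse x ^ m) has_derivative (\<lambda>v. - real m * inverse x ^ (m + 1) * v)) (at x)"
      unfolding has_field_derivative_def .
  next
    fix v
    have "times_cont_diff_on k {0<..} (\<lambda>x. inverse x ^ (m + 1) * (- real m * v))"
      by (intro times_cont_diff_on_linear[OF _ bounded_linear_mult_left] Suc.IH open_greaterThan)
    then show "times_cont_diff_on k {0<..} (\<lambda>x. - real m * inverse x ^ (m + 1) * v)"
      by (simp add: mult_ac)
  qed simp
qed

text \<open>The quotient \<open>s\<close> is smooth because \<open>flat 0 x\<close> and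
  \<open>flat 0 (1 - x)\<close> never vanish together. Rescaling compresses its transition into the
  middle third; constancy on both outer thirds lets neighbouring pieces be glued smoothly.\<close>

lemma smooth_step_exists:
  "\<exists>\<beta>::real \<Rightarrow> real. smooth_on UNIV \<beta> \<and> (\<forall>x\<le>1/3. \<beta> x = 0) \<and> (\<forall>x\<ge>2/3. \<beta> x = 1) \<and> (\<forall>x. 0 \<le> \<beta> x \<and> \<beta> x \<le> 1)"
proof -
  define s where "s x = flat 0 x * inverse (flat 0 x + flat 0 (1 - x))" for x
  have nn: "flat 0 x \<ge> 0" for x by (simp add: flat_def)
  have pos: "flat 0 x + flat 0 (1 - x) > 0" for x
    using nn[of x] nn[of "1 - x"] by (cases "x > 0") (auto simp: flat_def add_pos_nonneg add_nonneg_pos)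
  have f: "smooth_on UNIV (flat 0)" using times_cont_diff_on_flat unfolding smooth_on_def by blast
  have i: "smooth_on {0<..} (\<lambda>x::real. inverse x)"
    using times_cont_diff_on_inverse_power[where m=1] unfolding smooth_on_def by simp
  have "smooth_on UNIV (\<lambda>x::real. 1 - x)" by (intro smooth_on_diff smooth_on_const smooth_on_id open_UNIV)
  from smooth_on_comp[OF this f] have f': "smooth_on UNIV (\<lambda>x. flat 0 (1 - x))" by simp
  have "smooth_on UNIV (\<lambda>x. inverse (flat 0 x + flat 0 (1 - x)))"
    by (rule smooth_on_comp[OF smooth_on_add[OF open_UNIV f f'] i]) (use pos in auto)
  then have s: "smooth_on UNIV s"
    unfolding s_def by (rule smooth_on_bilinear[OF open_UNIV bounded_bilinear_mult f])
  have s0: "s x = 0" if "x \<le> 0" for x using that by (simp add: s_def flat_def)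
  have s1: "s x = 1" if "x \<ge> 1" for x
    using that pos[of x] by (simp add: s_def flat_def)
  have s01: "0 \<le> s x \<and> s x \<le> 1" for x
    using nn[of x] nn[of "1 - x"] pos[of x] by (auto simp: s_def divide_inverse[symmetric] divide_simps)
  have "smooth_on UNIV (\<lambda>x::real. x * 3 - 1)"
    by (intro smooth_on_diff smooth_on_const smooth_on_linear[OF _ bounded_linear_mult_left] smooth_on_id open_UNIV)
  from smooth_on_comp[OF this s] have "smooth_on UNIV (\<lambda>x. s (x * 3 - 1))" by simp
  then show ?thesis using s0 s1 s01 by (intro exI[of _ "\<lambda>x. s (x * 3 - 1)"]) auto
qed

section \<open>Smooth approximation of continuous loops\<close>

context lie_group
begin

text \<open>Uniform continuity in terms of the group: the pairs whose quotient lies outside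
  \<open>W\<close> form a compact set disjoint from the diagonal, and the distance of the two points
  attains a positive minimum on it.\<close>

lemma uniform_quotient:
  fixes c :: "'x::metric_space \<Rightarrow> 'g"
  assumes K: "compact K" and c: "continuous_on K c" "c ` K \<subseteq> carrier G"
    and W: "openin (top_of_set (carrier G)) W" "\<one> \<in> W"
  shows "\<exists>\<delta>>0. \<forall>x\<in>K. \<forall>y\<in>K. dist x y < \<delta> \<longrightarrow> inv (c x) \<otimes> c y \<in> W"
proof -
  define F where "F p = inv (c (fst p)) \<otimes> c (snd p)" for p
  have cf: "continuous_on (K \<times> K) (\<lambda>p. c (fst p))" and cs: "continuous_on (K \<times> K) (\<lambda>p. c (snd p))"
    by (rule continuous_on_compose2[OF c(1)], rule continuous_on_fst continuous_on_snd, rule continuous_on_id, force)+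
  have F: "continuous_on (K \<times> K) F"
    unfolding F_def by (rule continuous_on_mult[OF continuous_on_inverse[OF cf] cs]) (use c(2) in \<open>auto simp: image_subset_iff\<close>)
  define D where "D = (K \<times> K) \<inter> F -` (carrier G - W)"
  have img: "F \<in> (K \<times> K) \<rightarrow> carrier G" using c(2) unfolding F_def by (auto simp: image_subset_iff)
  have "closedin (top_of_set (carrier G)) (carrier G - W)" 
    by (rule closedin_diff[OF _ W(1)]) simp
  from continuous_closedin_preimage_gen[OF F img this] have "closedin (top_of_set (K \<times> K)) D" unfolding D_def .
  then have D: "compact D" by (rule closedin_compact[OF compact_Times[OF K K]])
  show ?thesis
  proof (cases "D = {}")
    case True
    then have "F (x, y) \<in> W" if "x \<in> K" "y \<in> K" for x y using that img unfolding D_def by auto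
    then show ?thesis unfolding F_def by (intro exI[of _ 1]) auto
  next
    case False
    have "continuous_on D (\<lambda>p. dist (fst p) (snd p))" by (intro continuous_intros)
    from continuous_attains_inf[OF D False this] obtain p where p: "p \<in> D" "\<And>q. q \<in> D \<Longrightarrow> dist (fst p) (snd p) \<le> dist (fst q) (snd q)"
      by blast
    have pos: "dist (fst p) (snd p) > 0"
    proof (rule ccontr)
      assume "\<not> ?thesis"
      then have e: "fst p = snd p" by simp
      have "c (snd p) \<in> carrier G" using p(1) c(2) unfolding D_def by auto
      then have "F p = \<one>" unfolding F_def e by simp
      then show False using p(1) W(2) unfolding D_def by auto
    qed
    have "inv (c x) \<otimes> c y \<in> W" if xy: "x \<in> K" "y \<in> K" "dist x y < dist (fst p) (snd p)" for x y
    proof (rule ccontr)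
      assume "inv (c x) \<otimes> c y \<notin> W"
      moreover have "F (x, y) \<in> carrier G" by (rule funcset_mem[OF img]) (simp add: xy)
      ultimately have "(x, y) \<in> D" using xy(1,2) unfolding D_def by (simp add: F_def)
      from p(2)[OF this] xy(3) show False by simp
    qed
    then show ?thesis by (intro exI[of _ "dist (fst p) (snd p)"] conjI pos ballI impI)
  qed
qed

text \<open>This triple product is the form in which approximations are compared: the inverse of the
  first error, the change of the approximated values, and the second error.\<close>

lemma nbhd_quotient:
  assumes W: "openin (top_of_set (carrier G)) W" "\<one> \<in> W"
  shows "\<exists>V. openin (top_of_set (carrier G)) V \<and> \<one> \<in> V \<and> (\<forall>a\<in>V. \<forall>b\<in>V. \<forall>d\<in>V. inv a \<otimes> b \<otimes> d \<in> W)"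
proof -
  let ?C = "carrier G \<times> carrier G \<times> carrier G"
  define F where "F p = inv (fst p) \<otimes> fst (snd p) \<otimes> snd (snd p)" for p
  have F: "continuous_on ?C F" unfolding F_def
    by (intro continuous_on_mult continuous_on_inverse continuous_intros) auto
  have "F \<in> ?C \<rightarrow> carrier G" unfolding F_def by auto
  from continuous_openin_preimage[OF F this W(1)] obtain T where T: "open T" "?C \<inter> F -` W = ?C \<inter> T"
    unfolding openin_open by blast
  have "F (\<one>, \<one>, \<one>) = \<one>" unfolding F_def by simp
  then have "(\<one>, \<one>, \<one>) \<in> ?C \<inter> F -` W" using W(2) by simp
  then have "(\<one>, \<one>, \<one>) \<in> T" unfolding T(2) by blast
  from open_prod_elim[OF T(1) this] obtain A1 A' where A1: "open A1" "open A'" "(\<one>, \<one>, \<one>) \<in> A1 \<times> A'" "A1 \<times> A' \<subseteq> T" .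
  then have "(\<one>, \<one>) \<in> A'" by simp
  from open_prod_elim[OF A1(2) this] obtain A2 A3 where A2: "open A2" "open A3" "(\<one>, \<one>) \<in> A2 \<times> A3" "A2 \<times> A3 \<subseteq> A'" .
  let ?V = "carrier G \<inter> (A1 \<inter> A2 \<inter> A3)"
  have "inv a \<otimes> b \<otimes> d \<in> W" if "a \<in> ?V" "b \<in> ?V" "d \<in> ?V" for a b d
  proof -
    have "(a, b, d) \<in> ?C \<inter> T" using that A1(4) A2(4) by auto
    then have "(a, b, d) \<in> ?C \<inter> F -` W" unfolding T(2) .
    then show ?thesis unfolding F_def by simp
  qed
  moreover have "openin (top_of_set (carrier G)) ?V" by (intro openin_open_Int open_Int A1 A2)
  moreover have "\<one> \<in> ?V" using A1(3) A2(3) by auto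
  ultimately show ?thesis by (intro exI[of _ ?V]) blast
qed

lemma chart_ball_in_nbhd:
  assumes W: "openin (top_of_set (carrier G)) W" "\<one> \<in> W"
  shows "\<exists>U \<phi> r. (U, \<phi>) \<in> A \<and> \<one> \<in> U \<and> 0 < r \<and> ball (\<phi> \<one>) r \<subseteq> \<phi> ` U \<and> (\<forall>v\<in>ball (\<phi> \<one>) r. inv_into U \<phi> v \<in> W)"
proof -
  obtain U \<phi> where U: "(U, \<phi>) \<in> A" "\<one> \<in> U" using chart_at[OF one_closed] by blast
  note D = chartD[OF U(1)]
  have "inv_into U \<phi> \<in> \<phi> ` U \<rightarrow> carrier G" using D(9) chart_carrier[OF U(1)] by blast
  from continuous_openin_preimage[OF D(5) this W(1)] have "open (\<phi> ` U \<inter> inv_into U \<phi> -` W)"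
    using D(2) by (simp add: openin_open_eq)
  moreover have "\<phi> \<one> \<in> \<phi> ` U \<inter> inv_into U \<phi> -` W" using U(2) D(7)[OF U(2)] W(2) by simp
  ultimately obtain r where "0 < r" "ball (\<phi> \<one>) r \<subseteq> \<phi> ` U \<inter> inv_into U \<phi> -` W" unfolding open_contains_ball by blast
  then show ?thesis using U by (intro exI[of _ U] exI[of _ \<phi>] exI[of _ r]) auto
qed

text \<open>On each cell of a fine grid the loop is replaced by an interpolation in the chart
  between its values at the two grid points. The smooth step makes the interpolation constant near
  both ends, so neighbouring pieces agree on an overlap.\<close>

lemma smooth_loop_approximation:
  fixes c :: "real \<Rightarrow> 'g"
  assumes c: "continuous_on UNIV c" "\<And>x. c x \<in> carrier G" "\<And>x. c (x + 2 * pi) = c x"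
    and W: "openin (top_of_set (carrier G)) W" "\<one> \<in> W"
  shows "\<exists>\<gamma>\<in>carrier LG. \<forall>x. inv (c x) \<otimes> \<gamma> x \<in> W"
proof -
  obtain W' where W': "openin (top_of_set (carrier G)) W'" "\<one> \<in> W'"
      "\<And>a b d. a \<in> W' \<Longrightarrow> b \<in> W' \<Longrightarrow> d \<in> W' \<Longrightarrow> inv a \<otimes> b \<otimes> d \<in> W"
    using nbhd_quotient[OF W] by blast
  obtain U \<phi> r where U: "(U, \<phi>) \<in> A" "\<one> \<in> U" and r: "0 < r" "ball (\<phi> \<one>) r \<subseteq> \<phi> ` U"
      and rW: "\<And>v. v \<in> ball (\<phi> \<one>) r \<Longrightarrow> inv_into U \<phi> v \<in> W'"
    using chart_ball_in_nbhd[OF W'(1,2)] by blast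
  note D = chartD[OF U(1)]
  define p where "p = \<phi> \<one>"
  define \<psi> where "\<psi> = inv_into U \<phi>"
  define V where "V = {x \<in> U. dist p (\<phi> x) < r}"
  have V: "openin (top_of_set (carrier G)) V" "\<one> \<in> V"
    unfolding V_def using chart_ball_openin[OF U(1)] U(2) r(1) by (auto simp: p_def)
  have VW: "x \<in> W'" if "x \<in> V" for x
    using rW[of "\<phi> x"] D(7)[of x] that unfolding V_def p_def by auto
  have per: "c (x + 2 * pi * of_int q) = c x" for x and q :: int by (rule periodic_of_int) (rule c(3))
  have "\<exists>\<delta>>0. \<forall>x\<in>{0..2*pi}. \<forall>y\<in>{0..2*pi}. dist x y < \<delta> \<longrightarrow> inv (c x) \<otimes> c y \<in> V"
    by (rule uniform_quotient[OF compact_Icc continuous_on_subset[OF c(1) subset_UNIV] _ V]) (use c(2) in auto)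
  then obtain \<delta> where "\<delta> > 0" "\<forall>x\<in>{0..2*pi}. \<forall>y\<in>{0..2*pi}. dist x y < \<delta> \<longrightarrow> inv (c x) \<otimes> c y \<in> V"
    by (elim exE conjE) (rule that)
  then have \<delta>: "\<delta> > 0" "\<And>x y. x \<in> {0..2*pi} \<Longrightarrow> y \<in> {0..2*pi} \<Longrightarrow> dist x y < \<delta> \<Longrightarrow> inv (c x) \<otimes> c y \<in> V"
    by simp_all
  obtain N :: nat where N: "2 * pi / \<delta> < real N" using reals_Archimedean2 by blast
  have "2 * pi / \<delta> > 0" using \<delta>(1) by simp
  then have N0: "real N > 0" using N by linarith
  define h where "h = 2 * pi / real N"
  have h: "h > 0" "h < \<delta>" "real N * h = 2 * pi" using N N0 \<delta>(1) unfolding h_def by (simp_all add: field_simps)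
  \<comment> \<open>Cells are indexed by all integers; reducing the index modulo \<open>N\<close>
    moves the cell into one period, where uniform continuity is available.\<close>
  have near: "inv (c (of_int j * h)) \<otimes> c y \<in> V" if y: "of_int j * h \<le> y" "y \<le> (of_int j + 1) * h" for j :: int and y
  proof -
    define q i where "q = j div int N" and "i = j mod int N"
    have j: "of_int j = of_int q * real N + of_int i"
    proof -
      have "real_of_int j = real_of_int (q * int N + i)" unfolding q_def i_def div_mult_mod_eq ..
      then show ?thesis by simp
    qed
    have "int N > 0" using N0 by simp
    from pos_mod_bound[OF this, of j] pos_mod_sign[OF this, of j]
    have i: "0 \<le> i" "i + 1 \<le> int N" unfolding i_def by linarith+
    have jh: "of_int j * h = of_int i * h + 2 * pi * of_int q"
      unfolding j using h(3) by (simp add: algebra_simps)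
    define y' where "y' = y - 2 * pi * of_int q"
    have y': "of_int i * h \<le> y'" "y' \<le> of_int i * h + h" using y jh unfolding y'_def by (simp_all add: algebra_simps)
    have "of_int (i + 1) * h \<le> real N * h" using i(2) h(1) by (intro mult_right_mono) linarith+
    then have up: "of_int i * h + h \<le> 2 * pi" using h(3) by (simp add: algebra_simps)
    have lo: "0 \<le> of_int i * h" using i(1) h(1) by simp
    have "inv (c (of_int i * h)) \<otimes> c y' \<in> V"
      by (rule \<delta>(2)) (use y' up lo h in \<open>auto simp: dist_real_def\<close>)
    moreover have "c (of_int j * h) = c (of_int i * h)" unfolding jh by (rule per)
    moreover have "c y = c y'" using per[of y' q] unfolding y'_def by simp
    ultimately show ?thesis by simp
  qed
  obtain \<beta> :: "real \<Rightarrow> real" where \<beta>: "smooth_on UNIV \<beta>" "\<And>x. x \<le> 1/3 \<Longrightarrow> \<beta> x = 0" "\<And>x. x \<ge> 2/3 \<Longrightarrow> \<beta> x = 1"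
      "\<And>x. 0 \<le> \<beta> x" "\<And>x. \<beta> x \<le> 1"
    using smooth_step_exists by blast
  define w where "w j = \<phi> (inv (c (of_int j * h)) \<otimes> c ((of_int j + 1) * h)) - p" for j :: int
  have nw: "inv (c (of_int j * h)) \<otimes> c ((of_int j + 1) * h) \<in> V" for j
    by (rule near) (use h(1) in auto)
  have w: "norm (w j) < r" for j
    using nw[of j] unfolding V_def w_def by (simp add: dist_norm norm_minus_commute)
  define \<Gamma> where "\<Gamma> j x = c (of_int j * h) \<otimes> \<psi> (p + \<beta> ((x - of_int j * h) / h) *\<^sub>R w j)" for j x
  have inball: "p + \<beta> t *\<^sub>R w j \<in> ball p r" for t j
  proof -
    have "\<bar>\<beta> t\<bar> * norm (w j) \<le> 1 * norm (w j)" using \<beta>(4,5)[of t] by (intro mult_right_mono) auto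
    then show ?thesis using w[of j] by (simp add: dist_norm)
  qed
  have \<Gamma>s: "smooth_into A UNIV (\<Gamma> j)" for j
  proof -
    have "smooth_on UNIV (\<lambda>x::real. (x - of_int j * h) / h)"
      by (intro smooth_on_linear[OF _ bounded_linear_divide] smooth_on_diff smooth_on_id smooth_on_const open_UNIV)
    from smooth_on_comp[OF this \<beta>(1)] have "smooth_on UNIV (\<lambda>x. \<beta> ((x - of_int j * h) / h))" by simp
    then have "smooth_on UNIV (\<lambda>x. p + \<beta> ((x - of_int j * h) / h) *\<^sub>R w j)"
      by (intro smooth_on_add[OF open_UNIV smooth_on_const] smooth_on_linear[OF open_UNIV bounded_linear_scaleR_left])
    then have "smooth_into A UNIV (\<lambda>x. \<psi> (p + \<beta> ((x - of_int j * h) / h) *\<^sub>R w j))"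
      unfolding \<psi>_def by (rule smooth_into_compose[OF smooth_into_chart_inverse[OF U(1)] open_UNIV])
        (use inball r(2) in \<open>auto simp: p_def\<close>)
    then show ?thesis unfolding \<Gamma>_def by (rule smooth_into_mult[OF smooth_into_constant[OF open_UNIV c(2)]])
  qed
  have \<Gamma>0: "\<Gamma> j x = c (of_int j * h)" if "(x - of_int j * h) / h \<le> 1/3" for j x
  proof -
    have "\<psi> p = \<one>" unfolding \<psi>_def p_def by (rule D(7)[OF U(2)])
    then show ?thesis unfolding \<Gamma>_def \<beta>(2)[OF that] using c(2) by simp
  qed
  have \<Gamma>1: "\<Gamma> j x = c ((of_int j + 1) * h)" if "(x - of_int j * h) / h \<ge> 2/3" for j x
  proof -
    have "\<psi> (p + 1 *\<^sub>R w j) = inv (c (of_int j * h)) \<otimes> c ((of_int j + 1) * h)"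
      unfolding \<psi>_def w_def using D(7)[of "inv (c (of_int j * h)) \<otimes> c ((of_int j + 1) * h)"] nw[of j] unfolding V_def by simp
    then show ?thesis unfolding \<Gamma>_def \<beta>(3)[OF that] using c(2) by (simp add: m_assoc[symmetric])
  qed
  define \<gamma> where "\<gamma> x = \<Gamma> \<lfloor>x / h\<rfloor> x" for x
  have fl: "\<lfloor>x / h\<rfloor> = j \<longleftrightarrow> of_int j * h \<le> x \<and> x < (of_int j + 1) * h" for x and j :: int
    unfolding floor_eq_iff using h(1) by (simp add: field_simps)
  \<comment> \<open>The interval reaches a third of a cell to the left of its grid point. There the
    previous piece has already reached \<open>c (of_int j * h)\<close> and piece \<open>j\<close>
    has not yet left it.\<close>
  have loc: "\<gamma> x = \<Gamma> j x" if x: "x \<in> {of_int j * h - h / 3<..<(of_int j + 1) * h}" for x j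
  proof (cases "of_int j * h \<le> x")
    case True
    then show ?thesis unfolding \<gamma>_def using x fl[of x j] by simp
  next
    case False
    have "\<lfloor>x / h\<rfloor> = j - 1" unfolding fl using x False h(1) by (simp add: algebra_simps)
    moreover have "\<Gamma> (j - 1) x = c (of_int j * h)"
      using \<Gamma>1[where j="j - 1" and x=x] x h(1) by (simp add: field_simps)
    moreover have "\<Gamma> j x = c (of_int j * h)"
    proof (rule \<Gamma>0)
      have "(x - of_int j * h) / h \<le> 0" using False h(1) by (simp add: divide_nonpos_pos)
      then show "(x - of_int j * h) / h \<le> 1/3" by linarith
    qed
    ultimately show ?thesis unfolding \<gamma>_def by simp
  qed
  have "smooth_into A UNIV \<gamma>"
  proof (rule smooth_into_local[OF topological_atlas])
    fix x :: real
    define j where "j = \<lfloor>x / h\<rfloor>"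
    let ?T = "{of_int j * h - h / 3<..<(of_int j + 1) * h}"
    have "x \<in> ?T" using fl[of x j] h(1) unfolding j_def by auto
    moreover have "smooth_into A ?T \<gamma>"
      by (rule smooth_into_cong[OF smooth_into_subset[OF \<Gamma>s[of j]] _ topological_atlas]) (simp_all add: loc)
    ultimately show "\<exists>T. x \<in> T \<and> T \<subseteq> UNIV \<and> smooth_into A T \<gamma>" by blast
  qed
  moreover have "\<gamma> (x + 2 * pi) = \<gamma> x" for x
  proof -
    define j where "j = \<lfloor>x / h\<rfloor>"
    have sh: "of_int (j + int N) * h = of_int j * h + 2 * pi"
      using h(3) by (simp add: algebra_simps)
    have "\<lfloor>(x + 2 * pi) / h\<rfloor> = j + int N"
    proof (rule iffD2[OF fl])
      have "of_int j * h \<le> x \<and> x < (of_int j + 1) * h" using iffD1[OF fl refl, of x] unfolding j_def .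
      then show "of_int (j + int N) * h \<le> x + 2 * pi \<and> x + 2 * pi < (of_int (j + int N) + 1) * h"
        unfolding distrib_right sh by simp
    qed
    moreover have e: "c (of_int (j + int N) * h) = c (of_int j * h)"
      unfolding sh by (rule c(3))
    moreover have "w (j + int N) = w j"
    proof -
      have "(of_int (j + int N) + 1) * h = (of_int j + 1) * h + 2 * pi" using sh by (simp add: algebra_simps)
      then show ?thesis unfolding w_def e using c(3)[of "(of_int j + 1) * h"] by simp
    qed
    ultimately show ?thesis unfolding \<gamma>_def \<Gamma>_def j_def[symmetric] using sh by simp
  qed
  ultimately have "\<gamma> \<in> carrier LG" unfolding loop_carrier_iff by blast
  moreover have "inv (c x) \<otimes> \<gamma> x \<in> W" for x
  proof -
    define j where "j = \<lfloor>x / h\<rfloor>"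
    let ?a = "inv (c (of_int j * h)) \<otimes> c x" and ?b = "\<psi> (p + \<beta> ((x - of_int j * h) / h) *\<^sub>R w j)"
    have a: "?a \<in> W'" using fl[of x j] unfolding j_def by (intro VW near) auto
    have b: "?b \<in> W'" unfolding \<psi>_def using rW inball unfolding p_def by blast
    have bc: "?b \<in> carrier G" using b openin_imp_subset[OF W'(1)] by blast
    have "inv ?a \<otimes> ?b \<otimes> \<one> \<in> W" by (rule W'(3)[OF a b W'(2)])
    moreover have "inv ?a \<otimes> ?b \<otimes> \<one> = inv (c x) \<otimes> (c (of_int j * h) \<otimes> ?b)"
      using c(2) bc by (simp add: inv_mult_group m_assoc)
    ultimately show ?thesis unfolding \<gamma>_def \<Gamma>_def j_def by simp
  qed
  ultimately show ?thesis by blast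
qed

section \<open>Characters of the loop group\<close>

text \<open>A continuous function with finitely many values is constant along the radial contraction
  of a small loop, so the character is 1 on small loops and takes equal values on loops with small
  quotient. The null-homotopy of a general loop is only continuous; it is sampled at finitely many
  stages, each stage is replaced by a nearby smooth loop, and consecutive replacements have small
  quotient.\<close>

lemma finite_character_trivial:
  fixes f :: "(real \<Rightarrow> 'g) \<Rightarrow> complex"
  assumes sc: "simply_connected (carrier G)"
    and mult: "\<And>\<gamma> \<eta>. \<gamma> \<in> carrier LG \<Longrightarrow> \<eta> \<in> carrier LG \<Longrightarrow> f (\<lambda>x. \<gamma> x \<otimes> \<eta> x) = f \<gamma> * f \<eta>"
    and nz: "\<And>\<gamma>. \<gamma> \<in> carrier LG \<Longrightarrow> f \<gamma> \<noteq> 0"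
    and fin: "finite (f ` carrier LG)"
    and cont: "\<And>(\<sigma> :: real \<Rightarrow> real \<Rightarrow> 'g) \<gamma> s. limitin (loop_topology G A) \<sigma> \<gamma> (at s within {0..1})
      \<Longrightarrow> ((\<lambda>t. f (\<sigma> t)) \<longlongrightarrow> f \<gamma>) (at s within {0..1})"
    and \<gamma>: "\<gamma> \<in> carrier LG"
  shows "f \<gamma> = 1"
proof -
  have one: "f (\<lambda>x. \<one>) = 1"
    using mult[OF constant_loop[OF one_closed] constant_loop[OF one_closed]] nz[OF constant_loop[OF one_closed]] by simp
  obtain U \<phi> r where U: "(U, \<phi>) \<in> A" "\<one> \<in> U" and r: "0 < r" "ball (\<phi> \<one>) r \<subseteq> \<phi> ` U"
    using chart_ball_in_nbhd[OF openin_subtopology_self one_closed] by blast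
  note D = chartD[OF U(1)]
  define W where "W = {x \<in> U. dist (\<phi> \<one>) (\<phi> x) < r}"
  have W: "openin (top_of_set (carrier G)) W" "\<one> \<in> W"
    unfolding W_def using chart_ball_openin[OF U(1)] U(2) r(1) by auto
  have small: "f \<eta> = 1" if \<eta>: "\<eta> \<in> carrier LG" "\<And>x. \<eta> x \<in> W" for \<eta>
  proof -
    have \<eta>W: "\<eta> x \<in> U \<and> \<phi> (\<eta> x) \<in> ball (\<phi> \<one>) r" for x using \<eta>(2)[of x] unfolding W_def by simp
    define \<sigma> where "\<sigma> s x = inv_into U \<phi> (\<phi> \<one> + s *\<^sub>R (\<phi> (\<eta> x) - \<phi> \<one>))" for s x
    have \<sigma>: "\<sigma> s \<in> carrier LG" "limitin (loop_topology G A) \<sigma> (\<sigma> s) (at s within {0..1})" if "s \<in> {0..1}" for s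
      using limitin_scaled_loops[OF U r \<eta>(1) \<eta>W that] unfolding \<sigma>_def[abs_def] by blast+
    have "continuous_on {0..1} (\<lambda>s. f (\<sigma> s))"
      unfolding continuous_on_def using cont[OF \<sigma>(2)] by blast
    moreover have "finite ((\<lambda>s. f (\<sigma> s)) ` {0..1})"
      by (rule finite_subset[OF _ fin]) (use \<sigma>(1) in blast)
    ultimately have "(\<lambda>s. f (\<sigma> s)) constant_on {0..1}"
      by (rule continuous_finite_range_constant[OF connected_Icc])
    then have "f (\<sigma> 0) = f (\<sigma> 1)" unfolding constant_on_def by (metis atLeastAtMost_iff order_refl zero_le_one)
    moreover have "\<sigma> 0 = (\<lambda>x. \<one>)" unfolding \<sigma>_def using D(7)[OF U(2)] by simp
    moreover have "\<sigma> 1 = \<eta>" unfolding \<sigma>_def using D(7) \<eta>W by (simp add: fun_eq_iff)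
    ultimately show ?thesis using one by simp
  qed
  obtain W' where W': "openin (top_of_set (carrier G)) W'" "\<one> \<in> W'"
      "\<And>a b d. a \<in> W' \<Longrightarrow> b \<in> W' \<Longrightarrow> d \<in> W' \<Longrightarrow> inv a \<otimes> b \<otimes> d \<in> W"
    using nbhd_quotient[OF W] by blast
  have W'c: "x \<in> carrier G" if "x \<in> W'" for x using that openin_imp_subset[OF W'(1)] by blast
  define g where "g t = \<gamma> (2 * pi * t)" for t :: real
  have \<gamma>c: "continuous_on UNIV \<gamma>" using loop_smooth[OF \<gamma>] unfolding smooth_into_def by blast
  have gp: "path g" unfolding path_def g_def
    by (rule continuous_on_compose2[OF \<gamma>c]) (auto intro!: continuous_intros)
  have "pathfinish g = pathstart g"
    using loop_periodic[OF \<gamma>, of 0] unfolding pathfinish_def pathstart_def g_def by simp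
  moreover have "path_image g \<subseteq> carrier G" unfolding path_image_def g_def using loop_value[OF \<gamma>] by auto
  moreover have "path (\<lambda>t. \<one>)" "pathfinish (\<lambda>t. \<one>) = pathstart (\<lambda>t. \<one>)" "path_image (\<lambda>t. \<one>) \<subseteq> carrier G"
    by (auto simp: path_def pathfinish_def pathstart_def path_image_def)
  ultimately have "homotopic_loops (carrier G) g (\<lambda>t. \<one>)" using sc gp unfolding simply_connected_def by blast
  \<comment> \<open>Viewed on the circle, every stage of the homotopy becomes a periodic function of
    the angle, to which the smoothing lemma applies.\<close>
  from homotopic_loops_imp_homotopic_circlemaps[OF this]
  obtain K where K: "continuous_on ({0..1} \<times> sphere 0 1) K" "K ` ({0..1} \<times> sphere 0 1) \<subseteq> carrier G"
    and K0: "\<And>z. K (0::real, z) = g (Arg2pi z / (2 * pi))" and K1: "\<And>z. K (1, z) = \<one>"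
    unfolding homotopic_with_def by (auto simp: prod_topology_subtopology_eu image_subset_iff_funcset)
  have K0\<gamma>: "K (0, cis x) = \<gamma> x" for x
  proof -
    have "cis (Arg2pi (cis x)) = cis x" using Arg2pi_eq[of "cis x"] by (simp add: cis_conv_exp)
    then have "sin (Arg2pi (cis x)) = sin x \<and> cos (Arg2pi (cis x)) = cos x" by (simp add: complex_eq_iff)
    then obtain n :: int where "Arg2pi (cis x) = x + 2 * pi * of_int n" using sin_cos_eq_iff by (metis mult.commute mult.assoc)
    then show ?thesis unfolding K0 g_def using periodic_int[OF \<gamma>, of x n] by simp
  qed
  from uniform_quotient[OF compact_Times[OF compact_Icc compact_sphere] K W'(1,2)]
  obtain \<delta> where \<delta>0: "\<delta> > 0" and \<delta>d: "\<forall>a\<in>{0..1} \<times> sphere 0 1. \<forall>b\<in>{0..1} \<times> sphere 0 1. dist a b < \<delta> \<longrightarrow> inv (K a) \<otimes> K b \<in> W'"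
    by (elim exE conjE) (rule that)
  have \<delta>: "\<delta> > 0" "\<And>a b. a \<in> {0..1} \<times> sphere 0 1 \<Longrightarrow> b \<in> {0..1} \<times> sphere 0 1 \<Longrightarrow> dist a b < \<delta> \<Longrightarrow> inv (K a) \<otimes> K b \<in> W'"
    using \<delta>0 \<delta>d by blast+
  obtain N :: nat where N: "1 / \<delta> < real N" using reals_Archimedean2 by blast
  have "1 / \<delta> > 0" using \<delta>(1) by simp
  then have N0: "real N > 0" using N by linarith
  define c where "c i x = K (real i / real N, cis x)" for i :: nat and x :: real
  have mem: "(real i / real N, cis x) \<in> {0..1} \<times> sphere 0 1" if "i \<le> N" for i x using that N0 by simp
  have cc: "c i x \<in> carrier G" if "i \<le> N" for i x using K(2) mem[OF that] unfolding c_def by blast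
  have "\<exists>\<eta>\<in>carrier LG. \<forall>x. inv (c i x) \<otimes> \<eta> x \<in> W'" if i: "i \<le> N" for i
  proof (rule smooth_loop_approximation[OF _ _ _ W'(1,2)])
    show "continuous_on UNIV (c i)" unfolding c_def
      by (rule continuous_on_compose2[OF K(1)]) (use mem[OF i] in \<open>auto intro!: continuous_intros\<close>)
    show "c i x \<in> carrier G" for x by (rule cc[OF i])
    show "c i (x + 2 * pi) = c i x" for x unfolding c_def by (simp add: cis.ctr)
  qed
  then obtain \<eta> where \<eta>: "\<And>i. i \<le> N \<Longrightarrow> \<eta> i \<in> carrier LG" "\<And>i x. i \<le> N \<Longrightarrow> inv (c i x) \<otimes> \<eta> i x \<in> W'"
    by metis
  have close: "f \<mu> = f \<nu>" if "\<mu> \<in> carrier LG" "\<nu> \<in> carrier LG" "\<And>x. inv (\<mu> x) \<otimes> \<nu> x \<in> W" for \<mu> \<nu>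
  proof -
    have l: "(\<lambda>x. inv (\<mu> x) \<otimes> \<nu> x) \<in> carrier LG" by (intro loop_mult_closed loop_inverse_closed that)
    have "f (\<lambda>x. \<mu> x \<otimes> (inv (\<mu> x) \<otimes> \<nu> x)) = f \<mu> * f (\<lambda>x. inv (\<mu> x) \<otimes> \<nu> x)" by (rule mult[OF that(1) l])
    moreover have "(\<lambda>x. \<mu> x \<otimes> (inv (\<mu> x) \<otimes> \<nu> x)) = \<nu>"
      using loop_value[OF that(1)] loop_value[OF that(2)] by (simp add: m_assoc[symmetric])
    ultimately show ?thesis using small[OF l that(3)] by simp
  qed
  have step: "f (\<eta> (Suc i)) = f (\<eta> i)" if i: "Suc i \<le> N" for i
  proof (rule close[symmetric])
    show "\<eta> i \<in> carrier LG" "\<eta> (Suc i) \<in> carrier LG" using i \<eta>(1) by auto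
    fix x
    let ?a = "inv (c i x) \<otimes> \<eta> i x" and ?d = "inv (c (Suc i) x) \<otimes> \<eta> (Suc i) x" and ?b = "inv (c i x) \<otimes> c (Suc i) x"
    have b: "?b \<in> W'" unfolding c_def
    proof (rule \<delta>(2)[OF mem mem])
      have "dist (real i / real N, cis x) (real (Suc i) / real N, cis x) = 1 / real N"
        using N0 by (simp add: dist_Pair_Pair dist_real_def diff_divide_distrib[symmetric])
      also have "\<dots> < \<delta>" using N N0 \<delta>(1) by (simp add: field_simps)
      finally show "dist (real i / real N, cis x) (real (Suc i) / real N, cis x) < \<delta>" .
    qed (use i in auto)
    have "inv ?a \<otimes> ?b \<otimes> ?d \<in> W" by (rule W'(3)[OF \<eta>(2) b \<eta>(2)]) (use i in auto)
    moreover have "inv ?a \<otimes> ?b \<otimes> ?d = inv (\<eta> i x) \<otimes> \<eta> (Suc i) x"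
    proof -
      have [simp]: "c i x \<in> carrier G" "c (Suc i) x \<in> carrier G" "\<eta> i x \<in> carrier G" "\<eta> (Suc i) x \<in> carrier G"
        using i cc \<eta>(1) loop_value by auto
      have "inv ?a \<otimes> ?b \<otimes> ?d = inv (\<eta> i x) \<otimes> (c i x \<otimes> (inv (c i x) \<otimes> (c (Suc i) x \<otimes> (inv (c (Suc i) x) \<otimes> \<eta> (Suc i) x))))"
        by (simp add: inv_mult_group m_assoc)
      also have "\<dots> = inv (\<eta> i x) \<otimes> \<eta> (Suc i) x" by (simp add: m_assoc[symmetric])
      finally show ?thesis .
    qed
    ultimately show "inv (\<eta> i x) \<otimes> \<eta> (Suc i) x \<in> W" by simp
  qed
  have chain: "f (\<eta> i) = f (\<eta> 0)" if "i \<le> N" for i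
    using that by (induction i) (simp_all add: step)
  have WW: "b \<in> W" if "b \<in> W'" for b using W'(3)[OF W'(2) that W'(2)] W'c[OF that] by simp
  have "f \<gamma> = f (\<eta> 0)"
    by (rule close[OF \<gamma> \<eta>(1)]) (use WW[OF \<eta>(2)[of 0]] in \<open>simp_all add: c_def K0\<gamma>\<close>)
  also have "\<dots> = f (\<eta> N)" using chain[of N] by simp
  also have "\<dots> = 1"
  proof (rule small[OF \<eta>(1)])
    show "\<eta> N x \<in> W" for x using WW[OF \<eta>(2)[of N x]] loop_value[OF \<eta>(1)[of N]] N0 by (simp add: c_def K1)
  qed simp
  finally show ?thesis .
qed

end

section \<open>Conjugated representations\<close>

lemma one_PU: "\<one>\<^bsub>PU\<^esub> = proj id"
  unfolding projective_unitary_group_def FactGroup_def projective_class_def r_coset_def unitary_mult by auto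

lemma PU_assoc:
  assumes "p \<in> carrier PU" "q \<in> carrier PU" "r \<in> carrier PU"
  shows "p \<odot> q \<odot> r = p \<odot> (q \<odot> r)"
  by (rule monoid.m_assoc[OF group.is_monoid[OF group_PU] assms])

lemma PU_closed:
  "p \<in> carrier PU \<Longrightarrow> q \<in> carrier PU \<Longrightarrow> p \<odot> q \<in> carrier PU"
  by (rule monoid.m_closed[OF group.is_monoid[OF group_PU]])

lemma PU_left_id: "p \<in> carrier PU \<Longrightarrow> proj id \<odot> p = p"
  using monoid.l_one[OF group.is_monoid[OF group_PU]] unfolding one_PU .

lemma PU_right_id: "p \<in> carrier PU \<Longrightarrow> p \<odot> proj id = p"
  using monoid.r_one[OF group.is_monoid[OF group_PU]] unfolding one_PU .

lemma class_inv:
  assumes "u \<in> unitaries"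
  shows "proj (inv_into UNIV u) \<odot> proj u = proj id"
    "proj u \<odot> proj (inv_into UNIV u) = proj id"
proof -
  have "inv_into UNIV u \<circ> u = id" using unitaryD(7)[OF assms] by simp
  then show "proj (inv_into UNIV u) \<odot> proj u = proj id"
    using PU_mult[OF unitary_inv[OF assms] assms] by simp
  have "u \<circ> inv_into UNIV u = id" using unitaryD(4)[OF assms] by (simp add: surj_iff)
  then show "proj u \<odot> proj (inv_into UNIV u) = proj id"
    using PU_mult[OF assms unitary_inv[OF assms]] by simp
qed

lemma circle_cis: "z \<in> carrier circle_group \<longleftrightarrow> (\<exists>\<theta>. z = cis \<theta>)"
proof
  assume "z \<in> carrier circle_group"
  then have "cmod z = 1" unfolding circle_group_def by simp
  then show "\<exists>\<theta>. z = cis \<theta>" using cis_Arg_unique rcis_cmod_Arg[of z] by (metis rcis_def mult_1 of_real_1)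
qed (auto simp: circle_group_def)

lemma unitary_continuous_conjugate:
  assumes "continuous_map (top_of_set S) unitary_topology U" "P \<in> unitaries" "Q \<in> unitaries"
  shows "continuous_map (top_of_set S) unitary_topology (\<lambda>z. Q \<circ> U z \<circ> P)"
proof -
  have U: "U ` S \<subseteq> unitaries" "\<And>x. continuous_on S (\<lambda>z. U z x)"
    using assms(1) unfolding continuous_map_unitary_iff by auto
  have "continuous_on S (\<lambda>z. (Q \<circ> U z \<circ> P) x)" for x
    using bounded_linear.continuous_on[OF unitary_bounded_linear[OF assms(3)] U(2)[of "P x"]] by simp
  moreover have "(\<lambda>z. Q \<circ> U z \<circ> P) ` S \<subseteq> unitaries"
    using U(1) by (auto intro!: unitary_comp assms(2,3))
  ultimately show ?thesis unfolding continuous_map_unitary_iff by blast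
qed

text \<open>A unitary commuting with \<open>U\<close> up to phases shifts the energy by a fixed amount; the lowest
  energy forces the shift to vanish.\<close>

lemma commute_up_to_phase:
  fixes U :: "complex \<Rightarrow> 'h \<Rightarrow> 'h::complex_hilbert_space"
  assumes U: "U \<in> hom circle_group unitary_group" and sum: "hilbert_direct_sum {n0..} (energy_space U)"
    and nz: "(UNIV :: 'h set) \<noteq> {0}" and A: "A \<in> unitaries"
    and c: "\<And>\<theta> x. U (cis \<theta>) (A x) = c \<theta> *\<^sub>C A (U (cis \<theta>) x)"
  shows "U (cis \<theta>) (A x) = A (U (cis \<theta>) x)"
proof -
  have Uc: "\<And>\<theta>. U (cis \<theta>) \<in> unitaries" by (rule hom_circleD(4)[OF U])
  obtain x1 :: 'h where x1: "x1 \<noteq> 0" using nz by auto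
  have "\<exists>d::nat. \<exists>x\<in>energy_space U (n0 + int d). x \<noteq> 0"
  proof (rule ccontr)
    assume z: "\<not> (\<exists>d::nat. \<exists>x\<in>energy_space U (n0 + int d). x \<noteq> 0)"
    have "x1 = 0"
    proof (rule orthogonal_dense_zero[of "\<Union>n\<in>{n0..}. energy_space U n"])
      fix x assume "x \<in> (\<Union>n\<in>{n0..}. energy_space U n)"
      then obtain n where "n \<ge> n0" "x \<in> energy_space U n" by auto
      then have "x \<in> energy_space U (n0 + int (nat (n - n0)))" by simp
      then have "x = 0" using z by blast
      then show "cinner x1 x = 0" by (simp add: cinner_zero_right)
    qed (use sum in \<open>simp add: hilbert_direct_sum_def\<close>)
    then show False using x1 by simp
  qed
  then obtain d :: nat where d: "\<exists>x\<in>energy_space U (n0 + int d). x \<noteq> 0"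
    and dmin: "\<And>d'. d' < d \<Longrightarrow> \<not> (\<exists>x\<in>energy_space U (n0 + int d'). x \<noteq> 0)"
    using exists_least_iff[of "\<lambda>d. \<exists>x\<in>energy_space U (n0 + int d). x \<noteq> 0"] by blast
  define l where "l = n0 + int d"
  obtain x0 where x0: "x0 \<in> energy_space U l" "x0 \<noteq> 0" using d unfolding l_def by blast
  have low: "l \<le> n" if "n \<ge> n0" "y \<in> energy_space U n" "y \<noteq> 0" for n y
  proof (rule ccontr)
    assume "\<not> l \<le> n"
    then have "nat (n - n0) < d" using that(1) unfolding l_def by linarith
    moreover have "n0 + int (nat (n - n0)) = n" using that(1) by simp
    ultimately show False using dmin[of "nat (n - n0)"] that(2,3) by metis
  qed
  \<comment> \<open>There is no nonzero vector below the lowest energy \<open>l\<close>, so the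
    image of \<open>x0\<close> can only have moved up. Stated for an arbitrary unitary
    \<open>B\<close>, this applies to \<open>A\<close> and to its inverse, whose shifts add up to
    zero.\<close>
  have shift: "\<exists>j\<ge>0. \<forall>\<theta>. b \<theta> = cis (of_int j * \<theta>)"
    if B: "B \<in> unitaries" and b: "\<And>\<theta> x. U (cis \<theta>) (B x) = b \<theta> *\<^sub>C B (U (cis \<theta>) x)" for B b
  proof -
    have Bx: "B x0 \<noteq> 0"
    proof
      assume "B x0 = 0"
      then have "norm x0 = 0" using unitaryD(5)[OF B, of x0] by simp
      then show False using x0(2) by simp
    qed
    have ev: "U (cis \<theta>) (B x0) = (b \<theta> * cis (of_int l * \<theta>)) *\<^sub>C B x0" for \<theta>
      unfolding b energy_spaceD[OF x0(1)] unitaryD(2)[OF B] scaleC_scaleC ..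
    from eigenvector_energy[of U, OF Uc sum Bx ev]
    obtain m where m: "m \<ge> n0" "\<And>\<theta>. b \<theta> * cis (of_int l * \<theta>) = cis (of_int m * \<theta>)" by blast
    have "B x0 \<in> energy_space U m" unfolding energy_space_def using ev unfolding m(2) by blast
    then have "m - l \<ge> 0" using low[OF m(1) _ Bx] by simp
    moreover have "b \<theta> = cis (of_int (m - l) * \<theta>)" for \<theta>
    proof -
      have "b \<theta> * cis (of_int l * \<theta>) * cis (- (of_int l * \<theta>)) = cis (of_int m * \<theta>) * cis (- (of_int l * \<theta>))"
        unfolding m(2) ..
      then show ?thesis by (simp add: mult.assoc cis_mult left_diff_distrib)
    qed
    ultimately show ?thesis by blast
  qed
  let ?B = "inv_into UNIV A"
  have AB: "A (?B x) = x" for x by (rule surj_f_inv_f[OF unitaryD(4)[OF A]])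
  have BA: "?B (A x) = x" for x by (rule inv_f_f[OF unitaryD(7)[OF A]])
  note B = unitary_inv[OF A]
  obtain j where j: "j \<ge> 0" "\<And>\<theta>. c \<theta> = cis (of_int j * \<theta>)" using shift[OF A c] by blast
  have c0: "c \<theta> \<noteq> 0" for \<theta> unfolding j(2) by (metis norm_cis norm_zero zero_neq_one)
  have "U (cis \<theta>) (?B x) = inverse (c \<theta>) *\<^sub>C ?B (U (cis \<theta>) x)" for \<theta> x
  proof -
    have "?B (U (cis \<theta>) x) = c \<theta> *\<^sub>C U (cis \<theta>) (?B x)"
      using arg_cong[OF c[of \<theta> "?B x"], of ?B] unfolding AB unitaryD(2)[OF B] BA .
    then show ?thesis by (simp add: scaleC_scaleC c0 scaleC_one)
  qed
  from shift[OF B this] obtain j' where j': "j' \<ge> 0" "\<And>\<theta>. inverse (c \<theta>) = cis (of_int j' * \<theta>)" by blast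
  have "j = 0"
  proof (rule ccontr)
    assume "j \<noteq> 0"
    then have p: "real_of_int (j + j') \<noteq> 0" using j(1) j'(1) by linarith
    have "c \<theta> * inverse (c \<theta>) = cis (of_int (j + j') * \<theta>)" for \<theta>
      unfolding j'(2) unfolding j(2) cis_mult by (simp add: distrib_right)
    from this[of "pi / of_int (j + j')"] have "1 = cis pi" using p c0 by simp
    then show False by (simp add: complex_eq_iff)
  qed
  then show ?thesis using c[of \<theta> x] j(2) by (simp add: scaleC_one)
qed

text \<open>The witnesses quantified in \<open>positive_energy\<close>, made explicit; positive
  energy is proved by exhibiting an instance of this locale.\<close>

locale loop_rep = lie_group G A
  for G :: "('g::t2_space, 'b) monoid_scheme" (structure) and A :: "('g, 'e::euclidean_space) atlas" +
  fixes \<pi> :: "(real \<Rightarrow> 'g) \<Rightarrow> ('h::complex_hilbert_space \<Rightarrow> 'h) set"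
    and \<rho> :: "(real \<Rightarrow> 'g) \<times> complex \<Rightarrow> ('h \<Rightarrow> 'h) set"
    and U :: "complex \<Rightarrow> 'h \<Rightarrow> 'h" and n0 :: int
  assumes pi_hom: "\<pi> \<in> hom LG PU"
    and pi_continuous: "continuous_map (loop_topology G A) projective_unitary_topology \<pi>"
    and rho_hom: "\<rho> \<in> hom (loop_rot_group G A) PU"
    and rho_continuous: "continuous_map (loop_rot_topology G A) projective_unitary_topology \<rho>"
    and rho_pi: "\<And>\<gamma>. \<gamma> \<in> carrier LG \<Longrightarrow> \<rho> (\<gamma>, \<one>\<^bsub>circle_group\<^esub>) = \<pi> \<gamma>"
    and U_hom: "U \<in> hom circle_group unitary_group"
    and U_continuous: "continuous_map (top_of_set (carrier circle_group)) unitary_topology U"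
    and rho_U: "\<And>z. z \<in> carrier circle_group \<Longrightarrow> \<rho> (\<one>\<^bsub>LG\<^esub>, z) = proj (U z)"
    and energy_sum: "hilbert_direct_sum {n0..} (energy_space U)"
    and energy_finite: "\<And>n. n \<ge> n0 \<Longrightarrow> finite_dimensional (energy_space U n)"

section \<open>Positive energy as an instance of \<open>loop_rep\<close>\<close>

context lie_group
begin

lemma positive_energy_iff: "positive_energy G A \<pi> \<longleftrightarrow> (\<exists>\<rho> U n0. loop_rep G A \<pi> \<rho> U n0)"
  unfolding positive_energy_def loop_rep_def loop_rep_axioms_def using lie_group_axioms by blast

text \<open>\<open>conjugate_rep\<close> is a function on arbitrary maps, whereas identities between
  its values need the maps to be loops in \<open>G\<close>.\<close>

lemma positive_energy_cong:
  assumes pe: "positive_energy G A \<pi>" and eq: "\<And>\<gamma>. \<gamma> \<in> carrier LG \<Longrightarrow> \<pi> \<gamma> = \<pi>' \<gamma>"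
  shows "positive_energy G A \<pi>'"
proof -
  obtain \<rho> U n0 where "loop_rep G A \<pi> \<rho> U n0" using pe unfolding positive_energy_iff by blast
  then interpret loop_rep G A \<pi> \<rho> U n0 .
  interpret L: group LG by (rule group_loop_group)
  have "loop_rep G A \<pi>' \<rho> U n0"
  proof
    show "\<pi>' \<in> hom LG PU"
      using pi_hom unfolding hom_def by (auto simp: eq[symmetric] L.m_closed)
    show "continuous_map (loop_topology G A) projective_unitary_topology \<pi>'"
      by (rule continuous_map_eq[OF pi_continuous]) (simp add: eq topspace_loop_topology)
    show "\<rho> (\<gamma>, \<one>\<^bsub>circle_group\<^esub>) = \<pi>' \<gamma>" if "\<gamma> \<in> carrier LG" for \<gamma> using rho_pi[OF that] eq[OF that] by simp
  qed (rule rho_hom rho_continuous U_hom U_continuous rho_U energy_sum energy_finite; assumption)+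
  then show ?thesis unfolding positive_energy_iff by blast
qed

lemma rot_group_mult:
  "(\<gamma>, z) \<otimes>\<^bsub>loop_rot_group G A\<^esub> (\<eta>, w) = ((\<lambda>x. \<gamma> x \<otimes> rotate_loop z \<eta> x), z * w)"
  unfolding loop_rot_group_def loop_mult[symmetric] by (simp add: circle_group_def)

lemma rot_group_carrier: "(\<gamma>, z) \<in> carrier (loop_rot_group G A) \<longleftrightarrow> \<gamma> \<in> carrier LG \<and> z \<in> carrier circle_group"
  unfolding loop_rot_group_def by simp

end

context loop_rep
begin

lemma pi_mult: "\<gamma> \<in> carrier LG \<Longrightarrow> \<eta> \<in> carrier LG \<Longrightarrow> \<pi> (\<lambda>x. \<gamma> x \<otimes> \<eta> x) = \<pi> \<gamma> \<odot> \<pi> \<eta>"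
  using hom_mult[OF pi_hom, of \<gamma> \<eta>] unfolding loop_mult .

lemma pi_carrier: "\<gamma> \<in> carrier LG \<Longrightarrow> \<pi> \<gamma> \<in> carrier PU"
  by (rule hom_in_carrier[OF pi_hom])

lemma pi_one: "\<pi> (\<lambda>x. \<one>) = proj id"
  using hom_one[OF pi_hom group_loop_group group_PU] unfolding loop_one one_PU .

lemma pi_rep: "\<gamma> \<in> carrier LG \<Longrightarrow> \<exists>u\<in>unitaries. \<pi> \<gamma> = proj u"
  using pi_carrier unfolding PU_carrier_iff by blast

lemma U_unitary: "U (cis \<theta>) \<in> unitaries"
  by (rule hom_circleD(4)[OF U_hom])

lemma U_class: "proj (U (cis \<theta>)) \<in> carrier PU"
  by (rule PU_carrier[OF U_unitary])

text \<open>The image under \<open>\<rho>\<close> of the defining commutation relation of the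
  semidirect product.\<close>

lemma rotation_covariance:
  assumes \<gamma>: "\<gamma> \<in> carrier LG"
  shows "proj (U (cis \<theta>)) \<odot> \<pi> \<gamma> = \<pi> (\<lambda>x. \<gamma> (x - \<theta>)) \<odot> proj (U (cis \<theta>))"
proof -
  have c: "cis \<theta> \<in> carrier circle_group" and o: "1 \<in> carrier circle_group" by (simp_all add: circle_group_def)
  have one: "(\<lambda>x. \<one>) \<in> carrier LG" by (rule constant_loop) simp
  have s: "(\<lambda>x. \<gamma> (x - \<theta>)) \<in> carrier LG" by (rule shift_loop[OF \<gamma>])
  have r1: "\<rho> (\<eta>, 1) = \<pi> \<eta>" if "\<eta> \<in> carrier LG" for \<eta>
    using rho_pi[OF that] by (simp add: circle_group_def)
  have rU: "\<rho> (\<lambda>x. \<one>, cis \<theta>) = proj (U (cis \<theta>))" using rho_U[OF c] unfolding loop_one .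
  have "(\<lambda>x. \<one>, cis \<theta>) \<otimes>\<^bsub>loop_rot_group G A\<^esub> (\<gamma>, 1) = (\<lambda>x. \<gamma> (x - \<theta>), 1) \<otimes>\<^bsub>loop_rot_group G A\<^esub> (\<lambda>x. \<one>, cis \<theta>)"
    unfolding rot_group_mult rotate_loop_cis[OF \<gamma>] using loop_value[OF \<gamma>] by (simp add: rotate_loop_def)
  from arg_cong[OF this, of \<rho>] show ?thesis
    using hom_mult[OF rho_hom, of "(\<lambda>x. \<one>, cis \<theta>)" "(\<gamma>, 1)"] hom_mult[OF rho_hom, of "(\<lambda>x. \<gamma> (x - \<theta>), 1)" "(\<lambda>x. \<one>, cis \<theta>)"]
    unfolding rot_group_carrier using one \<gamma> s c o r1[OF \<gamma>] r1[OF s] rU by simp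
qed

lemma positive_energy_conjugate_loop:
  assumes \<gamma>0: "\<gamma>0 \<in> carrier LG"
  shows "positive_energy G A (conjugate_rep G \<gamma>0 \<pi>)"
proof -
  obtain P where P: "P \<in> unitaries" "\<pi> \<gamma>0 = proj P" using pi_rep[OF \<gamma>0] by blast
  define Q where "Q = inv_into UNIV P"
  have Q: "Q \<in> unitaries" unfolding Q_def by (rule unitary_inv[OF P(1)])
  let ?p = "proj P" and ?q = "proj Q"
  have pc: "?p \<in> carrier PU" and qc: "?q \<in> carrier PU"
    by (rule PU_carrier[OF P(1)], rule PU_carrier[OF Q])
  have qp: "?q \<odot> ?p = proj id" and pq: "?p \<odot> ?q = proj id"
    unfolding Q_def by (rule class_inv[OF P(1)])+
  have conj_mult: "?q \<odot> (a \<odot> b) \<odot> ?p = (?q \<odot> a \<odot> ?p) \<odot> (?q \<odot> b \<odot> ?p)"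
    if a: "a \<in> carrier PU" and b: "b \<in> carrier PU" for a b
  proof -
    have "(?q \<odot> a \<odot> ?p) \<odot> (?q \<odot> b \<odot> ?p) = ?q \<odot> a \<odot> ((?p \<odot> ?q) \<odot> (b \<odot> ?p))"
      by (simp add: PU_assoc PU_closed a b pc qc)
    also have "\<dots> = ?q \<odot> (a \<odot> b) \<odot> ?p"
      unfolding pq by (simp add: PU_left_id PU_assoc PU_closed a b pc qc)
    finally show ?thesis ..
  qed
  have inv0: "(\<lambda>x. inv (\<gamma>0 x)) \<in> carrier LG" by (rule loop_inverse_closed[OF \<gamma>0])
  have pinv: "\<pi> (\<lambda>x. inv (\<gamma>0 x)) = ?q"
  proof -
    have "(\<lambda>x. inv (\<gamma>0 x) \<otimes> \<gamma>0 x) = (\<lambda>x. \<one>)" using loop_value[OF \<gamma>0] by simp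
    then have e: "\<pi> (\<lambda>x. inv (\<gamma>0 x)) \<odot> ?p = proj id"
      using pi_mult[OF inv0 \<gamma>0] unfolding P(2) pi_one[symmetric] by simp
    have "\<pi> (\<lambda>x. inv (\<gamma>0 x)) = \<pi> (\<lambda>x. inv (\<gamma>0 x)) \<odot> (?p \<odot> ?q)"
      unfolding pq using PU_right_id[OF pi_carrier[OF inv0]] by simp
    also have "\<dots> = proj id \<odot> ?q" unfolding e[symmetric] by (simp add: PU_assoc pi_carrier[OF inv0] pc qc)
    finally show ?thesis using PU_left_id[OF qc] by simp
  qed
  have conj: "conjugate_rep G \<gamma>0 \<pi> \<gamma> = ?q \<odot> \<pi> \<gamma> \<odot> ?p" if \<gamma>: "\<gamma> \<in> carrier LG" for \<gamma>
    unfolding conjugate_rep_def pi_mult[OF loop_mult_closed[OF inv0 \<gamma>] \<gamma>0] pi_mult[OF inv0 \<gamma>] pinv P(2) ..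
  define V where "V = (\<lambda>z. Q \<circ> U z \<circ> P)"
  note E = energy_conjugate[OF U_hom P(1) V_def[unfolded Q_def] energy_sum]
  have "loop_rep G A (\<lambda>\<gamma>. ?q \<odot> \<pi> \<gamma> \<odot> ?p) (\<lambda>a. ?q \<odot> \<rho> a \<odot> ?p) V n0"
  proof
    show "(\<lambda>\<gamma>. ?q \<odot> \<pi> \<gamma> \<odot> ?p) \<in> hom LG PU"
      by (rule homI) (simp_all add: PU_closed pc qc pi_carrier hom_mult[OF pi_hom] conj_mult)
    show "(\<lambda>a. ?q \<odot> \<rho> a \<odot> ?p) \<in> hom (loop_rot_group G A) PU"
      by (rule homI) (simp_all add: PU_closed pc qc hom_in_carrier[OF rho_hom] hom_mult[OF rho_hom] conj_mult)
    show "continuous_map (loop_topology G A) projective_unitary_topology (\<lambda>\<gamma>. ?q \<odot> \<pi> \<gamma> \<odot> ?p)"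
      by (intro continuous_map_PU_mult pi_continuous) (simp_all add: topspace_PU pc qc)
    show "continuous_map (loop_rot_topology G A) projective_unitary_topology (\<lambda>a. ?q \<odot> \<rho> a \<odot> ?p)"
      by (intro continuous_map_PU_mult rho_continuous) (simp_all add: topspace_PU pc qc)
    show "?q \<odot> \<rho> (\<gamma>, \<one>\<^bsub>circle_group\<^esub>) \<odot> ?p = ?q \<odot> \<pi> \<gamma> \<odot> ?p" if "\<gamma> \<in> carrier LG" for \<gamma>
      unfolding rho_pi[OF that] ..
    show "V \<in> hom circle_group unitary_group" by (rule E(1)) (rule energy_finite, simp)
    show "continuous_map (top_of_set (carrier circle_group)) unitary_topology V"
      unfolding V_def by (rule unitary_continuous_conjugate[OF U_continuous P(1) Q])
    show "?q \<odot> \<rho> (\<one>\<^bsub>LG\<^esub>, z) \<odot> ?p = proj (V z)" if z: "z \<in> carrier circle_group" for z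
    proof -
      have Uz: "U z \<in> unitaries" by (rule hom_in_carrier[OF U_hom z])
      show ?thesis unfolding rho_U[OF z] V_def PU_mult[OF Q Uz] PU_mult[OF unitary_comp[OF Q Uz] P(1)] ..
    qed
    show "hilbert_direct_sum {n0..} (energy_space V)" by (rule E(2)) (rule energy_finite, simp)
    show "finite_dimensional (energy_space V n)" if "n \<ge> n0" for n by (rule E(3)) (use that energy_finite in simp_all)
  qed
  then have "positive_energy G A (\<lambda>\<gamma>. ?q \<odot> \<pi> \<gamma> \<odot> ?p)" unfolding positive_energy_iff by blast
  then show ?thesis by (rule positive_energy_cong) (simp add: conj)
qed

end

section \<open>Conjugation by a one-parameter subgroup through \<open>z\<close>\<close>

locale twisted_rep = loop_rep G A \<pi> \<rho> U n0
  for G :: "('g::t2_space, 'b) monoid_scheme" (structure) and A :: "('g, 'e::euclidean_space) atlas"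
    and \<pi> :: "(real \<Rightarrow> 'g) \<Rightarrow> ('h::complex_hilbert_space \<Rightarrow> 'h) set"
    and \<rho> :: "(real \<Rightarrow> 'g) \<times> complex \<Rightarrow> ('h \<Rightarrow> 'h) set"
    and U :: "complex \<Rightarrow> 'h \<Rightarrow> 'h" and n0 :: int +
  fixes g :: "real \<Rightarrow> 'g" and z :: 'g and k :: nat
  assumes g_smooth: "smooth_into A UNIV g" and g_add: "\<And>s t. g (s + t) = g s \<otimes> g t" and g_period: "g (2 * pi) = z"
    and z_center: "z \<in> group_center G" and z_pow: "z [^] k = \<one>" and k2: "k \<ge> 2"
    and irreducible: "irreducible_rep G A \<pi>" and simply_conn: "simply_connected (carrier G)"
begin

lemma nontrivial: "(UNIV :: 'h set) \<noteq> {0}"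
  using irreducible unfolding irreducible_rep_def by blast

lemma k0: "real k > 0"
  using k2 by simp

lemma g_carrier: "g t \<in> carrier G"
  by (rule smooth_intoD[OF g_smooth UNIV_I])

lemma g_zero: "g 0 = \<one>"
  using g_add[of 0 0] g_carrier[of 0] by (simp add: l_cancel_one')

lemma g_minus: "g (- t) = inv (g t)"
  using g_add[of "- t" t] g_zero g_carrier by (intro inv_equality[symmetric]) simp_all

lemma z_carrier: "z \<in> carrier G"
  using g_carrier g_period by metis

lemma z_comm: "p \<in> carrier G \<Longrightarrow> z \<otimes> p = p \<otimes> z"
  using z_center unfolding group_center_def by blast

text \<open>Over a period \<open>g\<close> acquires the factor \<open>z\<close>, which is central
  and cancels from the conjugate.\<close>

lemma conj_closed:
  assumes \<gamma>: "\<gamma> \<in> carrier LG" shows "(\<lambda>x. inv (g x) \<otimes> \<gamma> x \<otimes> g x) \<in> carrier LG"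
proof -
  have "inv (g x \<otimes> z) \<otimes> \<gamma> x \<otimes> (g x \<otimes> z) = inv (g x) \<otimes> \<gamma> x \<otimes> g x" for x
  proof -
    have [simp]: "g x \<in> carrier G" "z \<in> carrier G" "\<gamma> x \<in> carrier G" using g_carrier z_carrier loop_value[OF \<gamma>] by auto
    have "inv (g x \<otimes> z) \<otimes> \<gamma> x \<otimes> (g x \<otimes> z) = inv z \<otimes> ((inv (g x) \<otimes> \<gamma> x \<otimes> g x) \<otimes> z)"
      by (simp add: inv_mult_group m_assoc)
    also have "(inv (g x) \<otimes> \<gamma> x \<otimes> g x) \<otimes> z = z \<otimes> (inv (g x) \<otimes> \<gamma> x \<otimes> g x)" by (rule z_comm[symmetric]) simp
    also have "inv z \<otimes> (z \<otimes> (inv (g x) \<otimes> \<gamma> x \<otimes> g x)) = inv (g x) \<otimes> \<gamma> x \<otimes> g x"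
      by (subst m_assoc[symmetric]) simp_all
    finally show ?thesis .
  qed
  then show ?thesis
    unfolding loop_carrier_iff g_add g_period loop_periodic[OF \<gamma>]
    by (intro conjI allI smooth_into_mult smooth_into_inv g_smooth loop_smooth[OF \<gamma>])
qed

abbreviation \<kappa> :: "'g \<Rightarrow> ('h \<Rightarrow> 'h) set" where
  "\<kappa> p \<equiv> \<pi> (\<lambda>x. p)"

lemma kappa_carrier: "p \<in> carrier G \<Longrightarrow> \<kappa> p \<in> carrier PU"
  by (rule pi_carrier[OF constant_loop])

lemma kappa_commute: "p \<in> carrier G \<Longrightarrow> proj (U (cis \<theta>)) \<odot> \<kappa> p = \<kappa> p \<odot> proj (U (cis \<theta>))"
  by (rule rotation_covariance[OF constant_loop])

text \<open>The loop \<open>x \<mapsto> g (k x)\<close> is a \<open>k\<close>-th power of the multivalued gauge transformation \<open>g\<close>;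
  it closes up because \<open>z\<^sup>k = 1\<close>.\<close>

definition h :: "real \<Rightarrow> 'g" where
  "h x = g (real k * x)"

lemma h_loop: "h \<in> carrier LG"
proof -
  have p: "g (2 * pi * real n) = z [^] n" for n
  proof (induction n)
    case (Suc n)
    have "2 * pi * real (Suc n) = 2 * pi * real n + 2 * pi" by (simp add: algebra_simps)
    then show ?case using Suc.IH g_add g_period by simp
  qed (simp add: g_zero)
  have "h (x + 2 * pi) = h x" for x
  proof -
    have "real k * (x + 2 * pi) = real k * x + 2 * pi * real k" by (simp add: algebra_simps)
    then show ?thesis unfolding h_def using g_add p[of k] z_pow g_carrier by simp
  qed
  moreover have "smooth_on UNIV (\<lambda>x. real k * x)"
    by (rule smooth_on_linear[OF open_UNIV bounded_linear_mult_right smooth_on_id[OF open_UNIV]])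
  from smooth_into_compose[OF g_smooth open_UNIV this] have "smooth_into A UNIV h" unfolding h_def[abs_def] by simp
  ultimately show ?thesis unfolding loop_carrier_iff by blast
qed

definition H :: "'h \<Rightarrow> 'h" where
  "H = (SOME u. u \<in> unitaries \<and> \<pi> h = proj u)"

lemma H: "H \<in> unitaries" "\<pi> h = proj H"
proof -
  have "\<exists>u. u \<in> unitaries \<and> \<pi> h = proj u" using pi_rep[OF h_loop] by blast
  from someI_ex[OF this] show "H \<in> unitaries" "\<pi> h = proj H" unfolding H_def by blast+
qed

definition U' :: "complex \<Rightarrow> 'h \<Rightarrow> 'h" where
  "U' = (\<lambda>w. inv_into UNIV H \<circ> U w \<circ> H)"

lemma U'_hom: "U' \<in> hom circle_group unitary_group"
  and U'_sum: "hilbert_direct_sum {n0..} (energy_space U')"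
  by (rule energy_conjugate[OF U_hom H(1) U'_def energy_sum]; rule energy_finite; simp)+

lemma U'_unitary: "U' (cis \<theta>) \<in> unitaries"
  by (rule hom_circleD(4)[OF U'_hom])

text \<open>Because \<open>g\<close> is a homomorphism, shifting \<open>h\<close> by \<theta>
  multiplies it by a constant loop. Carrying \<open>\<pi> h\<close> past the rotation therefore
  leaves only this constant factor.\<close>

lemma class_U': "proj (U' (cis \<theta>)) = \<kappa> (g (- (real k * \<theta>))) \<odot> proj (U (cis \<theta>))"
proof -
  let ?Q = "inv_into UNIV H" and ?u = "proj (U (cis \<theta>))" and ?p = "g (- (real k * \<theta>))"
  note Q = unitary_inv[OF H(1)]
  have kc: "\<kappa> ?p \<in> carrier PU" by (rule kappa_carrier[OF g_carrier])
  have "(\<lambda>x. h (x - \<theta>)) = (\<lambda>x. h x \<otimes> ?p)"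
    unfolding h_def g_add[symmetric] by (simp add: right_diff_distrib)
  then have sh: "\<pi> (\<lambda>x. h (x - \<theta>)) = proj H \<odot> \<kappa> ?p"
    using pi_mult[OF h_loop constant_loop[OF g_carrier]] H(2) by simp
  have "proj (U' (cis \<theta>)) = proj ?Q \<odot> ?u \<odot> proj H"
    unfolding U'_def PU_mult[OF Q U_unitary] PU_mult[OF unitary_comp[OF Q U_unitary] H(1)] ..
  also have "\<dots> = proj ?Q \<odot> (?u \<odot> \<pi> h)"
    unfolding H(2) by (rule PU_assoc[OF PU_carrier[OF Q] U_class PU_carrier[OF H(1)]])
  also have "\<dots> = (proj ?Q \<odot> proj H) \<odot> (\<kappa> ?p \<odot> ?u)"
    unfolding rotation_covariance[OF h_loop] sh
    by (simp add: PU_assoc PU_closed PU_carrier[OF Q] PU_carrier[OF H(1)] kc U_class)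
  also have "\<dots> = \<kappa> ?p \<odot> ?u" unfolding class_inv(1)[OF H(1)] by (rule PU_left_id[OF PU_closed[OF kc U_class]])
  finally show ?thesis .
qed

text \<open>The classes commute since the twist of \<open>U'\<close> is by constant loops, which
  rotations fix. The remaining phase is removed by the lowest energy argument.\<close>

lemma U_U'_commute: "U (cis s) (U' (cis t) x) = U' (cis t) (U (cis s) x)"
proof -
  let ?p = "g (- (real k * t))"
  have "\<exists>c. \<forall>x. U (cis s) (U' (cis t) x) = c *\<^sub>C U' (cis t) (U (cis s) x)" for s
  proof -
    have kc: "\<kappa> ?p \<in> carrier PU" by (rule kappa_carrier[OF g_carrier])
    have uu: "proj (U (cis s)) \<odot> proj (U (cis t)) = proj (U (cis t)) \<odot> proj (U (cis s))"
      unfolding PU_mult[OF U_unitary U_unitary]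
      using hom_circleD(2)[OF U_hom, of "cis s" "cis t"] hom_circleD(2)[OF U_hom, of "cis t" "cis s"] by (simp add: mult.commute)
    have "proj (U (cis s)) \<odot> proj (U' (cis t)) = proj (U (cis s)) \<odot> \<kappa> ?p \<odot> proj (U (cis t))"
      unfolding class_U' by (rule PU_assoc[symmetric, OF U_class kc U_class])
    also have "\<dots> = \<kappa> ?p \<odot> (proj (U (cis s)) \<odot> proj (U (cis t)))"
      unfolding kappa_commute[OF g_carrier] by (rule PU_assoc[OF kc U_class U_class])
    also have "\<dots> = proj (U' (cis t)) \<odot> proj (U (cis s))"
      unfolding uu class_U' by (rule PU_assoc[symmetric, OF kc U_class U_class])
    finally have "proj (U (cis s) \<circ> U' (cis t)) = proj (U' (cis t) \<circ> U (cis s))"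
      unfolding PU_mult[OF U_unitary U'_unitary] PU_mult[OF U'_unitary U_unitary] .
    then show ?thesis unfolding class_eq_iff by (auto simp: fun_eq_iff)
  qed
  then obtain c where "\<And>s x. U (cis s) (U' (cis t) x) = c s *\<^sub>C U' (cis t) (U (cis s) x)" by metis
  from commute_up_to_phase[OF U_hom energy_sum nontrivial U'_unitary this] show ?thesis .
qed

sublocale energies: commuting_energies U U' n0 n0
proof
  show "U a \<circ> U' b = U' b \<circ> U a" if ab: "a \<in> sphere 0 1" "b \<in> sphere 0 1" for a b
  proof -
    obtain s t where "a = cis s" "b = cis t" using ab circle_cis[of a] circle_cis[of b] by (auto simp: circle_group_def)
    then show ?thesis using U_U'_commute by (simp add: fun_eq_iff)
  qed
qed (rule U_hom U'_hom energy_sum U'_sum energy_finite; assumption)+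

text \<open>The factor from \<open>U'\<close> contributes the twist \<open>g (- \<theta>)\<close>
  together with a rotation by \<theta>/k; the untwisted \<open>U\<close> supplies the rest of the
  rotation.\<close>

definition V0 :: "real \<Rightarrow> 'h \<Rightarrow> 'h" where
  "V0 \<theta> = U' (cis (\<theta> / k)) \<circ> U (cis (\<theta> - \<theta> / k))"

lemma V0_unitary: "V0 \<theta> \<in> unitaries"
  unfolding V0_def by (rule unitary_comp[OF U'_unitary U_unitary])

lemma V0_add: "V0 (s + t) x = V0 s (V0 t x)"
proof -
  have 1: "(s + t) / k = s / k + t / k" and 2: "s + t - (s + t) / k = (s - s / k) + (t - t / k)"
    by (simp_all add: add_divide_distrib)
  show ?thesis unfolding V0_def o_def 2 unfolding 1 hom_circleD(5)[OF U_hom] hom_circleD(5)[OF U'_hom] U_U'_commute ..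
qed

lemma class_V0: "proj (V0 \<theta>) = \<kappa> (g (- \<theta>)) \<odot> proj (U (cis \<theta>))"
proof -
  have kc: "\<kappa> (g (- \<theta>)) \<in> carrier PU" by (rule kappa_carrier[OF g_carrier])
  have "proj (V0 \<theta>) = \<kappa> (g (- \<theta>)) \<odot> proj (U (cis (\<theta> / k))) \<odot> proj (U (cis (\<theta> - \<theta> / k)))"
    unfolding V0_def PU_mult[OF U'_unitary U_unitary, symmetric] class_U' using k0 by simp
  also have "\<dots> = \<kappa> (g (- \<theta>)) \<odot> proj (U (cis (\<theta> / k)) \<circ> U (cis (\<theta> - \<theta> / k)))"
    unfolding PU_mult[OF U_unitary U_unitary, symmetric] by (rule PU_assoc[OF kc U_class U_class])
  also have "U (cis (\<theta> / k)) \<circ> U (cis (\<theta> - \<theta> / k)) = U (cis \<theta>)"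
    using hom_circleD(2)[OF U_hom, of "cis (\<theta> / k)" "cis (\<theta> - \<theta> / k)"] by (simp add: cis_mult)
  finally show ?thesis .
qed

text \<open>The full turn \<open>V0 (2\<pi>)\<close> represents the constant loop \<open>z\<^sup>-\<^sup>1\<close>. It commutes with every \<open>\<pi> \<gamma>\<close> up to
  a root of unity depending on \<open>\<gamma>\<close>, that is, up to a character of the loop group of finite order.\<close>

lemma full_turn_commutes:
  assumes \<gamma>: "\<gamma> \<in> carrier LG" and u: "u \<in> \<pi> \<gamma>"
  shows "V0 (2 * pi) (u x) = u (V0 (2 * pi) x)"
proof -
  define P where "P = V0 (2 * pi)"
  have P: "P \<in> unitaries" unfolding P_def by (rule V0_unitary)
  have ziv: "inv z \<in> carrier G" using z_carrier by simp
  have "cis (2 * pi) = 1" by (simp add: complex_eq_iff)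
  then have cP: "proj P = \<kappa> (inv z)"
    unfolding P_def class_V0 g_minus g_period using hom_circleD(3)[OF U_hom] PU_right_id[OF kappa_carrier[OF ziv]] by simp
  obtain x1 :: 'h where x1: "x1 \<noteq> 0" using nontrivial by auto
  have inj0: "u y \<noteq> 0" if "u \<in> unitaries" "y \<noteq> 0" for u and y :: 'h
    using unitaryD(5)[OF that(1), of y] that(2) by auto
  have rel: "\<exists>c\<in>sphere 0 1. \<forall>x. P (u x) = c *\<^sub>C u (P x)"
    if \<gamma>: "\<gamma> \<in> carrier LG" and u: "u \<in> unitaries" "\<pi> \<gamma> = proj u" for \<gamma> u
  proof -
    have "inv z \<otimes> \<gamma> x = \<gamma> x \<otimes> inv z" for x
    proof -
      have [simp]: "z \<in> carrier G" "\<gamma> x \<in> carrier G" using z_carrier loop_value[OF \<gamma>] by auto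
      have "inv z \<otimes> \<gamma> x = inv z \<otimes> ((\<gamma> x \<otimes> z) \<otimes> inv z)" by (simp add: m_assoc)
      also have "\<gamma> x \<otimes> z = z \<otimes> \<gamma> x" by (rule z_comm[symmetric]) simp
      also have "(z \<otimes> \<gamma> x) \<otimes> inv z = z \<otimes> (\<gamma> x \<otimes> inv z)" by (rule m_assoc) simp_all
      also have "inv z \<otimes> (z \<otimes> (\<gamma> x \<otimes> inv z)) = (inv z \<otimes> z) \<otimes> (\<gamma> x \<otimes> inv z)"
        by (rule m_assoc[symmetric]) simp_all
      finally show ?thesis by simp
    qed
    then have "\<kappa> (inv z) \<odot> \<pi> \<gamma> = \<pi> \<gamma> \<odot> \<kappa> (inv z)"
      using pi_mult[OF constant_loop[OF ziv] \<gamma>] pi_mult[OF \<gamma> constant_loop[OF ziv]] by simp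
    then have "proj (P \<circ> u) = proj (u \<circ> P)"
      unfolding cP[symmetric] u(2) PU_mult[OF P u(1)] PU_mult[OF u(1) P] .
    then show ?thesis unfolding class_eq_iff by (auto simp: fun_eq_iff)
  qed
  \<comment> \<open>A phase in the choice of \<open>u\<close> cancels from the relation, so one
    constant serves all representatives of \<open>\<pi> \<gamma>\<close>.\<close>
  define f where "f \<gamma> = (SOME c. c \<in> sphere 0 1 \<and> (\<forall>u\<in>\<pi> \<gamma>. \<forall>x. P (u x) = c *\<^sub>C u (P x)))" for \<gamma>
  have f: "cmod (f \<gamma>) = 1" "\<And>u x. u \<in> \<pi> \<gamma> \<Longrightarrow> P (u x) = f \<gamma> *\<^sub>C u (P x)" if \<gamma>: "\<gamma> \<in> carrier LG" for \<gamma>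
  proof -
    obtain u where u: "u \<in> unitaries" "\<pi> \<gamma> = proj u" using pi_rep[OF \<gamma>] by blast
    obtain c where c: "c \<in> sphere 0 1" "\<And>x. P (u x) = c *\<^sub>C u (P x)" using rel[OF \<gamma> u] by blast
    have "\<exists>c. c \<in> sphere 0 1 \<and> (\<forall>u\<in>\<pi> \<gamma>. \<forall>x. P (u x) = c *\<^sub>C u (P x))"
    proof (intro exI[of _ c] conjI ballI allI c(1))
      fix v x assume "v \<in> \<pi> \<gamma>"
      then obtain d where "v = (\<lambda>x. d *\<^sub>C u x)" unfolding u(2) class_iff by blast
      then show "P (v x) = c *\<^sub>C v (P x)" by (simp add: unitaryD(2)[OF P] c(2) scaleC_scaleC mult.commute)
    qed
    from someI_ex[OF this] show "cmod (f \<gamma>) = 1" "\<And>u x. u \<in> \<pi> \<gamma> \<Longrightarrow> P (u x) = f \<gamma> *\<^sub>C u (P x)"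
      unfolding f_def[symmetric] by auto
  qed
  have P0: "P x1 \<noteq> 0" by (rule inj0[OF P x1])
  have "f \<gamma> = 1"
  proof (rule finite_character_trivial[OF simply_conn _ _ _ _ \<gamma>])
    show "f (\<lambda>x. \<gamma> x \<otimes> \<eta> x) = f \<gamma> * f \<eta>" if \<gamma>: "\<gamma> \<in> carrier LG" and \<eta>: "\<eta> \<in> carrier LG" for \<gamma> \<eta>
    proof -
      obtain u where u: "u \<in> unitaries" "\<pi> \<gamma> = proj u" using pi_rep[OF \<gamma>] by blast
      obtain v where v: "v \<in> unitaries" "\<pi> \<eta> = proj v" using pi_rep[OF \<eta>] by blast
      have "u \<circ> v \<in> \<pi> (\<lambda>x. \<gamma> x \<otimes> \<eta> x)"
        unfolding pi_mult[OF \<gamma> \<eta>] u(2) v(2) PU_mult[OF u(1) v(1)] by (rule self_in_class)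
      from f(2)[OF loop_mult_closed[OF \<gamma> \<eta>] this, of x1]
      have "P (u (v x1)) = f (\<lambda>x. \<gamma> x \<otimes> \<eta> x) *\<^sub>C u (v (P x1))" by simp
      moreover have "P (u (v x1)) = (f \<gamma> * f \<eta>) *\<^sub>C u (v (P x1))"
        using f(2)[OF \<gamma>, of u "v x1"] f(2)[OF \<eta>, of v x1] self_in_class[of u] self_in_class[of v]
        by (simp add: u(2) v(2) unitaryD(2)[OF u(1)] scaleC_scaleC)
      ultimately show ?thesis using scaleC_cancel inj0[OF u(1) inj0[OF v(1) P0]] by metis
    qed
    show "f \<gamma> \<noteq> 0" if "\<gamma> \<in> carrier LG" for \<gamma> using f(1)[OF that] by auto
    \<comment> \<open>The \<open>k\<close>-th power of the full turn is
      \<open>V0 (2 * pi * k)\<close>, whose class comes from the constant loop at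
      \<open>g (- (2 * pi * k))\<close>, the identity. That power is thus a scalar, while commuting
      it past \<open>u\<close> produces the factor \<open>f \<gamma> ^ k\<close>.\<close>
    have "f \<gamma> ^ k = 1" if \<gamma>: "\<gamma> \<in> carrier LG" for \<gamma>
    proof -
      obtain u where u: "u \<in> unitaries" "\<pi> \<gamma> = proj u" using pi_rep[OF \<gamma>] by blast
      have Pu: "P (u x) = f \<gamma> *\<^sub>C u (P x)" for x using f(2)[OF \<gamma>, of u x] self_in_class[of u] u(2) by simp
      have pow: "(P ^^ n) (u x) = (f \<gamma> ^ n) *\<^sub>C u ((P ^^ n) x)" for n x
        by (induction n) (simp_all add: scaleC_one Pu unitaryD(2)[OF P] scaleC_scaleC mult.commute)
      have PV: "P ^^ n = V0 (2 * pi * real n)" for n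
      proof (induction n)
        case 0
        have "cis 0 = 1" by simp
        then show ?case unfolding V0_def using hom_circleD(3)[OF U_hom] hom_circleD(3)[OF U'_hom] by (simp add: id_def)
      next
        case (Suc n)
        have "2 * pi * real (Suc n) = 2 * pi + 2 * pi * real n" by (simp add: algebra_simps)
        then show ?case using Suc.IH V0_add by (simp add: P_def fun_eq_iff)
      qed
      have "g (- (2 * pi * real k)) = \<one>"
      proof -
        have "h (- 2 * pi) = h 0" using loop_periodic[OF h_loop, of "- 2 * pi"] by simp
        moreover have "- (2 * pi * real k) = real k * (- 2 * pi)" by simp
        ultimately show ?thesis by (simp only: h_def mult_zero_right g_zero)
      qed
      moreover have "cis (2 * pi * real k) = 1" by (rule cis_multiple_2pi) simp
      ultimately have "proj (P ^^ k) = proj id"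
        unfolding PV class_V0 using pi_one hom_circleD(3)[OF U_hom] PU_left_id[OF PU_carrier[OF unitary_id]] by simp
      then obtain c where c: "c \<in> sphere 0 1" "P ^^ k = (\<lambda>x. c *\<^sub>C id x)" unfolding class_eq_iff by blast
      have c0: "c \<noteq> 0" using c(1) by auto
      have "c *\<^sub>C u x1 = (f \<gamma> ^ k) *\<^sub>C (c *\<^sub>C u x1)"
        using pow[of k x1] unfolding c(2) id_apply unitaryD(2)[OF u(1)] .
      then have "c *\<^sub>C u x1 = (f \<gamma> ^ k * c) *\<^sub>C u x1" by (simp add: scaleC_scaleC)
      from scaleC_cancel[OF this inj0[OF u(1) x1]] show ?thesis using c0 by simp
    qed
    then have "f ` carrier LG \<subseteq> {w. w ^ k = 1}" by blast
    moreover have "finite {w::complex. w ^ k = 1}" using k2 by (intro finite_roots_unity) simp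
    ultimately show "finite (f ` carrier LG)" by (rule finite_subset)
  next
    fix \<sigma> :: "real \<Rightarrow> real \<Rightarrow> 'g" and \<eta> s
    assume lim: "limitin (loop_topology G A) \<sigma> \<eta> (at s within {0..1})"
    have \<eta>: "\<eta> \<in> carrier LG" using limitin_topspace[OF lim] unfolding topspace_loop_topology .
    have \<sigma>: "\<forall>\<^sub>F t in at s within {0..1}. \<sigma> t \<in> carrier LG"
      using limitinD[OF lim openin_topspace limitin_topspace[OF lim]] unfolding topspace_loop_topology .
    obtain u0 where u0: "u0 \<in> unitaries" "\<pi> \<eta> = proj u0" using pi_rep[OF \<eta>] by blast
    have "limitin projective_unitary_topology (\<pi> \<circ> \<sigma>) (proj u0) (at s within {0..1})"
      unfolding u0(2)[symmetric] by (rule continuous_map_limit[OF pi_continuous lim])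
    note PL = this[unfolded PU_limit_iff[OF u0(1)], rule_format]
    have n1: "norm x1 > 0" using x1 by simp
    show "((\<lambda>t. f (\<sigma> t)) \<longlongrightarrow> f \<eta>) (at s within {0..1})"
    proof (rule tendstoI)
      fix \<epsilon> :: real assume \<epsilon>: "\<epsilon> > 0"
      \<comment> \<open>Evaluated at \<open>x1\<close>, the commutation relation involves the
        representatives only at \<open>x1\<close> and \<open>P x1\<close>. Each contributes half of
        the error, and the factor \<open>norm x1\<close> cancels because \<open>u0\<close> and
        \<open>P\<close> are isometric.\<close>
      have e: "\<epsilon> * norm x1 / 2 > 0" using \<epsilon> n1 by simp
      show "\<forall>\<^sub>F t in at s within {0..1}. dist (f (\<sigma> t)) (f \<eta>) < \<epsilon>"
        using PL[of "{x1, P x1}", OF _ e, simplified] \<sigma>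
      proof eventually_elim
        case (elim t)
        then obtain u where u: "u \<in> unitaries" "\<pi> (\<sigma> t) = proj u"
            "norm (u x1 - u0 x1) < \<epsilon> * norm x1 / 2" "norm (u (P x1) - u0 (P x1)) < \<epsilon> * norm x1 / 2" by auto
        have a: "P (u x1) = f (\<sigma> t) *\<^sub>C u (P x1)" using f(2)[OF elim(2), of u x1] self_in_class[of u] u(2) by simp
        have b: "P (u0 x1) = f \<eta> *\<^sub>C u0 (P x1)" using f(2)[OF \<eta>, of u0 x1] self_in_class[of u0] u0(2) by simp
        have "(f (\<sigma> t) - f \<eta>) *\<^sub>C u0 (P x1) = P (u x1 - u0 x1) - f (\<sigma> t) *\<^sub>C (u (P x1) - u0 (P x1))"
          unfolding scaleC_diff_left scaleC_diff unitaryD(6)[OF P] a b by simp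
        then have "norm ((f (\<sigma> t) - f \<eta>) *\<^sub>C u0 (P x1)) \<le> norm (P (u x1 - u0 x1)) + norm (f (\<sigma> t) *\<^sub>C (u (P x1) - u0 (P x1)))"
          by (metis norm_triangle_ineq4)
        then have "cmod (f (\<sigma> t) - f \<eta>) * norm x1 \<le> norm (u x1 - u0 x1) + norm (u (P x1) - u0 (P x1))"
          unfolding norm_scaleC unitaryD(5)[OF P] unitaryD(5)[OF u0(1)] f(1)[OF elim(2)] by simp
        also have "\<dots> < \<epsilon> * norm x1" using add_strict_mono[OF u(3,4)] by (simp only: field_sum_of_halves)
        finally show ?case unfolding dist_norm by (simp only: mult_less_cancel_right_pos[OF n1])
      qed
    qed
  qed
  then show ?thesis using f(2)[OF \<gamma> u, of x] unfolding P_def by (simp add: scaleC_one)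
qed

text \<open>A form of Schur's lemma: a joint energy vector of \<open>U\<close> and \<open>U'\<close>
  is an eigenvector of the full turn. Its eigenspace is closed and invariant under the loops, hence
  the whole space by irreducibility.\<close>

lemma full_turn_scalar: "\<exists>\<alpha>. \<forall>x. V0 (2 * pi) x = cis \<alpha> *\<^sub>C x"
proof -
  define P where "P = V0 (2 * pi)"
  have P: "P \<in> unitaries" unfolding P_def by (rule V0_unitary)
  obtain x1 :: 'h where x1: "x1 \<noteq> 0" using nontrivial by auto
  have "\<exists>n m x. x \<in> energies.joint n m \<and> x \<noteq> 0"
  proof (rule ccontr)
    assume z: "\<not> (\<exists>n m x. x \<in> energies.joint n m \<and> x \<noteq> 0)"
    have "x1 = 0"
    proof (rule energies.joint_orthogonal_zero)
      fix n m x assume "x \<in> energies.joint n m"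
      then have "x = 0" using z by blast
      then show "cinner x1 x = 0" by (simp add: cinner_zero_right)
    qed
    then show False using x1 by simp
  qed
  then obtain n m x where x: "x \<in> energy_space U n" "x \<in> energy_space U' m" "x \<noteq> 0"
    unfolding energies.joint_def by blast
  define \<alpha> where "\<alpha> = of_int n * (2 * pi - 2 * pi / k) + of_int m * (2 * pi / k)"
  have Px: "P x = cis \<alpha> *\<^sub>C x"
    unfolding P_def V0_def o_def energy_spaceD[OF x(1)] unitaryD(2)[OF U'_unitary] energy_spaceD[OF x(2)] scaleC_scaleC cis_mult \<alpha>_def ..
  define W where "W = {y. P y = cis \<alpha> *\<^sub>C y}"
  have "csubspace W"
  proof (rule complex_vector.subspaceI)
    have "P 0 = 0" using unitaryD(5)[OF P, of 0] by simp
    then show "0 \<in> W" unfolding W_def by (simp add: scaleC_zero)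
  qed (auto simp: W_def unitaryD(1,2)[OF P] scaleC_add_right scaleC_scaleC mult.commute)
  moreover have "closed W" unfolding W_def
    by (intro closed_Collect_eq linear_continuous_on unitary_bounded_linear[OF P] bounded_linear_scaleC)
  moreover have "u ` W \<subseteq> W" if \<gamma>: "\<gamma> \<in> carrier LG" and u: "u \<in> \<pi> \<gamma>" for \<gamma> u
  proof -
    obtain v where v: "v \<in> unitaries" "\<pi> \<gamma> = proj v" using pi_rep[OF \<gamma>] by blast
    have "u \<in> unitaries" using class_memD[OF v(1)] u v(2) by blast
    from unitaryD(2)[OF this] show ?thesis
      unfolding W_def using full_turn_commutes[OF \<gamma> u] by (auto simp: P_def)
  qed
  ultimately have "W = {0} \<or> W = UNIV" using irreducible unfolding irreducible_rep_def by blast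
  moreover have "x \<in> W" unfolding W_def using Px by simp
  ultimately have "W = UNIV" using x(3) by blast
  then show ?thesis unfolding W_def P_def by blast
qed

text \<open>Chosen so that the phase \<open>cis (\<tau> * \<theta>)\<close> cancels the scalar of
  the full turn at \<theta> = 2\<pi>; any such number will do.\<close>

definition \<tau> :: real where
  "\<tau> = (SOME t. \<forall>x. V0 (2 * pi) x = cis (- (t * (2 * pi))) *\<^sub>C x)"

definition V1 :: "real \<Rightarrow> 'h \<Rightarrow> 'h" where
  "V1 \<theta> = (\<lambda>x. cis (\<tau> * \<theta>) *\<^sub>C V0 \<theta> x)"

definition V :: "complex \<Rightarrow> 'h \<Rightarrow> 'h" where
  "V w = V1 (Arg w)"

lemma V1_period: "V1 (2 * pi) = id"
proof -
  obtain \<alpha> where \<alpha>: "\<And>x. V0 (2 * pi) x = cis \<alpha> *\<^sub>C x" using full_turn_scalar by blast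
  have "\<exists>t. \<forall>x. V0 (2 * pi) x = cis (- (t * (2 * pi))) *\<^sub>C x"
    by (rule exI[of _ "- \<alpha> / (2 * pi)"]) (simp add: \<alpha>)
  from someI_ex[OF this] have "\<forall>x. V0 (2 * pi) x = cis (- (\<tau> * (2 * pi))) *\<^sub>C x" unfolding \<tau>_def .
  then show ?thesis unfolding V1_def by (simp add: scaleC_scaleC cis_mult scaleC_one id_def)
qed

lemma V1_comp: "V1 \<theta> = (\<lambda>x. cis (\<tau> * \<theta>) *\<^sub>C x) \<circ> V0 \<theta>"
  unfolding V1_def by (simp add: o_def)

lemma V1_unitary: "V1 \<theta> \<in> unitaries"
  unfolding V1_comp by (rule unitary_comp[OF unitary_scaleC V0_unitary]) simp

lemma V1_add: "V1 (s + t) = V1 s \<circ> V1 t"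
  unfolding V1_def V0_add by (simp add: fun_eq_iff unitaryD(2)[OF V0_unitary] scaleC_scaleC cis_mult distrib_left)

lemma V1_class: "proj (V1 \<theta>) = \<kappa> (g (- \<theta>)) \<odot> proj (U (cis \<theta>))"
proof -
  have "proj (V1 \<theta>) = proj (V0 \<theta>)"
    unfolding class_eq_iff V1_def by (rule bexI[of _ "cis (\<tau> * \<theta>)"]) simp_all
  then show ?thesis using class_V0 by simp
qed

lemma V_cis: "V (cis \<theta>) = V1 \<theta>"
proof -
  have "cis (Arg (cis \<theta>)) = cis \<theta>" by (simp add: cis_Arg sgn_eq)
  then have "sin (Arg (cis \<theta>)) = sin \<theta> \<and> cos (Arg (cis \<theta>)) = cos \<theta>" by (simp add: complex_eq_iff)
  then obtain n :: int where "Arg (cis \<theta>) = \<theta> + 2 * pi * of_int n" unfolding sin_cos_eq_iff by blast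
  moreover have "V1 (\<theta> + 2 * pi * of_int n) = V1 \<theta>"
    by (rule periodic_of_int) (simp add: V1_add V1_period)
  ultimately show ?thesis unfolding V_def by simp
qed

lemma V_hom: "V \<in> hom circle_group unitary_group"
proof (rule homI)
  show "V a \<in> unitaries" if "a \<in> carrier circle_group" for a
    unfolding V_def by (rule V1_unitary)
  show "V (a \<otimes>\<^bsub>circle_group\<^esub> b) = V a \<otimes>\<^bsub>unitary_group\<^esub> V b"
    if ab: "a \<in> carrier circle_group" "b \<in> carrier circle_group" for a b
  proof -
    obtain s t where "a = cis s" "b = cis t" using ab unfolding circle_cis by blast
    then show ?thesis using V1_add[of s t] by (simp add: circle_group_def cis_mult V_cis unitary_mult)
  qed
qed

lemma continuous_on_V0: "continuous_on UNIV (\<lambda>\<theta>. V0 \<theta> x)"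
proof -
  have strong: "continuous_on UNIV (\<lambda>\<theta>. F (cis (r \<theta>)) y)"
    if F: "continuous_map (top_of_set (carrier circle_group)) unitary_topology F" and r: "continuous_on UNIV r"
    for F and r :: "real \<Rightarrow> real" and y :: 'h
  proof -
    have "continuous_on (carrier circle_group) (\<lambda>w. F w y)" using F unfolding continuous_map_unitary_iff by blast
    then show ?thesis
      by (rule continuous_on_compose2) (use r in \<open>auto intro!: continuous_intros simp: circle_group_def\<close>)
  qed
  have U'c: "continuous_map (top_of_set (carrier circle_group)) unitary_topology U'"
    unfolding U'_def by (rule unitary_continuous_conjugate[OF U_continuous H(1) unitary_inv[OF H(1)]])
  have "((\<lambda>\<theta>. V0 \<theta> x) \<longlongrightarrow> V0 \<theta>0 x) (at \<theta>0)" for \<theta>0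
  proof -
    let ?y = "\<lambda>\<theta>. U (cis (\<theta> - \<theta> / k)) x"
    have y: "(?y \<longlongrightarrow> ?y \<theta>0) (at \<theta>0)"
    proof -
      have r: "continuous_on UNIV (\<lambda>\<theta>. \<theta> - \<theta> / real k)" using k0 by (intro continuous_intros) simp
      show ?thesis using strong[OF U_continuous r, of x] unfolding continuous_on_def by simp
    qed
    have w: "((\<lambda>\<theta>. U' (cis (\<theta> / k)) (?y \<theta>0)) \<longlongrightarrow> U' (cis (\<theta>0 / k)) (?y \<theta>0)) (at \<theta>0)"
    proof -
      have r: "continuous_on UNIV (\<lambda>\<theta>. \<theta> / real k)" using k0 by (intro continuous_intros) simp
      show ?thesis using strong[OF U'c r, of "?y \<theta>0"] unfolding continuous_on_def by simp
    qed
    \<comment> \<open>Both the operator and its argument vary. As the operators are isometric, the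
      change of the argument tends to zero whatever the operator; the change of the operator is then
      needed only at a fixed vector.\<close>
    have "((\<lambda>\<theta>. U' (cis (\<theta> / k)) (?y \<theta> - ?y \<theta>0)) \<longlongrightarrow> 0) (at \<theta>0)"
      by (rule tendsto_norm_zero_cancel) (simp add: unitaryD(5)[OF U'_unitary] tendsto_norm_zero LIM_zero y)
    from Limits.tendsto_add[OF this w] show ?thesis unfolding V0_def by (simp add: unitaryD(6)[OF U'_unitary])
  qed
  then show ?thesis by (simp add: continuous_on_def)
qed

text \<open>The argument function jumps on the negative axis. Near a point \<open>w0\<close> of
  angle \<theta>0 the angle \<theta>0 plus the argument of \<open>w / w0\<close> varies
  continuously, and periodicity of \<open>V1\<close> makes it give the same operator.\<close>

lemma V_continuous: "continuous_map (top_of_set (carrier circle_group)) unitary_topology V"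
  unfolding continuous_map_unitary_iff
proof (intro conjI allI)
  show "V ` carrier circle_group \<subseteq> unitaries" using V1_unitary unfolding V_def by blast
  fix x
  have c1: "continuous_on UNIV (\<lambda>\<theta>. V1 \<theta> x)"
  proof -
    have sc: "continuous_on UNIV (\<lambda>\<theta>. c \<theta> *\<^sub>C y \<theta>)" if c: "continuous_on UNIV c" and y: "continuous_on UNIV y"
      for c :: "real \<Rightarrow> complex" and y :: "real \<Rightarrow> 'h"
    proof -
      have e: "c \<theta> *\<^sub>C y \<theta> = Re (c \<theta>) *\<^sub>R y \<theta> + Im (c \<theta>) *\<^sub>R (\<i> *\<^sub>C y \<theta>)" for \<theta>
        unfolding scaleC_of_real[symmetric] scaleC_scaleC scaleC_add_left[symmetric]
        by (rule arg_cong[of _ _ "\<lambda>c. c *\<^sub>C y \<theta>"]) (simp add: complex_eq_iff)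
      show ?thesis unfolding e
        by (intro continuous_intros c y bounded_linear.continuous_on[OF bounded_linear_scaleC])
    qed
    show ?thesis unfolding V1_def by (intro sc continuous_on_V0 continuous_intros)
  qed
  show "continuous_on (carrier circle_group) (\<lambda>w. V w x)"
    unfolding continuous_on_eq_continuous_within
  proof
    fix w0 assume w0: "w0 \<in> carrier circle_group"
    then obtain \<theta>0 where \<theta>0: "w0 = cis \<theta>0" unfolding circle_cis by blast
    have w00: "w0 \<noteq> 0" using w0 by (auto simp: circle_group_def)
    have d: "isCont (\<lambda>w. w / w0) w0" using w00 by simp
    have "isCont Arg (w0 / w0)" using w00 by (intro continuous_at_Arg) simp
    then have a: "isCont (\<lambda>w. \<theta>0 + Arg (w / w0)) w0"
      by (intro isCont_add[OF continuous_const] isCont_o2[OF d])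
    have v: "isCont (\<lambda>\<theta>. V1 \<theta> x) \<theta>" for \<theta>
      using c1 unfolding continuous_on_eq_continuous_at[OF open_UNIV] by blast
    have "isCont (\<lambda>w. V1 (\<theta>0 + Arg (w / w0)) x) w0"
      by (rule isCont_o2[OF a v])
    then have "continuous (at w0 within carrier circle_group) (\<lambda>w. V1 (\<theta>0 + Arg (w / w0)) x)"
      by (rule continuous_at_imp_continuous_at_within)
    then show "continuous (at w0 within carrier circle_group) (\<lambda>w. V w x)"
    proof (rule continuous_transform_within[OF _ zero_less_one w0])
      fix w assume "w \<in> carrier circle_group"
      then obtain t where t: "w = cis t" unfolding circle_cis by blast
      have "w / w0 = cis (t - \<theta>0)" unfolding t \<theta>0 by (simp add: cis_divide)
      then have "V1 (\<theta>0 + Arg (w / w0)) = V1 \<theta>0 \<circ> V1 (t - \<theta>0)"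
        using V_cis[of "t - \<theta>0"] unfolding V_def V1_add by simp
      also have "\<dots> = V w" unfolding t V_cis V1_add[symmetric] by simp
      finally show "V1 (\<theta>0 + Arg (w / w0)) x = V w x" by simp
    qed
  qed
qed

lemma V_energy:
  "\<exists>j0. hilbert_direct_sum {j0..} (energy_space V) \<and> (\<forall>j\<ge>j0. finite_dimensional (energy_space V j))"
  by (rule energies.combination_energy[OF k2 V_hom, of \<tau>]) (simp add: V_cis V1_def V0_def)

text \<open>Since g (x - \<theta>) = g x g (- \<theta>), the rotation of a conjugated loop and the
  conjugate of the rotated loop differ by conjugation with the constant
  \<open>g (- \<theta>)\<close>. The twist contained in \<open>V\<close> accounts for exactly this
  difference.\<close>

lemma V_covariance:
  assumes \<eta>: "\<eta> \<in> carrier LG"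
  shows "proj (V (cis \<theta>)) \<odot> conjugate_rep G g \<pi> \<eta> =
    conjugate_rep G g \<pi> (\<lambda>x. \<eta> (x - \<theta>)) \<odot> proj (V (cis \<theta>))"
proof -
  let ?c = "\<lambda>\<eta> x. inv (g x) \<otimes> \<eta> x \<otimes> g x" and ?\<eta> = "\<lambda>x. \<eta> (x - \<theta>)" and ?u = "proj (U (cis \<theta>))"
  note c1 = conj_closed[OF \<eta>] and c2 = conj_closed[OF shift_loop[OF \<eta>]]
  have kl: "(\<lambda>x. g (- \<theta>)) \<in> carrier LG" by (rule constant_loop[OF g_carrier])
  have sl: "(\<lambda>x. ?c \<eta> (x - \<theta>)) \<in> carrier LG" by (rule shift_loop[OF c1])
  have "g (- \<theta>) \<otimes> ?c \<eta> (x - \<theta>) = ?c ?\<eta> x \<otimes> g (- \<theta>)" for x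
  proof -
    have [simp]: "g t \<in> carrier G" "\<eta> t \<in> carrier G" for t using g_carrier loop_value[OF \<eta>] by auto
    have gd: "g (x - \<theta>) = g x \<otimes> g (- \<theta>)" using g_add[of x "- \<theta>"] by simp
    have gd': "g (x - \<theta>) = g (- \<theta>) \<otimes> g x" using g_add[of "- \<theta>" x] by simp
    have "g (- \<theta>) \<otimes> (inv (g (- \<theta>) \<otimes> g x) \<otimes> \<eta> (x - \<theta>) \<otimes> (g x \<otimes> g (- \<theta>)))
        = g (- \<theta>) \<otimes> (inv (g x) \<otimes> (inv (g (- \<theta>)) \<otimes> (\<eta> (x - \<theta>) \<otimes> (g x \<otimes> g (- \<theta>)))))"
      by (simp add: inv_mult_group m_assoc)
    also have "\<dots> = (g (- \<theta>) \<otimes> inv (g (- \<theta>) \<otimes> g x)) \<otimes> (\<eta> (x - \<theta>) \<otimes> (g x \<otimes> g (- \<theta>)))"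
      by (simp add: inv_mult_group m_assoc)
    also have "g (- \<theta>) \<otimes> inv (g (- \<theta>) \<otimes> g x) = inv (g x)"
      unfolding gd'[symmetric] gd by (simp add: inv_mult_group m_assoc[symmetric])
    finally show ?thesis using gd gd' by (simp add: m_assoc)
  qed
  then have e: "\<kappa> (g (- \<theta>)) \<odot> \<pi> (\<lambda>x. ?c \<eta> (x - \<theta>)) = \<pi> (?c ?\<eta>) \<odot> \<kappa> (g (- \<theta>))"
    unfolding pi_mult[OF kl sl, symmetric] pi_mult[OF c2 kl, symmetric] by simp
  note carr = kappa_carrier[OF g_carrier, of "- \<theta>"] U_class[of \<theta>] pi_carrier[OF c1] pi_carrier[OF c2] pi_carrier[OF sl]
  have "proj (V (cis \<theta>)) \<odot> \<pi> (?c \<eta>) = \<kappa> (g (- \<theta>)) \<odot> (?u \<odot> \<pi> (?c \<eta>))"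
    unfolding V_cis V1_class by (rule PU_assoc[OF carr(1,2,3)])
  also have "\<dots> = \<kappa> (g (- \<theta>)) \<odot> \<pi> (\<lambda>x. ?c \<eta> (x - \<theta>)) \<odot> ?u"
    unfolding rotation_covariance[OF c1] by (rule PU_assoc[OF carr(1,5,2), symmetric])
  also have "\<dots> = \<pi> (?c ?\<eta>) \<odot> (\<kappa> (g (- \<theta>)) \<odot> ?u)"
    unfolding e by (rule PU_assoc[OF carr(4,1,2)])
  finally show ?thesis unfolding conjugate_rep_def V_cis V1_class .
qed

lemma positive_energy_conjugate: "positive_energy G A (conjugate_rep G g \<pi>)"
proof -
  let ?p = "conjugate_rep G g \<pi>"
  interpret L: group LG by (rule group_loop_group)
  have pc: "?p \<gamma> \<in> carrier PU" if "\<gamma> \<in> carrier LG" for \<gamma>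
    unfolding conjugate_rep_def by (rule pi_carrier[OF conj_closed[OF that]])
  have pm: "?p (\<lambda>x. \<gamma> x \<otimes> \<eta> x) = ?p \<gamma> \<odot> ?p \<eta>" if \<gamma>: "\<gamma> \<in> carrier LG" and \<eta>: "\<eta> \<in> carrier LG" for \<gamma> \<eta>
  proof -
    have "inv (g x) \<otimes> (\<gamma> x \<otimes> \<eta> x) \<otimes> g x = (inv (g x) \<otimes> \<gamma> x \<otimes> g x) \<otimes> (inv (g x) \<otimes> \<eta> x \<otimes> g x)" for x
    proof -
      have [simp]: "g x \<in> carrier G" "\<gamma> x \<in> carrier G" "\<eta> x \<in> carrier G"
        using g_carrier loop_value[OF \<gamma>] loop_value[OF \<eta>] by auto
      have "g x \<otimes> (inv (g x) \<otimes> (\<eta> x \<otimes> g x)) = \<eta> x \<otimes> g x" by (subst m_assoc[symmetric]) simp_all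
      then show ?thesis by (simp add: m_assoc)
    qed
    then show ?thesis unfolding conjugate_rep_def pi_mult[OF conj_closed[OF \<gamma>] conj_closed[OF \<eta>], symmetric] by simp
  qed
  have pcont: "continuous_map (loop_topology G A) projective_unitary_topology ?p"
    using continuous_map_compose[OF continuous_map_conj_loop[OF g_smooth conj_closed] pi_continuous]
    unfolding conjugate_rep_def o_def .
  obtain j0 where j0: "hilbert_direct_sum {j0..} (energy_space V)" "\<And>j. j \<ge> j0 \<Longrightarrow> finite_dimensional (energy_space V j)"
    using V_energy by blast
  \<comment> \<open>An extension is determined by its values on the two factors of the semidirect
    product; \<open>V_covariance\<close> is the relation that makes it multiplicative.\<close>
  let ?\<rho> = "\<lambda>a. ?p (fst a) \<odot> proj (V (snd a))"
  have V1: "V 1 = id" by (rule hom_circleD(3)[OF V_hom])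
  have Vc: "proj (V w) \<in> carrier PU" for w
    unfolding V_def by (rule PU_carrier[OF V1_unitary])
  have p1: "?p (\<lambda>x. \<one>) = proj id"
    using g_carrier pi_one unfolding conjugate_rep_def by simp
  have "loop_rep G A ?p ?\<rho> V j0"
  proof
    show "?p \<in> hom LG PU"
      by (rule homI) (simp_all add: pc loop_mult pm)
    show "continuous_map (loop_topology G A) projective_unitary_topology ?p" by (rule pcont)
    show "?\<rho> \<in> hom (loop_rot_group G A) PU"
    proof (rule homI)
      fix a assume "a \<in> carrier (loop_rot_group G A)"
      then have "fst a \<in> carrier LG" using rot_group_carrier[of "fst a" "snd a"] by simp
      then show "?\<rho> a \<in> carrier PU" by (intro PU_closed pc Vc)
    next
      fix a b assume "a \<in> carrier (loop_rot_group G A)" "b \<in> carrier (loop_rot_group G A)"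
      then obtain \<gamma> w \<eta> v where ab: "a = (\<gamma>, w)" "b = (\<eta>, v)" and l: "\<gamma> \<in> carrier LG" "\<eta> \<in> carrier LG"
          and c: "w \<in> carrier circle_group" "v \<in> carrier circle_group"
        using rot_group_carrier by (cases a, cases b) auto
      obtain \<theta> where \<theta>: "w = cis \<theta>" using c(1) unfolding circle_cis by blast
      have sh: "(\<lambda>x. \<eta> (x - \<theta>)) \<in> carrier LG" by (rule shift_loop[OF l(2)])
      have V_mult: "proj (V (w * v)) = proj (V w) \<odot> proj (V v)"
        using hom_mult[OF V_hom c] hom_in_carrier[OF V_hom c(1)] hom_in_carrier[OF V_hom c(2)]
        by (simp add: PU_mult unitary_mult) (simp add: circle_group_def)
      have "?\<rho> (a \<otimes>\<^bsub>loop_rot_group G A\<^esub> b) = (?p \<gamma> \<odot> ?p (\<lambda>x. \<eta> (x - \<theta>))) \<odot> (proj (V w) \<odot> proj (V v))"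
        unfolding ab rot_group_mult fst_conv snd_conv V_mult unfolding \<theta> rotate_loop_cis[OF l(2)] pm[OF l(1) sh] ..
      also have "\<dots> = ?p \<gamma> \<odot> ((?p (\<lambda>x. \<eta> (x - \<theta>)) \<odot> proj (V w)) \<odot> proj (V v))"
        by (simp add: PU_assoc PU_closed pc l sh Vc)
      also have "\<dots> = ?\<rho> a \<odot> ?\<rho> b"
        unfolding ab fst_conv snd_conv \<theta> V_covariance[OF l(2), symmetric] by (simp add: PU_assoc PU_closed pc l Vc)
      finally show "?\<rho> (a \<otimes>\<^bsub>loop_rot_group G A\<^esub> b) = ?\<rho> a \<odot> ?\<rho> b" .
    qed
    show "continuous_map (loop_rot_topology G A) projective_unitary_topology ?\<rho>"
      unfolding loop_rot_topology_def
    proof (rule continuous_map_PU_mult)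
      show "continuous_map (prod_topology (loop_topology G A) (top_of_set (carrier circle_group))) projective_unitary_topology (\<lambda>a. ?p (fst a))"
        using continuous_map_compose[OF continuous_map_fst pcont] unfolding o_def .
      show "continuous_map (prod_topology (loop_topology G A) (top_of_set (carrier circle_group))) projective_unitary_topology
          (\<lambda>a. proj (V (snd a)))"
        using continuous_map_compose[OF continuous_map_compose[OF continuous_map_snd V_continuous] continuous_map_class] unfolding o_def .
    qed
    show "?\<rho> (\<gamma>, \<one>\<^bsub>circle_group\<^esub>) = ?p \<gamma>" if "\<gamma> \<in> carrier LG" for \<gamma>
      using V1 PU_right_id[OF pc[OF that]] by (simp add: circle_group_def)
    show "V \<in> hom circle_group unitary_group" by (rule V_hom)
    show "continuous_map (top_of_set (carrier circle_group)) unitary_topology V" by (rule V_continuous)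
    show "?\<rho> (\<one>\<^bsub>LG\<^esub>, w) = proj (V w)" for w
      unfolding fst_conv snd_conv loop_one p1 by (rule PU_left_id[OF Vc])
    show "hilbert_direct_sum {j0..} (energy_space V)" by (rule j0(1))
    show "finite_dimensional (energy_space V n)" if "n \<ge> j0" for n by (rule j0(2)[OF that])
  qed
  then show ?thesis unfolding positive_energy_iff by blast
qed

end

theorem proposition4p3p1:
  fixes G :: "('g::t2_space, 'b) monoid_scheme"
    and A :: "('g, 'e::euclidean_space) atlas"
    and Z :: "'g set"
    and \<pi> :: "(real \<Rightarrow> 'g) \<Rightarrow> ('h::complex_hilbert_space \<Rightarrow> 'h) set"
    and \<zeta> :: "real \<Rightarrow> 'g"
  assumes "simple_lie_group G A"
    and "compact (carrier G)"
    and "connected (carrier G)"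
    and "simply_connected (carrier G)"
    and "subgroup Z G"
    and "Z \<subseteq> group_center G"
    and "positive_energy G A \<pi>"
    and "irreducible_rep G A \<pi>"
    and "\<zeta> \<in> twisted_loops G A Z"
  shows "positive_energy G A (conjugate_rep G \<zeta> \<pi>)"
proof -
  interpret lie_group G A using assms(1) unfolding simple_lie_group_def by blast
  have \<zeta>: "smooth_into A UNIV \<zeta>" using assms(9) unfolding twisted_loops_def smooth_map_line_iff by blast
  obtain z where "z \<in> Z" and tw: "\<And>x. \<zeta> (x + 2 * pi) \<otimes>\<^bsub>G\<^esub> inv\<^bsub>G\<^esub> (\<zeta> x) = z"
    using assms(9) unfolding twisted_loops_def by blast
  then have zc: "z \<in> group_center G" using assms(6) by blast
  then have z: "z \<in> carrier G" and zcomm: "\<And>p. p \<in> carrier G \<Longrightarrow> z \<otimes>\<^bsub>G\<^esub> p = p \<otimes>\<^bsub>G\<^esub> z"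
    unfolding group_center_def by blast+
  have \<zeta>c: "\<zeta> x \<in> carrier G" for x by (rule smooth_intoD[OF \<zeta> UNIV_I])
  have \<zeta>p: "\<zeta> (x + 2 * pi) = z \<otimes>\<^bsub>G\<^esub> \<zeta> x" for x
    unfolding tw[of x, symmetric] using \<zeta>c by (simp add: m_assoc)
  obtain C \<phi> where C: "(C, \<phi>) \<in> A" "\<one>\<^bsub>G\<^esub> \<in> C" using chart_at[OF one_closed] by blast
  have "simple_bracket (lie_bracket G C \<phi>)" using assms(1) C unfolding simple_lie_group_def by blast
  from central_finite_order[OF C this assms(2) zc] obtain k :: nat where k: "k \<ge> 2" "z [^]\<^bsub>G\<^esub> k = \<one>\<^bsub>G\<^esub>" by blast
  have "inv\<^bsub>G\<^esub> (\<zeta> 0) \<otimes>\<^bsub>G\<^esub> \<zeta> (2 * pi) = z"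
    using \<zeta>p[of 0] zcomm[OF \<zeta>c[of 0]] \<zeta>c[of 0] z by (simp add: m_assoc[symmetric])
  from one_parameter_subgroup_exists[OF C assms(2) \<zeta> this] obtain g where
    g: "smooth_into A UNIV g" "\<And>s t. g (s + t) = g s \<otimes>\<^bsub>G\<^esub> g t" "g (2 * pi) = z" by auto
  obtain \<rho> U n0 where "loop_rep G A \<pi> \<rho> U n0" using assms(7) unfolding positive_energy_iff by blast
  then interpret loop_rep G A \<pi> \<rho> U n0 .
  interpret twisted_rep G A \<pi> \<rho> U n0 g z k
    by unfold_locales (rule g zc k assms(8) assms(4))+
  obtain \<rho>' V' m0 where "loop_rep G A (conjugate_rep G g \<pi>) \<rho>' V' m0"
    using positive_energy_conjugate unfolding positive_energy_iff by blast
  then interpret conj: loop_rep G A "conjugate_rep G g \<pi>" \<rho>' V' m0 .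
  \<comment> \<open>Over a period both \<open>\<zeta>\<close> and \<open>g\<close> acquire the same
    central factor \<open>z\<close>, so the quotient is periodic.\<close>
  define \<gamma>0 where "\<gamma>0 x = \<zeta> x \<otimes>\<^bsub>G\<^esub> inv\<^bsub>G\<^esub> (g x)" for x
  have "\<gamma>0 (x + 2 * pi) = \<gamma>0 x" for x
  proof -
    have [simp]: "\<zeta> x \<in> carrier G" "g x \<in> carrier G" "z \<in> carrier G" using \<zeta>c g_carrier z by auto
    have "\<gamma>0 (x + 2 * pi) = z \<otimes>\<^bsub>G\<^esub> \<zeta> x \<otimes>\<^bsub>G\<^esub> (inv\<^bsub>G\<^esub> z \<otimes>\<^bsub>G\<^esub> inv\<^bsub>G\<^esub> (g x))"
      unfolding \<gamma>0_def \<zeta>p g(2,3) by (simp add: inv_mult_group)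
    also have "\<dots> = \<gamma>0 x" unfolding zcomm[OF \<zeta>c] \<gamma>0_def by (simp add: m_assoc) (simp add: m_assoc[symmetric])
    finally show ?thesis .
  qed
  then have \<gamma>0: "\<gamma>0 \<in> carrier (loop_group G A)"
    unfolding loop_carrier_iff \<gamma>0_def[abs_def] by (intro conjI allI smooth_into_mult smooth_into_inv \<zeta> g(1))
  show ?thesis
  \<comment> \<open>The conjugation applied last to the representation acts first on the loop.
    Conjugating by \<open>g\<close> and then by \<open>\<gamma>0\<close> thus gives conjugation by
    the product of \<open>\<gamma>0\<close> and \<open>g\<close> in this order, which is
    \<open>\<zeta>\<close>.\<close>
  proof (rule positive_energy_cong[OF conj.positive_energy_conjugate_loop[OF \<gamma>0]])
    fix \<gamma> assume \<gamma>: "\<gamma> \<in> carrier (loop_group G A)"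
    have "inv\<^bsub>G\<^esub> (g x) \<otimes>\<^bsub>G\<^esub> (inv\<^bsub>G\<^esub> (\<gamma>0 x) \<otimes>\<^bsub>G\<^esub> \<gamma> x \<otimes>\<^bsub>G\<^esub> \<gamma>0 x) \<otimes>\<^bsub>G\<^esub> g x = inv\<^bsub>G\<^esub> (\<zeta> x) \<otimes>\<^bsub>G\<^esub> \<gamma> x \<otimes>\<^bsub>G\<^esub> \<zeta> x" for x
    proof -
      have [simp]: "\<zeta> x \<in> carrier G" "g x \<in> carrier G" "\<gamma> x \<in> carrier G" "\<gamma>0 x \<in> carrier G"
        using \<zeta>c g_carrier loop_value[OF \<gamma>] loop_value[OF \<gamma>0] by auto
      have e: "\<zeta> x = \<gamma>0 x \<otimes>\<^bsub>G\<^esub> g x" unfolding \<gamma>0_def by (simp add: m_assoc)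
      show ?thesis unfolding e by (simp add: inv_mult_group m_assoc)
    qed
    then show "conjugate_rep G \<gamma>0 (conjugate_rep G g \<pi>) \<gamma> = conjugate_rep G \<zeta> \<pi> \<gamma>"
      unfolding conjugate_rep_def by simp
  qed
qed

end
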